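(* Let $(K,v)$ be a nontrivially valued field of residue characteristic $p>0$. If $K$ has characteristic $0$, then assume in addition that it contains all $p$-th roots of unity. Then $(K,v)$ is a deeply ramified field if and only if $\Omega_{\mathcal{O}_L|\mathcal{O}_K}=0$ for all unibranched Galois extensions $(L|K,v)$ of prime degree $p$.
   Context: Valuations are Krull valuations of arbitrary rank. For a valued field $(K,v)$, $\mathcal{O}_K$ denotes the valuation ring, $vK$ the value group, $Kv$ the residue field. $(L|K,v)$ denotes a field extension $L|K$ with a valuation $v$ on $L$, $K$ being endowed with the restriction of $v$; it is called unibranched if the extension of $v$ from $K$ to $L$ is unique. $\Omega_{B|A}$ is the module of relative Kähler differentials of an $A$-algebra $B$. A nontrivially valued field $(K,v)$ is called a deeply ramified field if both of the following hold: (DRvg) whenever $\Gamma_1\subsetneq\Gamma_2$ are convex subgroups of $vK$, then $\Gamma_2/\Gamma_1$ is not isomorphic to $\mathbb{Z}$; (DRvr) if $\mathrm{char}\,Kv=p>0$, then the map $\mathcal{O}_{\hat K}/p\mathcal{O}_{\hat K}\to\mathcal{O}_{\hat K}/p\mathcal{O}_{\hat K}$, $x\mapsto x^p$, is surjective, where $\hat K$ is the completion of $(K,v)$ for the valuation topology and $\mathcal{O}_{\hat K}$ its valuation ring. *)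

theory Defs
  imports "HOL-Algebra.Algebra" "HOL-Algebra.Algebraic_Closure_Type"
begin

section \<open>The divisible hull of an ordered abelian group\<close>

definition nsmul :: "nat \<Rightarrow> 'g::ab_group_add \<Rightarrow> 'g" where
  "nsmul n x = ((+) x ^^ n) 0"

lemma nsmul_0 [simp]: "nsmul 0 x = 0"
  and nsmul_Suc [simp]: "nsmul (Suc n) x = x + nsmul n x"
  by (simp_all add: nsmul_def)

lemma nsmul_zero [simp]: "nsmul n 0 = 0"
  by (induction n) auto

lemma nsmul_add: "nsmul n (x + y) = nsmul n x + nsmul n y"
  by (induction n) (auto simp: algebra_simps)

lemma nsmul_uminus: "nsmul n (- x) = - nsmul n x"
  by (induction n) auto

lemma nsmul_plus: "nsmul (m + n) x = nsmul m x + nsmul n x"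
  by (induction m) (auto simp: algebra_simps)

lemma nsmul_mult: "nsmul (m * n) x = nsmul m (nsmul n x)"
  by (induction m) (auto simp: nsmul_plus)

lemma nsmul_commute: "nsmul m (nsmul n x) = nsmul n (nsmul m x)"
  by (metis mult.commute nsmul_mult)

lemma nsmul_nsmul: "nsmul m (nsmul n x) = nsmul (m * n) x"
  by (simp add: nsmul_mult)

lemma nsmul_strict_mono:
  fixes x y :: "'g::linordered_ab_group_add"
  assumes "x < y" "n > 0"
  shows "nsmul n x < nsmul n y"
  using assms(2)
proof (induction n)
  case (Suc n)
  then show ?case
    using assms(1) by (cases n) (auto intro: add_strict_mono)
qed simp

lemma nsmul_le_iff:
  "n > 0 \<Longrightarrow> nsmul n x \<le> nsmul n y \<longleftrightarrow> x \<le> (y :: 'g::linordered_ab_group_add)"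
  by (metis linorder_not_le nless_le nsmul_strict_mono)

lemma nsmul_eq_iff:
  "n > 0 \<Longrightarrow> nsmul n x = nsmul n y \<longleftrightarrow> x = (y :: 'g::linordered_ab_group_add)"
  by (metis nless_le linorder_neqE nsmul_strict_mono)

declare nsmul_Suc [simp del]

text \<open>The pair \<open>(g, n)\<close> stands for the fraction \<open>g / (n + 1)\<close>.\<close>

definition div_rel :: "'g::linordered_ab_group_add \<times> nat \<Rightarrow> 'g \<times> nat \<Rightarrow> bool" where
  "div_rel x y \<longleftrightarrow> nsmul (Suc (snd y)) (fst x) = nsmul (Suc (snd x)) (fst y)"

lemma equivp_div_rel: "equivp (div_rel :: 'g::linordered_ab_group_add \<times> nat \<Rightarrow> _)"
proof (rule equivpI)
  show "transp (div_rel :: 'g \<times> nat \<Rightarrow> _)"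
  proof (rule transpI)
    fix x y z :: "'g \<times> nat"
    assume "div_rel x y" "div_rel y z"
    then have *: "nsmul (Suc (snd y)) (fst x) = nsmul (Suc (snd x)) (fst y)"
      "nsmul (Suc (snd z)) (fst y) = nsmul (Suc (snd y)) (fst z)"
      by (auto simp: div_rel_def)
    have "nsmul (Suc (snd y)) (nsmul (Suc (snd z)) (fst x))
        = nsmul (Suc (snd z)) (nsmul (Suc (snd x)) (fst y))"
      by (subst nsmul_commute) (simp only: *)
    also have "\<dots> = nsmul (Suc (snd x)) (nsmul (Suc (snd y)) (fst z))"
      by (subst nsmul_commute) (simp only: *)
    also have "\<dots> = nsmul (Suc (snd y)) (nsmul (Suc (snd x)) (fst z))"
      by (rule nsmul_commute)
    finally show "div_rel x z"
      by (simp add: div_rel_def nsmul_eq_iff)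
  qed
qed (auto simp: reflp_def symp_def div_rel_def)

quotient_type (overloaded) 'g div_hull = "'g::linordered_ab_group_add \<times> nat" / div_rel
  by (rule equivp_div_rel)

lemma div_plus_aux:
  assumes "nsmul M' g = nsmul M g'" "nsmul N' h = nsmul N h'"
  shows "nsmul (M' * N') (nsmul N g + nsmul M h) = nsmul (M * N) (nsmul N' g' + nsmul M' h')"
proof -
  have "nsmul (M' * N') (nsmul N g) = nsmul (N' * N) (nsmul M' g)"
    by (simp add: nsmul_nsmul mult_ac)
  moreover have "nsmul (M' * N') (nsmul M h) = nsmul (M' * M) (nsmul N' h)"
    by (simp add: nsmul_nsmul mult_ac)
  ultimately show ?thesis
    by (simp add: assms nsmul_add) (simp add: nsmul_nsmul mult_ac)
qed

lemma div_le_aux: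
  fixes g g' h h' :: "'g::linordered_ab_group_add"
  assumes "nsmul M' g = nsmul M g'" "nsmul N' h = nsmul N h'"
    "M > 0" "N > 0" "M' > 0" "N' > 0"
  shows "nsmul N g \<le> nsmul M h \<longleftrightarrow> nsmul N' g' \<le> nsmul M' h'"
proof -
  have "nsmul N g \<le> nsmul M h \<longleftrightarrow> nsmul (M' * N') (nsmul N g) \<le> nsmul (M' * N') (nsmul M h)"
    using assms by (intro nsmul_le_iff [symmetric]) auto
  also have "nsmul (M' * N') (nsmul N g) = nsmul (N' * N) (nsmul M' g)"
    by (simp add: nsmul_nsmul mult_ac)
  also have "\<dots> = nsmul (M * N) (nsmul N' g')"
    by (simp add: assms nsmul_nsmul mult_ac)
  also have "nsmul (M' * N') (nsmul M h) = nsmul (M' * M) (nsmul N' h)"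
    by (simp add: nsmul_nsmul mult_ac)
  also have "\<dots> = nsmul (M * N) (nsmul M' h')"
    by (simp add: assms nsmul_nsmul mult_ac)
  also have "nsmul (M * N) (nsmul N' g') \<le> nsmul (M * N) (nsmul M' h')
      \<longleftrightarrow> nsmul N' g' \<le> nsmul M' h'"
    using assms by (intro nsmul_le_iff) auto
  finally show ?thesis .
qed

instantiation div_hull :: (linordered_ab_group_add) linordered_ab_group_add
begin

lift_definition zero_div_hull :: "'a div_hull" is "(0, 0)" .

lift_definition plus_div_hull :: "'a div_hull \<Rightarrow> 'a div_hull \<Rightarrow> 'a div_hull"
  is "\<lambda>(g, m) (h, n). (nsmul (Suc n) g + nsmul (Suc m) h, Suc m * Suc n - 1)"
  by (auto simp: div_rel_def simp del: mult_Suc mult_Suc_right intro!: div_plus_aux)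

lift_definition uminus_div_hull :: "'a div_hull \<Rightarrow> 'a div_hull"
  is "\<lambda>(g, m). (- g, m)"
  by (auto simp: div_rel_def nsmul_uminus)

definition minus_div_hull :: "'a div_hull \<Rightarrow> 'a div_hull \<Rightarrow> 'a div_hull" where
  "minus_div_hull x y = x + (- y)"

lift_definition less_eq_div_hull :: "'a div_hull \<Rightarrow> 'a div_hull \<Rightarrow> bool"
  is "\<lambda>(g, m) (h, n). nsmul (Suc n) g \<le> nsmul (Suc m) h"
  unfolding div_rel_def split_beta by (intro div_le_aux) auto

definition less_div_hull :: "'a div_hull \<Rightarrow> 'a div_hull \<Rightarrow> bool" where
  "less_div_hull x y \<longleftrightarrow> x \<le> y \<and> \<not> y \<le> x"

instance
proof
  fix x y z :: "'a div_hull"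
  show "x + y + z = x + (y + z)"
    by transfer (auto simp: div_rel_def nsmul_add nsmul_nsmul mult_ac add_ac simp del: mult_Suc mult_Suc_right)
  show "x + y = y + x"
    by transfer (auto simp: div_rel_def nsmul_add nsmul_nsmul mult_ac add_ac simp del: mult_Suc mult_Suc_right)
  show "0 + x = x"
    by transfer (auto simp: div_rel_def nsmul_Suc)
  show "- x + x = 0"
    by transfer (auto simp: div_rel_def nsmul_uminus nsmul_Suc)
  show "x - y = x + - y"
    by (simp add: minus_div_hull_def)
  show "x < y \<longleftrightarrow> x \<le> y \<and> \<not> y \<le> x"
    by (simp add: less_div_hull_def)
  show "x \<le> x"
    by transfer auto
  show "x \<le> y \<or> y \<le> x"
    by transfer auto
  show "x = y" if "x \<le> y" "y \<le> x"
    using that by transfer (auto simp: div_rel_def)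
  show "x \<le> z" if "x \<le> y" "y \<le> z"
    using that
  proof (transfer, clarsimp)
    fix f g h :: 'a and k m n :: nat
    assume 1: "nsmul (Suc m) f \<le> nsmul (Suc k) g" and 2: "nsmul (Suc n) g \<le> nsmul (Suc m) h"
    have "nsmul (Suc m) (nsmul (Suc n) f) = nsmul (Suc n) (nsmul (Suc m) f)"
      by (rule nsmul_commute)
    also have "\<dots> \<le> nsmul (Suc n) (nsmul (Suc k) g)"
      using 1 by (simp add: nsmul_le_iff)
    also have "\<dots> = nsmul (Suc k) (nsmul (Suc n) g)"
      by (rule nsmul_commute)
    also have "\<dots> \<le> nsmul (Suc k) (nsmul (Suc m) h)"
      using 2 by (simp add: nsmul_le_iff)
    also have "\<dots> = nsmul (Suc m) (nsmul (Suc k) h)"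
      by (rule nsmul_commute)
    finally show "nsmul (Suc n) f \<le> nsmul (Suc k) h"
      by (simp add: nsmul_le_iff)
  qed
  show "z + x \<le> z + y" if "x \<le> y"
    using that
  proof (transfer, clarsimp simp del: mult_Suc mult_Suc_right)
    fix f g h :: 'a and k m n :: nat
    assume 1: "nsmul (Suc n) f \<le> nsmul (Suc m) g"
    let ?c = "Suc k * Suc k"
    have "nsmul ?c (nsmul (Suc n) f) \<le> nsmul ?c (nsmul (Suc m) g)"
      using 1 by (simp add: nsmul_le_iff del: mult_Suc mult_Suc_right)
    then show "nsmul (Suc k * Suc n) (nsmul (Suc m) h + nsmul (Suc k) f)
        \<le> nsmul (Suc k * Suc m) (nsmul (Suc n) h + nsmul (Suc k) g)"
      by (simp add: nsmul_add nsmul_nsmul mult_ac del: mult_Suc mult_Suc_right)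
  qed
qed

end

lift_definition div_frac :: "'g::linordered_ab_group_add \<Rightarrow> nat \<Rightarrow> 'g div_hull" is Pair .

definition div_embed :: "'g::linordered_ab_group_add \<Rightarrow> 'g div_hull" where
  "div_embed g = div_frac g 0"

lemma div_embed_add: "div_embed (x + y) = div_embed x + div_embed y"
  unfolding div_embed_def by transfer (simp add: div_rel_def nsmul_Suc)

lemma div_embed_le_iff [simp]: "div_embed x \<le> div_embed y \<longleftrightarrow> x \<le> y"
  unfolding div_embed_def by transfer (simp add: nsmul_Suc)

lemma nsmul_div_frac: "nsmul k (div_frac g m) = div_frac (nsmul k g) m"
proof (induction k)
  case 0
  show ?case
    by (simp, transfer) (simp add: div_rel_def)
next
  case (Suc k)
  have "div_frac g m + div_frac h m = div_frac (g + h) m" for h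
    by transfer (simp add: div_rel_def nsmul_add nsmul_nsmul del: mult_Suc mult_Suc_right)
  with Suc show ?case
    by (simp add: nsmul_Suc)
qed

lemma div_hull_divisible:
  assumes "n > 0"
  shows "\<exists>y. nsmul n y = (x :: 'g::linordered_ab_group_add div_hull)"
proof -
  obtain g m where x: "x = div_frac g m"
    by transfer (use equivp_reflp [OF equivp_div_rel] in fastforce)
  have "div_frac (nsmul n g) (n * Suc m - 1) = div_frac g m"
    using assms by transfer (simp add: div_rel_def nsmul_nsmul mult_ac del: mult_Suc mult_Suc_right)
  with x show ?thesis
    by (metis nsmul_div_frac)
qed

lemma div_hull_torsion_over_embed:
  "\<exists>n>0. nsmul n x \<in> range (div_embed :: 'g::linordered_ab_group_add \<Rightarrow> _)"
proof -
  obtain g m where x: "x = div_frac g m"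
    by transfer (use equivp_reflp [OF equivp_div_rel] in fastforce)
  have "div_frac (nsmul (Suc m) g) m = div_frac g 0"
    by transfer (simp add: div_rel_def nsmul_Suc)
  with x have "nsmul (Suc m) x = div_embed g"
    by (simp add: nsmul_div_frac div_embed_def)
  then show ?thesis
    by (intro exI [of _ "Suc m"]) auto
qed


section \<open>Valuations\<close>

text \<open>Valuations are written additively, with values in an arbitrary linearly ordered abelian group;
  the value group is the image of the nonzero elements and need not be all of \<open>'g\<close>. The value
  \<open>v 0 = \<infinity>\<close> is left implicit: \<open>v \<zero>\<close> is never used.\<close>

definition valuation :: "('a, 'm) ring_scheme \<Rightarrow> ('a \<Rightarrow> 'g::linordered_ab_group_add) \<Rightarrow> bool" where
  "valuation F v \<longleftrightarrow>
     (\<forall>x\<in>carrier F - {\<zero>\<^bsub>F\<^esub>}. \<forall>y\<in>carrier F - {\<zero>\<^bsub>F\<^esub>}.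
        v (x \<otimes>\<^bsub>F\<^esub> y) = v x + v y \<and>
        (x \<oplus>\<^bsub>F\<^esub> y \<noteq> \<zero>\<^bsub>F\<^esub> \<longrightarrow> min (v x) (v y) \<le> v (x \<oplus>\<^bsub>F\<^esub> y)))"

definition value_group :: "('a, 'm) ring_scheme \<Rightarrow> ('a \<Rightarrow> 'g::linordered_ab_group_add) \<Rightarrow> 'g monoid" where
  "value_group F v = \<lparr>carrier = v ` (carrier F - {\<zero>\<^bsub>F\<^esub>}), monoid.mult = (+), one = 0\<rparr>"

definition valuation_ring ::
  "('a, 'm) ring_scheme \<Rightarrow> ('a \<Rightarrow> 'g::linordered_ab_group_add) \<Rightarrow> ('a, 'm) ring_scheme" where
  "valuation_ring F v = F\<lparr>carrier := {x \<in> carrier F. x = \<zero>\<^bsub>F\<^esub> \<or> 0 \<le> v x}\<rparr>"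

definition valuation_ideal ::
  "('a, 'm) ring_scheme \<Rightarrow> ('a \<Rightarrow> 'g::linordered_ab_group_add) \<Rightarrow> 'a set" where
  "valuation_ideal F v = {x \<in> carrier F. x = \<zero>\<^bsub>F\<^esub> \<or> 0 < v x}"

definition residue_field ::
  "('a, 'm) ring_scheme \<Rightarrow> ('a \<Rightarrow> 'g::linordered_ab_group_add) \<Rightarrow> 'a set ring" where
  "residue_field F v = valuation_ring F v Quot valuation_ideal F v"

text \<open>The additive order of \<open>\<one>\<close>, which is \<open>0\<close> if \<open>\<one>\<close> has infinite order.\<close>

definition ring_characteristic :: "('a, 'm) ring_scheme \<Rightarrow> nat" where
  "ring_characteristic R = group.ord (add_monoid R) \<one>\<^bsub>R\<^esub>"

definition nontrivially_valued_field ::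
  "('a, 'm) ring_scheme \<Rightarrow> ('a \<Rightarrow> 'g::linordered_ab_group_add) \<Rightarrow> bool" where
  "nontrivially_valued_field F v \<longleftrightarrow>
     field F \<and> valuation F v \<and> carrier (value_group F v) \<noteq> {0}"


section \<open>Completion\<close>

text \<open>The completion for the valuation topology is constructed as the ring of Cauchy nets indexed by
  the value group, modulo the null nets. The sets \<open>{x. x = 0 \<or> \<gamma> < v x}\<close> with \<open>\<gamma>\<close> in
  the value group form a neighbourhood base of \<open>0\<close>, so that nets of this shape suffice. The type
  \<open>'g\<close> may be larger than the value group (which may even be bounded in \<open>'g\<close>), hence the filter
  below in place of \<open>at_top\<close>; the entries of a net outside the value group are irrelevant modulo null
  nets.\<close>

definition value_filter :: "('a, 'm) ring_scheme \<Rightarrow> ('a \<Rightarrow> 'g::linordered_ab_group_add) \<Rightarrow> 'g filter" where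
  "value_filter F v = (INF \<delta>\<in>carrier (value_group F v).
     principal {\<alpha> \<in> carrier (value_group F v). \<delta> \<le> \<alpha>})"

definition cauchy_net ::
  "('a, 'm) ring_scheme \<Rightarrow> ('a \<Rightarrow> 'g::linordered_ab_group_add) \<Rightarrow> ('g \<Rightarrow> 'a) \<Rightarrow> bool" where
  "cauchy_net F v x \<longleftrightarrow> range x \<subseteq> carrier F \<and>
     (\<forall>\<gamma>\<in>carrier (value_group F v).
        \<forall>\<^sub>F (\<alpha>, \<beta>) in value_filter F v \<times>\<^sub>F value_filter F v.
          x \<alpha> = x \<beta> \<or> \<gamma> < v (x \<alpha> \<ominus>\<^bsub>F\<^esub> x \<beta>))"

definition null_net ::
  "('a, 'm) ring_scheme \<Rightarrow> ('a \<Rightarrow> 'g::linordered_ab_group_add) \<Rightarrow> ('g \<Rightarrow> 'a) \<Rightarrow> bool" where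
  "null_net F v x \<longleftrightarrow> range x \<subseteq> carrier F \<and>
     (\<forall>\<gamma>\<in>carrier (value_group F v).
        \<forall>\<^sub>F \<alpha> in value_filter F v. x \<alpha> = \<zero>\<^bsub>F\<^esub> \<or> \<gamma> < v (x \<alpha>))"

definition cauchy_net_ring ::
  "('a, 'm) ring_scheme \<Rightarrow> ('a \<Rightarrow> 'g::linordered_ab_group_add) \<Rightarrow> ('g \<Rightarrow> 'a) ring" where
  "cauchy_net_ring F v =
     \<lparr>carrier = {x. cauchy_net F v x},
      monoid.mult = (\<lambda>x y \<alpha>. x \<alpha> \<otimes>\<^bsub>F\<^esub> y \<alpha>), one = (\<lambda>\<alpha>. \<one>\<^bsub>F\<^esub>),
      ring.zero = (\<lambda>\<alpha>. \<zero>\<^bsub>F\<^esub>), add = (\<lambda>x y \<alpha>. x \<alpha> \<oplus>\<^bsub>F\<^esub> y \<alpha>)\<rparr>"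

definition completion ::
  "('a, 'm) ring_scheme \<Rightarrow> ('a \<Rightarrow> 'g::linordered_ab_group_add) \<Rightarrow> ('g \<Rightarrow> 'a) set ring" where
  "completion F v = cauchy_net_ring F v Quot {x. null_net F v x}"

text \<open>The continuous extension of \<open>v\<close> to the completion: \<open>v\<close> is eventually constant along a Cauchy
  net that is not a null net.\<close>

definition completion_valuation ::
  "('a, 'm) ring_scheme \<Rightarrow> ('a \<Rightarrow> 'g::linordered_ab_group_add) \<Rightarrow> ('g \<Rightarrow> 'a) set \<Rightarrow> 'g" where
  "completion_valuation F v a =
     (THE \<gamma>. \<exists>x\<in>a. \<forall>\<^sub>F \<alpha> in value_filter F v. x \<alpha> \<noteq> \<zero>\<^bsub>F\<^esub> \<and> v (x \<alpha>) = \<gamma>)"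


section \<open>Deeply ramified fields\<close>

definition convex_subgroup :: "'g::linordered_ab_group_add set \<Rightarrow> 'g monoid \<Rightarrow> bool" where
  "convex_subgroup \<Gamma> G \<longleftrightarrow>
     subgroup \<Gamma> G \<and> (\<forall>a\<in>\<Gamma>. \<forall>b\<in>carrier G. 0 \<le> b \<and> b \<le> a \<longrightarrow> b \<in> \<Gamma>)"

text \<open>For a quotient of convex subgroups, an isomorphism of groups with \<open>\<int>\<close> is the same as one of
  ordered groups up to sign.\<close>

definition DRvg :: "('a, 'm) ring_scheme \<Rightarrow> ('a \<Rightarrow> 'g::linordered_ab_group_add) \<Rightarrow> bool" where
  "DRvg F v \<longleftrightarrow>
     (\<forall>\<Gamma>\<^sub>1 \<Gamma>\<^sub>2. convex_subgroup \<Gamma>\<^sub>1 (value_group F v) \<and> convex_subgroup \<Gamma>\<^sub>2 (value_group F v) \<and>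
        \<Gamma>\<^sub>1 \<subset> \<Gamma>\<^sub>2 \<longrightarrow> \<not> ((value_group F v)\<lparr>carrier := \<Gamma>\<^sub>2\<rparr> Mod \<Gamma>\<^sub>1) \<cong> integer_group)"

definition DRvr :: "('a, 'm) ring_scheme \<Rightarrow> ('a \<Rightarrow> 'g::linordered_ab_group_add) \<Rightarrow> bool" where
  "DRvr F v \<longleftrightarrow>
     (let p = ring_characteristic (residue_field F v);
          O_hat = valuation_ring (completion F v) (completion_valuation F v);
          Q = O_hat Quot (PIdl\<^bsub>O_hat\<^esub> ([p] \<cdot>\<^bsub>O_hat\<^esub> \<one>\<^bsub>O_hat\<^esub>))
      in p > 0 \<longrightarrow> (\<lambda>x. x [^]\<^bsub>Q\<^esub> p) ` carrier Q = carrier Q)"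

definition deeply_ramified_field :: "('a, 'm) ring_scheme \<Rightarrow> ('a \<Rightarrow> 'g::linordered_ab_group_add) \<Rightarrow> bool" where
  "deeply_ramified_field F v \<longleftrightarrow> nontrivially_valued_field F v \<and> DRvg F v \<and> DRvr F v"


section \<open>Kaehler differentials\<close>

definition free_module :: "('b, 'm) ring_scheme \<Rightarrow> 'x set \<Rightarrow> ('b, 'x \<Rightarrow> 'b) module" where
  "free_module B S =
     \<lparr>carrier = {f \<in> S \<rightarrow>\<^sub>E carrier B. finite {x \<in> S. f x \<noteq> \<zero>\<^bsub>B\<^esub>}},
      monoid.mult = undefined, one = undefined,
      ring.zero = (\<lambda>x\<in>S. \<zero>\<^bsub>B\<^esub>), add = (\<lambda>f g. \<lambda>x\<in>S. f x \<oplus>\<^bsub>B\<^esub> g x),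
      module.smult = (\<lambda>b f. \<lambda>x\<in>S. b \<otimes>\<^bsub>B\<^esub> f x)\<rparr>"

definition quot_module :: "('b, 'c, 'm) module_scheme \<Rightarrow> 'c set \<Rightarrow> ('b, 'c set) module" where
  "quot_module M N =
     \<lparr>carrier = a_rcosets\<^bsub>M\<^esub> N, monoid.mult = undefined, one = undefined,
      ring.zero = N, add = set_add M,
      module.smult = (\<lambda>b C. \<Union>x\<in>C. N +>\<^bsub>M\<^esub> (b \<odot>\<^bsub>M\<^esub> x))\<rparr>"

definition basis_elt :: "('b, 'm) ring_scheme \<Rightarrow> 'b \<Rightarrow> 'b \<Rightarrow> 'b" where
  "basis_elt B b = (\<lambda>x\<in>carrier B. if x = b then \<one>\<^bsub>B\<^esub> else \<zero>\<^bsub>B\<^esub>)"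

text \<open>The differentials of \<open>B\<close> over \<open>A\<close>, where \<open>B\<close> is an \<open>A\<close>-algebra via \<open>\<phi> : A \<rightarrow> B\<close>: the free
  \<open>B\<close>-module on symbols \<open>db\<close>, modulo the relations \<open>d(b + c) = db + dc\<close>,
  \<open>d(b c) = b dc + c db\<close> and \<open>d(\<phi>(a)) = 0\<close>.\<close>

definition kaehler_relations ::
  "('a, 'k) ring_scheme \<Rightarrow> ('b, 'm) ring_scheme \<Rightarrow> ('a \<Rightarrow> 'b) \<Rightarrow> ('b \<Rightarrow> 'b) set" where
  "kaehler_relations A B \<phi> =
     (let M = free_module B (carrier B); d = basis_elt B in
        {d (b \<oplus>\<^bsub>B\<^esub> c) \<ominus>\<^bsub>M\<^esub> (d b \<oplus>\<^bsub>M\<^esub> d c) | b c. b \<in> carrier B \<and> c \<in> carrier B} \<union>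
        {d (b \<otimes>\<^bsub>B\<^esub> c) \<ominus>\<^bsub>M\<^esub> (b \<odot>\<^bsub>M\<^esub> d c \<oplus>\<^bsub>M\<^esub> c \<odot>\<^bsub>M\<^esub> d b) | b c. b \<in> carrier B \<and> c \<in> carrier B} \<union>
        {d (\<phi> a) | a. a \<in> carrier A})"

definition kaehler ::
  "('a, 'k) ring_scheme \<Rightarrow> ('b, 'm) ring_scheme \<Rightarrow> ('a \<Rightarrow> 'b) \<Rightarrow> ('b, ('b \<Rightarrow> 'b) set) module" where
  "kaehler A B \<phi> =
     (let M = free_module B (carrier B)
      in quot_module M ((\<lambda>N. submodule N B M) hull kaehler_relations A B \<phi>))"


section \<open>Algebraic extensions\<close>

text \<open>The base field is a type \<open>'a\<close>; its algebraic extensions are, up to isomorphism, the intermediate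
  fields \<open>L\<close> of \<open>'a alg_closure\<close>.\<close>

abbreviation base_field :: "'a::field ring" where
  "base_field \<equiv> ring_of_type_algebra"

definition ext_field :: "'a::field alg_closure set \<Rightarrow> 'a alg_closure ring" where
  "ext_field L = ring_of_type_algebra\<lparr>carrier := L\<rparr>"

definition intermediate_field :: "'a::field alg_closure set \<Rightarrow> bool" where
  "intermediate_field L \<longleftrightarrow>
     subfield L (ring_of_type_algebra :: 'a alg_closure ring) \<and> range to_ac \<subseteq> L"

definition ext_degree :: "'a::field alg_closure set \<Rightarrow> nat" where
  "ext_degree L = vector_space.dim (\<lambda>c x. to_ac c * x) L"

definition normal_extension :: "'a::field alg_closure set \<Rightarrow> bool" where
  "normal_extension L \<longleftrightarrow>
     (\<forall>f :: 'a poly. Factorial_Ring.irreducible f \<and> (\<exists>x\<in>L. poly (map_poly to_ac f) x = 0) \<longrightarrow>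
        {x. poly (map_poly to_ac f) x = 0} \<subseteq> L)"

definition separable_extension :: "'a::field alg_closure set \<Rightarrow> bool" where
  "separable_extension L \<longleftrightarrow>
     (\<forall>x\<in>L. \<exists>f :: 'a poly. Factorial_Ring.irreducible f \<and> poly (map_poly to_ac f) x = 0 \<and>
        rsquarefree (map_poly to_ac f))"

definition galois_extension :: "'a::field alg_closure set \<Rightarrow> bool" where
  "galois_extension L \<longleftrightarrow>
     intermediate_field L \<and> normal_extension L \<and> separable_extension L"

text \<open>Since \<open>L\<close> is algebraic over the base field, \<open>wL / vK\<close> is torsion. So every extension of \<open>v\<close> to
  \<open>L\<close> takes values, up to a unique isomorphism over the value group of \<open>v\<close>, in the divisible hull.\<close>

definition extends_valuation ::
  "('a::field \<Rightarrow> 'g::linordered_ab_group_add) \<Rightarrow> 'a alg_closure set \<Rightarrow> ('a alg_closure \<Rightarrow> 'g div_hull) \<Rightarrow> bool" where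
  "extends_valuation v L w \<longleftrightarrow>
     valuation (ext_field L) w \<and> (\<forall>x. x \<noteq> 0 \<longrightarrow> w (to_ac x) = div_embed (v x))"

definition unibranched ::
  "('a::field \<Rightarrow> 'g::linordered_ab_group_add) \<Rightarrow> 'a alg_closure set \<Rightarrow> bool" where
  "unibranched v L \<longleftrightarrow>
     (\<forall>w w'. extends_valuation v L w \<and> extends_valuation v L w' \<longrightarrow> (\<forall>x\<in>L - {0}. w x = w' x))"

end

theory Submission imports Defs begin

text \<open>Let \<open>L|K\<close> be cyclic of prime degree \<open>p\<close> and unibranched, let \<open>\<sigma>\<close> generate its Galois group, and
  let \<open>I\<close> be the ideal of \<open>\<O>\<^sub>L\<close> generated by the elements \<open>\<sigma> b - b\<close>. Then \<open>\<Omega>\<close> vanishes if and only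
  if \<open>I = I\<^sup>2\<close>: the derivation \<open>b \<mapsto> \<sigma> b - b\<close> into \<open>I/I\<^sup>2\<close> gives one direction, and for the other one
  approximates elements of \<open>\<O>\<^sub>L\<close> by elements of \<open>K\<close> modulo squares of elements of \<open>I\<close>.

  Write \<open>L = K(x)\<close> with \<open>x\<close> an Artin-Schreier or Kummer generator. The ideal \<open>I\<close> is then governed by
  how well \<open>K\<close> approximates \<open>x\<close>. The condition (DRvr) says that every \<open>a \<in> \<O>\<^sub>K\<close> is a \<open>p\<close>-th power up to
  any error that divides \<open>p\<close>; together with (DRvg) it lets one improve the approximations until
  \<open>I\<close> is idempotent. Conversely, if \<open>a\<close> is not congruent to a \<open>p\<close>-th power modulo \<open>e\<close>, then
  a root of \<open>X\<^sup>p - (e\<^sup>2)\<^sup>p\<^sup>-\<^sup>1 X - a\<close> or of \<open>X\<^sup>p - a\<close> is so far from \<open>K\<close> that it generates a unibranched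
  extension with \<open>I \<noteq> I\<^sup>2\<close>. If (DRvg) fails, then the value of some \<open>a\<close> generates a
  quotient \<open>\<int>\<close> of convex subgroups; in characteristic \<open>p\<close> this contradicts (DRvr), and in
  characteristic \<open>0\<close> the roots of \<open>X\<^sup>p - a\<close> have the same effect as before.\<close>

section \<open>Valuation rings of a field\<close>

text \<open>Nothing is henselian here and the rank is arbitrary. Each extension of \<open>v\<close>
  is cut out by a valuation ring \<open>V\<close> of the algebraic closure, values are compared by
  divisibility in \<open>V\<close>, and being unibranched becomes invariance of
  \<open>L \<inter> V\<close> under \<open>\<sigma>\<close> for all such \<open>V\<close>. For the
  extensions built in the converse this must be proved: if \<open>\<sigma>\<close> moves
  \<open>L \<inter> V\<close>, averaging with an element of unit trace approximates every
  \<open>x\<close> from \<open>K\<close> as closely as its conjugates do. So an \<open>x\<close>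
  farther from \<open>K\<close> than \<open>D x = \<sigma> x - x\<close> forces invariance. The same
  distance refutes idempotence: interpolation at \<open>c\<close> gives \<open>y\<close> in
  \<open>K\<close> such that \<open>D x\<close> divides \<open>(x - y) * D c ^ (p - 1)\<close>, and
  idempotence makes the value of \<open>D c\<close> as small as desired compared with that of
  \<open>D x\<close>. Hence it suffices to bound \<open>(x - y) ^ k\<close> by
  \<open>D x ^ (k - 1)\<close> for one fixed \<open>k\<close>. This is the origin of the square in
  the Artin-Schreier polynomial: \<open>D x\<close> has the value of \<open>e * e\<close> while
  \<open>e\<close> does not divide \<open>x - y\<close>, so \<open>k = 2\<close>. For Kummer
  generators \<open>D x = (w - 1) * x\<close>, where \<open>(w - 1) ^ (p - 1)\<close> has the value
  of \<open>p\<close>, so \<open>k = p\<close>.\<close>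

locale valuation_subring =
  fixes V :: "'b::field set"
  assumes one_mem [simp, intro]: "1 \<in> V"
    and diff_mem [intro]: "x \<in> V \<Longrightarrow> y \<in> V \<Longrightarrow> x - y \<in> V"
    and mult_mem [intro]: "x \<in> V \<Longrightarrow> y \<in> V \<Longrightarrow> x * y \<in> V"
    and mem_or_inverse_mem: "x \<in> V \<or> inverse x \<in> V"
begin

lemma zero_mem [simp, intro]: "0 \<in> V"
  using diff_mem [of 1 1] by simp

lemma uminus_mem [intro]: "x \<in> V \<Longrightarrow> - x \<in> V"
  using diff_mem [of 0 x] by simp

lemma add_mem [intro]: "x \<in> V \<Longrightarrow> y \<in> V \<Longrightarrow> x + y \<in> V"
  using diff_mem [of x "- y"] uminus_mem by simp

lemma power_mem [intro]: "x \<in> V \<Longrightarrow> x ^ n \<in> V"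
  by (induction n) auto

lemma of_nat_mem [simp, intro]: "of_nat n \<in> V"
  by (induction n) auto

lemma sum_mem [intro]: "(\<And>i. i \<in> A \<Longrightarrow> f i \<in> V) \<Longrightarrow> sum f A \<in> V"
  by (induction A rule: infinite_finite_induct) auto

lemma prod_mem [intro]: "(\<And>i. i \<in> A \<Longrightarrow> f i \<in> V) \<Longrightarrow> prod f A \<in> V"
  by (induction A rule: infinite_finite_induct) auto

text \<open>Divisibility in \<open>V\<close> encodes the valuation: \<open>a \<preceq> b\<close> means that the value of \<open>a\<close> is at most
  that of \<open>b\<close>, with \<open>0\<close> as the greatest element.\<close>

definition vle :: "'b \<Rightarrow> 'b \<Rightarrow> bool" (infix "\<preceq>" 50) where
  "a \<preceq> b \<longleftrightarrow> (\<exists>z\<in>V. b = a * z)"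

definition veq :: "'b \<Rightarrow> 'b \<Rightarrow> bool" (infix "\<asymp>" 50) where
  "a \<asymp> b \<longleftrightarrow> a \<preceq> b \<and> b \<preceq> a"

lemma vle_refl [simp, intro]: "a \<preceq> a"
  unfolding vle_def by (rule bexI [of _ 1]) auto

lemma vle_trans [trans]: "a \<preceq> b \<Longrightarrow> b \<preceq> c \<Longrightarrow> a \<preceq> c"
  unfolding vle_def using mult_mem by (metis mult.assoc)

lemma vle_0 [simp, intro]: "a \<preceq> 0"
  unfolding vle_def by (rule bexI [of _ 0]) auto

lemma zero_vle_iff [simp]: "0 \<preceq> a \<longleftrightarrow> a = 0"
  unfolding vle_def by auto

lemma one_vle_iff: "1 \<preceq> a \<longleftrightarrow> a \<in> V"
  unfolding vle_def by auto

lemma vle_iff_divide_mem: "a \<noteq> 0 \<Longrightarrow> a \<preceq> b \<longleftrightarrow> b / a \<in> V"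
  unfolding vle_def by (metis nonzero_mult_div_cancel_left times_divide_eq_right)

lemma vle_total: "a \<preceq> b \<or> b \<preceq> a"
proof (cases "a = 0 \<or> b = 0")
  case False
  then show ?thesis
    using mem_or_inverse_mem [of "b / a"] by (auto simp: vle_iff_divide_mem)
qed auto

lemma vle_linear: "\<not> a \<preceq> b \<Longrightarrow> b \<preceq> a"
  using vle_total by blast

lemma vle_mult: "a \<preceq> b \<Longrightarrow> c \<preceq> d \<Longrightarrow> a * c \<preceq> b * d"
  unfolding vle_def by (metis mult.assoc mult.left_commute mult_mem)

lemma vle_add: "c \<preceq> a \<Longrightarrow> c \<preceq> b \<Longrightarrow> c \<preceq> a + b"
  unfolding vle_def by (metis add_mem distrib_left)

lemma vle_uminus [simp]: "c \<preceq> - a \<longleftrightarrow> c \<preceq> a"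
  unfolding vle_def by (metis minus_minus mult_minus_right uminus_mem)

lemma uminus_vle [simp]: "- c \<preceq> a \<longleftrightarrow> c \<preceq> a"
  unfolding vle_def by (metis minus_mult_commute uminus_mem minus_minus mult_minus_left)

lemma vle_diff: "c \<preceq> a \<Longrightarrow> c \<preceq> b \<Longrightarrow> c \<preceq> a - b"
  using vle_add [of c a "- b"] by simp

lemma vle_minus_commute: "c \<preceq> a - b \<longleftrightarrow> c \<preceq> b - a"
  by (metis minus_diff_eq vle_uminus)

lemma vle_sum: "(\<And>i. i \<in> A \<Longrightarrow> c \<preceq> f i) \<Longrightarrow> c \<preceq> sum f A"
  by (induction A rule: infinite_finite_induct) (auto intro: vle_add)

lemma vle_power: "a \<preceq> b \<Longrightarrow> a ^ n \<preceq> b ^ n"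
  by (induction n) (auto intro: vle_mult)

lemma vle_mult_mem: "a \<preceq> b \<Longrightarrow> z \<in> V \<Longrightarrow> a \<preceq> b * z"
  using vle_mult [of a b 1 z] by (simp add: one_vle_iff)

lemma vle_mult_mem': "a \<preceq> b \<Longrightarrow> z \<in> V \<Longrightarrow> a \<preceq> z * b"
  by (simp add: mult.commute vle_mult_mem)

lemma vle_mult_cancel_left [simp]: "c \<noteq> 0 \<Longrightarrow> c * a \<preceq> c * b \<longleftrightarrow> a \<preceq> b"
  unfolding vle_def by auto

lemma vle_mult_cancel_right [simp]: "c \<noteq> 0 \<Longrightarrow> a * c \<preceq> b * c \<longleftrightarrow> a \<preceq> b"
  by (simp add: mult.commute [of _ c])

lemma vle_mult_self: "z \<in> V \<Longrightarrow> a \<preceq> a * z"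
  unfolding vle_def by auto

lemma vle_divide_iff: "c \<noteq> 0 \<Longrightarrow> a \<preceq> b / c \<longleftrightarrow> a * c \<preceq> b"
  using vle_mult_cancel_right [of c a "b / c"] by simp

lemma divide_vle_iff: "c \<noteq> 0 \<Longrightarrow> a / c \<preceq> b \<longleftrightarrow> a \<preceq> b * c"
  using vle_mult_cancel_right [of c "a / c" b] by simp

lemma vle_mem: "a \<preceq> b \<Longrightarrow> a \<in> V \<Longrightarrow> b \<in> V"
  unfolding vle_def by auto

text \<open>Otherwise \<open>a = b * z\<close> with \<open>z\<close> integral, and
  \<open>z ^ n\<close> would be a unit; a factor of a unit is a unit.\<close>

lemma vle_imp_power_vle:
  assumes "a ^ n \<preceq> b ^ n" "n > 0"
  shows "a \<preceq> b"
proof (rule ccontr)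
  assume *: "\<not> a \<preceq> b"
  then have "b \<preceq> a"
    using vle_linear by blast
  then obtain z where z: "z \<in> V" "a = b * z"
    unfolding vle_def by auto
  have "b \<noteq> 0"
    using * by auto
  then have "z ^ n \<preceq> 1"
    using assms(1) z vle_mult_cancel_left [of "b ^ n" "z ^ n" 1] by (simp add: power_mult_distrib)
  then obtain u where u: "u \<in> V" "1 = z ^ n * u"
    unfolding vle_def by auto
  obtain m where "n = Suc m"
    using assms(2) by (cases n) auto
  then have "z * (z ^ m * u) = 1"
    using u by (simp add: mult_ac)
  moreover have "z ^ m * u \<in> V"
    using z u by auto
  ultimately have "b = a * (z ^ m * u)"
    by (metis mult.assoc mult.right_neutral z(2))
  then show False
    using * \<open>z ^ m * u \<in> V\<close> unfolding vle_def by blast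
qed

lemma vle_power_iff: "n > 0 \<Longrightarrow> a ^ n \<preceq> b ^ n \<longleftrightarrow> a \<preceq> b"
  using vle_imp_power_vle vle_power by blast

lemma power_vle_power: "x \<in> V \<Longrightarrow> m \<le> n \<Longrightarrow> x ^ m \<preceq> x ^ n"
  by (metis le_Suc_ex power_add power_mem vle_mult_self)

lemma mem_power_iff: "n > 0 \<Longrightarrow> x ^ n \<in> V \<longleftrightarrow> x \<in> V"
  using vle_power_iff [of n 1 x] by (simp add: one_vle_iff)

lemma veq_refl [simp, intro]: "a \<asymp> a"
  by (simp add: veq_def)

lemma veq_sym: "a \<asymp> b \<Longrightarrow> b \<asymp> a"
  by (simp add: veq_def)

lemma veq_trans [trans]: "a \<asymp> b \<Longrightarrow> b \<asymp> c \<Longrightarrow> a \<asymp> c"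
  unfolding veq_def using vle_trans by blast

lemma vle_veq_trans [trans]: "a \<preceq> b \<Longrightarrow> b \<asymp> c \<Longrightarrow> a \<preceq> c"
  and veq_vle_trans [trans]: "a \<asymp> b \<Longrightarrow> b \<preceq> c \<Longrightarrow> a \<preceq> c"
  unfolding veq_def using vle_trans by blast+

lemma veq_mult: "a \<asymp> b \<Longrightarrow> c \<asymp> d \<Longrightarrow> a * c \<asymp> b * d"
  unfolding veq_def using vle_mult by blast

lemma veq_power: "a \<asymp> b \<Longrightarrow> a ^ n \<asymp> b ^ n"
  unfolding veq_def using vle_power by blast

lemma veq_prod: "(\<And>i. i \<in> A \<Longrightarrow> f i \<asymp> g i) \<Longrightarrow> prod f A \<asymp> prod g A"
  by (induction A rule: infinite_finite_induct) (auto intro: veq_mult)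

lemma veq_uminus [simp]: "- a \<asymp> b \<longleftrightarrow> a \<asymp> b" "a \<asymp> - b \<longleftrightarrow> a \<asymp> b"
  by (simp_all add: veq_def)

lemma veq_0_iff [simp]: "a \<asymp> 0 \<longleftrightarrow> a = 0" "0 \<asymp> a \<longleftrightarrow> a = 0"
  by (auto simp: veq_def)

lemma veq_power_iff: "n > 0 \<Longrightarrow> a ^ n \<asymp> b ^ n \<longleftrightarrow> a \<asymp> b"
  by (simp add: veq_def vle_power_iff)

lemma veq_mult_cancel_left [simp]: "c \<noteq> 0 \<Longrightarrow> c * a \<asymp> c * b \<longleftrightarrow> a \<asymp> b"
  by (simp add: veq_def)

lemma veq_mult_cancel_right [simp]: "c \<noteq> 0 \<Longrightarrow> a * c \<asymp> b * c \<longleftrightarrow> a \<asymp> b"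
  by (simp add: veq_def)

lemma veq_divide:
  assumes "a \<asymp> b" "c \<asymp> d"
  shows "a / c \<asymp> b / d"
proof (cases "c = 0")
  case False
  then have "d \<noteq> 0"
    using assms by auto
  have "(a / c) * (c * d) \<asymp> (b / d) * (c * d)"
    using veq_mult [OF assms(1) veq_sym [OF assms(2)]] False \<open>d \<noteq> 0\<close> by simp
  then show ?thesis
    using False \<open>d \<noteq> 0\<close> by (simp del: times_divide_eq_left times_divide_eq_right)
qed (use assms in auto)

text \<open>The strict triangle inequality: by totality, \<open>\<not> b \<preceq> a\<close> says
  that \<open>b\<close> has the larger value. Likewise \<open>\<not> x \<preceq> 1\<close> says
  everywhere below that \<open>x\<close> lies in the maximal ideal.\<close>

lemma veq_add_strict:
  assumes "\<not> b \<preceq> a"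
  shows "a + b \<asymp> a"
proof -
  have "a \<preceq> b"
    using assms vle_linear by blast
  moreover have "a + b \<preceq> a"
    using assms vle_linear [of "a + b" b] vle_diff [of _ "a + b" b] by (metis add_diff_cancel_right' vle_refl)
  ultimately show ?thesis
    by (simp add: veq_def vle_add)
qed

lemma veq_diff_strict: "\<not> b \<preceq> a \<Longrightarrow> a - b \<asymp> a"
  using veq_add_strict [of "- b" a] by simp

lemma veq_close:
  assumes "c \<preceq> a - b" "\<not> c \<preceq> b"
  shows "a \<asymp> b"
  using veq_add_strict [of "a - b" b] assms vle_trans by auto

end

locale subfield_set =
  fixes L :: "'b::field set"
  assumes one_mem [simp, intro]: "1 \<in> L"
    and diff_mem [simp, intro]: "x \<in> L \<Longrightarrow> y \<in> L \<Longrightarrow> x - y \<in> L"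
    and mult_mem [simp, intro]: "x \<in> L \<Longrightarrow> y \<in> L \<Longrightarrow> x * y \<in> L"
    and inverse_mem [simp, intro]: "x \<in> L \<Longrightarrow> inverse x \<in> L"
begin

lemma zero_mem [simp, intro]: "0 \<in> L"
  using diff_mem [of 1 1] by simp

lemma uminus_mem [simp, intro]: "x \<in> L \<Longrightarrow> - x \<in> L"
  using diff_mem [of 0 x] by simp

lemma add_mem [simp, intro]: "x \<in> L \<Longrightarrow> y \<in> L \<Longrightarrow> x + y \<in> L"
  using diff_mem [of x "- y"] uminus_mem by simp

lemma divide_mem [simp, intro]: "x \<in> L \<Longrightarrow> y \<in> L \<Longrightarrow> x / y \<in> L"
  by (simp add: divide_inverse inverse_mem mult_mem)

lemma power_mem [simp, intro]: "x \<in> L \<Longrightarrow> x ^ n \<in> L"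
  by (induction n) auto

lemma of_nat_mem [simp, intro]: "of_nat n \<in> L"
  by (induction n) auto

lemma sum_mem [intro]: "(\<And>i. i \<in> A \<Longrightarrow> f i \<in> L) \<Longrightarrow> sum f A \<in> L"
  by (induction A rule: infinite_finite_induct) auto

lemma prod_mem [intro]: "(\<And>i. i \<in> A \<Longrightarrow> f i \<in> L) \<Longrightarrow> prod f A \<in> L"
  by (induction A rule: infinite_finite_induct) auto

lemma poly_mem: "(\<And>i. coeff f i \<in> L) \<Longrightarrow> x \<in> L \<Longrightarrow> poly f x \<in> L"
  unfolding poly_altdef by auto

end

text \<open>A subring \<open>A\<close> of the field lies over \<open>V\<^sub>0\<close> if and only if the maximal ideal of \<open>V\<^sub>0\<close> does not
  generate the unit ideal of \<open>A\<close>, which is why Zorn's lemma applies to the condition \<open>A \<inter> L = V\<^sub>0\<close>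
  directly.\<close>

theorem (in subfield_set) valuation_subring_extension:
  assumes V0: "V\<^sub>0 \<subseteq> L" "1 \<in> V\<^sub>0"
      "\<And>x y. x \<in> V\<^sub>0 \<Longrightarrow> y \<in> V\<^sub>0 \<Longrightarrow> x - y \<in> V\<^sub>0" "\<And>x y. x \<in> V\<^sub>0 \<Longrightarrow> y \<in> V\<^sub>0 \<Longrightarrow> x * y \<in> V\<^sub>0"
      "\<And>x. x \<in> L \<Longrightarrow> x \<in> V\<^sub>0 \<or> inverse x \<in> V\<^sub>0"
  obtains V where "valuation_subring V" "V \<inter> L = V\<^sub>0"
proof -
  define P where "P A \<longleftrightarrow> 1 \<in> A \<and> (\<forall>x\<in>A. \<forall>y\<in>A. x - y \<in> A \<and> x * y \<in> A) \<and> A \<inter> L = V\<^sub>0" for A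
  have "\<exists>M\<in>Collect P. \<forall>B\<in>Collect P. M \<subseteq> B \<longrightarrow> B = M"
  proof (rule subset_Zorn_nonempty)
    show "Collect P \<noteq> {}"
      using V0 by (auto simp: P_def intro!: exI [of _ V\<^sub>0])
  next
    fix C assume "C \<noteq> {}" and C: "subset.chain (Collect P) C"
    then have sub: "\<And>A. A \<in> C \<Longrightarrow> P A" and tot: "\<And>A B. A \<in> C \<Longrightarrow> B \<in> C \<Longrightarrow> A \<subseteq> B \<or> B \<subseteq> A"
      by (auto simp: subset_chain_def)
    have "x - y \<in> \<Union>C \<and> x * y \<in> \<Union>C" if xy: "x \<in> \<Union>C" "y \<in> \<Union>C" for x y
    proof -
      obtain A where "A \<in> C" "x \<in> A" "y \<in> A"
        using xy tot by blast
      with sub [of A] show ?thesis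
        unfolding P_def by blast
    qed
    moreover have "\<Union>C \<inter> L = V\<^sub>0" "1 \<in> \<Union>C"
      using sub \<open>C \<noteq> {}\<close> by (auto simp: P_def)
    ultimately show "\<Union>C \<in> Collect P"
      by (simp add: P_def)
  qed
  then obtain A where "P A" and max: "\<And>B. P B \<Longrightarrow> A \<subseteq> B \<Longrightarrow> B = A"
    by auto
  then have A: "1 \<in> A" "\<And>x y. x \<in> A \<Longrightarrow> y \<in> A \<Longrightarrow> x - y \<in> A" "\<And>x y. x \<in> A \<Longrightarrow> y \<in> A \<Longrightarrow> x * y \<in> A"
      and AL: "A \<inter> L = V\<^sub>0"
    by (auto simp: P_def)
  have A0: "0 \<in> A"
    using A(1) A(2) by fastforce
  have A_minus: "- x \<in> A" if "x \<in> A" for x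
    using A(2) [OF A0 that] by simp
  have A_add: "x + y \<in> A" if "x \<in> A" "y \<in> A" for x y
    using A(2) [OF that(1) A_minus [OF that(2)]] by simp
  have A_sum: "sum f I \<in> A" if "\<And>i. i \<in> I \<Longrightarrow> f i \<in> A" for f :: "nat \<Rightarrow> 'b" and I
    using that by (induction I rule: infinite_finite_induct) (auto intro: A_add A0)
  have A_power: "x ^ n \<in> A" if "x \<in> A" for x n
    using that by (induction n) (auto intro: A)
  have V0A: "V\<^sub>0 \<subseteq> A"
    using AL by auto
  \<comment> \<open>\<open>N\<close> is the maximal ideal of \<open>V\<^sub>0\<close> and
    \<open>M\<close> the ideal of \<open>A\<close> generated by it. Single products suffice to
    describe \<open>M\<close>, because of two elements of \<open>N\<close> one divides the other in
    \<open>V\<^sub>0\<close>.\<close>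
  define N where "N = {m \<in> V\<^sub>0. m = 0 \<or> inverse m \<notin> V\<^sub>0}"
  define M where "M = {m * a | m a. m \<in> N \<and> a \<in> A}"
  have M_mult: "x * a \<in> M" if "x \<in> M" "a \<in> A" for x a
    using that A(3) unfolding M_def by (smt (verit) mem_Collect_eq mult.assoc)
  have M_add_aux: "m * a + m' * a' \<in> M"
    if "m \<in> N" "a \<in> A" "a' \<in> A" "m \<noteq> 0" "m' / m \<in> V\<^sub>0" for m a m' a'
  proof -
    have "m * a + m' * a' = m * (a + m' / m * a')"
      using that by (simp add: field_simps)
    moreover have "a + m' / m * a' \<in> A"
      using that V0A by (intro A_add A) auto
    ultimately show ?thesis
      using that unfolding M_def by blast
  qed
  have M_add: "x + y \<in> M" if "x \<in> M" "y \<in> M" for x y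
  proof -
    obtain m a m' a' where *: "x = m * a" "y = m' * a'" "m \<in> N" "m' \<in> N" "a \<in> A" "a' \<in> A"
      using \<open>x \<in> M\<close> \<open>y \<in> M\<close> unfolding M_def by blast
    show ?thesis
    proof (cases "m = 0 \<or> m' = 0")
      case False
      have "m' / m \<in> L"
        using * V0 by (auto simp: N_def)
      then have "m' / m \<in> V\<^sub>0 \<or> m / m' \<in> V\<^sub>0"
        using V0(5) [of "m' / m"] by simp
      then show ?thesis
        using M_add_aux [of m a a' m'] M_add_aux [of m' a' a m] * False by (auto simp: add.commute)
    qed (use that * in auto)
  qed
  have M0: "0 \<in> M"
  proof -
    have "0 \<in> V\<^sub>0"
      using V0(2,3) by fastforce
    then show ?thesis
      unfolding M_def N_def using A0 by force
  qed
  have M_sum: "sum f I \<in> M" if "\<And>i. i \<in> I \<Longrightarrow> f i \<in> M" for f :: "nat \<Rightarrow> 'b" and I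
    using that by (induction I rule: infinite_finite_induct) (auto intro: M_add M0)
  have M1: "1 \<notin> M"
  proof
    assume "1 \<in> M"
    then obtain m a where *: "1 = m * a" "m \<in> N" "a \<in> A"
      unfolding M_def by blast
    then have "m \<noteq> 0" "m \<in> L"
      using V0(1) by (auto simp: N_def)
    moreover from this * have "a = inverse m"
      by (simp add: inverse_unique)
    ultimately show False
      using * AL by (auto simp: N_def)
  qed
  have MA: "M \<subseteq> A"
    using V0A A(3) by (auto simp: M_def N_def)
  \<comment> \<open>Chevalley's argument: for \<open>y\<close> outside \<open>A\<close> the ring
    generated by \<open>A\<close> and \<open>y\<close> is too big, which makes \<open>M\<close>
    generate its unit ideal; this is a relation \<open>Q n y\<close>. If \<open>y\<close> and its
    inverse both had such relations, the shorter one could be used to shorten the longer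
    one.\<close>
  define Q where "Q n y \<longleftrightarrow> (\<exists>a. (\<forall>i<n. a i \<in> M) \<and> (\<Sum>i<n. a i * y ^ i) = 1)" for n :: nat and y :: 'b
  have Q: "\<exists>n. Q n x" if "x \<notin> A" for x
  proof -
    define B where "B = {poly q x | q. \<forall>i. coeff q i \<in> A}"
    have "poly [:a:] x \<in> B" if "a \<in> A" for a
      unfolding B_def using that A0 by (auto simp: coeff_pCons split: nat.splits intro!: exI [of _ "[:a:]"])
    then have "A \<subseteq> B"
      by auto
    have "poly [:0, 1:] x \<in> B"
      unfolding B_def using A A0 by (intro CollectI exI [of _ "[:0, 1:]"]) (auto simp: coeff_pCons split: nat.splits)
    then have "x \<in> B"
      by simp
    have "y - z \<in> B \<and> y * z \<in> B" if yz: "y \<in> B" "z \<in> B" for y z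
    proof -
      obtain q r where qr: "y = poly q x" "z = poly r x" "\<forall>i. coeff q i \<in> A" "\<forall>i. coeff r i \<in> A"
        using yz unfolding B_def by auto
      have "y - z = poly (q - r) x" "\<forall>i. coeff (q - r) i \<in> A" "y * z = poly (q * r) x" "\<forall>i. coeff (q * r) i \<in> A"
        using qr A by (auto simp: coeff_mult intro!: A_sum)
      then show ?thesis
        unfolding B_def by blast
    qed
    then have "B \<inter> L \<noteq> V\<^sub>0"
      using max [of B] \<open>A \<subseteq> B\<close> \<open>x \<in> B\<close> \<open>x \<notin> A\<close> A unfolding P_def by blast
    then obtain l where l: "l \<in> B" "l \<in> L" "l \<notin> V\<^sub>0"
      using V0A V0(1) \<open>A \<subseteq> B\<close> by auto
    \<comment> \<open>The new element \<open>l\<close> of \<open>L\<close> lies outside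
      \<open>V\<^sub>0\<close>, so its inverse is in \<open>N\<close>; multiplying the polynomial
      expression of \<open>l\<close> by that inverse gives the relation.\<close>
    then have l': "inverse l \<in> N" "l \<noteq> 0"
      using V0(3) [OF V0(2) V0(2)] V0(5) [of l] unfolding N_def by auto
    obtain q where q: "l = poly q x" "\<forall>i. coeff q i \<in> A"
      using l unfolding B_def by auto
    have "(\<Sum>i<Suc (degree q). inverse l * coeff q i * x ^ i) = inverse l * l"
      unfolding q(1) by (subst (3) poly_altdef) (simp add: sum_distrib_left mult_ac lessThan_Suc_atMost)
    then have "(\<Sum>i<Suc (degree q). inverse l * coeff q i * x ^ i) = 1"
      using l' by simp
    moreover have "inverse l * coeff q i \<in> M" for i
      using q l' unfolding M_def by blast
    ultimately show ?thesis
      unfolding Q_def by (intro exI [of _ "Suc (degree q)"] exI [of _ "\<lambda>i. inverse l * coeff q i"]) auto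
  qed
  \<comment> \<open>Without knowing that \<open>A\<close> is local: a relation for the inverse,
    multiplied by \<open>(1 - b) ^ n\<close>, puts this power into \<open>M\<close>, although it is
    congruent to \<open>1\<close> modulo \<open>M\<close>.\<close>
  have inv: "inverse (1 - b) \<in> A" if "b \<in> M" for b
  proof (rule ccontr)
    assume "inverse (1 - b) \<notin> A"
    then obtain n a where a: "\<And>i. i < n \<Longrightarrow> a i \<in> M" "(\<Sum>i<n. a i * inverse (1 - b) ^ i) = 1"
      using Q unfolding Q_def by blast
    have b1: "1 - b \<noteq> 0" "1 - b \<in> A"
      using that M1 MA A by auto
    have "(1 - b) ^ n = (1 - b) ^ n * (\<Sum>i<n. a i * inverse (1 - b) ^ i)"
      using a by simp
    also have "\<dots> = (\<Sum>i<n. a i * (1 - b) ^ (n - i))"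
      unfolding sum_distrib_left
      by (intro sum.cong refl) (use b1 in \<open>simp add: power_diff power_inverse field_simps\<close>)
    also have "\<dots> \<in> M"
      using a b1 by (intro M_sum M_mult A_power) auto
    finally have "(1 - b) ^ n \<in> M" .
    moreover have "1 - (1 - b) ^ k \<in> M" for k
    proof (induction k)
      case (Suc k)
      have "1 - (1 - b) ^ Suc k = (1 - (1 - b) ^ k) + b * (1 - b) ^ k"
        by (simp add: algebra_simps)
      also have "\<dots> \<in> M"
        using Suc that b1 by (intro M_add M_mult A_power)
      finally show ?case .
    qed (use M0 in auto)
    ultimately have "(1 - b) ^ n + (1 - (1 - b) ^ n) \<in> M"
      by (intro M_add)
    then show False
      using M1 by simp
  qed
  \<comment> \<open>As \<open>1 - b 0\<close> is a unit of \<open>A\<close>, the relation for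
    \<open>inverse y\<close> can be solved for \<open>y ^ n\<close> in terms of lower powers, and
    this removes the top term of the relation for \<open>y\<close>.\<close>
  have step: "Q n y" if Qn: "Q (Suc n) y" and Qm: "Q (Suc m) (inverse y)" and "m \<le> n" "y \<noteq> 0" for n m y
  proof -
    obtain a where a: "\<And>i. i < Suc n \<Longrightarrow> a i \<in> M" "(\<Sum>i<Suc n. a i * y ^ i) = 1"
      using Qn unfolding Q_def by blast
    obtain b where b: "\<And>i. i < Suc m \<Longrightarrow> b i \<in> M" "(\<Sum>i<Suc m. b i * inverse y ^ i) = 1"
      using Qm unfolding Q_def by blast
    define u where "u = inverse (1 - b 0)"
    have "b 0 \<in> M"
      using b by auto
    then have u: "u \<in> A" "1 - b 0 \<noteq> 0"
      using inv M1 by (auto simp: u_def)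
    have "1 - b 0 = (\<Sum>i<m. b (Suc i) * inverse y ^ Suc i)"
      using b(2) unfolding sum.lessThan_Suc_shift by (simp add: algebra_simps)
    then have "y ^ n * (u * (1 - b 0)) = (\<Sum>i<m. (u * b (Suc i)) * (y ^ n * inverse y ^ Suc i))"
      by (simp add: sum_distrib_left mult_ac)
    also have "\<dots> = (\<Sum>i<m. (u * b (Suc i)) * y ^ (n - Suc i))"
      using \<open>m \<le> n\<close> \<open>y \<noteq> 0\<close>
      by (intro sum.cong refl arg_cong [where f = "(*) _"]) (simp add: power_diff field_simps power_inverse)
    also have "\<dots> = (\<Sum>i<n. (if i < m then u * b (Suc i) else 0) * y ^ (n - Suc i))"
      using \<open>m \<le> n\<close> by (intro sum.mono_neutral_cong_left) auto
    also have "\<dots> = (\<Sum>i<n. (if n - Suc i < m then u * b (Suc (n - Suc i)) else 0) * y ^ (n - Suc (n - Suc i)))"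
      by (rule sum.nat_diff_reindex [symmetric])
    also have "\<dots> = (\<Sum>i<n. (if n - Suc i < m then u * b (Suc (n - Suc i)) else 0) * y ^ i)"
      by (intro sum.cong refl) auto
    finally have yn: "y ^ n = (\<Sum>i<n. (if n - Suc i < m then u * b (Suc (n - Suc i)) else 0) * y ^ i)"
      using u by (simp add: u_def)
    define a' where "a' i = a i + (if n - Suc i < m then b (Suc (n - Suc i)) * (u * a n) else 0)" for i
    have "(\<Sum>i<n. a' i * y ^ i) = (\<Sum>i<n. a i * y ^ i) + a n * y ^ n"
      unfolding yn a'_def sum_distrib_left sum.distrib [symmetric] by (intro sum.cong) (auto simp: algebra_simps)
    also have "\<dots> = 1"
      using a(2) by simp
    finally have "(\<Sum>i<n. a' i * y ^ i) = 1" .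
    moreover have "a' i \<in> M" if "i < n" for i
      using a(1) [of i] a(1) [of n] b that u MA unfolding a'_def by (auto intro!: M_add M_mult A)
    ultimately show ?thesis
      unfolding Q_def by blast
  qed
  have "\<not> (Q n y \<and> Q m (inverse y))" if "y \<noteq> 0" for n m y
    using that
  proof (induction "n + m" arbitrary: n m y rule: less_induct)
    case less
    show ?case
    proof
      assume *: "Q n y \<and> Q m (inverse y)"
      moreover have "\<not> Q 0 z" for z
        by (simp add: Q_def)
      ultimately have "n \<noteq> 0" "m \<noteq> 0"
        by metis+
      then obtain n' m' where nm: "n = Suc n'" "m = Suc m'"
        using not0_implies_Suc by blast
      show False
      proof (cases "m' \<le> n'")
        case True
        then have "Q n' y"
          using step * nm less.prems by blast
        then show False
          using less.hyps [of n' m y] * nm less.prems by simp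
      next
        case False
        then have "Q m' (inverse y)"
          using step [of m' "inverse y" n'] * nm less.prems by simp
        then show False
          using less.hyps [of n m' y] * nm less.prems by simp
      qed
    qed
  qed
  then have "x \<in> A \<or> inverse x \<in> A" for x
    using Q A0 by (cases "x = 0") (auto, blast)
  then have "valuation_subring A"
    using A by unfold_locales auto
  then show thesis
    using AL that by blast
qed

section \<open>Cyclic extensions of prime degree\<close>

text \<open>Galois theory is reduced to an automorphism with fixed field \<open>K\<close> whose
  \<open>p\<close>-th iterate is trivial. No dimension occurs; interpolation at the conjugates of an
  element takes the place of bases.\<close>

locale cyclic_extension = K: subfield_set K + L: subfield_set L
  for K L :: "'b::field set" +
  fixes \<sigma> :: "'b \<Rightarrow> 'b" and p :: nat
  assumes p_prime: "Factorial_Ring.prime p"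
    and K_subset_L: "K \<subseteq> L"
    and \<sigma>_mem [simp, intro]: "x \<in> L \<Longrightarrow> \<sigma> x \<in> L"
    and \<sigma>_add: "x \<in> L \<Longrightarrow> y \<in> L \<Longrightarrow> \<sigma> (x + y) = \<sigma> x + \<sigma> y"
    and \<sigma>_mult: "x \<in> L \<Longrightarrow> y \<in> L \<Longrightarrow> \<sigma> (x * y) = \<sigma> x * \<sigma> y"
    and \<sigma>_base [simp]: "x \<in> K \<Longrightarrow> \<sigma> x = x"
    and \<sigma>_fixed: "x \<in> L \<Longrightarrow> \<sigma> x = x \<Longrightarrow> x \<in> K"
    and \<sigma>_cyclic: "x \<in> L \<Longrightarrow> (\<sigma> ^^ p) x = x"
    and nontrivial: "\<exists>x\<in>L. x \<notin> K"
begin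

lemma K_in_L [intro]: "x \<in> K \<Longrightarrow> x \<in> L"
  using K_subset_L by blast

lemma p_gt_1: "p > 1" and p_gt_0: "p > 0"
  using p_prime prime_gt_1_nat prime_gt_0_nat by blast+

abbreviation conj :: "nat \<Rightarrow> 'b \<Rightarrow> 'b" where
  "conj i \<equiv> \<sigma> ^^ i"

abbreviation D :: "'b \<Rightarrow> 'b" where
  "D x \<equiv> \<sigma> x - x"

lemma conj_mem [simp, intro]: "x \<in> L \<Longrightarrow> conj i x \<in> L"
  by (induction i) auto

lemma conj_base [simp]: "x \<in> K \<Longrightarrow> conj i x = x"
  by (induction i) auto

lemma conj_0 [simp]: "conj i 0 = 0" and conj_1 [simp]: "conj i 1 = 1"
  by simp_all

lemma conj_add: "x \<in> L \<Longrightarrow> y \<in> L \<Longrightarrow> conj i (x + y) = conj i x + conj i y"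
  by (induction i) (auto simp: \<sigma>_add)

lemma conj_mult: "x \<in> L \<Longrightarrow> y \<in> L \<Longrightarrow> conj i (x * y) = conj i x * conj i y"
  by (induction i) (auto simp: \<sigma>_mult)

lemma conj_uminus: "x \<in> L \<Longrightarrow> conj i (- x) = - conj i x"
  using conj_mult [of "-1" x i] by (simp add: K.uminus_mem)

lemma conj_diff: "x \<in> L \<Longrightarrow> y \<in> L \<Longrightarrow> conj i (x - y) = conj i x - conj i y"
  using conj_add [of x "- y" i] by (simp add: conj_uminus)

lemma conj_eq_0_iff: "x \<in> L \<Longrightarrow> conj i x = 0 \<longleftrightarrow> x = 0"
  using conj_mult [of x "inverse x" i] by (cases "x = 0") (auto simp: L.inverse_mem)

lemma conj_inverse: "x \<in> L \<Longrightarrow> conj i (inverse x) = inverse (conj i x)"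
  using conj_mult [of x "inverse x" i] by (cases "x = 0") (auto simp: conj_eq_0_iff intro: inverse_unique [symmetric])

lemma conj_divide: "x \<in> L \<Longrightarrow> y \<in> L \<Longrightarrow> conj i (x / y) = conj i x / conj i y"
  by (simp add: divide_inverse conj_mult conj_inverse L.inverse_mem)

lemma conj_power: "x \<in> L \<Longrightarrow> conj i (x ^ n) = conj i x ^ n"
  by (induction n) (auto simp: conj_mult L.power_mem)

lemma conj_sum: "(\<And>k. k \<in> A \<Longrightarrow> f k \<in> L) \<Longrightarrow> conj i (sum f A) = (\<Sum>k\<in>A. conj i (f k))"
  by (induction A rule: infinite_finite_induct) (auto simp: conj_add L.sum_mem)

lemma conj_prod: "(\<And>k. k \<in> A \<Longrightarrow> f k \<in> L) \<Longrightarrow> conj i (prod f A) = (\<Prod>k\<in>A. conj i (f k))"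
  by (induction A rule: infinite_finite_induct) (auto simp: conj_mult L.prod_mem)

lemmas \<sigma>_diff = conj_diff [of _ _ 1, simplified]
  and \<sigma>_sum = conj_sum [of _ _ 1, simplified]
  and \<sigma>_power = conj_power [of _ 1, simplified]
  and \<sigma>_divide = conj_divide [of _ _ 1, simplified]
  and \<sigma>_eq_0_iff = conj_eq_0_iff [of _ 1, simplified]

lemma conj_conj: "conj i (conj j x) = conj (i + j) x"
  by (simp add: funpow_add)

lemma D_nonzero: "x \<in> L \<Longrightarrow> x \<notin> K \<Longrightarrow> D x \<noteq> 0"
  using \<sigma>_fixed by auto

lemma conj_mult_p: "x \<in> L \<Longrightarrow> conj (k * p) x = x"
  by (induction k) (auto simp: funpow_add \<sigma>_cyclic)

lemma conj_mod: "x \<in> L \<Longrightarrow> conj (i mod p) x = conj i x"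
  using conj_conj [of "i mod p" "i div p * p" x] conj_mult_p [of x "i div p"] by simp

lemma conj_cyclic_mult:
  assumes "conj i x = x"
  shows "conj (i * j) x = x"
  using assms by (induction j) (auto simp: funpow_add)

lemma ex_mult_mod_eq_1:
  assumes "\<not> p dvd i"
  obtains j k where "i * j = k * p + 1"
proof -
  have "coprime i p"
    using assms p_prime by (metis coprime_commute prime_imp_coprime)
  then have "i * x = p * y + 1 \<longrightarrow> thesis" for x y
    using that by (metis mult.commute)
  moreover have "i \<noteq> 0"
    using assms by (metis dvd_0_right)
  ultimately show thesis
    using bezout_nat [of i p] \<open>coprime i p\<close> by (metis coprime_imp_gcd_eq_1)
qed

text \<open>As \<open>i\<close> is invertible modulo \<open>p\<close>, \<open>\<sigma>\<close> is an
  iterate of \<open>conj i\<close>.\<close>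

lemma conj_fixed:
  assumes "x \<in> L" "conj i x = x" "\<not> p dvd i"
  shows "x \<in> K"
proof -
  obtain j k where "i * j = k * p + 1"
    using ex_mult_mod_eq_1 assms by blast
  then have "conj (1 + k * p) x = x"
    using conj_cyclic_mult [OF assms(2), of j] by (simp add: add.commute)
  then have "conj 1 (conj (k * p) x) = x"
    by (simp only: conj_conj)
  then have "\<sigma> x = x"
    by (simp add: conj_mult_p assms(1))
  then show ?thesis
    using assms(1) \<sigma>_fixed by blast
qed

lemma conj_distinct:
  assumes "x \<in> L" "x \<notin> K" "i < p" "j < p" "conj i x = conj j x"
  shows "i = j"
  using assms(3-5)
proof (induction i j rule: linorder_wlog)
  case (le i j)
  have "conj (p - i) (conj i x) = conj (p - i) (conj j x)"
    using le by simp
  then have "conj (p - i + j) x = conj (p - i + i) x"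
    by (simp only: conj_conj)
  then have "conj (p - i + j) x = x"
    using assms le by (simp add: \<sigma>_cyclic)
  then have "p dvd p - i + j"
    using conj_fixed [of x "p - i + j"] assms by auto
  then have "p dvd j - i"
    using le by (metis Nat.diff_add_assoc2 Nat.add_diff_assoc dvd_add_right_iff dvd_refl less_imp_le)
  then show ?case
    using le by (auto dest: dvd_imp_le)
next
  case (sym i j)
  then show ?case
    by metis
qed

lemma cyclic_sum:
  assumes "g p = g 0"
  shows "(\<Sum>i<p. g (Suc i)) = (\<Sum>i<p. g i :: 'b)"
  using sum.lessThan_Suc_shift [of g p] sum.lessThan_Suc [of g p] assms by (simp add: add.commute)

lemma cyclic_prod:
  assumes "g p = g 0"
  shows "(\<Prod>i<p. g (Suc i)) = (\<Prod>i<p. g i :: 'b)"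
proof -
  have "g 0 * (\<Prod>i<p. g (Suc i)) = (\<Prod>i<p. g i) * g 0"
    using prod.lessThan_Suc_shift [of g p] prod.lessThan_Suc [of g p] assms by argo
  show ?thesis
  proof (cases "g 0 = 0")
    case True
    obtain q where q: "p = Suc q"
      using p_gt_0 by (cases p) auto
    then have "g (Suc q) = 0" "q \<in> {..<p}" "0 \<in> {..<p}"
      using True assms by auto
    then have "(\<Prod>i<p. g (Suc i)) = 0" "(\<Prod>i<p. g i) = 0"
      using True by (meson finite_lessThan prod_zero)+
    then show ?thesis
      by metis
  next
    case False
    then show ?thesis
      using \<open>g 0 * _ = _\<close> by (metis mult.commute mult_cancel_left)
  qed
qed

definition trace :: "'b \<Rightarrow> 'b" where
  "trace x = (\<Sum>i<p. conj i x)"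

definition norm :: "'b \<Rightarrow> 'b" where
  "norm x = (\<Prod>i<p. conj i x)"

lemma trace_mem [intro]: assumes "x \<in> L" shows "trace x \<in> K"
proof (rule \<sigma>_fixed)
  show "trace x \<in> L"
    using assms by (auto simp: trace_def)
  show "\<sigma> (trace x) = trace x"
    using assms cyclic_sum [of "\<lambda>i. conj i x"] by (simp add: trace_def \<sigma>_sum \<sigma>_cyclic conj_mem)
qed

lemma norm_mem [intro]: assumes "x \<in> L" shows "norm x \<in> K"
proof (rule \<sigma>_fixed)
  show "norm x \<in> L"
    using assms by (auto simp: norm_def)
  show "\<sigma> (norm x) = norm x"
    using assms cyclic_prod [of "\<lambda>i. conj i x"] conj_prod [of "{..<p}" "\<lambda>i. conj i x" 1]
    by (simp add: norm_def \<sigma>_cyclic conj_mem)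
qed

lemma norm_eq_0_iff: "x \<in> L \<Longrightarrow> norm x = 0 \<longleftrightarrow> x = 0"
  using p_gt_0 by (auto simp: norm_def conj_eq_0_iff)

lemma norm_base: "x \<in> K \<Longrightarrow> norm x = x ^ p"
  by (simp add: norm_def)

lemma norm_mult: "x \<in> L \<Longrightarrow> y \<in> L \<Longrightarrow> norm (x * y) = norm x * norm y"
  by (simp add: norm_def conj_mult prod.distrib)

lemma norm_\<sigma>: "x \<in> L \<Longrightarrow> norm (\<sigma> x) = norm x"
  using cyclic_prod [of "\<lambda>i. conj i x"] by (simp add: norm_def \<sigma>_cyclic flip: funpow_swap1)

lemma conj_poly:
  assumes "\<And>i. coeff f i \<in> L" "x \<in> L"
  shows "conj i (poly f x) = poly (map_poly (conj i) f) (conj i x)"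
proof -
  have "degree (map_poly (conj i) f) \<le> degree f"
    by (rule map_poly_degree_leq)
  then have "poly (map_poly (conj i) f) (conj i x) = (\<Sum>k\<le>degree f. coeff (map_poly (conj i) f) k * conj i x ^ k)"
    by (subst poly_altdef, intro sum.mono_neutral_left) (auto simp: coeff_eq_0)
  also have "\<dots> = conj i (poly f x)"
    using assms unfolding poly_altdef
    by (subst conj_sum) (auto simp: coeff_map_poly conj_mult conj_power L.power_mem)
  finally show ?thesis ..
qed

lemma conj_poly_base:
  assumes "\<And>i. coeff f i \<in> K" "x \<in> L"
  shows "conj i (poly f x) = poly f (conj i x)"
proof -
  have "map_poly (conj i) f = f"
    using assms by (intro poly_eqI) (simp add: coeff_map_poly)
  then show ?thesis
    using conj_poly [of f x i] assms by auto
qed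

lemma card_conj:
  assumes "x \<in> L" "x \<notin> K"
  shows "card ((\<lambda>i. conj i x) ` {..<p}) = p"
  using conj_distinct [OF assms] by (subst card_image) (auto simp: inj_on_def)

text \<open>Applying \<open>\<sigma>\<close> to the coefficients permutes the \<open>p\<close>
  interpolation conditions cyclically, and a polynomial of degree less than \<open>p\<close> is
  determined by them. So the coefficients are fixed by \<open>\<sigma>\<close>.\<close>

lemma interpolation_coeffs:
  assumes "x \<in> L" "x \<notin> K" "\<And>i. coeff f i \<in> L" "degree f < p" "y \<in> L"
    and "\<And>i. i < p \<Longrightarrow> poly f (conj i x) = conj i y"
  shows "coeff f i \<in> K"
proof -
  have "map_poly \<sigma> f = f"
  proof (rule poly_eqI_degree)
    fix z assume "z \<in> (\<lambda>i. conj i x) ` {..<p}"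
    then obtain i where i: "i < p" "z = conj i x"
      by auto
    \<comment> \<open>The predecessor of \<open>i\<close> in the cycle of indices modulo
      \<open>p\<close>.\<close>
    define j where "j = (i + p - 1) mod p"
    have "j < p"
      using p_gt_0 by (simp add: j_def)
    have "(1 + j) mod p = (i + p) mod p"
      using p_gt_0 mod_add_right_eq [of 1 "i + p - 1" p] unfolding j_def by simp
    then have "conj (1 + j) w = conj i w" if "w \<in> L" for w
      using that by (metis conj_mod mod_add_self2)
    then have **: "\<sigma> (conj j w) = conj i w" if "w \<in> L" for w
      using that by simp
    have "poly (map_poly \<sigma> f) z = \<sigma> (poly f (conj j x))"
      using conj_poly [of f "conj j x" 1] assms ** i conj_mem by simp
    also have "\<dots> = poly f z"
      using assms ** i \<open>j < p\<close> by simp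
    finally show "poly (map_poly \<sigma> f) z = poly f z" .
  next
    show "degree (map_poly \<sigma> f) < card ((\<lambda>i. conj i x) ` {..<p})"
      using map_poly_degree_leq [of \<sigma> f] assms by (simp add: card_conj)
  qed (use assms in \<open>simp add: card_conj\<close>)
  then have "\<sigma> (coeff f i) = coeff f i"
    by (metis K.zero_mem \<sigma>_base coeff_map_poly)
  then show ?thesis
    using assms \<sigma>_fixed by blast
qed

lemma coeff_mult_mem: "(\<And>i. coeff f i \<in> L) \<Longrightarrow> (\<And>i. coeff g i \<in> L) \<Longrightarrow> coeff (f * g) i \<in> L"
  by (auto simp: coeff_mult)

lemma coeff_prod_mem:
  "(\<And>k i. k \<in> A \<Longrightarrow> coeff (f k) i \<in> L) \<Longrightarrow> coeff (prod f A) i \<in> L"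
  by (induction A arbitrary: i rule: infinite_finite_induct) (auto intro: coeff_mult_mem)

definition charpoly :: "'b \<Rightarrow> 'b poly" where
  "charpoly x = (\<Prod>i<p. [:- conj i x, 1:])"

lemma poly_charpoly: "poly (charpoly x) y = (\<Prod>i<p. y - conj i x)"
  by (simp add: charpoly_def poly_prod algebra_simps)

lemma monic_charpoly: "coeff (charpoly x) p = 1" and degree_charpoly: "degree (charpoly x) = p"
proof -
  have "lead_coeff (charpoly x) = 1"
    by (simp add: charpoly_def lead_coeff_prod)
  moreover show "degree (charpoly x) = p"
    by (simp add: charpoly_def degree_prod_eq_sum_degree)
  ultimately show "coeff (charpoly x) p = 1"
    by simp
qed

lemma coeff_charpoly_mem_L: "x \<in> L \<Longrightarrow> coeff (charpoly x) i \<in> L"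
  unfolding charpoly_def by (rule coeff_prod_mem) (auto simp: coeff_pCons split: nat.splits)

text \<open>Subtracting \<open>monom 1 p\<close> brings the degree below \<open>p\<close>; the
  difference interpolates the conjugates of \<open>- (x ^ p)\<close> at those of
  \<open>x\<close>.\<close>

lemma coeff_charpoly_mem:
  assumes "x \<in> L"
  shows "coeff (charpoly x) i \<in> K"
proof (cases "x \<in> K")
  case True
  then have "charpoly x = [:- x, 1:] ^ p"
    by (simp add: charpoly_def)
  moreover have "coeff ([:- x, 1:] ^ n) i \<in> K" for n i
    using True by (induction n arbitrary: i)
      (auto simp: coeff_mult coeff_pCons intro!: K.sum_mem K.mult_mem split: nat.splits)
  ultimately show ?thesis
    by simp
next
  case False
  have "degree (charpoly x - monom 1 p) < p"
    using monic_charpoly [of x] degree_charpoly [of x] p_gt_0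
    by (intro coeff_0_degree_minus_1 [THEN le_less_trans] degree_le) (auto simp: coeff_eq_0 le_less not_less_iff_gr_or_eq)
  moreover have "coeff (charpoly x - monom 1 p) i \<in> L" for i
    using coeff_charpoly_mem_L [OF assms] by (auto simp: coeff_monom)
  moreover have "poly (charpoly x - monom 1 p) (conj i x) = conj i (- (x ^ p))" if "i < p" for i
  proof -
    have "poly (charpoly x) (conj i x) = 0"
      using that by (auto simp: poly_charpoly)
    then show ?thesis
      using assms by (simp add: poly_monom conj_power conj_uminus L.power_mem)
  qed
  moreover have "- (x ^ p) \<in> L"
    using assms by auto
  ultimately have "coeff (charpoly x - monom 1 p) i \<in> K"
    using interpolation_coeffs [OF assms False, of "charpoly x - monom 1 p" "- (x ^ p)" i] by blast
  then have "coeff (charpoly x - monom 1 p) i + coeff (monom 1 p) i \<in> K"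
    by (intro K.add_mem) (auto simp: coeff_monom)
  then show ?thesis
    by simp
qed

lemma poly_pderiv_charpoly: "poly (pderiv (charpoly x)) x = (\<Prod>i\<in>{1..<p}. x - conj i x)"
proof -
  have "{..<p} = insert 0 {1..<p}"
    using p_gt_0 by auto
  then have "charpoly x = [:- x, 1:] * (\<Prod>i\<in>{1..<p}. [:- conj i x, 1:])"
    by (simp add: charpoly_def)
  then show ?thesis
    by (simp add: pderiv_mult pderiv_pCons poly_prod algebra_simps del: mult_pCons_left)
qed

definition lagrange :: "'b \<Rightarrow> nat \<Rightarrow> 'b poly" where
  "lagrange x i = (\<Prod>j\<in>{..<p} - {i}. smult (1 / (conj i x - conj j x)) [:- conj j x, 1:])"

lemma poly_lagrange_eval:
  "poly (lagrange x i) y = (\<Prod>j\<in>{..<p} - {i}. (y - conj j x) / (conj i x - conj j x))"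
  by (simp add: lagrange_def poly_prod algebra_simps diff_divide_distrib)

lemma poly_lagrange:
  assumes "x \<in> L" "x \<notin> K" "i < p" "k < p"
  shows "poly (lagrange x i) (conj k x) = (if k = i then 1 else 0)"
proof (cases "k = i")
  case True
  have "conj i x - conj j x \<noteq> 0" if "j \<in> {..<p} - {i}" for j
    using that conj_distinct [OF assms(1,2), of i j] assms by auto
  then show ?thesis
    using True unfolding poly_lagrange_eval by (auto intro!: prod.neutral)
next
  case False
  then show ?thesis
    using assms unfolding poly_lagrange_eval by (auto intro!: bexI [of _ k])
qed

lemma coeff_lagrange_mem: "x \<in> L \<Longrightarrow> coeff (lagrange x i) k \<in> L"
  unfolding lagrange_def
  by (rule coeff_prod_mem) (auto simp: coeff_pCons intro!: L.mult_mem split: nat.splits)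

lemma degree_lagrange: assumes "i < p" shows "degree (lagrange x i) < p"
proof -
  have "degree (smult (1 / (conj i x - conj j x)) [:- conj j x, 1:]) \<le> 1" for j
    by (rule order_trans [OF degree_smult_le]) simp
  then have "degree (lagrange x i) \<le> (\<Sum>j\<in>{..<p} - {i}. 1)"
    unfolding lagrange_def by (intro order_trans [OF degree_prod_sum_le] sum_mono) (simp_all del: smult_pCons)
  also have "\<dots> < p"
    using assms by simp
  finally show ?thesis .
qed

text \<open>Its coefficients are the coordinates of \<open>y\<close> with respect to the powers of
  \<open>x\<close> below \<open>p\<close>. The explicit denominators, differences of conjugates of
  \<open>x\<close>, are what the estimates use.\<close>

definition interp :: "'b \<Rightarrow> 'b \<Rightarrow> 'b poly" where
  "interp x y = (\<Sum>i<p. smult (conj i y) (lagrange x i))"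

lemma poly_interp_conj:
  assumes "x \<in> L" "x \<notin> K" "k < p"
  shows "poly (interp x y) (conj k x) = conj k y"
proof -
  have "poly (interp x y) (conj k x) = (\<Sum>i<p. conj i y * (if k = i then 1 else 0))"
    unfolding interp_def poly_sum poly_smult by (intro sum.cong refl) (simp only: poly_lagrange [OF assms(1,2) _ assms(3)] lessThan_iff)
  also have "\<dots> = conj k y"
    using assms(3) by (subst sum.remove [of _ k]) (auto intro!: sum.neutral)
  finally show ?thesis .
qed

lemma poly_interp: "x \<in> L \<Longrightarrow> x \<notin> K \<Longrightarrow> poly (interp x y) x = y"
  using poly_interp_conj [of x 0 y] p_gt_0 by simp

lemma degree_interp: "degree (interp x y) < p"
  unfolding interp_def using p_gt_0 degree_lagrange
  by (intro degree_sum_less) (auto intro: le_less_trans [OF degree_smult_le])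

lemma coeff_interp_mem:
  assumes "x \<in> L" "x \<notin> K" "y \<in> L"
  shows "coeff (interp x y) i \<in> K"
proof (rule interpolation_coeffs [OF assms(1,2) _ _ assms(3)])
  show "coeff (interp x y) i \<in> L" for i
    unfolding interp_def using assms
    by (auto simp: coeff_sum coeff_lagrange_mem intro!: L.sum_mem)
qed (use assms degree_interp poly_interp_conj in auto)

lemma interp_1: assumes "x \<in> L" "x \<notin> K" shows "interp x 1 = 1"
proof (rule poly_eqI_degree)
  show "degree (interp x 1) < card ((\<lambda>i. conj i x) ` {..<p})"
    using degree_interp assms by (simp add: card_conj)
qed (use assms p_gt_0 in \<open>auto simp: card_conj poly_interp_conj\<close>)

end

section \<open>Powers with exponent p modulo p\<close>

context valuation_subring
begin

text \<open>All mixed binomial coefficients are divisible by \<open>p\<close>. The congruence for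
  the cofactor \<open>z\<close> isolates its term without \<open>x\<close>; for \<open>y = 1\<close>
  and \<open>x\<close> in the maximal ideal it shows that \<open>z\<close> is a unit.\<close>

lemma binomial_prime:
  assumes p: "Factorial_Ring.prime p" and "x \<in> V" "y \<in> V"
  obtains z where "z \<in> V" "(x + y) ^ p = x ^ p + y ^ p + of_nat p * x * y * z"
    "x \<preceq> z - y ^ (p - 2)"
proof -
  obtain q where q: "p = Suc (Suc q)"
    using prime_ge_2_nat [OF p] by (metis Suc_1 Suc_le_D add_2_eq_Suc le_Suc_ex)
  define m where "m k = (p choose k) div p" for k
  have m: "p choose k = p * m k" if "0 < k" "k < p" for k
    using dvd_choose_prime [of k p] that p unfolding m_def by auto
  define z where "z = (\<Sum>k\<le>q. of_nat (m (Suc k)) * x ^ k * y ^ (q - k))"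
  have "(x + y) ^ p = (\<Sum>k\<le>Suc (Suc q). of_nat (p choose k) * x ^ k * y ^ (p - k))"
    unfolding q by (rule binomial_ring)
  also have "\<dots> = y ^ p + (\<Sum>k\<le>q. of_nat (p choose Suc k) * x ^ Suc k * y ^ (p - Suc k)) + x ^ p"
    by (subst sum.atMost_Suc, subst sum.atMost_Suc_shift) (simp add: q)
  also have "(\<Sum>k\<le>q. of_nat (p choose Suc k) * x ^ Suc k * y ^ (p - Suc k)) = of_nat p * x * y * z"
    unfolding z_def sum_distrib_left
  proof (intro sum.cong refl)
    fix k assume "k \<in> {..q}"
    then have "p - Suc k = Suc (q - k)"
      by (auto simp: q)
    moreover have "of_nat (p choose Suc k) = (of_nat p * of_nat (m (Suc k)) :: 'b)"
      using m [of "Suc k"] \<open>k \<in> _\<close> q by (metis atMost_iff less_Suc_eq_le not_less_eq of_nat_mult zero_less_Suc)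
    ultimately show "of_nat (p choose Suc k) * x ^ Suc k * y ^ (p - Suc k) =
        of_nat p * x * y * (of_nat (m (Suc k)) * x ^ k * y ^ (q - k))"
      by (simp only: power_Suc mult_ac)
  qed
  finally have "(x + y) ^ p = x ^ p + y ^ p + of_nat p * x * y * z"
    by simp
  moreover have "z \<in> V"
    unfolding z_def using assms by (intro sum_mem mult_mem power_mem) auto
  moreover have "x \<preceq> z - y ^ (p - 2)"
  proof -
    have "m 1 = 1"
      by (simp add: m_def q)
    then have "z - y ^ (p - 2) = (\<Sum>k<q. x * (of_nat (m (Suc (Suc k))) * x ^ k * y ^ (q - Suc k)))"
      unfolding z_def by (subst sum.atMost_shift) (simp add: q mult_ac)
    moreover have "x \<preceq> \<dots>"
      using assms by (intro vle_sum vle_mult_self mult_mem power_mem) auto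
    ultimately show ?thesis
      by simp
  qed
  ultimately show thesis
    using that by blast
qed

lemma diff_power_prime:
  assumes p: "Factorial_Ring.prime p" and "x \<in> V" "y \<in> V"
  shows "of_nat p * (x - y) * y \<preceq> (x - y) ^ p - (x ^ p - y ^ p)"
proof -
  obtain z where "z \<in> V" "(x - y + y) ^ p = (x - y) ^ p + y ^ p + of_nat p * (x - y) * y * z"
    using binomial_prime [OF p, of "x - y" y] assms by auto
  then have "(x - y) ^ p - (x ^ p - y ^ p) = (of_nat p * (x - y) * y) * - z"
    by (simp add: algebra_simps)
  then show ?thesis
    using \<open>z \<in> V\<close> vle_mult_self uminus_mem by metis
qed

lemma diff_power_prime_vle:
  assumes "Factorial_Ring.prime p" "x \<in> V" "y \<in> V"
  shows "of_nat p \<preceq> (x - y) ^ p - (x ^ p - y ^ p)"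
  using diff_power_prime [OF assms] assms by (meson diff_mem vle_mult_self vle_trans)

lemma sum_power_prime_vle:
  assumes p: "Factorial_Ring.prime p" and "finite A" "\<And>i. i \<in> A \<Longrightarrow> f i \<in> V"
  shows "of_nat p \<preceq> sum f A ^ p - (\<Sum>i\<in>A. f i ^ p)"
  using assms(2,3)
proof (induction A rule: finite_induct)
  case empty
  then show ?case
    using prime_gt_0_nat [OF p] by (simp add: power_0_left)
next
  case (insert i A)
  have "sum f A \<in> V"
    using insert by auto
  then obtain z where z: "z \<in> V" "(f i + sum f A) ^ p = f i ^ p + sum f A ^ p + of_nat p * f i * sum f A * z"
    using binomial_prime [OF p, of "f i" "sum f A"] insert by auto
  have "of_nat p \<preceq> (sum f A ^ p - (\<Sum>i\<in>A. f i ^ p)) + of_nat p * (f i * sum f A * z)"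
    using insert \<open>sum f A \<in> V\<close> z by (intro vle_add vle_mult_self) auto
  then show ?case
    using insert z by (simp add: algebra_simps)
qed

text \<open>Surjectivity of the Frobenius on \<open>(K \<inter> V)/e\<close> for every \<open>e \<in> K\<close> that divides \<open>p\<close>; this is
  surjectivity on \<open>(K \<inter> V)/p\<close> if \<open>p \<noteq> 0\<close>, and density of \<open>K\<^sup>p\<close> in \<open>K\<close> if \<open>p = 0\<close>.\<close>

definition frobenius_dense :: "'b set \<Rightarrow> nat \<Rightarrow> bool" where
  "frobenius_dense K p \<longleftrightarrow>
     (\<forall>a\<in>K \<inter> V. \<forall>e\<in>K - {0}. e \<preceq> of_nat p \<longrightarrow> (\<exists>y\<in>K \<inter> V. e \<preceq> a - y ^ p))"

lemma sum_nonunit: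
  assumes "\<And>i. i \<in> A \<Longrightarrow> \<not> f i \<preceq> 1"
  shows "\<not> sum f A \<preceq> 1"
  using assms
proof (induction A rule: infinite_finite_induct)
  case (insert i A)
  then have "\<not> f i \<preceq> 1" "\<not> sum f A \<preceq> 1"
    by auto
  moreover have "f i \<preceq> f i + sum f A \<or> sum f A \<preceq> f i + sum f A"
    using vle_total [of "f i" "sum f A"] vle_add by blast
  ultimately show ?case
    using insert vle_trans by auto
qed auto

lemma ex_vle_minimal:
  fixes f :: "nat \<Rightarrow> 'b"
  assumes "n > 0"
  obtains i where "i < n" "\<And>j. j < n \<Longrightarrow> f i \<preceq> f j"
proof -
  have "\<exists>i<n. \<forall>j<n. f i \<preceq> f j"
    using assms
  proof (induction n)
    case (Suc n)
    show ?case
    proof (cases "n = 0")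
      case False
      then obtain i where i: "i < n" "\<forall>j<n. f i \<preceq> f j"
        using Suc by auto
      show ?thesis
      proof (cases "f i \<preceq> f n")
        case True
        then show ?thesis
          using i by (auto simp: less_Suc_eq intro!: exI [of _ i])
      next
        case False
        then show ?thesis
          using i vle_linear vle_trans by (intro exI [of _ n]) (metis lessI less_Suc_eq vle_refl)
      qed
    qed auto
  qed auto
  then show thesis
    using that by blast
qed

end

section \<open>Valuations moved by the Galois group\<close>

locale cyclic_extension_valuation = cyclic_extension K L \<sigma> p + valuation_subring V
  for K L :: "'b::field set" and \<sigma> p and V :: "'b set"
begin

text \<open>If the valuation is moved by \<open>\<sigma>\<close>, then \<open>L\<close> contains an integral element of unit trace. To
  find it, one takes \<open>t\<close> for which the set of those \<open>i\<close> where \<open>conj i t\<close> is a unit is nonempty and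
  as small as possible; products \<open>t * conj k t\<close> show that this set is a single point because \<open>p\<close>
  is prime.\<close>

lemma ex_unit_trace:
  assumes tors: "\<And>x. x \<in> L \<Longrightarrow> x \<noteq> 0 \<Longrightarrow> \<exists>n>0. \<exists>c\<in>K. x ^ n \<asymp> c"
    and s: "s \<in> L" "s \<in> V" "\<sigma> s \<notin> V"
  obtains t where "t \<in> L" "\<And>i. conj i t \<in> V" "trace t \<asymp> 1"
proof -
  define J where "J t = {i. i < p \<and> conj i t \<preceq> 1}" for t
  define good where "good t \<longleftrightarrow> t \<in> L \<and> (\<forall>i. conj i t \<in> V) \<and> J t \<noteq> {}" for t
  have finJ: "finite (J t)" for t
    by (simp add: J_def)
  obtain t0 where t0: "good t0" "J t0 \<noteq> {..<p}"
  proof -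
    \<comment> \<open>By \<open>tors\<close>, a power of the conjugate of least value has the value
      of some \<open>c\<close> in \<open>K\<close>. Dividing by \<open>c\<close> makes all
      conjugates integral and this one a unit. Since \<open>s\<close> and \<open>\<sigma> s\<close>
      differ in value, not all of them become units.\<close>
    obtain i0 where i0: "i0 < p" "\<And>j. j < p \<Longrightarrow> conj i0 s \<preceq> conj j s"
      using ex_vle_minimal [of p "\<lambda>i. conj i s"] p_gt_0 by blast
    have "s \<noteq> 0"
      using s by auto
    then obtain n c where c: "n > 0" "c \<in> K" "conj i0 s ^ n \<asymp> c"
      using tors [of "conj i0 s"] s conj_eq_0_iff by auto
    have "c \<noteq> 0"
      using c s \<open>s \<noteq> 0\<close> conj_eq_0_iff by auto
    have conj_t: "conj i (s ^ n / c) = conj i s ^ n / c" for i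
      using s c by (simp add: conj_divide conj_power K_in_L)
    have V: "conj i (s ^ n / c) \<in> V" for i
    proof -
      have "c \<preceq> conj (i mod p) s ^ n"
        using c i0(2) [of "i mod p"] p_gt_0 veq_vle_trans [OF veq_sym [OF c(3)]] vle_power by auto
      then show ?thesis
        using s \<open>c \<noteq> 0\<close> unfolding conj_t by (simp add: conj_mod vle_iff_divide_mem)
    qed
    have "i0 \<in> J (s ^ n / c)"
      unfolding J_def conj_t using i0 c \<open>c \<noteq> 0\<close> by (simp add: divide_vle_iff veq_def)
    moreover have "J (s ^ n / c) \<noteq> {..<p}"
    proof
      assume "J (s ^ n / c) = {..<p}"
      then have "0 \<in> J (s ^ n / c)" "1 \<in> J (s ^ n / c)"
        using p_gt_1 by auto
      then have "s ^ n \<preceq> c"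
        unfolding J_def conj_t using \<open>c \<noteq> 0\<close> by (simp add: divide_vle_iff)
      moreover have "c \<preceq> \<sigma> s ^ n"
        using V [of 1] \<open>c \<noteq> 0\<close> unfolding conj_t by (simp add: vle_iff_divide_mem)
      ultimately have "s \<preceq> \<sigma> s"
        using vle_trans c(1) vle_power_iff by blast
      then show False
        using s vle_mem by blast
    qed
    ultimately show thesis
      using that [of "s ^ n / c"] V s c unfolding good_def by (auto simp: K_in_L)
  qed
  obtain t where t: "good t" and min: "\<And>t'. good t' \<Longrightarrow> card (J t) \<le> card (J t')"
    using ex_has_least_nat [of good t0 "\<lambda>t. card (J t)"] t0 by auto
  have tL: "t \<in> L" and tV: "\<And>i. conj i t \<in> V" and tJ: "J t \<noteq> {}"
    using t by (auto simp: good_def)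
  have "i = j" if ij: "i \<in> J t" "j \<in> J t" "i \<le> j" for i j
  proof (rule ccontr)
    assume "i \<noteq> j"
    define k where "k = j - i"
    have k: "0 < k" "k < p"
      using ij \<open>i \<noteq> j\<close> by (auto simp: k_def J_def)
    \<comment> \<open>\<open>conj m t'\<close> is a unit exactly if \<open>m\<close> and
      \<open>m + k\<close> both index units among the conjugates of \<open>t\<close>. By minimality
      nothing is lost, so \<open>J t\<close> is stable under adding \<open>k\<close>; as
      \<open>k\<close> is invertible modulo \<open>p\<close>, it is everything, which is more than
      \<open>J t0\<close>.\<close>
    define t' where "t' = t * conj k t"
    have conj_t': "conj m t' = conj m t * conj (m + k) t" for m
      using tL by (simp add: t'_def conj_mult conj_conj)
    have J': "\<And>m. m \<in> J t' \<Longrightarrow> m \<in> J t" "\<And>m. m \<in> J t' \<Longrightarrow> (m + k) mod p \<in> J t"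
    proof -
      fix m assume "m \<in> J t'"
      then have m: "m < p" "conj m t * conj (m + k) t \<preceq> 1"
        by (auto simp: J_def conj_t')
      then have "conj m t \<preceq> 1" "conj (m + k) t \<preceq> 1"
        using tV vle_mult_mem vle_mult_mem' vle_refl vle_trans by metis+
      then show "(m + k) mod p \<in> J t"
        using tL p_gt_0 by (simp add: J_def conj_mod)
      show "m \<in> J t"
        using \<open>conj m t \<preceq> 1\<close> m by (simp add: J_def)
    qed
    have "i \<in> J t'"
    proof -
      have "conj i t \<preceq> 1" "conj (i + k) t \<preceq> 1" "i < p"
        using ij by (auto simp: J_def k_def)
      then have "conj i t * conj (i + k) t \<preceq> 1"
        using vle_mult by fastforce
      then show ?thesis
        using \<open>i < p\<close> by (simp add: J_def conj_t')
    qed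
    then have "good t'"
      using tL tV unfolding good_def conj_t' by (auto simp: t'_def)
    then have "J t' = J t"
      using J'(1) finJ min by (metis card_seteq subsetI)
    then have step: "(m + k) mod p \<in> J t" if "m \<in> J t" for m
      using J'(2) that by auto
    have all: "(i + n * k) mod p \<in> J t" for n
    proof (induction n)
      case 0
      then show ?case
        using ij by (simp add: J_def)
    next
      case (Suc n)
      have "((i + n * k) mod p + k) mod p = (i + Suc n * k) mod p"
        by (simp add: mod_simps algebra_simps)
      then show ?case
        using step [OF Suc] by simp
    qed
    have "\<not> p dvd k"
      using k by (auto dest: dvd_imp_le)
    then obtain a l where al: "k * a = l * p + 1"
      using ex_mult_mod_eq_1 by blast
    have "r \<in> J t" if "r < p" for r
    proof -
      have "i < p"
        using ij by (auto simp: J_def)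
      have "i + (a * (r + p - i)) * k = i + (r + p - i) * (k * a)"
        by (simp add: algebra_simps)
      also have "\<dots> = i + (r + p - i) + (r + p - i) * l * p"
        unfolding al by (simp add: distrib_left mult.assoc)
      also have "\<dots> = r + p + (r + p - i) * l * p"
        using \<open>i < p\<close> by simp
      finally have "(i + (a * (r + p - i)) * k) mod p = r"
        using that by simp
      then show ?thesis
        using all by metis
    qed
    then have "J t = {..<p}"
      by (auto simp: J_def)
    moreover have "J t0 \<subset> {..<p}"
      using t0 by (auto simp: J_def)
    ultimately have "card (J t0) < card (J t)"
      by (metis finite_lessThan psubset_card_mono)
    then show False
      using min t0 by (meson not_le)
  qed
  then have single: "i = j" if "i \<in> J t" "j \<in> J t" for i j
    using that by (metis nat_le_linear)
  obtain i where i: "i \<in> J t"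
    using tJ by auto
  define t' where "t' = conj i t"
  have t'L: "t' \<in> L" and t'V: "conj m t' \<in> V" for m
    using tL tV by (simp_all add: t'_def conj_conj)
  have "\<not> conj m t' \<preceq> 1" if "m \<in> {1..<p}" for m
  proof
    assume "conj m t' \<preceq> 1"
    then have "(m + i) mod p \<in> J t"
      using tL p_gt_0 by (simp add: J_def t'_def conj_conj conj_mod)
    then have "(m + i) mod p = i"
      by (rule single [OF _ i])
    moreover have "i < p"
      using i by (simp add: J_def)
    ultimately have "(m + i) mod p = (0 + i) mod p"
      by simp
    then have "p dvd m"
      by (metis add_diff_cancel_right' diff_zero mod_eq_dvd_iff_nat le_add2 add_0)
    then show False
      using that by (auto dest: dvd_imp_le)
  qed
  then have "\<not> (\<Sum>m\<in>{1..<p}. conj m t') \<preceq> 1"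
    by (rule sum_nonunit)
  moreover have "conj 0 t' \<asymp> 1"
    using i tV [of i] by (auto simp: t'_def J_def veq_def one_vle_iff)
  ultimately have "conj 0 t' + (\<Sum>m\<in>{1..<p}. conj m t') \<asymp> conj 0 t'"
    by (intro veq_add_strict) (use veq_def vle_trans in blast)
  moreover have "trace t' = conj 0 t' + (\<Sum>m\<in>{1..<p}. conj m t')"
    unfolding trace_def using p_gt_0 by (simp add: lessThan_atLeast0 sum.atLeast_Suc_lessThan)
  ultimately have "trace t' \<asymp> 1"
    using \<open>conj 0 t' \<asymp> 1\<close> veq_trans by metis
  then show thesis
    using that t'L t'V by blast
qed

text \<open>\<open>y\<close> is the mean of the conjugates of \<open>x\<close> with the integral
  weights \<open>conj i t\<close>, whose sum is a unit. So \<open>x - y\<close> is the same mean of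
  the differences \<open>x - conj i x\<close>.\<close>

lemma ex_approximation_if_not_invariant:
  assumes "\<And>x. x \<in> L \<Longrightarrow> x \<noteq> 0 \<Longrightarrow> \<exists>n>0. \<exists>c\<in>K. x ^ n \<asymp> c"
    and "s \<in> L" "s \<in> V" "\<sigma> s \<notin> V"
    and x: "x \<in> L" and c: "\<And>i. i < p \<Longrightarrow> c \<preceq> conj i x - x"
  obtains y where "y \<in> K" "c \<preceq> x - y"
proof -
  obtain t where t: "t \<in> L" "\<And>i. conj i t \<in> V" "trace t \<asymp> 1"
    using ex_unit_trace [OF assms(1-4)] by blast
  then have tr: "trace t \<noteq> 0" "trace t \<preceq> 1"
    by (auto simp: veq_def)
  define y where "y = trace (t * x) / trace t"
  have "(x - y) * trace t = x * trace t - trace (t * x)"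
    using tr by (simp add: y_def field_simps)
  also have "\<dots> = (\<Sum>i<p. (x - conj i x) * conj i t)"
    using t x by (simp add: trace_def sum_distrib_left sum_subtractf [symmetric] conj_mult algebra_simps)
  finally have *: "(x - y) * trace t = (\<Sum>i<p. (x - conj i x) * conj i t)" .
  have "c \<preceq> (x - y) * trace t"
    unfolding * using t c by (intro vle_sum vle_mult_mem) (auto simp: vle_minus_commute [of _ x])
  also have "(x - y) * trace t \<preceq> (x - y) * 1"
    using tr by (intro vle_mult) auto
  finally have "c \<preceq> x - y"
    by simp
  moreover have "y \<in> K"
    using t x by (auto simp: y_def)
  ultimately show thesis
    using that by blast
qed

end

section \<open>Invariant valuations: distances of conjugates and approximation from K\<close>

locale cyclic_valued_extension = cyclic_extension_valuation K L \<sigma> p V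
  for K L :: "'b::field set" and \<sigma> p and V :: "'b set" +
  assumes \<sigma>_V: "x \<in> L \<Longrightarrow> x \<in> V \<Longrightarrow> \<sigma> x \<in> V"
begin

lemma conj_V: "x \<in> L \<Longrightarrow> x \<in> V \<Longrightarrow> conj i x \<in> V"
  by (induction i) (auto simp: \<sigma>_V)

lemma norm_1_imp_unit:
  assumes "x \<in> L" "x \<in> V" "norm x = 1"
  shows "inverse x \<in> V"
proof -
  have "norm x = x * (\<Prod>m\<in>{1..<p}. conj m x)"
    unfolding norm_def using p_gt_0 by (simp add: lessThan_atLeast0 prod.atLeast_Suc_lessThan)
  then have "inverse x = (\<Prod>m\<in>{1..<p}. conj m x)"
    using assms(3) by (intro inverse_unique) simp
  then show ?thesis
    using assms conj_V by (auto intro: prod_mem)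
qed

text \<open>The quotient \<open>\<sigma> x / x\<close> has norm \<open>1\<close>. It or its inverse
  is integral, and the inverse of an integral element of norm \<open>1\<close> is the product of its
  other conjugates, hence integral too.\<close>

lemma \<sigma>_veq:
  assumes "x \<in> L"
  shows "\<sigma> x \<asymp> x"
proof (cases "x = 0")
  case False
  define z where "z = \<sigma> x / x"
  have z: "z \<in> L" "z \<noteq> 0"
    using assms False by (auto simp: z_def \<sigma>_eq_0_iff)
  have "norm z * norm x = norm (\<sigma> x)"
    using assms False by (simp add: z_def flip: norm_mult)
  then have "norm z = 1"
    using assms False norm_\<sigma> norm_eq_0_iff by simp
  moreover from this have "norm (inverse z) = 1"
    using norm_mult [of z "inverse z"] z norm_base [of 1] by simp
  ultimately have "z \<in> V \<and> inverse z \<in> V"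
    using norm_1_imp_unit [of z] norm_1_imp_unit [of "inverse z"] mem_or_inverse_mem [of z] z by auto
  then show ?thesis
    using assms False unfolding z_def by (simp add: veq_def vle_iff_divide_mem \<sigma>_eq_0_iff)
qed auto

lemma conj_veq: "x \<in> L \<Longrightarrow> conj i x \<asymp> x"
  by (induction i) (auto intro: veq_trans [OF \<sigma>_veq])

lemma norm_veq: "x \<in> L \<Longrightarrow> norm x \<asymp> x ^ p"
  using veq_prod [of "{..<p}" "\<lambda>i. conj i x" "\<lambda>_. x"] conj_veq by (simp add: norm_def)

lemma D_V: "x \<in> L \<Longrightarrow> x \<in> V \<Longrightarrow> D x \<in> V"
  by (simp add: \<sigma>_V diff_mem)

lemma D_vle_conj_diff:
  assumes "x \<in> L"
  shows "D x \<preceq> conj i x - x"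
proof (induction i)
  case (Suc i)
  have "conj (Suc i) x - x = conj i (D x) + (conj i x - x)"
    using assms by (simp add: conj_diff funpow_swap1)
  moreover have "D x \<preceq> conj i (D x)"
    using assms conj_veq [of "D x" i] by (auto simp: veq_def)
  ultimately show ?case
    using Suc by (metis vle_add)
qed auto

lemma D_vle_conj_diff_conj:
  assumes "x \<in> L"
  shows "conj i x - x \<preceq> conj (i * k) x - x"
proof (induction k)
  case (Suc k)
  have "conj (i * Suc k) x - x = conj (i * k) (conj i x - x) + (conj (i * k) x - x)"
    using assms by (simp add: conj_diff conj_conj algebra_simps)
  moreover have "conj i x - x \<preceq> conj (i * k) (conj i x - x)"
    using assms conj_veq [of "conj i x - x" "i * k"] by (auto simp: veq_def)
  ultimately show ?case
    using Suc by (metis vle_add)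
qed auto

text \<open>One difference divides the other by telescoping; for the converse, \<open>conj i\<close>
  generates the Galois group as well as \<open>\<sigma>\<close> does.\<close>

lemma conj_diff_self_veq:
  assumes "x \<in> L" "\<not> p dvd i"
  shows "conj i x - x \<asymp> D x"
proof -
  obtain j k where jk: "i * j = k * p + 1"
    using ex_mult_mod_eq_1 assms by blast
  have "conj (i * j) x = conj 1 (conj (k * p) x)"
    by (simp only: conj_conj jk add.commute)
  also have "\<dots> = \<sigma> x"
    using assms by (simp add: conj_mult_p)
  finally have "conj (i * j) x = \<sigma> x" .
  then show ?thesis
    using D_vle_conj_diff_conj [OF assms(1), of i j] D_vle_conj_diff [OF assms(1), of i] by (simp add: veq_def)
qed

lemma conj_diff_veq:
  assumes "x \<in> L" "i < p" "j < p" "i \<noteq> j"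
  shows "conj i x - conj j x \<asymp> D x"
  using assms(2-4)
proof (induction i j rule: linorder_wlog)
  case (le i j)
  have "conj i (conj (j - i) x - x) = conj j x - conj i x"
    using assms le by (simp add: conj_diff conj_conj)
  moreover have "\<not> p dvd j - i"
    using le by (auto dest: dvd_imp_le)
  ultimately have "conj j x - conj i x \<asymp> D x"
    using conj_diff_self_veq [OF assms(1), of "j - i"] conj_veq [of "conj (j - i) x - x" i] assms veq_trans
    by (metis L.diff_mem conj_mem)
  then show ?case
    by (metis minus_diff_eq veq_uminus(1))
next
  case (sym i j)
  then have "- (conj j x - conj i x) \<asymp> D x"
    by (metis minus_diff_eq veq_uminus(1))
  then show ?case
    by simp
qed

lemma poly_pderiv_charpoly_veq:
  assumes "x \<in> L"
  shows "poly (pderiv (charpoly x)) x \<asymp> D x ^ (p - 1)"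
proof -
  have "(\<Prod>i\<in>{1..<p}. x - conj i x) \<asymp> (\<Prod>i\<in>{1..<p}. D x)"
    using assms conj_diff_veq [of x 0] by (intro veq_prod) auto
  then show ?thesis
    by (simp add: poly_pderiv_charpoly)
qed

lemma coeff_mult_V: "(\<And>i. coeff f i \<in> V) \<Longrightarrow> (\<And>i. coeff g i \<in> V) \<Longrightarrow> coeff (f * g) i \<in> V"
  by (auto simp: coeff_mult)

lemma coeff_prod_V:
  "(\<And>k i. k \<in> A \<Longrightarrow> coeff (f k) i \<in> V) \<Longrightarrow> coeff (prod f A) i \<in> V"
  by (induction A arbitrary: i rule: infinite_finite_induct) (auto intro: coeff_mult_V)

lemma coeff_charpoly_V: "x \<in> L \<Longrightarrow> x \<in> V \<Longrightarrow> coeff (charpoly x) i \<in> V"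
  unfolding charpoly_def using conj_V
  by (intro coeff_prod_V) (auto simp: coeff_pCons uminus_mem split: nat.splits)

text \<open>The Lagrange polynomial has \<open>p - 1\<close> denominators, each with the value of
  \<open>D x\<close>; one factor \<open>D x\<close> clears each of them.\<close>

lemma coeff_lagrange_V:
  assumes x: "x \<in> L" "x \<in> V" "x \<notin> K" "i < p"
  shows "D x ^ (p - 1) * coeff (lagrange x i) k \<in> V"
proof -
  let ?A = "{..<p} - {i}"
  have "smult (D x ^ (p - 1)) (lagrange x i)
      = (\<Prod>j\<in>?A. [:D x:]) * (\<Prod>j\<in>?A. smult (1 / (conj i x - conj j x)) [:- conj j x, 1:])"
    using x by (simp add: lagrange_def poly_const_pow del: smult_pCons)
  also have "\<dots> = (\<Prod>j\<in>?A. smult (D x / (conj i x - conj j x)) [:- conj j x, 1:])"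
    unfolding prod.distrib [symmetric] by (intro prod.cong) auto
  finally have eq: "smult (D x ^ (p - 1)) (lagrange x i) = \<dots>" .
  have "coeff (smult (D x / (conj i x - conj j x)) [:- conj j x, 1:]) k \<in> V" if "j \<in> ?A" for j k
  proof -
    have "conj i x - conj j x \<asymp> D x"
      using conj_diff_veq [of x i j] x that by auto
    moreover from this have "conj i x - conj j x \<noteq> 0"
      using D_nonzero [of x] x by auto
    ultimately have "D x / (conj i x - conj j x) \<in> V"
      by (simp add: veq_def vle_iff_divide_mem)
    then show ?thesis
      using x conj_V mult_mem [of "D x / (conj i x - conj j x)" "conj j x"]
      by (auto simp: coeff_pCons uminus_mem split: nat.splits)
  qed
  then have "coeff (smult (D x ^ (p - 1)) (lagrange x i)) k \<in> V"
    unfolding eq by (rule coeff_prod_V)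
  then show ?thesis
    by simp
qed

text \<open>\<open>D x ^ (p - 1)\<close> clears the denominators of \<open>interp x b\<close>. So
  every multiple \<open>r\<close> in \<open>K\<close> of it lies in the conductor of the ring
  generated by \<open>x\<close> over \<open>K \<inter> V\<close>.\<close>

lemma ex_poly_mult:
  assumes x: "x \<in> L" "x \<in> V" "x \<notin> K" and b: "b \<in> L" "b \<in> V"
    and r: "r \<in> K" "D x ^ (p - 1) \<preceq> r"
  obtains h where "\<And>i. coeff h i \<in> K" "\<And>i. coeff h i \<in> V" "poly h x = r * b"
proof -
  have "coeff (smult r (interp x b)) i \<in> V" for i
  proof -
    have "r * coeff (interp x b) i = (\<Sum>k<p. conj k b * (r * coeff (lagrange x k) i))"
      by (simp add: interp_def coeff_sum sum_distrib_left mult_ac)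
    moreover have "r * coeff (lagrange x k) i \<in> V" if "k < p" for k
      using vle_mem [OF vle_mult [OF r(2) vle_refl] coeff_lagrange_V [OF x that]] .
    then have "(\<Sum>k<p. conj k b * (r * coeff (lagrange x k) i)) \<in> V"
      using b conj_V by (intro sum_mem mult_mem [of "conj _ b"]) auto
    ultimately show ?thesis
      by simp
  qed
  moreover have "coeff (smult r (interp x b)) i \<in> K" for i
    using x b r coeff_interp_mem [of x b i] by auto
  moreover have "poly (smult r (interp x b)) x = r * b"
    using x by (simp add: poly_interp)
  ultimately show thesis
    using that by blast
qed

text \<open>\<open>y\<close> is the constant term of \<open>interp x b\<close>. Since
  \<open>interp x 1 = 1\<close>, the Lagrange weights at \<open>0\<close> have sum \<open>1\<close>,
  so \<open>b - y\<close> combines the differences \<open>b - conj i b\<close> with weights whose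
  denominators are cleared by \<open>D x ^ (p - 1)\<close>. A small value of \<open>D x\<close> thus
  gives a good approximation of every \<open>b\<close>.\<close>

lemma ex_approximation:
  assumes x: "x \<in> L" "x \<in> V" "x \<notin> K" and b: "b \<in> L"
  obtains y where "y \<in> K" "D b \<preceq> (b - y) * D x ^ (p - 1)"
proof -
  define y where "y = poly (interp x b) 0"
  have "y = coeff (interp x b) 0"
    by (simp add: y_def poly_0_coeff_0)
  then have "y \<in> K"
    using coeff_interp_mem [of x b 0] x b by simp
  have "b - y = b * poly (interp x 1) 0 - y"
    using x by (simp add: interp_1)
  also have "\<dots> = (\<Sum>i<p. (b - conj i b) * poly (lagrange x i) 0)"
    by (simp add: y_def interp_def poly_sum sum_distrib_left sum_subtractf [symmetric] algebra_simps)
  finally have *: "b - y = (\<Sum>i<p. (b - conj i b) * poly (lagrange x i) 0)" .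
  have "(b - y) * D x ^ (p - 1) = (\<Sum>i<p. (b - conj i b) * (D x ^ (p - 1) * poly (lagrange x i) 0))"
    unfolding * sum_distrib_right by (intro sum.cong refl) (simp only: mult_ac)
  also have "D b \<preceq> \<dots>"
  proof (intro vle_sum vle_mult_mem)
    fix i assume "i \<in> {..<p}"
    then show "D x ^ (p - 1) * poly (lagrange x i) 0 \<in> V"
      using coeff_lagrange_V [OF x, of i 0] by (simp add: poly_0_coeff_0)
    show "D b \<preceq> b - conj i b"
      using D_vle_conj_diff [OF b] by (subst vle_minus_commute)
  qed
  finally show thesis
    using that \<open>y \<in> K\<close> by blast
qed

text \<open>The ideal generated by the elements \<open>D b\<close> with \<open>b\<close> integral equals its own square. As the
  ideals of a valuation ring are totally ordered, this can be tested on the generators.\<close>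

definition idempotent_ideal :: bool where
  "idempotent_ideal \<longleftrightarrow> (\<forall>b\<in>L \<inter> V - K. \<exists>c\<in>L \<inter> V - K. D c ^ 2 \<preceq> D b)"

text \<open>Iterating the definition reaches the exponent \<open>2 ^ n\<close>; lower exponents
  follow because \<open>D c\<close> is integral.\<close>

lemma idempotent_ideal_power:
  assumes idempotent_ideal "b \<in> L" "b \<in> V" "b \<notin> K"
  obtains c where "c \<in> L" "c \<in> V" "c \<notin> K" "D c ^ n \<preceq> D b"
proof -
  have "\<exists>c\<in>L \<inter> V - K. D c ^ (2 ^ n) \<preceq> D b" for n
  proof (induction n)
    case 0
    then show ?case
      using assms by (intro bexI [of _ b]) auto
  next
    case (Suc n)
    then obtain c where c: "c \<in> L \<inter> V - K" "D c ^ (2 ^ n) \<preceq> D b"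
      by auto
    then obtain c' where c': "c' \<in> L \<inter> V - K" "D c' ^ 2 \<preceq> D c"
      using assms(1) unfolding idempotent_ideal_def by auto
    then have "(D c' ^ 2) ^ (2 ^ n) \<preceq> D b"
      using vle_power c vle_trans by blast
    then show ?case
      using c' by (intro bexI [of _ c']) (simp_all add: power_mult [symmetric] mult.commute)
  qed
  then obtain c where c: "c \<in> L \<inter> V - K" "D c ^ (2 ^ n) \<preceq> D b"
    by blast
  moreover have "D c ^ n \<preceq> D c ^ (2 ^ n)"
    using c D_V by (intro power_vle_power) auto
  ultimately show thesis
    using that [of c] vle_trans by auto
qed

text \<open>This is what makes every derivation over \<open>K \<inter> V\<close> vanish at
  \<open>b\<close>: modulo \<open>y\<close>, \<open>b\<close> is \<open>r * poly h u\<close>, its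
  differential is \<open>r\<close> times that of \<open>poly h u\<close>, and the factor
  \<open>poly (pderiv f) u\<close> of \<open>r\<close> kills the differential of \<open>u\<close>
  because \<open>poly f u = 0\<close>.\<close>

lemma idempotent_ideal_decomposition:
  assumes idempotent_ideal and b: "b \<in> L" "b \<in> V"
  obtains y r b' z u f h where "y \<in> K" "y \<in> V" "r \<in> K" "r \<in> V" "b' \<in> L" "b' \<in> V" "z \<in> L" "z \<in> V"
    "u \<in> L" "u \<in> V" "\<And>i. coeff f i \<in> K" "\<And>i. coeff f i \<in> V" "\<And>i. coeff h i \<in> K" "\<And>i. coeff h i \<in> V"
    "poly f u = 0" "poly h u = r * b'" "r = z * poly (pderiv f) u" "b = y + r * r * b'"
proof (cases "b \<in> K")
  case True
  then show thesis
    using that [of b 0 0 0 0 0 0] b by simp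
next
  case False
  \<comment> \<open>Of the \<open>3 * p\<close> factors, \<open>p - 1\<close> are lost in
    approximating \<open>b\<close>; the other \<open>2 * p + 1\<close> suffice for
    \<open>r * r\<close> to divide \<open>b - y\<close>.\<close>
  obtain u where u: "u \<in> L" "u \<in> V" "u \<notin> K" "D u ^ (3 * p) \<preceq> D b"
    using idempotent_ideal_power [OF assms False] by blast
  obtain y where y: "y \<in> K" "D b \<preceq> (b - y) * D u ^ (p - 1)"
    using ex_approximation [OF u(1-3) b(1)] by blast
  have Du: "D u \<in> L" "D u \<in> V" "D u \<noteq> 0"
    using u D_V D_nonzero by auto
  \<comment> \<open>An element of \<open>K\<close> is needed that is divisible by
    \<open>D u ^ (p - 1)\<close>, which is both the conductor factor of \<open>ex_poly_mult\<close>
    and the value of the derivative at \<open>u\<close>. The norm has the value of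
    \<open>D u ^ p\<close>.\<close>
  define r where "r = norm (D u)"
  have r: "r \<in> K" "r \<asymp> D u ^ p" "r \<noteq> 0"
    using Du norm_veq norm_eq_0_iff by (auto simp: r_def)
  then have "r \<in> V"
    using Du vle_mem [of "D u ^ p" r] by (auto simp: veq_def power_mem)
  have "D u ^ (2 * p + 1) * D u ^ (p - 1) = D u ^ (3 * p)"
  proof -
    have "2 * p + 1 + (p - 1) = 3 * p"
      using p_gt_0 by simp
    then show ?thesis
      by (metis power_add)
  qed
  then have "D u ^ (2 * p + 1) * D u ^ (p - 1) \<preceq> (b - y) * D u ^ (p - 1)"
    using u(4) y(2) vle_trans by metis
  then have "D u ^ (2 * p + 1) \<preceq> b - y"
    using Du by simp
  moreover have "D u ^ (2 * p) \<preceq> D u ^ (2 * p + 1)"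
    using Du by (intro power_vle_power) auto
  moreover have "r * r \<asymp> D u ^ (2 * p)"
    using veq_mult [OF r(2) r(2)] by (simp add: mult_2 power_add)
  ultimately have rr: "r * r \<preceq> b - y"
    using vle_trans unfolding veq_def by blast
  define b' where "b' = (b - y) / (r * r)"
  have b': "b' \<in> L" "b' \<in> V" "b = y + r * r * b'"
    using rr r b y Du by (auto simp: b'_def vle_iff_divide_mem K_in_L)
  have "y \<in> V"
    using b b' \<open>r \<in> V\<close> diff_mem [of b "r * r * b'"] by (simp add: mult_mem)
  have pd: "poly (pderiv (charpoly u)) u \<asymp> D u ^ (p - 1)"
    using u(1) by (rule poly_pderiv_charpoly_veq)
  have "D u ^ (p - 1) \<preceq> D u ^ p"
    using Du by (intro power_vle_power) auto
  then have "D u ^ (p - 1) \<preceq> r" "poly (pderiv (charpoly u)) u \<preceq> r"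
    using r(2) pd vle_trans unfolding veq_def by blast+
  then obtain z where z: "z \<in> V" "r = z * poly (pderiv (charpoly u)) u"
    unfolding vle_def by (auto simp: mult.commute)
  have "poly (pderiv (charpoly u)) u \<noteq> 0" "poly (pderiv (charpoly u)) u \<in> L"
    using z r u by (auto simp: poly_pderiv_charpoly intro!: L.prod_mem)
  then have "z \<in> L"
    using z r by (metis K_in_L L.divide_mem nonzero_mult_div_cancel_right)
  obtain h where h: "\<And>i. coeff h i \<in> K" "\<And>i. coeff h i \<in> V" "poly h u = r * b'"
    using ex_poly_mult [OF u(1-3) b'(1,2) r(1) \<open>D u ^ (p - 1) \<preceq> r\<close>] by blast
  have "poly (charpoly u) u = 0"
    using p_gt_0 by (auto simp: poly_charpoly intro!: bexI [of _ 0])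
  then show thesis
    using that [of y r b' z u "charpoly u" h] y \<open>y \<in> V\<close> r \<open>r \<in> V\<close> b' z \<open>z \<in> L\<close> u h
      coeff_charpoly_mem coeff_charpoly_V by blast
qed

end

section \<open>Roots of unity and p-divisibility of values\<close>

context valuation_subring
begin

text \<open>Expanding \<open>(z - 1 + 1) ^ p = 1\<close> and cancelling \<open>z - 1\<close> gives
  \<open>(z - 1) ^ (p - 1) = - (of_nat p * w)\<close>, where \<open>w\<close> is congruent to
  \<open>1\<close> modulo \<open>z - 1\<close>. So \<open>z - 1\<close> is no unit, and then
  \<open>w\<close> is one.\<close>

lemma root_of_unity_diff_veq:
  assumes p: "Factorial_Ring.prime p" "\<not> of_nat p \<preceq> 1" and z: "z ^ p = 1" "z \<noteq> 1"
  shows "(z - 1) ^ (p - 1) \<asymp> of_nat p" "\<not> z - 1 \<preceq> 1" "z \<in> V"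
proof -
  have "p > 1"
    using prime_gt_1_nat p by blast
  show "z \<in> V"
    using z \<open>p > 1\<close> mem_power_iff [of p z] by simp
  then have x: "z - 1 \<in> V" "z - 1 \<noteq> 0"
    using z by auto
  obtain w where w: "w \<in> V" "(z - 1 + 1) ^ p = (z - 1) ^ p + 1 ^ p + of_nat p * (z - 1) * 1 * w"
    "z - 1 \<preceq> w - 1 ^ (p - 2)"
    using binomial_prime [OF p(1), of "z - 1" 1] x by auto
  then have "0 = (z - 1) ^ p + of_nat p * (z - 1) * w"
    using z by simp
  also have "(z - 1) ^ p = (z - 1) * (z - 1) ^ (p - 1)"
    using \<open>p > 1\<close> by (cases p) auto
  finally have "(z - 1) * ((z - 1) ^ (p - 1) + of_nat p * w) = 0"
    by (simp add: distrib_left mult_ac)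
  then have eq: "(z - 1) ^ (p - 1) = - (of_nat p * w)"
    using x by (simp add: eq_neg_iff_add_eq_0)
  show nonunit: "\<not> z - 1 \<preceq> 1"
  proof
    assume "z - 1 \<preceq> 1"
    then have "- (of_nat p * w) \<preceq> 1"
      using vle_power [of "z - 1" 1 "p - 1"] unfolding eq by simp
    then have "of_nat p * w \<preceq> 1"
      by simp
    then show False
      using p(2) w(1) vle_mult_self vle_trans by blast
  qed
  have "w \<asymp> 1"
    using veq_close [OF w(3)] nonunit by simp
  then have "of_nat p * w \<asymp> of_nat p * 1"
    by (intro veq_mult) auto
  then show "(z - 1) ^ (p - 1) \<asymp> of_nat p"
    unfolding eq by simp
qed

lemma root_of_unity_power_neq_1:
  fixes z :: 'b
  assumes "Factorial_Ring.prime p" "z ^ p = 1" "z \<noteq> 1" "\<not> p dvd i"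
  shows "z ^ i \<noteq> 1"
proof
  assume *: "z ^ i = 1"
  have "coprime i p"
    using assms by (metis coprime_commute prime_imp_coprime)
  moreover have "i \<noteq> 0"
    using assms by (metis dvd_0_right)
  ultimately obtain a b where ab: "i * a = p * b + 1"
    using bezout_nat [of i p] by (metis coprime_imp_gcd_eq_1)
  have "(z ^ i) ^ a = (z ^ p) ^ b * z"
    by (simp only: power_mult [symmetric] ab) (simp only: power_add power_mult power_one_right)
  then show False
    using * assms by simp
qed

text \<open>The consequence of (DRvg) that Kummer extensions need.\<close>

definition dense_values :: "'b set \<Rightarrow> bool" where
  "dense_values K \<longleftrightarrow> (\<forall>a\<in>K - {0}. \<not> a \<preceq> 1 \<longrightarrow>
     (\<forall>n. \<exists>x\<in>K. \<not> x \<preceq> 1 \<and> x ^ n \<preceq> a \<and> (\<exists>m. a \<preceq> x ^ m)))"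

text \<open>The error of the approximation has larger value than \<open>x\<close>, so the
  approximating power has the value of \<open>x\<close>. In particular, nonnegative values in
  \<open>K\<close> below that of \<open>p\<close> are divisible by \<open>p\<close>.\<close>

lemma frobenius_dense_root:
  assumes "frobenius_dense K p" "e \<in> K" "e \<noteq> 0" "e \<preceq> of_nat p" "x \<in> K" "x \<in> V" "\<not> e \<preceq> x"
  obtains y where "y \<in> K" "y \<in> V" "y ^ p \<asymp> x"
proof -
  obtain y where y: "y \<in> K" "y \<in> V" "e \<preceq> x - y ^ p"
    using assms unfolding frobenius_dense_def by blast
  then have "y ^ p \<asymp> x"
    using veq_close [of e "y ^ p" x] assms vle_minus_commute by auto
  then show thesis
    using that y by blast
qed

lemma veq_close_add:
  assumes "a \<asymp> a'" "\<not> b \<preceq> a"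
  shows "a + b \<asymp> a'"
  using assms veq_add_strict veq_trans by blast

lemma sum_veq_minimal:
  assumes "finite A" "\<exists>i\<in>A. f i \<noteq> 0"
    and "\<And>i j. i \<in> A \<Longrightarrow> j \<in> A \<Longrightarrow> i \<noteq> j \<Longrightarrow> f i \<noteq> 0 \<Longrightarrow> f j \<noteq> 0 \<Longrightarrow> \<not> f i \<asymp> f j"
  obtains m where "m \<in> A" "f m \<noteq> 0" "sum f A \<asymp> f m" "\<And>i. i \<in> A \<Longrightarrow> f m \<preceq> f i"
proof -
  have "\<exists>m\<in>A. f m \<noteq> 0 \<and> sum f A \<asymp> f m \<and> (\<forall>i\<in>A. f m \<preceq> f i)"
    using assms
  proof (induction A rule: finite_induct)
    case (insert i A)
    show ?case
    proof (cases "\<exists>j\<in>A. f j \<noteq> 0")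
      case True
      then obtain m where m: "m \<in> A" "f m \<noteq> 0" "sum f A \<asymp> f m" "\<forall>i\<in>A. f m \<preceq> f i"
        using insert by (metis insertCI)
      have ne: "\<not> f i \<asymp> f m" if "f i \<noteq> 0"
        using insert.prems(2) [of i m] insert.hyps m that by auto
      show ?thesis
      proof (cases "f i \<preceq> f m")
        case True
        then have "f i \<noteq> 0"
          using m by auto
        then have "\<not> f m \<preceq> f i"
          using ne True by (simp add: veq_def)
        then have "\<not> sum f A \<preceq> f i"
          using m vle_trans veq_def by blast
        then have "f i + sum f A \<asymp> f i"
          by (rule veq_add_strict)
        then show ?thesis
          using insert.hyps m True \<open>f i \<noteq> 0\<close> vle_trans by (intro bexI [of _ i]) auto
      next
        case False
        then have "\<not> f i \<preceq> sum f A"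
          using m vle_trans veq_def by blast
        then have "sum f A + f i \<asymp> f m"
          using m veq_close_add by blast
        then show ?thesis
          using insert.hyps m False vle_linear by (intro bexI [of _ m]) (auto simp: add.commute)
      qed
    next
      case False
      then have "sum f A = 0"
        by (simp add: sum.neutral)
      then show ?thesis
        using insert False by (intro bexI [of _ i]) auto
    qed
  qed auto
  then show thesis
    using that by blast
qed

end

section \<open>Criteria for idempotence\<close>

context cyclic_valued_extension
begin

lemma ex_integral_generator:
  obtains u where "u \<in> L" "u \<in> V" "u \<notin> K"
proof -
  obtain x where x: "x \<in> L" "x \<notin> K"
    using nontrivial by auto
  then have "inverse x \<notin> K"
    using K.inverse_mem [of "inverse x"] by auto
  then show thesis
    using mem_or_inverse_mem [of x] x that by blast
qed

text \<open>Either \<open>u\<close> already serves for \<open>b\<close>, or an approximate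
  \<open>p\<close>-th root \<open>c\<close> of \<open>b\<close> does: from \<open>c ^ p\<close>
  close to \<open>b\<close> follows \<open>D c ^ p\<close> close to \<open>D b\<close>, and then
  both have the same value. To find \<open>c\<close>, a multiple of \<open>b\<close> is written as a
  polynomial in \<open>u ^ p\<close>, whose coefficients are replaced by \<open>p\<close>-th
  powers.\<close>

lemma idempotent_idealI_frobenius:
  assumes FD: "frobenius_dense K p" and e: "e \<in> K" "e \<noteq> 0" "\<not> e \<preceq> 1" "e \<preceq> of_nat p"
    and u: "u \<in> L" "u \<in> V" "u \<notin> K" "D u ^ (p\<^sup>2) \<preceq> e"
  shows idempotent_ideal
  unfolding idempotent_ideal_def
proof
  fix b assume "b \<in> L \<inter> V - K"
  then have b: "b \<in> L" "b \<in> V" "b \<notin> K"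
    by auto
  define d where "d = D u"
  have d: "d \<in> L" "d \<in> V" "d \<noteq> 0"
    using u D_V D_nonzero by (auto simp: d_def)
  have pp: "p\<^sup>2 = p * (p - 1) + p"
    using p_gt_0 by (cases p) (auto simp: power2_eq_square)
  \<comment> \<open>Otherwise \<open>d ^ p\<^sup>2\<close> would divide \<open>d ^ p\<close>, so
    \<open>d\<close> would be a unit, and \<open>e\<close> too.\<close>
  have d_not: "\<not> e \<preceq> d ^ p"
  proof
    assume *: "e \<preceq> d ^ p"
    have "d ^ (p * (p - 1)) * d ^ p \<preceq> 1 * d ^ p"
      using vle_trans [OF u(4) [folded d_def] *] pp by (simp add: power_add)
    then have "d ^ (p * (p - 1)) \<preceq> 1"
      using d by (subst (asm) vle_mult_cancel_right) auto
    then have "d \<preceq> 1"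
      using vle_imp_power_vle [of d "p * (p - 1)" 1] p_gt_1 by auto
    then show False
      using e(3) * vle_power [of d 1 p] vle_trans by auto
  qed
  show "\<exists>c\<in>L \<inter> V - K. (D c)\<^sup>2 \<preceq> D b"
  proof (cases "d\<^sup>2 \<preceq> D b")
    case True
    then show ?thesis
      using u by (auto simp: d_def)
  next
    case Db: False
    have n: "norm d \<in> K" "norm d \<in> V" "norm d \<asymp> d ^ p"
      using d norm_veq [of d] vle_mem [of "d ^ p" "norm d"] by (auto simp: veq_def power_mem)
    then have "\<not> e \<preceq> norm d"
      using d_not vle_veq_trans by blast
    then obtain y0 where y0: "y0 \<in> K" "y0 \<in> V" "y0 ^ p \<asymp> norm d"
      using frobenius_dense_root FD e n by metis
    then have y0d: "y0 \<asymp> d"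
      using veq_power_iff [of p y0 d] n veq_trans p_gt_0 by blast
    then have "y0 \<noteq> 0"
      using d by auto
    \<comment> \<open>The mixed terms in \<open>\<sigma> v = (d + u) ^ p\<close> are multiples of
      \<open>p\<close>, hence of \<open>e\<close>, and therefore of larger value than
      \<open>d ^ p\<close>; so \<open>D v\<close> has the value of \<open>d ^ p\<close>.\<close>
    define v where "v = u ^ p"
    have v: "v \<in> L" "v \<in> V"
      using u by (auto simp: v_def)
    have "D v \<asymp> d ^ p"
    proof -
      obtain z where z: "z \<in> V" "(d + u) ^ p = d ^ p + u ^ p + of_nat p * d * u * z"
        using binomial_prime [OF p_prime, of d u] d u by auto
      have "D v = d ^ p + of_nat p * d * (u * z)"
        using u z by (simp add: v_def \<sigma>_power d_def mult_ac)
      moreover have "\<not> of_nat p * d * (u * z) \<preceq> d ^ p"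
      proof
        assume *: "of_nat p * d * (u * z) \<preceq> d ^ p"
        have "e * 1 \<preceq> of_nat p * (d * (u * z))"
          using e d u z by (intro vle_mult) (auto simp: one_vle_iff)
        then show False
          using d_not * vle_trans by (simp add: mult.assoc)
      qed
      ultimately show ?thesis
        using veq_add_strict by simp
    qed
    then have vK: "v \<notin> K" and "D v \<asymp> y0 ^ p"
      using d veq_trans [OF _ veq_sym [OF veq_power [OF y0d]]] by auto
    \<comment> \<open>Then \<open>w ^ p\<close> has the value of \<open>D v ^ (p - 1)\<close>, the
      factor that clears denominators over \<open>v\<close>, and is a \<open>p\<close>-th power in
      \<open>K\<close>, so that it can be divided out of an approximate \<open>p\<close>-th
      root.\<close>
    define w where "w = y0 ^ (p - 1)"
    have w: "w \<in> K" "w \<in> V" "w \<noteq> 0"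
      using y0 \<open>y0 \<noteq> 0\<close> by (auto simp: w_def)
    have wp: "D v ^ (p - 1) \<asymp> w ^ p"
      using veq_power [OF \<open>D v \<asymp> y0 ^ p\<close>, of "p - 1"] by (simp add: w_def mult.commute flip: power_mult)
    then obtain h where h: "\<And>i. coeff h i \<in> K" "\<And>i. coeff h i \<in> V" "poly h v = w ^ p * b"
      using ex_poly_mult [OF v vK b(1,2), of "w ^ p"] w unfolding veq_def by blast
    have "\<exists>y. y \<in> K \<and> y \<in> V \<and> e \<preceq> coeff h i - y ^ p" for i
      using FD e h unfolding frobenius_dense_def by blast
    then obtain y where y: "\<And>i. y i \<in> K" "\<And>i. y i \<in> V" "\<And>i. e \<preceq> coeff h i - y i ^ p"
      by metis
    \<comment> \<open>Modulo \<open>p\<close>, and so modulo \<open>e\<close>, the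
      \<open>p\<close>-th power acts on each term; this turns \<open>y i * u ^ i\<close> into nearly
      \<open>coeff h i * v ^ i\<close>.\<close>
    define s where "s = (\<Sum>i\<le>degree h. y i * u ^ i)"
    have s: "s \<in> L" "s \<in> V"
      using y u by (auto simp: s_def intro!: sum_mem L.sum_mem)
    have es: "e \<preceq> s ^ p - w ^ p * b"
    proof -
      have 1: "of_nat p \<preceq> s ^ p - (\<Sum>i\<le>degree h. (y i * u ^ i) ^ p)"
        unfolding s_def using y u by (intro sum_power_prime_vle p_prime) auto
      have "w ^ p * b - (\<Sum>i\<le>degree h. (y i * u ^ i) ^ p) = (\<Sum>i\<le>degree h. (coeff h i - y i ^ p) * v ^ i)"
        unfolding h(3) [symmetric] poly_altdef sum_subtractf [symmetric] v_def
        by (intro sum.cong refl) (simp add: algebra_simps power_mult_distrib power_commutes flip: power_mult)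
      moreover have "e \<preceq> \<dots>"
        using y v by (intro vle_sum vle_mult_mem) auto
      moreover have "e \<preceq> s ^ p - (\<Sum>i\<le>degree h. (y i * u ^ i) ^ p)"
        using 1 e(4) vle_trans by blast
      ultimately have "e \<preceq> (s ^ p - (\<Sum>i\<le>degree h. (y i * u ^ i) ^ p)) - (w ^ p * b - (\<Sum>i\<le>degree h. (y i * u ^ i) ^ p))"
        by (metis vle_diff)
      then show ?thesis
        by simp
    qed
    define c where "c = s / w"
    \<comment> \<open>The precision left after division by \<open>w ^ p\<close>. Since
      \<open>d ^ p\<^sup>2\<close> divides \<open>e\<close>, it is at least \<open>d ^ p\<close>,
      still beyond \<open>D b\<close> in the present case.\<close>
    define e' where "e' = e / w ^ p"
    have c: "c \<in> L"
      using s w by (simp add: c_def K_in_L)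
    have "w ^ p \<asymp> d ^ (p * (p - 1))"
      using veq_power [OF y0d, of "p * (p - 1)"] by (simp add: w_def mult.commute flip: power_mult)
    then have wd: "w ^ p \<preceq> d ^ (p * (p - 1))"
      by (simp add: veq_def)
    moreover have "d ^ (p * (p - 1)) \<preceq> d ^ p\<^sup>2"
      using d pp by (intro power_vle_power) auto
    ultimately have "w ^ p \<preceq> e"
      using u(4) vle_trans unfolding d_def by blast
    then have "e' \<in> V"
      using w by (simp add: e'_def vle_iff_divide_mem)
    have e'e: "e' \<preceq> e"
      unfolding e'_def using w by (simp add: divide_vle_iff vle_mult_self power_mem)
    have ec: "e' \<preceq> c ^ p - b"
    proof -
      have "c ^ p - b = (s ^ p - w ^ p * b) / w ^ p"
        using w by (simp add: c_def field_simps)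
      then show ?thesis
        using es w unfolding e'_def by (simp add: vle_divide_iff)
    qed
    then have "c ^ p - b \<in> V"
      using \<open>e' \<in> V\<close> vle_mem by blast
    then have "c ^ p - b + b \<in> V"
      using b by (intro add_mem)
    then have cV: "c \<in> V"
      using mem_power_iff p_gt_0 by simp
    have "c ^ p - b \<preceq> \<sigma> (c ^ p - b)"
      using \<sigma>_veq [of "c ^ p - b"] c b by (simp add: veq_def)
    from vle_diff [OF vle_trans [OF ec this] ec] have "e' \<preceq> D (c ^ p - b)" .
    moreover have "D (c ^ p - b) = (\<sigma> c ^ p - c ^ p) - D b"
      using c b by (simp add: \<sigma>_diff \<sigma>_power)
    moreover have "of_nat p \<preceq> D c ^ p - (\<sigma> c ^ p - c ^ p)"
      using c cV by (intro diff_power_prime_vle p_prime \<sigma>_V)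
    then have "e' \<preceq> D c ^ p - (\<sigma> c ^ p - c ^ p)"
      using e'e e vle_trans by blast
    ultimately have "e' \<preceq> (D c ^ p - (\<sigma> c ^ p - c ^ p)) + ((\<sigma> c ^ p - c ^ p) - D b)"
      by (intro vle_add) auto
    then have "e' \<preceq> D c ^ p - D b"
      by (simp add: algebra_simps)
    moreover have "\<not> e' \<preceq> D b"
    proof
      assume "e' \<preceq> D b"
      then have "e \<preceq> D b * w ^ p"
        using w by (simp add: e'_def divide_vle_iff)
      also have "D b * w ^ p \<preceq> D b * d ^ (p * (p - 1))"
        using wd by (intro vle_mult) auto
      finally have "d ^ p * d ^ (p * (p - 1)) \<preceq> D b * d ^ (p * (p - 1))"
        using u(4) vle_trans unfolding d_def pp by (metis power_add add.commute)
      then have "d ^ p \<preceq> D b"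
        using d by (subst (asm) vle_mult_cancel_right) auto
      then show False
        using Db power_vle_power [of d 2 p] d p_gt_1 vle_trans by (metis Suc_1 Suc_leI)
    qed
    ultimately have Dc: "D c ^ p \<asymp> D b"
      by (rule veq_close)
    then have "D c \<noteq> 0"
      using D_nonzero [of b] b p_gt_0 by (auto simp: power_0_left)
    then have "c \<notin> K"
      by auto
    moreover have "D c ^ 2 \<preceq> D c ^ p"
      using D_V c cV p_gt_1 by (intro power_vle_power) auto
    moreover from this Dc have "D c ^ 2 \<preceq> D b"
      using vle_veq_trans by blast
    ultimately show ?thesis
      using c cV by blast
  qed
qed

text \<open>With \<open>p = 0\<close> every nonzero \<open>e\<close> of \<open>K\<close> divides
  \<open>p\<close>, so any \<open>u\<close> is admissible: \<open>e\<close> is built from the norm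
  of \<open>D u\<close>, and the factor \<open>m\<close> keeps it out of the units.\<close>

lemma idempotent_idealI_char_p:
  assumes "frobenius_dense K p" "of_nat p = (0::'b)" "m \<in> K" "m \<noteq> 0" "\<not> m \<preceq> 1"
  shows idempotent_ideal
proof -
  obtain u where u: "u \<in> L" "u \<in> V" "u \<notin> K"
    using ex_integral_generator by blast
  have Du: "D u \<in> L" "D u \<in> V" "D u \<noteq> 0"
    using u D_V D_nonzero by auto
  have "m \<in> V"
    using assms vle_linear one_vle_iff by blast
  have n: "norm (D u) \<asymp> D u ^ p"
    using Du norm_veq by blast
  have "norm (D u) ^ p \<asymp> D u ^ p\<^sup>2"
    using veq_power [OF n, of p] by (simp add: power2_eq_square power_mult)
  then have 1: "D u ^ p\<^sup>2 \<preceq> norm (D u) ^ p * m"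
    using \<open>m \<in> V\<close> by (intro vle_mult_mem) (simp add: veq_def)
  have "norm (D u) ^ p \<in> V"
    using n Du vle_mem [of "D u ^ p" "norm (D u)"] by (auto simp: veq_def)
  then have 2: "\<not> norm (D u) ^ p * m \<preceq> 1"
    using assms(5) vle_mult_mem' [of m m "norm (D u) ^ p"] vle_trans by blast
  show ?thesis
    by (rule idempotent_idealI_frobenius [OF assms(1) _ _ 2 _ u 1])
       (use assms Du in \<open>auto simp: norm_eq_0_iff norm_mem K.mult_mem K.power_mem\<close>)
qed

lemma not_idempotent_ideal:
  assumes x: "x \<in> L" "x \<in> V" "x \<notin> K" "\<not> D x \<preceq> 1"
    and k: "k > 0" "\<And>y. y \<in> K \<Longrightarrow> (x - y) ^ k \<preceq> D x ^ (k - 1)"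
  shows "\<not> idempotent_ideal"
proof
  assume idempotent_ideal
  \<comment> \<open>One factor more than the \<open>k\<close>-th power of the approximation estimate
    consumes; the surplus factor \<open>D c\<close> would have to be a unit, and then
    \<open>D x\<close> as well.\<close>
  then obtain c where c: "c \<in> L" "c \<in> V" "c \<notin> K" "D c ^ Suc (k * (p - 1)) \<preceq> D x"
    using idempotent_ideal_power x by blast
  have nz: "D c \<noteq> 0" "D x \<noteq> 0"
    using c x D_nonzero by auto
  obtain y where y: "y \<in> K" "D x \<preceq> (x - y) * D c ^ (p - 1)"
    using ex_approximation [OF c(1-3) x(1)] by blast
  have "D x * D x ^ (k - 1) = D x ^ k"
    using k(1) by (cases k) auto
  also have "D x ^ k \<preceq> (x - y) ^ k * D c ^ (k * (p - 1))"
    using vle_power [OF y(2), of k] by (simp add: power_mult_distrib mult.commute flip: power_mult)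
  also have "\<dots> \<preceq> D x ^ (k - 1) * D c ^ (k * (p - 1))"
    using y k by (intro vle_mult) auto
  finally have "D x * D x ^ (k - 1) \<preceq> D c ^ (k * (p - 1)) * D x ^ (k - 1)"
    by (simp add: mult.commute)
  then have *: "D x \<preceq> D c ^ (k * (p - 1))"
    using nz by (subst (asm) vle_mult_cancel_right) auto
  then have "D c * D c ^ (k * (p - 1)) \<preceq> 1 * D c ^ (k * (p - 1))"
    using vle_trans [OF c(4) *] by simp
  then have "D c \<preceq> 1"
    using nz by (subst (asm) vle_mult_cancel_right) auto
  then show False
    using * x(4) vle_power [of "D c" 1 "k * (p - 1)"] vle_trans by (metis power_one)
qed

end

section \<open>Kummer extensions\<close>

context cyclic_extension
begin

text \<open>\<open>R j\<close> is a Lagrange resolvent, an eigenvector of \<open>\<sigma>\<close>.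
  If those with \<open>0 < j < p\<close> all vanished, orthogonality of the powers of
  \<open>z\<close> would give \<open>R 0 = of_nat p * b\<close>; but \<open>R 0\<close> lies in
  \<open>K\<close>, \<open>b\<close> does not, and \<open>p\<close> is invertible.\<close>

lemma ex_kummer_generator:
  assumes z: "z \<in> K" "z ^ p = 1" "z \<noteq> 1" and char: "of_nat p \<noteq> (0::'b)"
  obtains x w where "x \<in> L" "x \<noteq> 0" "x ^ p \<in> K" "w \<in> K" "w ^ p = 1" "w \<noteq> 1" "\<sigma> x = w * x"
proof -
  obtain b where b: "b \<in> L" "b \<notin> K"
    using nontrivial by auto
  have z0: "z \<noteq> 0"
    using z p_gt_0 by (auto simp: power_0_left)
  define R where "R j = (\<Sum>i<p. z ^ (i * j) * conj i b)" for j
  have RL: "R j \<in> L" for j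
    using z b by (auto simp: R_def intro!: L.sum_mem)
  have \<sigma>R: "z ^ j * \<sigma> (R j) = R j" for j
  proof -
    have "z ^ j * \<sigma> (R j) = (\<Sum>i<p. z ^ (Suc i * j) * conj (Suc i) b)"
      using z b by (simp add: R_def \<sigma>_sum \<sigma>_mult sum_distrib_left power_add K_in_L mult.assoc)
    also have "\<dots> = R j"
      unfolding R_def using b z by (intro cyclic_sum) (simp add: \<sigma>_cyclic power_mult)
    finally show ?thesis .
  qed
  have zj: "z ^ j \<noteq> 1" if j: "\<not> p dvd j" for j
  proof
    assume *: "z ^ j = 1"
    obtain a l where "j * a = l * p + 1"
      using ex_mult_mod_eq_1 j by blast
    then have al: "j * a = p * l + 1"
      by (simp add: mult.commute)
    have "(z ^ j) ^ a = (z ^ p) ^ l * z"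
      by (simp only: power_mult [symmetric] al) (simp only: power_add power_mult power_one_right)
    then show False
      using * z by simp
  qed
  have "\<exists>j\<in>{1..<p}. R j \<noteq> 0"
  proof (rule ccontr)
    assume "\<not> ?thesis"
    then have *: "R j = 0" if "j \<in> {1..<p}" for j
      using that by auto
    have "(\<Sum>j<p. R j) = (\<Sum>i<p. (\<Sum>j<p. (z ^ i) ^ j) * conj i b)"
      unfolding R_def sum_distrib_right by (subst sum.swap) (simp add: power_mult)
    also have "\<dots> = (\<Sum>i\<in>{0}. (\<Sum>j<p. (z ^ i) ^ j) * conj i b)"
    proof (rule sum.mono_neutral_right)
      show "\<forall>i\<in>{..<p} - {0}. (\<Sum>j<p. (z ^ i) ^ j) * conj i b = 0"
      proof
        fix i assume i: "i \<in> {..<p} - {0}"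
        then have "z ^ i \<noteq> 1"
          by (intro zj) (auto dest: dvd_imp_le)
        moreover have "(z ^ i) ^ p = 1"
          using z by (metis mult.commute power_mult power_one)
        ultimately show "(\<Sum>j<p. (z ^ i) ^ j) * conj i b = 0"
          by (simp add: geometric_sum)
      qed
    qed (use p_gt_0 in auto)
    finally have "(\<Sum>j<p. R j) = of_nat p * b"
      by simp
    moreover have "(\<Sum>j<p. R j) = R 0"
      using p_gt_0 * by (subst sum.remove [of _ 0]) (auto intro!: sum.neutral)
    moreover have "R 0 \<in> K"
      using RL [of 0] \<sigma>R [of 0] \<sigma>_fixed by simp
    ultimately have "of_nat p * b \<in> K"
      by simp
    then have "of_nat p * b / of_nat p \<in> K"
      by (rule K.divide_mem) simp
    then show False
      using b char by simp
  qed
  then obtain j where j: "j \<in> {1..<p}" "R j \<noteq> 0"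
    by auto
  define w where "w = inverse (z ^ j)"
  have w: "w \<in> K" "w ^ p = 1"
    using z by (auto simp: w_def power_inverse) (metis mult.commute power_mult power_one inverse_1)
  have "z ^ j \<noteq> 1"
    using j by (intro zj) (auto dest: dvd_imp_le)
  then have "w \<noteq> 1"
    by (simp add: w_def)
  have \<sigma>w: "\<sigma> (R j) = w * R j"
    using \<sigma>R [of j] z0 by (simp add: w_def field_simps)
  have "R j ^ p \<in> K"
    using RL w \<sigma>w by (intro \<sigma>_fixed) (auto simp: \<sigma>_power power_mult_distrib)
  then show thesis
    using that [of "R j" w] RL j w \<sigma>w \<open>w \<noteq> 1\<close> by blast
qed

end

locale kummer_extension = cyclic_valued_extension K L \<sigma> p V
  for K L :: "'b::field set" and \<sigma> p and V :: "'b set" +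
  fixes x w :: 'b
  assumes char_p: "of_nat p \<noteq> (0::'b)" "\<not> of_nat p \<preceq> 1"
    and x: "x \<in> L" "x \<noteq> 0" "x ^ p \<in> K"
    and w: "w \<in> K" "w ^ p = 1" "w \<noteq> 1" and \<sigma>_x: "\<sigma> x = w * x"
begin

lemma w_diff: "(w - 1) ^ (p - 1) \<asymp> of_nat p" "\<not> w - 1 \<preceq> 1" "w \<in> V"
  using root_of_unity_diff_veq [OF p_prime char_p(2) w(2,3)] by auto

lemma w_diff_mem: "w - 1 \<in> V" "w - 1 \<noteq> 0" "w - 1 \<in> K"
  using w w_diff by auto

lemma w_diff_vle_p: "w - 1 \<preceq> of_nat p"
proof -
  have "(w - 1) ^ 1 \<preceq> (w - 1) ^ (p - 1)"
    using p_gt_1 w_diff_mem by (intro power_vle_power) auto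
  then show ?thesis
    using w_diff(1) vle_trans by (auto simp: veq_def)
qed

lemma \<sigma>_x_power: "\<sigma> (x ^ i) = w ^ i * x ^ i"
  using x by (simp add: \<sigma>_power \<sigma>_x power_mult_distrib)

lemma x_not_in_K: "x \<notin> K"
proof
  assume "x \<in> K"
  then have "w * x = x"
    using \<sigma>_x by simp
  then show False
    using x w by simp
qed

lemma D_x: "D x = (w - 1) * x"
  by (simp add: \<sigma>_x algebra_simps)

lemma w_power_diff_veq:
  assumes "0 < i" "i < p"
  shows "w ^ i - 1 \<asymp> w - 1"
proof -
  have "\<not> p dvd i"
    using assms by (auto dest: dvd_imp_le)
  then have "w ^ i \<noteq> 1"
    using root_of_unity_power_neq_1 [OF p_prime w(2,3)] by blast
  moreover have "(w ^ i) ^ p = 1"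
    using w by (metis mult.commute power_mult power_one)
  ultimately have "(w ^ i - 1) ^ (p - 1) \<asymp> of_nat p"
    using root_of_unity_diff_veq [OF p_prime char_p(2)] by blast
  then have "(w ^ i - 1) ^ (p - 1) \<asymp> (w - 1) ^ (p - 1)"
    using w_diff(1) veq_sym veq_trans by blast
  then show ?thesis
    using veq_power_iff p_gt_1 by simp
qed

lemma D_monomial_veq:
  assumes "0 < i" "i < p" "c \<in> K"
  shows "D (c * x ^ i) \<asymp> (w - 1) * (c * x ^ i)"
proof -
  have "D (c * x ^ i) = (w ^ i - 1) * (c * x ^ i)"
    using assms x by (simp add: \<sigma>_mult K_in_L \<sigma>_x_power algebra_simps)
  then show ?thesis
    using veq_mult [OF w_power_diff_veq [OF assms(1,2)] veq_refl] by simp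
qed


text \<open>Equal values would put the value of \<open>x ^ k\<close> into the value group of
  \<open>K\<close> for some \<open>k\<close> that is invertible modulo \<open>p\<close>. As
  \<open>x ^ p\<close> is in \<open>K\<close>, the value of \<open>x\<close> would belong to that
  group as well, against \<open>nr\<close>.\<close>

lemma monomials_not_veq:
  assumes nr: "\<And>y. y \<in> K \<Longrightarrow> \<not> y ^ p \<asymp> x ^ p"
    and c: "c \<in> K" "c' \<in> K" "c \<noteq> 0" "c' \<noteq> 0" and ij: "i < p" "j < p" "i \<noteq> j"
  shows "\<not> c * x ^ i \<asymp> c' * x ^ j"
  using ij c
proof (induction i j arbitrary: c c' rule: linorder_wlog)
  case (le i j)
  show ?case
  proof
    assume *: "c * x ^ i \<asymp> c' * x ^ j"
    define k where "k = j - i"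
    have k: "0 < k" "k < p" "x ^ j = x ^ k * x ^ i"
      using le by (auto simp: k_def simp flip: power_add)
    have "c * x ^ i \<asymp> (c' * x ^ k) * x ^ i"
      using * k by (simp add: mult_ac)
    then have "c \<asymp> c' * x ^ k"
      using x by (subst (asm) veq_mult_cancel_right) auto
    then have "c / c' \<asymp> c' * x ^ k / c'"
      by (intro veq_divide) auto
    then have ck: "c / c' \<asymp> x ^ k"
      using le by simp
    have "\<not> p dvd k"
      using k by (auto dest: dvd_imp_le)
    then obtain a l where "k * a = l * p + 1"
      using ex_mult_mod_eq_1 by blast
    then have al: "k * a = p * l + 1"
      by (simp add: mult.commute)
    define y where "y = (c / c') ^ a / (x ^ p) ^ l"
    have "y \<in> K"
      using le x by (auto simp: y_def)
    have "(c / c') ^ a / (x ^ p) ^ l \<asymp> (x ^ k) ^ a / (x ^ p) ^ l"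
      using ck by (intro veq_divide veq_power) auto
    also have "(x ^ k) ^ a = (x ^ p) ^ l * x"
      by (simp only: power_mult [symmetric] al) (simp only: power_add power_mult power_one_right)
    finally have "y \<asymp> x"
      using x by (simp add: y_def)
    then show False
      using nr [OF \<open>y \<in> K\<close>] veq_power by blast
  qed
next
  case (sym i j)
  then show ?case
    using veq_sym by metis
qed

text \<open>The monomials of \<open>b\<close> have distinct values, so the least one has the value
  of \<open>b\<close> and all are integral. \<open>D\<close> multiplies the monomial of degree
  \<open>i\<close> by \<open>w ^ i - 1\<close>, which has the value of \<open>w - 1\<close> for
  \<open>i > 0\<close>; so again nothing cancels.\<close>

lemma D_veq_monomial:
  assumes nr: "\<And>y. y \<in> K \<Longrightarrow> \<not> y ^ p \<asymp> x ^ p"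
    and b: "b \<in> L" "b \<in> V" "b \<notin> K"
  obtains i c where "0 < i" "i < p" "c \<in> K" "c \<noteq> 0" "c * x ^ i \<in> V" "D b \<asymp> (w - 1) * (c * x ^ i)"
proof -
  define c where "c i = coeff (interp x b) i" for i
  have c: "c i \<in> K" for i
    using coeff_interp_mem x x_not_in_K b by (simp add: c_def)
  have "b = poly (interp x b) x"
    using poly_interp x x_not_in_K by simp
  also have "\<dots> = (\<Sum>i<p. c i * x ^ i)"
    unfolding poly_altdef c_def using degree_interp [of x b]
    by (intro sum.mono_neutral_left) (auto simp: coeff_eq_0)
  finally have b_eq: "b = (\<Sum>i<p. c i * x ^ i)" .
  have Db_eq: "D b = (\<Sum>i<p. (c i * (w ^ i - 1)) * x ^ i)"
  proof -
    have "\<sigma> b = (\<Sum>i<p. \<sigma> (c i * x ^ i))"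
      unfolding b_eq using c x by (intro \<sigma>_sum) auto
    also have "\<dots> = (\<Sum>i<p. c i * (w ^ i * x ^ i))"
      using c x by (intro sum.cong refl) (simp add: \<sigma>_mult \<sigma>_x_power K_in_L)
    finally have "D b = (\<Sum>i<p. c i * (w ^ i * x ^ i)) - (\<Sum>i<p. c i * x ^ i)"
      using b_eq by simp
    then show ?thesis
      by (simp add: sum_subtractf [symmetric] algebra_simps)
  qed
  have ne_V: "\<not> a * x ^ i \<asymp> a' * x ^ j"
    if "i < p" "j < p" "i \<noteq> j" "a \<in> K" "a' \<in> K" "a * x ^ i \<noteq> 0" "a' * x ^ j \<noteq> 0" for i j a a'
    using monomials_not_veq [OF nr that(4,5) _ _ that(1-3)] that by auto
  have "b \<noteq> 0"
    using b by auto
  then obtain m where m: "b \<asymp> c m * x ^ m" "\<And>i. i < p \<Longrightarrow> c m * x ^ m \<preceq> c i * x ^ i"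
  proof -
    assume that: "\<And>m. b \<asymp> c m * x ^ m \<Longrightarrow> (\<And>i. i < p \<Longrightarrow> c m * x ^ m \<preceq> c i * x ^ i) \<Longrightarrow> thesis"
    have ne: "\<not> c i * x ^ i \<asymp> c j * x ^ j"
      if "i \<in> {..<p}" "j \<in> {..<p}" "i \<noteq> j" "c i * x ^ i \<noteq> 0" "c j * x ^ j \<noteq> 0" for i j
      using ne_V c that by blast
    have ex: "\<exists>i\<in>{..<p}. c i * x ^ i \<noteq> 0"
      using \<open>b \<noteq> 0\<close> unfolding b_eq by (meson sum.neutral)
    obtain m where "m \<in> {..<p}" "c m * x ^ m \<noteq> 0" "(\<Sum>i<p. c i * x ^ i) \<asymp> c m * x ^ m"
        "\<And>i. i \<in> {..<p} \<Longrightarrow> c m * x ^ m \<preceq> c i * x ^ i"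
      by (rule sum_veq_minimal [OF finite_lessThan ex ne]) blast+
    then show thesis
      using that [of m] b_eq by auto
  qed
  have "c m * x ^ m \<in> V"
    using m(1) vle_mem [of b "c m * x ^ m"] b by (simp add: veq_def)
  then have V: "c i * x ^ i \<in> V" if "i < p" for i
    using m(2) that vle_mem by blast
  define c' where "c' i = c i * (w ^ i - 1)" for i
  have c': "c' i \<in> K" for i
    using c w by (simp add: c'_def)
  have ne: "\<not> c' i * x ^ i \<asymp> c' j * x ^ j"
    if "i \<in> {..<p}" "j \<in> {..<p}" "i \<noteq> j" "c' i * x ^ i \<noteq> 0" "c' j * x ^ j \<noteq> 0" for i j
    using ne_V c' that by blast
  have ex: "\<exists>i\<in>{..<p}. c' i * x ^ i \<noteq> 0"
  proof (rule ccontr)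
    assume "\<not> ?thesis"
    then have "D b = 0"
      unfolding Db_eq c'_def by (intro sum.neutral) blast
    then show False
      using D_nonzero b by blast
  qed
  obtain i where "i \<in> {..<p}" and i: "c' i * x ^ i \<noteq> 0" "(\<Sum>i<p. c' i * x ^ i) \<asymp> c' i * x ^ i"
    and "\<And>j. j \<in> {..<p} \<Longrightarrow> c' i * x ^ i \<preceq> c' j * x ^ j"
    by (rule sum_veq_minimal [OF finite_lessThan ex ne]) blast+
  then have "i < p"
    by simp
  from i have "i \<noteq> 0" "c i \<noteq> 0"
    by (auto simp: c'_def intro: Nat.gr0I)
  have "c' i * x ^ i \<asymp> (w - 1) * (c i * x ^ i)"
    using veq_mult [OF w_power_diff_veq veq_refl, of i "c i * x ^ i"] \<open>i < p\<close> \<open>i \<noteq> 0\<close> by (simp add: c'_def mult_ac)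
  moreover have "D b \<asymp> c' i * x ^ i"
    using i(2) Db_eq unfolding c'_def by simp
  ultimately have "D b \<asymp> (w - 1) * (c i * x ^ i)"
    using veq_trans by blast
  then show thesis
    using that [of i "c i"] \<open>i < p\<close> \<open>i \<noteq> 0\<close> \<open>c i \<noteq> 0\<close> c V by blast
qed

lemma w_diff_power_veq: "(w - 1) ^ p \<asymp> of_nat p * (w - 1)"
proof -
  have "(w - 1) ^ p = (w - 1) ^ (p - 1) * (w - 1)"
    using p_gt_0 by (cases p) auto
  then show ?thesis
    using veq_mult [OF w_diff(1) veq_refl] by metis
qed

text \<open>The value of \<open>p\<close> itself is not reached by
  \<open>frobenius_dense_root\<close>. Density of values splits it into two strictly smaller
  positive ones, those of \<open>a\<close> and \<open>of_nat p / a\<close>, to which it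
  applies.\<close>

lemma ex_root_p:
  assumes FD: "frobenius_dense K p" and DV: "dense_values K"
  obtains r where "r \<in> K" "r \<in> V" "r ^ p \<asymp> of_nat p"
proof -
  have pK: "(of_nat p :: 'b) \<in> K"
    by simp
  obtain a where a: "a \<in> K" "\<not> a \<preceq> 1" "a ^ 2 \<preceq> of_nat p"
    using DV char_p pK unfolding dense_values_def by (metis Diff_iff singletonD)
  have "a \<noteq> 0" "a \<in> V"
    using a char_p vle_linear [of a 1] by (auto simp: one_vle_iff)
  have *: "\<not> of_nat p \<preceq> y" if "y * z = of_nat p" "\<not> z \<preceq> 1" for y z
  proof
    assume "of_nat p \<preceq> y"
    then have "y * z \<preceq> y * 1"
      using that by simp
    moreover have "y \<noteq> 0"
      using that char_p by auto
    ultimately show False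
      using that vle_mult_cancel_left [of y z 1] by blast
  qed
  have "\<not> of_nat p / a \<preceq> 1"
  proof
    assume "of_nat p / a \<preceq> 1"
    then have "of_nat p \<preceq> a"
      using \<open>a \<noteq> 0\<close> by (simp add: divide_vle_iff)
    then have "a ^ 2 \<preceq> a"
      using a vle_trans by blast
    then have "a * a \<preceq> a * 1"
      by (simp only: power2_eq_square mult_1_right)
    then show False
      using a \<open>a \<noteq> 0\<close> vle_mult_cancel_left [of a a 1] by blast
  qed
  then have "\<not> of_nat p \<preceq> a" "\<not> of_nat p \<preceq> of_nat p / a"
    using *[of a "of_nat p / a"] *[of "of_nat p / a" a] a \<open>a \<noteq> 0\<close> by auto
  moreover have "of_nat p / a \<in> V"
    using \<open>\<not> of_nat p / a \<preceq> 1\<close> vle_linear one_vle_iff by blast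
  ultimately obtain y z where y: "y \<in> K" "y \<in> V" "y ^ p \<asymp> a" and z: "z \<in> K" "z \<in> V" "z ^ p \<asymp> of_nat p / a"
    using frobenius_dense_root [OF FD pK char_p(1) vle_refl] a \<open>a \<in> V\<close> pK
    by (metis K.divide_mem)
  have "(y * z) ^ p \<asymp> a * (of_nat p / a)"
    unfolding power_mult_distrib using y z by (intro veq_mult)
  then show thesis
    using that [of "y * z"] y z \<open>a \<noteq> 0\<close> by auto
qed

text \<open>Dividing by \<open>p\<close> lowers the value until it falls below that of
  \<open>p\<close>; each division is undone by a factor \<open>r\<close>, whose \<open>p\<close>-th
  power has the value of \<open>p\<close>.\<close>

lemma ex_root:
  assumes FD: "frobenius_dense K p" and DV: "dense_values K"
    and a: "a \<in> K" "a \<in> V" "a \<preceq> of_nat p ^ n"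
  obtains y where "y \<in> K" "y \<in> V" "y ^ p \<asymp> a"
proof -
  obtain r where r: "r \<in> K" "r \<in> V" "r ^ p \<asymp> of_nat p"
    using ex_root_p [OF FD DV] .
  have "\<exists>y\<in>K \<inter> V. y ^ p \<asymp> a"
    using a
  proof (induction n arbitrary: a)
    case 0
    then show ?case
      by (intro bexI [of _ 1]) (auto simp: veq_def one_vle_iff)
  next
    case (Suc n)
    show ?case
    proof (cases "of_nat p \<preceq> a")
      case True
      then have "a / of_nat p \<in> V" "a / of_nat p \<preceq> of_nat p ^ n"
        using Suc.prems char_p by (simp_all add: vle_iff_divide_mem divide_vle_iff mult.commute)
      then obtain y where y: "y \<in> K \<inter> V" "y ^ p \<asymp> a / of_nat p"
        using Suc.IH [of "a / of_nat p"] Suc.prems by auto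
      have "(y * r) ^ p \<asymp> a / of_nat p * of_nat p"
        unfolding power_mult_distrib using y r by (intro veq_mult)
      then show ?thesis
        using y r char_p by (intro bexI [of _ "y * r"]) auto
    next
      case False
      then show ?thesis
        using frobenius_dense_root [OF FD _ char_p(1) vle_refl] Suc.prems by (metis IntI K.of_nat_mem)
    qed
  qed
  then show thesis
    using that by blast
qed

text \<open>The element \<open>u\<close> required by \<open>idempotent_idealI_frobenius\<close> is
  \<open>(x - y - r * d) / s\<close>, after two rounds of approximating by \<open>p\<close>-th
  powers. One round, \<open>(x - y) / r\<close>, is not enough: its \<open>D\<close> has
  \<open>p\<^sup>2\<close>-th power of the value of \<open>P * (w - 1)\<close>, just beyond
  \<open>P\<close>. The second round improves this to \<open>w - 1\<close>.\<close>

lemma idempotent_ideal_unit: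
  assumes FD: "frobenius_dense K p" and DV: "dense_values K" and x1: "x \<asymp> 1"
  shows idempotent_ideal
proof -
  have xV: "x \<in> V"
    using x1 by (simp add: veq_def one_vle_iff)
  define P where "P = (of_nat p :: 'b)"
  have P: "P \<in> K" "P \<noteq> 0" "\<not> P \<preceq> 1" "P \<in> V"
    using char_p by (auto simp: P_def)
  obtain r where r: "r \<in> K" "r \<in> V" "r ^ p \<asymp> P"
    using ex_root_p [OF FD DV] unfolding P_def .
  have "r \<noteq> 0"
    using r P p_gt_0 by (auto simp: power_0_left)
  have rr: "r \<preceq> r ^ p"
    using power_vle_power [of r 1 p] r p_gt_0 by simp
  have "P * r \<preceq> P * P"
    using rr r P vle_veq_trans by (intro vle_mult) auto
  then have "P * r \<preceq> of_nat p ^ 2"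
    by (simp add: P_def power2_eq_square)
  \<comment> \<open>\<open>P * r\<close> is the precision of the second round: the error made in the
    first is a multiple of \<open>P * t\<close>, and \<open>r\<close> divides
    \<open>t\<close>.\<close>
  then obtain s where s: "s \<in> K" "s \<in> V" "s ^ p \<asymp> P * r"
    using ex_root [OF FD DV, of "P * r" 2] P r by auto
  have "s \<noteq> 0"
    using s P \<open>r \<noteq> 0\<close> p_gt_0 by (auto simp: power_0_left)
  have FD': "\<exists>y\<in>K \<inter> V. P \<preceq> a - y ^ p" if "a \<in> K" "a \<in> V" for a
    using FD that P unfolding frobenius_dense_def P_def by blast
  obtain y where y: "y \<in> K" "y \<in> V" "P \<preceq> x ^ p - y ^ p"
    using FD' [of "x ^ p"] x xV by auto
  define t where "t = x - y"
  have tV: "t \<in> V"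
    using xV y by (auto simp: t_def)
  define c where "c = x ^ p - y ^ p"
  have c: "c \<in> K"
    using x y by (simp add: c_def)
  have tc: "P * t \<preceq> t ^ p - c"
    using diff_power_prime [OF p_prime xV y(2)] y(2) unfolding t_def c_def P_def
    by (meson vle_mult_self vle_trans)
  then have "P \<preceq> t ^ p - c"
    using tV vle_mult_self vle_trans by blast
  then have "P \<preceq> (t ^ p - c) + c"
    using y unfolding c_def by (intro vle_add)
  then have "r ^ p \<preceq> t ^ p"
    using r veq_vle_trans by simp
  then have rt: "r \<preceq> t"
    using vle_power_iff p_gt_0 by blast
  have "r ^ p \<preceq> c"
    using y r veq_vle_trans unfolding c_def by blast
  then have "c / r ^ p \<in> V"
    using \<open>r \<noteq> 0\<close> by (simp add: vle_iff_divide_mem)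
  then obtain d where d: "d \<in> K" "d \<in> V" "P \<preceq> c / r ^ p - d ^ p"
    using FD' [of "c / r ^ p"] c r by auto
  define t' where "t' = t - r * d"
  have Pr: "P * r \<preceq> P * t"
    using rt P by simp
  have "t' ^ p = (t' ^ p - (t ^ p - (r * d) ^ p)) + (t ^ p - c) + r ^ p * (c / r ^ p - d ^ p)"
    using \<open>r \<noteq> 0\<close> by (simp add: algebra_simps power_mult_distrib)
  moreover have "P * r \<preceq> t' ^ p - (t ^ p - (r * d) ^ p)"
  proof -
    have "P * r * ((t - r * d) * d) \<preceq> t' ^ p - (t ^ p - (r * d) ^ p)"
      using diff_power_prime [OF p_prime tV, of "r * d"] r d unfolding t'_def P_def by (simp add: mult_ac mult_mem)
    then show ?thesis
      using vle_trans [OF vle_mult_self] tV r d by (metis diff_mem mult_mem)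
  qed
  moreover have "P * r \<preceq> t ^ p - c"
    using Pr tc vle_trans by blast
  moreover have "P * r \<preceq> r ^ p * (c / r ^ p - d ^ p)"
    using vle_mult [OF rr d(3)] by (simp add: mult.commute)
  ultimately have "P * r \<preceq> t' ^ p"
    using vle_add by metis
  then have "s ^ p \<preceq> t' ^ p"
    using s veq_vle_trans by blast
  then have st: "s \<preceq> t'"
    using vle_power_iff p_gt_0 by blast
  define u where "u = t' / s"
  have u: "u \<in> L" "u \<in> V"
    using st \<open>s \<noteq> 0\<close> x y r d s unfolding u_def t'_def t_def by (auto simp: vle_iff_divide_mem K_in_L)
  have "t' \<in> L" "\<sigma> t' - t' = (w - 1) * x"
    using x y r d by (auto simp: t'_def t_def K_in_L \<sigma>_diff \<sigma>_x algebra_simps)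
  then have Du: "D u = (w - 1) * x / s"
    using s by (simp add: u_def \<sigma>_divide K_in_L diff_divide_distrib [symmetric])
  then have "D u \<noteq> 0"
    using x w_diff_mem \<open>s \<noteq> 0\<close> by simp
  then have "u \<notin> K"
    by auto
  have "D u ^ p = ((w - 1) ^ p * x ^ p) / s ^ p"
    by (simp add: Du power_divide power_mult_distrib)
  also have "\<dots> \<asymp> ((P * (w - 1)) * 1 ^ p) / (P * r)"
    using w_diff_power_veq x1 s unfolding P_def by (intro veq_divide veq_mult veq_power)
  also have "\<dots> = (w - 1) / r"
    using P by simp
  finally have Dup: "D u ^ p \<asymp> (w - 1) / r" .
  have "D u ^ p\<^sup>2 = (D u ^ p) ^ p"
    by (simp add: power2_eq_square power_mult)
  also have "\<dots> \<asymp> ((w - 1) / r) ^ p"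
    by (rule veq_power [OF Dup])
  also have "\<dots> = (w - 1) ^ p / r ^ p"
    by (simp add: power_divide)
  also have "\<dots> \<asymp> P * (w - 1) / P"
    using w_diff_power_veq r unfolding P_def by (intro veq_divide)
  also have "\<dots> = w - 1"
    using P by simp
  finally have "D u ^ p\<^sup>2 \<preceq> of_nat p"
    using w_diff_vle_p veq_vle_trans by blast
  then show ?thesis
    using idempotent_idealI_frobenius [OF FD _ char_p vle_refl u \<open>u \<notin> K\<close>] by simp
qed

text \<open>\<open>D b\<close> has the value of \<open>(w - 1) * z\<close> for a monomial
  \<open>z\<close>. The value of \<open>z\<close> is not in that of \<open>K\<close>, so by
  \<open>ex_root\<close> it exceeds all multiples of the value of \<open>p\<close>. Density of
  values lets an element of \<open>K\<close> reduce \<open>z\<close> to a monomial \<open>z'\<close>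
  of at most a quarter of its value, and \<open>z'\<close> serves for \<open>b\<close>.\<close>

lemma idempotent_ideal_nonunit:
  assumes FD: "frobenius_dense K p" and DV: "dense_values K"
    and nr: "\<And>y. y \<in> K \<Longrightarrow> \<not> y ^ p \<asymp> x ^ p"
  shows idempotent_ideal
  unfolding idempotent_ideal_def
proof
  fix b assume "b \<in> L \<inter> V - K"
  then obtain i c where i: "0 < i" "i < p" "c \<in> K" "c \<noteq> 0" "c * x ^ i \<in> V" "D b \<asymp> (w - 1) * (c * x ^ i)"
    using D_veq_monomial [OF nr, of b] by blast
  define z where "z = c * x ^ i"
  define a where "a = z ^ p"
  have z: "z \<in> L" "z \<in> V" "z \<noteq> 0"
    using i x by (auto simp: z_def K_in_L)
  have a: "a \<in> K" "a \<in> V" "a \<noteq> 0"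
  proof -
    have "a = c ^ p * (x ^ p) ^ i"
      by (simp add: a_def z_def power_mult_distrib mult.commute flip: power_mult)
    then show "a \<in> K"
      using i x by (metis K.mult_mem K.power_mem)
  qed (use z in \<open>auto simp: a_def\<close>)
  have no_root: "\<not> y ^ p \<asymp> a" if "y \<in> K" for y
  proof
    assume "y ^ p \<asymp> a"
    then have "y * x ^ 0 \<asymp> c * x ^ i"
      using veq_power_iff p_gt_0 by (simp add: a_def z_def)
    moreover from this have "y \<noteq> 0"
      using z by (auto simp: z_def)
    ultimately show False
      using monomials_not_veq [OF nr \<open>y \<in> K\<close> i(3) _ i(4) p_gt_0 i(2)] i(1) by blast
  qed
  have large: "of_nat p ^ n \<preceq> a" for n
    using ex_root [OF FD DV a(1,2), of n] no_root vle_linear by blast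
  have "\<not> a \<preceq> 1"
    using no_root [of 1] a by (auto simp: veq_def one_vle_iff)
  \<comment> \<open>The factor \<open>p\<close> passes from \<open>a = z ^ p\<close> to
    \<open>z\<close>, and the factor \<open>4\<close> makes \<open>z' ^ 4\<close> divide
    \<open>z\<close>. The upper bound by \<open>y ^ m\<close> ensures that dividing by powers of
    \<open>y\<close> comes to an end in arbitrary rank.\<close>
  then obtain y m where y: "y \<in> K" "\<not> y \<preceq> 1" "y ^ (4 * p) \<preceq> a" "a \<preceq> y ^ m"
    using DV a unfolding dense_values_def by (metis Diff_iff singletonD)
  have "y \<noteq> 0"
    using y(3) a p_gt_0 by (auto simp: power_0_left)
  have "y \<in> V"
    using y vle_linear one_vle_iff by blast
  have "\<not> y ^ (p * Suc m) \<preceq> a"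
  proof
    assume "y ^ (p * Suc m) \<preceq> a"
    then have *: "y ^ (p * Suc m) \<preceq> y ^ m"
      using y vle_trans by blast
    have "m < p * Suc m"
      using p_gt_0 by (cases p) auto
    then have "y ^ Suc m \<preceq> y ^ (p * Suc m)"
      using \<open>y \<in> V\<close> by (intro power_vle_power) auto
    then have "y * y ^ m \<preceq> 1 * y ^ m"
      using * vle_trans by simp
    then show False
      using \<open>y \<noteq> 0\<close> y(2) by (subst (asm) vle_mult_cancel_right) auto
  qed
  then have ex: "\<exists>n. \<not> y ^ (p * n) \<preceq> a"
    by blast
  \<comment> \<open>Division of \<open>z\<close> by \<open>y ^ (N - 1)\<close> is the last that
    leaves an integral element, so the remainder \<open>z'\<close> divides \<open>y\<close>.\<close>
  define N where "N = (LEAST n. \<not> y ^ (p * n) \<preceq> a)"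
  have N: "\<not> y ^ (p * N) \<preceq> a"
    unfolding N_def using ex by (rule LeastI_ex)
  then have "N \<noteq> 0"
    using a(2) by (metis mult_zero_right one_vle_iff power_0)
  then obtain n where n: "N = Suc n"
    using not0_implies_Suc by blast
  then have yn: "y ^ (p * n) \<preceq> a"
    using not_less_Least [of n "\<lambda>n. \<not> y ^ (p * n) \<preceq> a"] by (simp add: N_def)
  define z' where "z' = (c / y ^ n) * x ^ i"
  have z'_eq: "z' = z / y ^ n"
    by (simp add: z'_def z_def)
  have z'p: "z' ^ p = a / y ^ (p * n)"
    by (simp add: z'_eq a_def power_divide mult.commute flip: power_mult)
  have cy: "c / y ^ n \<in> K"
    using i y by auto
  have "z' ^ p \<in> V"
    using yn \<open>y \<noteq> 0\<close> by (simp add: z'p vle_iff_divide_mem)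
  then have z': "z' \<in> V" "z' \<in> L" "z' \<noteq> 0"
    using mem_power_iff p_gt_0 cy x z \<open>y \<noteq> 0\<close> by (auto simp: z'_def K_in_L i y)
  have "z' ^ p \<preceq> y ^ p"
  proof -
    have "a \<preceq> y ^ (p * N)"
      using N vle_linear by blast
    then show ?thesis
      using \<open>y \<noteq> 0\<close> by (simp add: z'p n divide_vle_iff power_add)
  qed
  then have "(z' ^ p) ^ 4 \<preceq> (y ^ p) ^ 4"
    by (rule vle_power)
  also have "(y ^ p) ^ 4 \<preceq> z ^ p"
    using y(3) by (simp add: a_def mult.commute flip: power_mult)
  finally have "(z' ^ 4) ^ p \<preceq> z ^ p"
    by (simp add: mult.commute flip: power_mult)
  then have z'4: "z' ^ 4 \<preceq> z"
    using vle_power_iff p_gt_0 by blast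
  have "(of_nat p ^ 2) ^ p \<preceq> z ^ p"
    using large [of "2 * p"] by (simp add: a_def power_mult)
  then have "of_nat p ^ 2 \<preceq> z"
    using vle_power_iff p_gt_0 by blast
  then have w2: "(w - 1) ^ 2 \<preceq> z"
    using vle_power [OF w_diff_vle_p, of 2] vle_trans by blast
  \<comment> \<open>The value of \<open>z\<close> is split evenly: half of it covers
    \<open>w - 1\<close>, half covers \<open>z' ^ 2\<close>.\<close>
  have "((w - 1) * z' ^ 2) ^ 2 = (w - 1) ^ 2 * z' ^ 4"
    by (simp add: power_mult_distrib flip: power_mult)
  also have "\<dots> \<preceq> z * z"
    by (rule vle_mult [OF w2 z'4])
  finally have "((w - 1) * z' ^ 2) ^ 2 \<preceq> z ^ 2"
    by (simp add: power2_eq_square)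
  then have key: "(w - 1) * z' ^ 2 \<preceq> z"
    by (subst (asm) vle_power_iff) auto
  have Dz': "D z' \<asymp> (w - 1) * z'"
    unfolding z'_def using i cy by (intro D_monomial_veq)
  then have "D z' \<noteq> 0"
    using z' w_diff_mem by auto
  then have "z' \<notin> K"
    by auto
  have "D z' ^ 2 \<asymp> (w - 1) * ((w - 1) * z' ^ 2)"
    using veq_power [OF Dz', of 2] by (simp add: power2_eq_square mult_ac)
  also have "\<dots> \<preceq> (w - 1) * z"
    using key w_diff_mem by simp
  also have "\<dots> \<preceq> D b"
    using i(6) by (simp add: z_def veq_def)
  finally show "\<exists>c\<in>L \<inter> V - K. D c ^ 2 \<preceq> D b"
    using z' \<open>z' \<notin> K\<close> by blast
qed

lemma idempotent_ideal_kummer: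
  assumes FD: "frobenius_dense K p" and DV: "dense_values K"
  shows idempotent_ideal
proof (cases "\<exists>y\<in>K. y ^ p \<asymp> x ^ p")
  case True
  then obtain y where y: "y \<in> K" "y ^ p \<asymp> x ^ p"
    by auto
  then have "y \<asymp> x" "y \<noteq> 0"
    using veq_power_iff p_gt_0 x by auto
  then have "x / y \<asymp> 1"
    using veq_divide [OF veq_sym veq_refl, of y x y] by simp
  interpret K': kummer_extension K L \<sigma> p V "x / y" w
    by unfold_locales (use char_p x w y \<open>y \<noteq> 0\<close> in \<open>auto simp: power_divide \<sigma>_divide \<sigma>_x K_in_L\<close>)
  show ?thesis
    using K'.idempotent_ideal_unit FD DV \<open>x / y \<asymp> 1\<close> by blast
qed (use idempotent_ideal_nonunit FD DV in blast)

end

section \<open>Generators far from K\<close>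

context valuation_subring
begin

text \<open>If \<open>e\<close> divided \<open>x - y\<close> for an integral \<open>y\<close>,
  additivity of the Frobenius would make \<open>a - y ^ p\<close> a sum of multiples of
  \<open>e\<close>, as \<open>e\<close> also divides \<open>(e * e) ^ (p - 1)\<close>. A nonintegral
  \<open>y\<close> is still farther away. The case \<open>y = 0\<close> of the hypothesis shows that
  \<open>e\<close> is no unit.\<close>

lemma artin_schreier_bound:
  assumes K: "subfield_set K" and p: "Factorial_Ring.prime p" "of_nat p = (0::'b)"
    and a: "a \<in> K" "a \<in> V" and e: "e \<in> K" "\<And>y. y \<in> K \<Longrightarrow> y \<in> V \<Longrightarrow> \<not> e \<preceq> a - y ^ p"
    and x: "x ^ p - (e * e) ^ (p - 1) * x = a"
  shows "x \<in> V" "\<not> e * e \<preceq> 1" "\<And>y. y \<in> K \<Longrightarrow> (x - y) ^ 2 \<preceq> e * e"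
proof -
  interpret K: subfield_set K
    by fact
  obtain q where q: "p = Suc (Suc q)"
    using prime_ge_2_nat [OF p(1)] by (metis Suc_1 Suc_le_D add_2_eq_Suc le_Suc_ex)
  have ne: "\<not> e \<preceq> 1"
  proof
    assume "e \<preceq> 1"
    also have "1 \<preceq> a - 0 ^ p"
      using a q by (simp add: one_vle_iff)
    finally show False
      using e(2) [of 0] by simp
  qed
  then have eV: "e \<in> V"
    using vle_linear one_vle_iff by blast
  then show ne2: "\<not> e * e \<preceq> 1"
    using ne vle_mult_self vle_trans by blast
  show xV: "x \<in> V"
  proof (rule ccontr)
    assume "x \<notin> V"
    then have "x \<noteq> 0" "inverse x \<in> V"
      using mem_or_inverse_mem by auto
    have "x * x ^ (p - 1) = x * (a * inverse x + (e * e) ^ (p - 1))"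
      using x \<open>x \<noteq> 0\<close> by (simp add: q algebra_simps)
    then have "x ^ (p - 1) = a * inverse x + (e * e) ^ (p - 1)"
      using \<open>x \<noteq> 0\<close> by simp
    also have "\<dots> \<in> V"
      using a eV \<open>inverse x \<in> V\<close> by (intro add_mem mult_mem power_mem)
    finally show False
      using \<open>x \<notin> V\<close> mem_power_iff [of "p - 1" x] q by simp
  qed
  fix y assume y: "y \<in> K"
  show "(x - y) ^ 2 \<preceq> e * e"
  proof (cases "y \<in> V")
    case True
    have "\<not> e \<preceq> x - y"
    proof
      assume *: "e \<preceq> x - y"
      have "of_nat p \<preceq> (x - y) ^ p - (x ^ p - y ^ p)"
        using p xV True by (intro diff_power_prime_vle)
      then have "(x - y) ^ p = x ^ p - y ^ p"
        by (simp add: p)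
      then have eq: "a - y ^ p = (x - y) * (x - y) ^ (p - 1) - (e * e) ^ (p - 1) * (x - y) - (e * e) ^ (p - 1) * y"
        using x by (simp add: q algebra_simps)
      have "e \<preceq> e * (e * (e * e) ^ q)"
        using eV by (intro vle_mult_self) auto
      then have c: "e \<preceq> (e * e) ^ (p - 1)"
        by (simp add: q mult.assoc)
      have "e \<preceq> a - y ^ p"
        unfolding eq using True xV
        by (intro vle_diff [OF vle_diff [OF vle_mult_mem [OF *] vle_mult_mem [OF c]] vle_mult_mem [OF c]]) auto
      then show False
        using e y True by blast
    qed
    then have "(x - y) ^ 2 \<preceq> e ^ 2"
      using vle_linear vle_power by blast
    then show ?thesis
      by (simp add: power2_eq_square)
  next
    case False
    then have "x - y \<notin> V"
      using xV diff_mem [of x "x - y"] by auto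
    then have "x - y \<preceq> 1"
      using vle_linear one_vle_iff by blast
    then have "(x - y) ^ 2 \<preceq> 1"
      using vle_power by fastforce
    also have "1 \<preceq> e * e"
      using eV by (auto simp: one_vle_iff)
    finally show ?thesis .
  qed
qed

text \<open>Modulo \<open>p\<close>, \<open>(x - y) ^ p\<close> equals \<open>x ^ p - y ^ p\<close>,
  which \<open>p\<close> does not divide. So \<open>(x - y) ^ p\<close> has smaller value than
  \<open>p\<close>, that is, than \<open>(w - 1) ^ (p - 1)\<close>.\<close>

lemma kummer_bound:
  assumes p: "Factorial_Ring.prime p" "\<not> of_nat p \<preceq> 1"
    and a: "\<And>y. y \<in> K \<Longrightarrow> y \<in> V \<Longrightarrow> \<not> of_nat p \<preceq> x ^ p - y ^ p"
    and x: "x \<in> V" and w: "w ^ p = 1" "w \<noteq> 1"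
  shows "\<not> (w - 1) * x \<preceq> 1" "\<And>y. y \<in> K \<Longrightarrow> (x - y) ^ p \<preceq> ((w - 1) * x) ^ (p - 1)"
proof -
  have wd: "(w - 1) ^ (p - 1) \<asymp> of_nat p" "\<not> w - 1 \<preceq> 1" "w \<in> V"
    using root_of_unity_diff_veq p w by blast+
  show "\<not> (w - 1) * x \<preceq> 1"
    using wd x vle_mult_self vle_trans by blast
  have wx: "(w - 1) * x \<in> V"
    using wd x by auto
  fix y assume y: "y \<in> K"
  show "(x - y) ^ p \<preceq> ((w - 1) * x) ^ (p - 1)"
  proof (cases "y \<in> V")
    case True
    have "of_nat p \<preceq> (x - y) ^ p - (x ^ p - y ^ p)"
      using p x True by (intro diff_power_prime_vle)
    then have "\<not> of_nat p \<preceq> (x - y) ^ p"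
      using a [OF y True] vle_diff [of "of_nat p" "(x - y) ^ p" "(x - y) ^ p - (x ^ p - y ^ p)"] by auto
    then have "(x - y) ^ p \<preceq> of_nat p"
      using vle_linear by blast
    also have "of_nat p \<preceq> (w - 1) ^ (p - 1)"
      using wd by (simp add: veq_def)
    also have "\<dots> \<preceq> ((w - 1) * x) ^ (p - 1)"
      using x by (intro vle_power vle_mult_self)
    finally show ?thesis .
  next
    case False
    then have "x - y \<notin> V"
      using x diff_mem [of x "x - y"] by auto
    then have "x - y \<preceq> 1"
      using vle_linear one_vle_iff by blast
    then have "(x - y) ^ p \<preceq> 1"
      using vle_power [of "x - y" 1 p] by simp
    also have "1 \<preceq> ((w - 1) * x) ^ (p - 1)"
      using wx by (auto simp: one_vle_iff)
    finally show ?thesis .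
  qed
qed

text \<open>This holds if the value of \<open>a\<close> generates a quotient of convex subgroups that is isomorphic to
  \<open>\<int>\<close>: the values of \<open>c ^ p * a ^ i\<close> in this quotient are then not divisible by \<open>p\<close>, hence at least
  \<open>1\<close>, and the square absorbs the error made by passing to the quotient.\<close>

definition discrete_generator :: "'b set \<Rightarrow> nat \<Rightarrow> 'b \<Rightarrow> bool" where
  "discrete_generator K p a \<longleftrightarrow> \<not> a \<preceq> 1 \<and>
     (\<forall>c\<in>K - {0}. \<forall>i. 0 < i \<and> i < p \<and> c ^ p * a ^ i \<in> V \<longrightarrow> a \<preceq> (c ^ p * a ^ i)\<^sup>2)"

lemma discrete_generatorD:
  assumes "discrete_generator K p a" "c \<in> K" "c \<noteq> 0" "0 < i" "i < p" "c ^ p * a ^ i \<in> V"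
  shows "a \<preceq> (c ^ p * a ^ i)\<^sup>2"
  using assms unfolding discrete_generator_def by blast

lemma discrete_generator_not_power:
  assumes a: "discrete_generator K p a" "a \<noteq> 0" and K: "subfield_set K" and "p > 1" "y \<in> K"
  shows "\<not> y ^ p \<asymp> a"
proof
  interpret K: subfield_set K
    by fact
  assume *: "y ^ p \<asymp> a"
  then have "y \<noteq> 0"
    using a assms(4) by (auto simp: power_0_left)
  have "inverse y ^ p * a = a / y ^ p"
    by (simp add: power_inverse divide_inverse)
  also have "\<dots> \<asymp> y ^ p / y ^ p"
    using * by (intro veq_divide) (auto simp: veq_sym)
  finally have **: "inverse y ^ p * a ^ 1 \<asymp> 1"
    using \<open>y \<noteq> 0\<close> by simp
  then have "inverse y ^ p * a ^ 1 \<in> V"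
    by (simp add: veq_def one_vle_iff)
  then have "a \<preceq> (inverse y ^ p * a ^ 1)\<^sup>2"
    using assms(4,5) \<open>y \<noteq> 0\<close> by (intro discrete_generatorD [OF a(1)]) auto
  also have "(inverse y ^ p * a ^ 1)\<^sup>2 \<preceq> 1"
    using veq_power [OF **, of 2] by (simp add: veq_def)
  finally show False
    using a by (simp add: discrete_generator_def)
qed

text \<open>No element of \<open>K\<close> has the value of \<open>x\<close>, so no \<open>y\<close>
  approximates \<open>x\<close> better than \<open>0\<close> does.\<close>

lemma discrete_generator_bound:
  assumes a: "discrete_generator K p (x ^ p)" "x \<noteq> 0" and K: "subfield_set K" and "p > 1" "y \<in> K"
    and w: "\<not> w \<preceq> 1"
  shows "\<not> w * x \<preceq> x - y"
proof
  assume *: "w * x \<preceq> x - y"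
  have "\<not> y \<asymp> x"
    using discrete_generator_not_power [OF a(1) _ K assms(4,5)] a(2) veq_power by auto
  then consider "\<not> x \<preceq> y" | "\<not> y \<preceq> x"
    by (auto simp: veq_def)
  then have "x - y \<preceq> x"
  proof cases
    case 1
    then have "y - x \<asymp> y"
      by (rule veq_diff_strict)
    then have "x - y \<asymp> y"
      by (metis minus_diff_eq veq_uminus(1))
    moreover have "y \<preceq> x"
      using 1 by (rule vle_linear)
    ultimately show ?thesis
      unfolding veq_def using vle_trans by blast
  next
    case 2
    then show ?thesis
      using veq_diff_strict by (simp add: veq_def)
  qed
  then have "w * x \<preceq> 1 * x"
    using * vle_trans by simp
  then show False
    using w a by (subst (asm) vle_mult_cancel_right) auto
qed

end

context cyclic_extension_valuation
begin

lemma invariant_if_no_approximation: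
  assumes "\<And>x. x \<in> L \<Longrightarrow> x \<noteq> 0 \<Longrightarrow> \<exists>n>0. \<exists>c\<in>K. x ^ n \<asymp> c"
    and "x \<in> L" "\<And>i. i < p \<Longrightarrow> d \<preceq> conj i x - x" "\<And>y. y \<in> K \<Longrightarrow> \<not> d \<preceq> x - y"
  shows "cyclic_valued_extension K L \<sigma> p V"
proof unfold_locales
  fix s assume "s \<in> L" "s \<in> V"
  then show "\<sigma> s \<in> V"
    using ex_approximation_if_not_invariant [of s x d] assms by blast
qed

lemma conj_translation:
  assumes "x \<in> L" "d \<in> K" "\<sigma> x = x + d"
  shows "d \<preceq> conj i x - x"
proof -
  have "conj i x = x + of_nat i * d"
    using assms by (induction i) (simp_all add: \<sigma>_add K_in_L algebra_simps)
  then show ?thesis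
    using vle_mult_self [of "of_nat i" d] by (simp add: mult.commute)
qed

lemma conj_scaling:
  assumes "x \<in> L" "w \<in> K" "w \<in> V" "\<sigma> x = w * x"
  shows "(w - 1) * x \<preceq> conj i x - x"
proof -
  have "conj i x = w ^ i * x"
    using assms by (induction i) (simp_all add: \<sigma>_mult K_in_L)
  then have "conj i x - x = (w ^ i - 1) * x"
    by (simp add: left_diff_distrib)
  also have "\<dots> = (w - 1) * x * (\<Sum>k<i. w ^ k)"
    by (simp add: power_diff_1_eq mult_ac)
  finally show ?thesis
    using vle_mult_self [of "\<Sum>k<i. w ^ k" "(w - 1) * x"] assms by (auto intro: sum_mem)
qed

end

context kummer_extension
begin

text \<open>Every \<open>D b\<close> has the value of \<open>(w - 1) * z\<close> for a monomial
  \<open>z\<close>, and discreteness makes \<open>x\<close> divide \<open>z\<^sup>2\<close>. Hence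
  \<open>D x = (w - 1) * x\<close> divides \<open>(D b)\<^sup>2\<close> for each \<open>b\<close>,
  and \<open>D b ^ 3\<close> can never divide \<open>D x\<close>.\<close>

lemma not_idempotent_ideal_discrete:
  assumes "discrete_generator K p (x ^ p)"
  shows "\<not> idempotent_ideal"
proof
  assume id: idempotent_ideal
  have xp: "\<not> x ^ p \<preceq> 1"
    using assms by (simp add: discrete_generator_def)
  then have "x ^ p \<in> V"
    using vle_linear one_vle_iff by blast
  then have xV: "x \<in> V"
    using mem_power_iff p_gt_0 by simp
  have nx: "\<not> x \<preceq> 1"
    using xp vle_power [of x 1 p] by auto
  have nr: "\<not> y ^ p \<asymp> x ^ p" if "y \<in> K" for y
    using discrete_generator_not_power [OF assms _ _ p_gt_1 that] x K.subfield_set_axioms by auto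
  obtain b where b: "b \<in> L" "b \<in> V" "b \<notin> K" "D b ^ 3 \<preceq> D x"
    using idempotent_ideal_power [OF id x(1) xV x_not_in_K] by blast
  obtain i c where i: "0 < i" "i < p" "c \<in> K" "c \<noteq> 0" "c * x ^ i \<in> V" "D b \<asymp> (w - 1) * (c * x ^ i)"
    using D_veq_monomial [OF nr b(1-3)] by blast
  have eq: "(c * x ^ i) ^ p = c ^ p * (x ^ p) ^ i"
    by (simp add: power_mult_distrib mult.commute flip: power_mult)
  then have "c ^ p * (x ^ p) ^ i \<in> V"
    using i by (metis power_mem)
  then have "x ^ p \<preceq> ((c * x ^ i) ^ p)\<^sup>2"
    unfolding eq using discrete_generatorD [OF assms i(3,4,1,2)] by blast
  then have "x ^ p \<preceq> ((c * x ^ i)\<^sup>2) ^ p"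
    by (simp add: mult.commute flip: power_mult)
  then have xc: "x \<preceq> (c * x ^ i)\<^sup>2"
    using vle_power_iff p_gt_0 by blast
  have "D x \<preceq> (w - 1) * (c * x ^ i)\<^sup>2"
    using xc w_diff_mem by (simp add: D_x)
  also have "\<dots> \<preceq> (w - 1) * (c * x ^ i)\<^sup>2 * (w - 1)"
    using w_diff_mem by (intro vle_mult_self) auto
  also have "\<dots> = ((w - 1) * (c * x ^ i))\<^sup>2"
    by (simp add: power2_eq_square mult_ac)
  also have "\<dots> \<preceq> (D b)\<^sup>2"
    using i(6) by (intro vle_power) (simp add: veq_def)
  finally have Dxb: "D x \<preceq> (D b)\<^sup>2" .
  then have "D b ^ 3 \<preceq> (D b)\<^sup>2"
    using b vle_trans by blast
  then have "D b * (D b)\<^sup>2 \<preceq> 1 * (D b)\<^sup>2"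
    by (simp add: power3_eq_cube power2_eq_square mult.assoc)
  moreover have "D b \<noteq> 0"
    using b D_nonzero by blast
  ultimately have "D b \<preceq> 1"
    by (subst (asm) vle_mult_cancel_right) auto
  then have "(D b)\<^sup>2 \<preceq> 1"
    using vle_power by fastforce
  then have "(w - 1) * x \<preceq> 1"
    using Dxb vle_trans by (metis D_x)
  then have "x \<preceq> 1"
    using w_diff_mem vle_mult_self [of "w - 1" x] vle_trans by (metis mult.commute)
  then show False
    using nx by blast
qed

end

section \<open>Simple extensions inside the algebraic closure\<close>

abbreviation base :: "'a::field alg_closure set" where
  "base \<equiv> range to_ac"

abbreviation ac_poly :: "'a::field poly \<Rightarrow> 'a alg_closure \<Rightarrow> 'a alg_closure" where
  "ac_poly g \<equiv> poly (map_poly to_ac g)"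

lemma ac_poly_pCons: "ac_poly (pCons c g) x = to_ac c + x * ac_poly g x"
  by (simp add: map_poly_pCons)

lemma ac_poly_add: "ac_poly (g + h) x = ac_poly g x + ac_poly h x"
  by (induction g h rule: poly_induct2) (simp_all add: ac_poly_pCons algebra_simps)

lemma ac_poly_smult: "ac_poly (smult c g) x = to_ac c * ac_poly g x"
  by (induction g) (simp_all add: ac_poly_pCons algebra_simps)

lemma ac_poly_diff: "ac_poly (g - h) x = ac_poly g x - ac_poly h x"
  using ac_poly_add [of g "smult (-1) h" x] by (simp only: ac_poly_smult) simp

lemma ac_poly_mult: "ac_poly (g * h) x = ac_poly g x * ac_poly h x"
  by (induction g) (simp_all add: ac_poly_pCons ac_poly_add ac_poly_smult algebra_simps)

lemma ac_poly_const: "ac_poly [:c:] x = to_ac c"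
  by (simp add: ac_poly_pCons)

lemma ac_poly_pcompose: "ac_poly (pcompose g h) x = ac_poly g (ac_poly h x)"
  by (induction g) (simp_all add: ac_poly_pCons ac_poly_add ac_poly_mult ac_poly_const pcompose_pCons)

lemma map_poly_to_ac_mult: "map_poly to_ac (g * h) = map_poly to_ac g * map_poly to_ac h"
  by (intro poly_eqI) (simp add: coeff_map_poly coeff_mult to_ac_sum)

lemma map_poly_to_ac_pderiv: "map_poly to_ac (pderiv g) = pderiv (map_poly to_ac g)"
  by (intro poly_eqI) (simp add: coeff_map_poly coeff_pderiv)

lemma degree_map_poly_to_ac [simp]: "degree (map_poly to_ac g) = degree g"
  by (rule degree_map_poly) simp

lemma map_poly_to_ac_eq_0_iff [simp]: "map_poly to_ac g = 0 \<longleftrightarrow> g = 0"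
  by (simp add: poly_eq_iff coeff_map_poly)

lemma ex_base_poly:
  assumes "\<And>i. coeff f i \<in> base"
  obtains g where "f = map_poly to_ac g"
proof -
  have "f = map_poly to_ac (map_poly of_ac f)"
    using assms by (intro poly_eqI) (simp add: coeff_map_poly to_ac_of_ac)
  then show thesis
    using that by blast
qed

lemma subfield_set_base: "subfield_set (base :: 'a::field alg_closure set)"
proof
  fix x y :: "'a alg_closure"
  assume "x \<in> base" "y \<in> base"
  then show "x - y \<in> base" "x * y \<in> base" "inverse x \<in> base"
    by (auto simp flip: to_ac_diff to_ac_mult to_ac_inverse)
qed (auto intro: range_eqI [of _ _ 1])

interpretation base: subfield_set "base :: 'a::field alg_closure set"
  by (rule subfield_set_base)

text \<open>Any generator of the ideal of polynomials vanishing at \<open>x\<close>, not normalised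
  to be monic, so that irreducible polynomials qualify as they come.\<close>

definition minimal_poly :: "'a::field poly \<Rightarrow> 'a alg_closure \<Rightarrow> bool" where
  "minimal_poly m x \<longleftrightarrow> m \<noteq> 0 \<and> ac_poly m x = 0 \<and> (\<forall>g. ac_poly g x = 0 \<longrightarrow> m dvd g)"

lemma ex_minimal_poly:
  fixes x :: "'a::field alg_closure"
  obtains m where "minimal_poly m x"
proof -
  obtain f0 :: "'a poly" where "f0 \<noteq> 0" "ac_poly f0 x = 0"
    using alg_closure_algebraic .
  then obtain m where m: "m \<noteq> 0 \<and> ac_poly m x = 0"
    and min: "\<And>g. g \<noteq> 0 \<and> ac_poly g x = 0 \<Longrightarrow> degree m \<le> degree g"
    using ex_has_least_nat [of "\<lambda>g. g \<noteq> 0 \<and> ac_poly g x = 0" f0 degree] by blast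
  have "m dvd g" if g: "ac_poly g x = 0" for g
  proof (rule ccontr)
    assume "\<not> m dvd g"
    then have r: "g mod m \<noteq> 0" "degree (g mod m) < degree m"
      using m degree_mod_less' by (auto simp: dvd_eq_mod_eq_0)
    have "ac_poly (g div m * m + g mod m) x = 0"
      using g by simp
    then have "ac_poly (g mod m) x = 0"
      using m by (simp only: ac_poly_add ac_poly_mult) simp
    then show False
      using min r by (meson not_le)
  qed
  then show thesis
    using that m unfolding minimal_poly_def by blast
qed

lemma minimal_poly_irreducible:
  assumes m: "minimal_poly m x"
  shows "Factorial_Ring.irreducible m"
proof (rule Factorial_Ring.irreducibleI)
  show "m \<noteq> 0"
    using m by (simp add: minimal_poly_def)
  show "\<not> m dvd 1"
  proof
    assume "m dvd 1"
    then obtain g where "1 = m * g"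
      by (auto simp: dvd_def)
    then have "ac_poly m x * ac_poly g x = 1"
      using ac_poly_mult [of m g x] by simp
    then show False
      using m by (simp add: minimal_poly_def)
  qed
  fix a b assume ab: "m = a * b"
  then have "a \<noteq> 0" "b \<noteq> 0"
    using m by (auto simp: minimal_poly_def)
  have "ac_poly a x * ac_poly b x = 0"
    using m ab by (simp add: minimal_poly_def flip: ac_poly_mult)
  then have "m dvd a \<or> m dvd b"
    using m by (auto simp: minimal_poly_def)
  then have "a * b dvd a * 1 \<or> a * b dvd 1 * b"
    using ab by simp
  then show "a dvd 1 \<or> b dvd 1"
    using \<open>a \<noteq> 0\<close> \<open>b \<noteq> 0\<close> unfolding dvd_mult_cancel_left dvd_mult_cancel_right by blast
qed

lemma irreducible_imp_minimal_poly:
  assumes f: "Factorial_Ring.irreducible f" "ac_poly f x = 0"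
  shows "minimal_poly f x"
proof -
  obtain m where m: "minimal_poly m x"
    using ex_minimal_poly .
  then obtain q where q: "f = m * q"
    using f by (auto simp: minimal_poly_def dvd_def)
  have "\<not> m dvd 1"
    using minimal_poly_irreducible [OF m] by (simp add: irreducible_not_unit)
  then have "q dvd 1"
    using f q Factorial_Ring.irreducibleD by blast
  then have "f dvd m"
    unfolding q using mult_dvd_mono [of m m q 1] by simp
  then show ?thesis
    using m f dvd_trans [OF \<open>f dvd m\<close>] unfolding minimal_poly_def by force
qed

definition adjoin :: "'a::field alg_closure \<Rightarrow> 'a alg_closure set" where
  "adjoin x = range (\<lambda>g. ac_poly g x)"

lemma base_subset_adjoin: "base \<subseteq> adjoin x"
  unfolding adjoin_def by (metis ac_poly_const image_subsetI rangeI)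

lemma self_mem_adjoin: "x \<in> adjoin x"
  unfolding adjoin_def by (rule range_eqI [of _ _ "[:0, 1:]"]) (simp add: ac_poly_pCons)

lemma ex_inverse_poly:
  assumes "x \<noteq> 0"
  obtains g where "inverse x = ac_poly g x"
proof -
  obtain m where m: "minimal_poly m x"
    using ex_minimal_poly .
  obtain a h where h: "m = pCons a h"
    by (cases m)
  have "a \<noteq> 0"
  proof
    assume "a = 0"
    then have "ac_poly h x = 0" "h \<noteq> 0"
      using m h assms by (auto simp: minimal_poly_def ac_poly_pCons)
    then have "degree m \<le> degree h"
      using m dvd_imp_degree_le by (auto simp: minimal_poly_def)
    then show False
      using h \<open>h \<noteq> 0\<close> by simp
  qed
  have "to_ac a + x * ac_poly h x = 0"
    using m h by (simp add: minimal_poly_def ac_poly_pCons)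
  then have "to_ac a = - (x * ac_poly h x)"
    by (simp add: eq_neg_iff_add_eq_0)
  moreover have "x * (- ac_poly h x / to_ac a) = - (x * ac_poly h x) / to_ac a"
    by simp
  ultimately have "x * (- ac_poly h x / to_ac a) = 1"
    using \<open>a \<noteq> 0\<close> by (metis divide_self to_ac_eq_0_iff)
  then have "inverse x = - ac_poly h x / to_ac a"
    by (rule inverse_unique)
  also have "\<dots> = ac_poly (smult (- 1 / a) h) x"
    by (simp only: ac_poly_smult) simp
  finally show thesis
    using that by blast
qed

lemma subfield_set_adjoin: "subfield_set (adjoin x)"
proof
  show "1 \<in> adjoin x"
    using base_subset_adjoin by blast
  fix y z assume "y \<in> adjoin x" "z \<in> adjoin x"
  then obtain g h where gh: "y = ac_poly g x" "z = ac_poly h x"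
    by (auto simp: adjoin_def)
  then show "y - z \<in> adjoin x" "y * z \<in> adjoin x"
    unfolding adjoin_def by (auto simp flip: ac_poly_diff ac_poly_mult)
  show "inverse y \<in> adjoin x"
  proof (cases "y = 0")
    case False
    then obtain k where "inverse y = ac_poly k y"
      using ex_inverse_poly by blast
    then show ?thesis
      unfolding adjoin_def gh by (auto simp flip: ac_poly_pcompose)
  next
    case True
    then show ?thesis
      unfolding adjoin_def by (auto intro: range_eqI [of _ _ 0])
  qed
qed

lemma adjoin_subset:
  assumes "subfield_set L" "base \<subseteq> L" "x \<in> L"
  shows "adjoin x \<subseteq> L"
proof
  interpret L: subfield_set L
    by fact
  fix y assume "y \<in> adjoin x"
  then obtain g where "y = ac_poly g x"
    by (auto simp: adjoin_def)
  moreover have "ac_poly g x \<in> L"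
    using assms by (intro L.poly_mem) (auto simp: coeff_map_poly)
  ultimately show "y \<in> L"
    by simp
qed

interpretation ac: vector_space "\<lambda>(c::'a::field) x. to_ac c * x"
  by unfold_locales (simp_all add: algebra_simps)

lemma ext_degree_adjoin:
  assumes m: "minimal_poly m x"
  shows "ext_degree (adjoin x) = degree m"
proof -
  have degm: "degree m > 0"
  proof (rule ccontr)
    assume "\<not> degree m > 0"
    then obtain c where "m = [:c:]"
      using degree_eq_zeroE by auto
    moreover have "ac_poly m x = 0" "m \<noteq> 0"
      using m by (simp_all add: minimal_poly_def)
    ultimately show False
      by (simp add: ac_poly_const)
  qed
  have zero: "g = 0" if "degree g < degree m" "ac_poly g x = 0" for g
    using m that dvd_imp_degree_le [of m g] unfolding minimal_poly_def by fastforce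
  have poly_sum: "ac_poly (\<Sum>i<n. monom (c i) i) x = (\<Sum>i<n. to_ac (c i) * x ^ i)" for c and n :: nat
  proof (induction n)
    case (Suc n)
    have "ac_poly (monom (c n) n) x = to_ac (c n) * x ^ n"
      by (simp add: map_poly_monom poly_monom)
    then show ?case
      using Suc by (simp add: ac_poly_add)
  qed simp
  have deg: "degree (\<Sum>i<degree m. monom (c i) i) < degree m" for c
    using degm by (intro degree_sum_less) (auto intro: le_less_trans [OF degree_monom_le])
  \<comment> \<open>The basis is a set, so the powers must be distinct for its cardinality to be the
    degree.\<close>
  have inj: "inj_on (\<lambda>i. x ^ i) {..<degree m}"
  proof
    fix i j assume ij: "i \<in> {..<degree m}" "j \<in> {..<degree m}" "x ^ i = x ^ j"
    have "ac_poly (monom 1 i - monom 1 j) x = 0"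
      using ij by (simp add: ac_poly_diff map_poly_monom poly_monom)
    moreover have "degree (monom 1 i - monom 1 j :: 'a poly) < degree m"
      using ij by (intro degree_diff_less) (auto simp: degree_monom_eq)
    ultimately have "monom 1 i - monom 1 j = (0 :: 'a poly)"
      using zero by blast
    then have "degree (monom 1 i :: 'a poly) = degree (monom 1 j :: 'a poly)"
      by simp
    then show "i = j"
      by (simp add: degree_monom_eq)
  qed
  define B where "B = (\<lambda>i. x ^ i) ` {..<degree m}"
  have "ac.independent B"
  proof (rule ac.independent_if_scalars_zero)
    fix f y assume f: "(\<Sum>y\<in>B. to_ac (f y) * y) = 0" and y: "y \<in> B"
    obtain j where j: "j < degree m" "y = x ^ j"
      using y by (auto simp: B_def)
    define h where "h = (\<Sum>i<degree m. monom (f (x ^ i)) i)"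
    have "ac_poly h x = 0"
      using f unfolding h_def poly_sum B_def by (subst (asm) sum.reindex [OF inj]) simp
    then have "h = 0"
      using zero [of h] deg [of "\<lambda>i. f (x ^ i)"] unfolding h_def by argo
    moreover have "coeff h j = f (x ^ j)"
      using j by (simp add: h_def coeff_sum sum.delta)
    ultimately show "f y = 0"
      using j by simp
  qed (simp add: B_def)
  moreover have "ac.span B = ac.span (adjoin x)"
  proof
    have pow: "x ^ i \<in> adjoin x" for i
      using subfield_set.power_mem [OF subfield_set_adjoin self_mem_adjoin] .
    then show "ac.span B \<subseteq> ac.span (adjoin x)"
      by (intro ac.span_mono) (auto simp: B_def)
    have "adjoin x \<subseteq> ac.span B"
    proof
      fix y assume "y \<in> adjoin x"
      then obtain g where g: "y = ac_poly g x"
        by (auto simp: adjoin_def)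
      define r where "r = g mod m"
      have "y = ac_poly (g div m * m + r) x"
        by (simp add: g r_def)
      also have "\<dots> = ac_poly r x"
        using m by (simp only: ac_poly_add ac_poly_mult) (simp add: minimal_poly_def)
      also have "\<dots> = (\<Sum>i<degree m. to_ac (coeff r i) * x ^ i)"
      proof -
        have "m \<noteq> 0"
          using degm by auto
        then have "degree r < degree m"
          using degree_mod_less' [of m g] degm by (cases "r = 0") (auto simp: r_def)
        then show ?thesis
          unfolding poly_altdef
          by (intro sum.mono_neutral_cong_left) (auto simp: coeff_map_poly coeff_eq_0)
      qed
      also have "\<dots> \<in> ac.span B"
        by (intro ac.span_sum ac.span_scale ac.span_base) (auto simp: B_def)
      finally show "y \<in> ac.span B" .
    qed
    then show "ac.span (adjoin x) \<subseteq> ac.span B"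
      using ac.span_minimal ac.subspace_span by blast
  qed
  ultimately have "ac.dim (adjoin x) = card B"
    by (intro ac.dim_eq_card)
  then show ?thesis
    using inj by (simp add: ext_degree_def B_def card_image)
qed

section \<open>Degrees in towers of fields\<close>

interpretation R: cring "ring_of_type_algebra :: 'b::field ring"
  by (rule cring_from_type_algebra)

lemma ring_of_type_algebra_simps [simp]:
  "carrier ring_of_type_algebra = UNIV" "x \<otimes>\<^bsub>ring_of_type_algebra\<^esub> y = x * y"
  "x \<oplus>\<^bsub>ring_of_type_algebra\<^esub> y = x + y" "\<one>\<^bsub>ring_of_type_algebra\<^esub> = 1" "\<zero>\<^bsub>ring_of_type_algebra\<^esub> = 0"
  by (simp_all add: ring_of_type_algebra_def)

lemma a_inv_ring_of_type_algebra [simp]: "\<ominus>\<^bsub>ring_of_type_algebra\<^esub> x = - (x::'b::field)"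
  using R.minus_equality [of "- x" x] by simp

lemma m_inv_ring_of_type_algebra: "x \<noteq> 0 \<Longrightarrow> inv\<^bsub>ring_of_type_algebra\<^esub> x = inverse (x::'b::field)"
  by (intro R.comm_inv_char) auto

lemma subfield_iff_subfield_set:
  "subfield L (ring_of_type_algebra :: 'b::field ring) \<longleftrightarrow> subfield_set L"
proof
  assume L: "subfield L (ring_of_type_algebra :: 'b ring)"
  note sub = subringE [OF subfieldE(1) [OF L]]
  have inv: "inverse x \<in> L" if "x \<in> L" for x
    using R.subfield_m_inv(1) [OF L, of x] sub(2) that by (cases "x = 0") (auto simp: m_inv_ring_of_type_algebra)
  show "subfield_set L"
  proof
    fix x y assume "x \<in> L" "y \<in> L"
    then show "x - y \<in> L"
      using sub(5) [of y] sub(7) [of x "- y"] by simp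
  qed (use sub inv in auto)
next
  assume "subfield_set L"
  then interpret L: subfield_set L .
  show "subfield L (ring_of_type_algebra :: 'b ring)"
    by (intro field.subfieldI' field_from_type_algebra R.subringI) (auto simp: m_inv_ring_of_type_algebra)
qed




lemma span_eq_ring_Span: "ac.span (set us) = R.Span base us"
proof (induction us)
  case (Cons u us)
  have "x \<in> ac.span (set (u # us)) \<longleftrightarrow> x \<in> R.Span base (u # us)" for x
  proof -
    have "x - to_ac k * u \<in> A \<longleftrightarrow> (\<exists>v\<in>A. x = to_ac k * u + v)" for k A
      by (metis add_diff_cancel_left' diff_add_cancel add.commute)
    then show ?thesis
      using Cons by (simp add: R.line_extension_mem_iff ac.span_breakdown_eq)
  qed
  then show ?case
    by blast
qed simp

lemma ring_independent:
  "distinct us \<Longrightarrow> ac.independent (set us) \<Longrightarrow> R.independent base us"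
proof (induction us)
  case (Cons u us)
  then have "u \<notin> ac.span (set us)" "ac.independent (set us)"
    by (auto simp: ac.independent_insert split: if_splits)
  then show ?case
    using Cons unfolding span_eq_ring_Span by (intro R.li_Cons) auto
qed simp

lemma subalgebra_of_subfield_set:
  assumes "subfield_set L" "F \<subseteq> L"
  shows "subalgebra F L (ring_of_type_algebra :: 'b::field ring)"
proof -
  interpret L: subfield_set L
    by fact
  have "subfield L (ring_of_type_algebra :: 'b ring)"
    using assms by (simp add: subfield_iff_subfield_set)
  then have "subgroup L (add_monoid (ring_of_type_algebra :: 'b ring))"
    using subfieldE(1) subring.axioms(1) by blast
  then show ?thesis
    using assms(2) by (auto simp: subalgebra_def subalgebra_axioms_def)
qed

lemma dimension_eq_imp_eq:
  assumes "subfield F (ring_of_type_algebra :: 'b::field ring)" "R.dimension n F E" "R.dimension n F E'" "E \<subseteq> E'"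
  shows "E = E'"
proof -
  obtain us where us: "R.independent F us" "length us = n" "R.Span F us = E" "set us \<subseteq> UNIV"
    using R.exists_base [OF assms(1,2)] by auto
  then have "set us \<subseteq> E'"
    using R.Span_base_incl [OF assms(1), of us] assms(4) by simp
  then show ?thesis
    using R.independent_length_eq_dimension [OF assms(1,3) us(1)] us by simp
qed

text \<open>By the tower law the degree of \<open>adjoin x\<close> divides the prime
  \<open>p\<close>, and it is not \<open>1\<close>. The basis obtained from \<open>ac\<close> is
  turned into a list because \<open>R.Span\<close> and \<open>R.dimension\<close> work with
  lists.\<close>

lemma adjoin_eq_if_prime_degree:
  fixes L :: "'a::field alg_closure set"
  assumes L: "subfield_set L" "base \<subseteq> L" "ext_degree L = p" and p: "Factorial_Ring.prime p"
    and x: "x \<in> L" "x \<notin> base"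
  shows "adjoin x = L"
proof -
  interpret L: subfield_set L
    by fact
  define F where "F = adjoin x"
  have F: "subfield_set F" "base \<subseteq> F" "F \<subseteq> L" "x \<in> F"
    unfolding F_def
    by (rule subfield_set_adjoin base_subset_adjoin adjoin_subset [OF L(1,2) x(1)] self_mem_adjoin)+
  note sf = subfield_set_base [folded subfield_iff_subfield_set] F(1) [folded subfield_iff_subfield_set]
  obtain B where B: "B \<subseteq> L" "ac.independent B" "L \<subseteq> ac.span B" "card B = ac.dim L"
    using ac.basis_exists .
  have "card B = p"
    using B(4) L(3) by (simp add: ext_degree_def)
  then have "finite B"
    using p prime_gt_0_nat card_gt_0_iff by metis
  then obtain us where us: "set us = B" "distinct us"
    using finite_distinct_list by blast
  have "ac.subspace L"
    using L(2) by (auto simp: ac.subspace_def)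
  then have "ac.span B = L"
    using B ac.span_minimal by blast
  then have Span: "R.Span base us = L"
    using us span_eq_ring_Span by metis
  have dim_L: "R.dimension p base L"
    using R.dimension_independent [OF ring_independent [OF us(2)]] B us Span \<open>card B = p\<close> distinct_card by fastforce
  have fd_F: "R.finite_dimension base F"
    using R.subalbegra_incl_imp_finite_dimension [OF sf(1) R.finite_dimensionI [OF dim_L]]
      subalgebra_of_subfield_set [OF F(1,2)] F(3) by blast
  have "R.Span F us = L"
  proof
    show "R.Span F us \<subseteq> L"
      using R.subalgebra_Span_incl [OF sf(2) subalgebra_of_subfield_set [OF L(1) F(3)]] us B by blast
    have "R.Span base us \<subseteq> R.Span F us"
      using F(2) R.Span_eq_combine_set [OF sf(1), of us] R.Span_eq_combine_set [OF sf(2), of us]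
      by (simp del: R.Span.simps) blast
    then show "L \<subseteq> R.Span F us"
      using Span by simp
  qed
  then have fd_L: "R.finite_dimension F L"
    using R.Span_finite_dimension [OF sf(2), of us] by simp
  obtain a b where ab: "R.dimension a base F" "R.dimension b F L"
    using fd_F fd_L unfolding R.finite_dimension_def by blast
  have "p = a * b"
    using R.telescopic_base [OF sf ab] R.dimension_is_inj [OF sf(1) dim_L] by blast
  then consider "a = 1" | "b = 1"
    using p by (metis prime_product)
  then show ?thesis
  proof cases
    case 1
    then have "F = base"
      using dimension_eq_imp_eq [OF sf(1) R.dimension_one [OF sf(1)] _ F(2)] ab by auto
    then show ?thesis
      using F x by auto
  next
    case 2
    then show ?thesis
      using dimension_eq_imp_eq [OF sf(2) R.dimension_one [OF sf(2)] _ F(3)] ab by (auto simp: F_def)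
  qed
qed

lemma adjoin_0: "adjoin (0::'a::field alg_closure) = base"
proof
  show "adjoin 0 \<subseteq> (base :: 'a alg_closure set)"
    by (auto simp: adjoin_def poly_0_coeff_0 coeff_map_poly)
qed (rule base_subset_adjoin)

lemma ext_degree_base: "ext_degree (base :: 'a::field alg_closure set) = 1"
proof -
  have "minimal_poly [:0, 1::'a:] 0"
    unfolding minimal_poly_def
    by (auto simp: ac_poly_pCons poly_0_coeff_0 coeff_map_poly simp flip: poly_eq_0_iff_dvd [of _ 0, simplified])
  then show ?thesis
    using ext_degree_adjoin [of "[:0, 1:]" 0] by (simp add: adjoin_0)
qed

section \<open>Automorphisms of extensions of prime degree\<close>

lemma ex_other_root:
  fixes f :: "'a::field poly"
  assumes "degree f > 1" "ac_poly f x = 0" "ac_poly (pderiv f) x \<noteq> 0"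
  obtains r where "ac_poly f r = 0" "r \<noteq> x"
proof -
  obtain q where q: "map_poly to_ac f = [:- x, 1:] * q"
    using assms(2) by (auto simp: poly_eq_0_iff_dvd dvd_def)
  have "q \<noteq> 0"
    using q assms(1) by (metis degree_0 degree_map_poly_to_ac mult_zero_right not_less_zero)
  then have "degree (map_poly to_ac f) = 1 + degree q"
    unfolding q by (subst degree_mult_eq) auto
  then have "degree q > 0"
    using assms(1) by simp
  then obtain r where r: "poly q r = 0"
    using alg_closed_imp_poly_has_root by blast
  have "ac_poly (pderiv f) x = poly q x"
    by (simp add: map_poly_to_ac_pderiv q pderiv_mult pderiv_pCons del: mult_pCons_left)
  then have "r \<noteq> x"
    using r assms(3) by auto
  then show thesis
    using that [of r] r q by simp
qed

text \<open>The embedding with \<open>u \<mapsto> u'\<close> fixes only the base field, since every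
  other element generates \<open>L\<close> and \<open>u\<close> is moved. The product over the orbit
  of \<open>u\<close> is therefore defined over the base field and a multiple of \<open>f\<close>,
  so the orbit has exactly \<open>p\<close> elements.\<close>

theorem ex_cyclic_extension:
  fixes L :: "'a::field alg_closure set"
  assumes L: "subfield_set L" "base \<subseteq> L" "ext_degree L = p" and p: "Factorial_Ring.prime p"
    and u: "u \<in> L" "u \<notin> base" and f: "minimal_poly f u"
    and u': "ac_poly f u' = 0" "u' \<in> L" "u' \<noteq> u"
  obtains \<sigma> where "cyclic_extension base L \<sigma> p" "\<sigma> u = u'"
proof -
  interpret L: subfield_set L
    by fact
  have ad: "adjoin u = L"
    using adjoin_eq_if_prime_degree [OF L p u] .
  have deg_f: "degree f = p"
    using ext_degree_adjoin [OF f] ad L by simp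
  have ac_L: "ac_poly g x \<in> L" if "x \<in> L" for g x
    using that L(2) by (intro L.poly_mem) (auto simp: coeff_map_poly)
  \<comment> \<open>The choice of \<open>g\<close> is immaterial: two candidates differ by a
    multiple of \<open>f\<close>, which vanishes at \<open>u'\<close>.\<close>
  define \<tau> where "\<tau> x = ac_poly (SOME g. ac_poly g u = x) u'" for x
  have \<tau>: "\<tau> (ac_poly g u) = ac_poly g u'" for g
  proof -
    define h where "h = (SOME h. ac_poly h u = ac_poly g u)"
    have "ac_poly h u = ac_poly g u"
      unfolding h_def by (rule someI [of _ g]) simp
    then have "f dvd h - g"
      using f by (simp add: minimal_poly_def ac_poly_diff)
    then have "ac_poly (h - g) u' = 0"
      using u' by (auto simp: dvd_def ac_poly_mult)
    then show ?thesis
      by (simp add: \<tau>_def h_def ac_poly_diff)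
  qed
  have rep: "\<exists>g. x = ac_poly g u" if "x \<in> L" for x
    using that ad by (auto simp: adjoin_def)
  have \<tau>_L: "\<tau> x \<in> L" if "x \<in> L" for x
    using rep [OF that] \<tau> ac_L u' by auto
  have \<tau>_add: "\<tau> (x + y) = \<tau> x + \<tau> y" and \<tau>_mult: "\<tau> (x * y) = \<tau> x * \<tau> y" if xy: "x \<in> L" "y \<in> L" for x y
  proof -
    obtain g h where "x = ac_poly g u" "y = ac_poly h u"
      using rep xy by blast
    then show "\<tau> (x + y) = \<tau> x + \<tau> y" "\<tau> (x * y) = \<tau> x * \<tau> y"
      by (simp_all add: \<tau> flip: ac_poly_add ac_poly_mult)
  qed
  have \<tau>_base: "\<tau> (to_ac c) = to_ac c" for c
    using \<tau> [of "[:c:]"] by (simp add: ac_poly_const)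
  have \<tau>_u: "\<tau> u = u'"
    using \<tau> [of "[:0, 1:]"] by (simp add: ac_poly_pCons)
  have \<tau>_poly: "\<tau> (ac_poly g x) = ac_poly g (\<tau> x)" if "x \<in> L" for g x
  proof (induction g)
    case (pCons c g)
    have "to_ac c \<in> L"
      using L by auto
    then show ?case
      using pCons that ac_L by (simp add: ac_poly_pCons \<tau>_add \<tau>_mult \<tau>_base)
  qed (use \<tau>_base [of 0] in simp)
  have \<tau>_fixed: "x \<in> base" if x: "x \<in> L" "\<tau> x = x" for x
  proof (rule ccontr)
    assume "x \<notin> base"
    then have "u \<in> adjoin x"
      using adjoin_eq_if_prime_degree [OF L p x(1)] u by simp
    then obtain g where "u = ac_poly g x"
      by (auto simp: adjoin_def)
    then have "\<tau> u = u"
      using \<tau>_poly x by simp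
    then show False
      using \<tau>_u u' by simp
  qed
  have \<tau>_0: "\<tau> 0 = 0" and \<tau>_1: "\<tau> 1 = 1"
    using \<tau>_base [of 0] \<tau>_base [of 1] by simp_all
  have \<tau>_minus: "\<tau> (- x) = - \<tau> x" if "x \<in> L" for x
  proof -
    have "\<tau> (x + - x) = \<tau> x + \<tau> (- x)"
      using that by (intro \<tau>_add) auto
    then show ?thesis
      by (simp add: \<tau>_0 eq_neg_iff_add_eq_0 add.commute)
  qed
  have \<tau>_inj: "x = y" if xy: "x \<in> L" "y \<in> L" "\<tau> x = \<tau> y" for x y
  proof (rule ccontr)
    assume "x \<noteq> y"
    then have "\<tau> ((x - y) * inverse (x - y)) = \<tau> (x - y) * \<tau> (inverse (x - y))"
      using xy by (intro \<tau>_mult) auto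
    moreover have "\<tau> (x - y) = 0"
      using \<tau>_add [of x "- y"] \<tau>_minus [of y] xy by auto
    ultimately show False
      using \<open>x \<noteq> y\<close> by (simp add: \<tau>_1)
  qed
  define c where "c i = (\<tau> ^^ i) u" for i
  have c_Suc: "\<tau> (c i) = c (Suc i)" for i
    by (simp add: c_def)
  have c_L: "c i \<in> L" for i
    by (induction i) (use u \<tau>_L in \<open>auto simp: c_def\<close>)
  have pow_poly: "(\<tau> ^^ i) (ac_poly g x) = ac_poly g ((\<tau> ^^ i) x) \<and> (\<tau> ^^ i) x \<in> L" if "x \<in> L" for i g x
    using that by (induction i) (auto simp: \<tau>_poly \<tau>_L)
  have c_root: "ac_poly f (c i) = 0" for i
  proof -
    have "(\<tau> ^^ i) 0 = 0"
      by (induction i) (auto simp: \<tau>_0)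
    then show ?thesis
      using pow_poly [OF u(1), of i f] f by (simp add: c_def minimal_poly_def)
  qed
  have c_diff: "c (j - i) = u" if "i \<le> j" "c i = c j" for i j
    using that
  proof (induction i arbitrary: j)
    case (Suc i)
    then obtain j' where j': "j = Suc j'"
      by (cases j) auto
    then have "c i = c j'"
      using Suc.prems c_Suc c_L \<tau>_inj by metis
    then show ?case
      using Suc j' by simp
  qed (simp add: c_def)
  have "f \<noteq> 0"
    using f by (simp add: minimal_poly_def)
  then have fin: "finite {x. ac_poly f x = 0}"
    by (intro poly_roots_finite) simp
  then have "\<not> inj c"
    using finite_imageD [of c UNIV] finite_subset [of "range c" "{x. ac_poly f x = 0}"] c_root fin by auto
  then obtain i j where "i < j" "c i = c j"
    unfolding inj_on_def by (metis linorder_neqE_nat)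
  then have ex: "\<exists>n. 0 < n \<and> c n = u"
    using c_diff [of i j] by (intro exI [of _ "j - i"]) auto
  define n where "n = (LEAST n. 0 < n \<and> c n = u)"
  have n: "0 < n" "c n = u"
    using LeastI_ex [OF ex] by (auto simp: n_def)
  have n_min: "n \<le> k" if "0 < k" "c k = u" for k
    unfolding n_def using that by (intro Least_le) auto
  have inj: "inj_on c {..<n}"
  proof (rule linorder_inj_onI)
    fix i j assume ij: "i < j" "i \<in> {..<n}" "j \<in> {..<n}"
    then show "c i \<noteq> c j"
      using c_diff [of i j] n_min [of "j - i"] by auto
  qed auto
  have "n \<le> degree f"
  proof -
    have "card (c ` {..<n}) \<le> card {x. ac_poly f x = 0}"
      using fin c_root by (intro card_mono) auto
    also have "\<dots> \<le> degree (map_poly to_ac f)"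
      using \<open>f \<noteq> 0\<close> by (intro card_poly_roots_bound) simp
    finally show ?thesis
      using inj by (simp add: card_image)
  qed
  \<comment> \<open>\<open>\<tau>\<close> shifts the factors by one place, and the last lands on the
    first because \<open>c n = c 0\<close>.\<close>
  define P where "P = (\<Prod>i<n. [:- c i, 1:])"
  have map_mult: "(\<forall>k. coeff (g * h) k \<in> L) \<and> map_poly \<tau> (g * h) = map_poly \<tau> g * map_poly \<tau> h"
    if "\<forall>k. coeff g k \<in> L" "\<forall>k. coeff h k \<in> L" for g h
  proof
    show "\<forall>k. coeff (g * h) k \<in> L"
      using that by (auto simp: coeff_mult intro!: L.sum_mem)
    have "\<tau> (\<Sum>i\<in>A. F i) = (\<Sum>i\<in>A. \<tau> (F i))" if "\<And>i. i \<in> A \<Longrightarrow> F i \<in> L" for A :: "nat set" and F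
      using that by (induction A rule: infinite_finite_induct) (auto simp: \<tau>_0 \<tau>_add L.sum_mem)
    then show "map_poly \<tau> (g * h) = map_poly \<tau> g * map_poly \<tau> h"
      using that by (intro poly_eqI) (simp add: coeff_map_poly \<tau>_0 coeff_mult \<tau>_mult)
  qed
  have "(\<forall>k. coeff (\<Prod>i\<in>A. [:- c i, 1:]) k \<in> L) \<and> map_poly \<tau> (\<Prod>i\<in>A. [:- c i, 1:]) = (\<Prod>i\<in>A. [:- c (Suc i), 1:])"
    if "finite A" for A
    using that
  proof (induction A)
    case (insert i A)
    have "\<forall>k. coeff [:- c i, 1:] k \<in> L"
      using c_L by (auto simp: coeff_pCons split: nat.splits)
    moreover have "map_poly \<tau> [:- c i, 1:] = [:- c (Suc i), 1:]"
      using c_L by (simp add: map_poly_pCons \<tau>_0 \<tau>_1 \<tau>_minus c_Suc)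
    ultimately show ?case
      using map_mult [of "[:- c i, 1:]" "\<Prod>i\<in>A. [:- c i, 1:]"] insert by (simp del: mult_pCons_left)
  qed (auto simp: map_poly_pCons \<tau>_0 \<tau>_1 one_pCons coeff_pCons split: nat.splits)
  from this [of "{..<n}"] have PL: "coeff P k \<in> L" and map_P: "map_poly \<tau> P = (\<Prod>i<n. [:- c (Suc i), 1:])" for k
    by (auto simp: P_def)
  have "[:- c 0, 1:] * (\<Prod>i<n. [:- c (Suc i), 1:]) = P * [:- c n, 1:]"
    using prod.lessThan_Suc_shift [of "\<lambda>i. [:- c i, 1:]" n] prod.lessThan_Suc [of "\<lambda>i. [:- c i, 1:]" n]
    unfolding P_def by metis
  moreover have "c n = c 0"
    using n by (simp add: c_def)
  ultimately have "map_poly \<tau> P = P"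
    unfolding map_P by (metis mult.commute mult_cancel_left pCons_eq_0_iff one_neq_zero)
  then have "\<tau> (coeff P k) = coeff P k" for k
    by (metis coeff_map_poly \<tau>_0)
  then have "coeff P k \<in> base" for k
    using \<tau>_fixed PL by blast
  then obtain g where g: "P = map_poly to_ac g"
    using ex_base_poly by blast
  have "poly P u = 0"
    unfolding P_def poly_prod using n(1) by (intro prod_zero) (auto simp: c_def intro!: bexI [of _ 0])
  then have "f dvd g"
    using f g by (simp add: minimal_poly_def)
  moreover have "degree P = n"
    by (simp add: P_def degree_prod_eq_sum_degree)
  moreover have "P \<noteq> 0"
    by (auto simp: P_def)
  ultimately have "degree f \<le> n"
    using g dvd_imp_degree_le by auto
  then have "n = p"
    using \<open>n \<le> degree f\<close> deg_f by simp
  have "cyclic_extension base L \<tau> p"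
  proof unfold_locales
    fix x assume x: "x \<in> L"
    then obtain g where "x = ac_poly g u"
      using rep by blast
    then show "(\<tau> ^^ p) x = x"
      using pow_poly [OF u(1), of p g] n \<open>n = p\<close> by (simp add: c_def)
  qed (use p L u \<tau>_L \<tau>_add \<tau>_mult \<tau>_base \<tau>_fixed in auto)
  then show thesis
    using that \<tau>_u by blast
qed


lemma rsquarefree_iff_pderiv:
  fixes f :: "'b::field poly"
  shows "rsquarefree f \<longleftrightarrow> f \<noteq> 0 \<and> (\<forall>a. poly f a = 0 \<longrightarrow> poly (pderiv f) a \<noteq> 0)"
proof (cases "f = 0")
  case False
  have 1: "poly (pderiv f) a = 0 \<longleftrightarrow> 2 \<le> order a f" if a: "poly f a = 0" for a
  proof -
    obtain q where q: "f = [:- a, 1:] * q"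
      using a unfolding poly_eq_0_iff_dvd dvd_def by blast
    have "poly (pderiv f) a = poly q a"
      by (simp add: q pderiv_mult pderiv_pCons del: mult_pCons_left)
    also have "\<dots> = 0 \<longleftrightarrow> [:- a, 1:] ^ 2 dvd f"
      unfolding q power2_eq_square by (simp only: poly_eq_0_iff_dvd dvd_mult_cancel_left) simp
    also have "\<dots> \<longleftrightarrow> 2 \<le> order a f"
      using False by (simp add: order_divides)
    finally show ?thesis .
  qed
  have 2: "poly f a = 0 \<longleftrightarrow> order a f \<noteq> 0" for a
    using False by (simp add: order_root)
  have "(order a f = 0 \<or> order a f = 1) \<longleftrightarrow> (poly f a = 0 \<longrightarrow> poly (pderiv f) a \<noteq> 0)" for a
    using 1 [of a] 2 [of a] by (cases "poly f a = 0") auto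
  then show ?thesis
    using False by (simp add: rsquarefree_def)
qed (simp add: rsquarefree_def)

text \<open>Separability makes \<open>u\<close> a simple root of its polynomial, whose degree
  exceeds \<open>1\<close>, so there is a second root; normality puts it into
  \<open>L\<close>.\<close>

theorem galois_imp_cyclic_extension:
  fixes L :: "'a::field alg_closure set"
  assumes L: "galois_extension L" "ext_degree L = p" and p: "Factorial_Ring.prime p"
  obtains \<sigma> where "cyclic_extension base L \<sigma> p"
proof -
  have L': "subfield_set L" "base \<subseteq> L"
    using L(1) by (auto simp: galois_extension_def intermediate_field_def subfield_iff_subfield_set)
  have "L \<noteq> base"
    using L(2) ext_degree_base prime_gt_1_nat [OF p] by (metis less_irrefl)
  then obtain u where u: "u \<in> L" "u \<notin> base"
    using L'(2) by blast
  obtain f :: "'a poly" where f: "Factorial_Ring.irreducible f" "ac_poly f u = 0" "rsquarefree (map_poly to_ac f)"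
    using L(1) u unfolding galois_extension_def separable_extension_def by blast
  have min: "minimal_poly f u"
    using irreducible_imp_minimal_poly f by blast
  have "degree f = p"
    using ext_degree_adjoin [OF min] adjoin_eq_if_prime_degree [OF L' L(2) p u] L(2) by simp
  moreover have "ac_poly (pderiv f) u \<noteq> 0"
    using f rsquarefree_iff_pderiv [of "map_poly to_ac f"] by (auto simp: map_poly_to_ac_pderiv)
  ultimately obtain r where r: "ac_poly f r = 0" "r \<noteq> u"
    using ex_other_root [of f u] f p prime_gt_1_nat by blast
  have "r \<in> L"
    using L(1) f u r unfolding galois_extension_def normal_extension_def by blast
  then show thesis
    using ex_cyclic_extension [OF L' L(2) p u min r(1) _ r(2)] that by blast
qed

text \<open>The minimal polynomial of \<open>x\<close> divides \<open>charpoly x\<close>, so its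
  roots are among the conjugates of \<open>x\<close> and lie in \<open>L\<close>. They are simple
  because the conjugates are distinct.\<close>

theorem cyclic_extension_imp_galois:
  fixes L :: "'a::field alg_closure set"
  assumes "cyclic_extension base L \<sigma> p"
  shows "galois_extension L"
proof -
  interpret cyclic_extension base L \<sigma> p
    by fact
  have charpoly: "\<exists>g. charpoly x = map_poly to_ac g" if "x \<in> L" for x
    using ex_base_poly coeff_charpoly_mem [OF that] by metis
  have root: "poly (charpoly x) x = 0" for x
    unfolding poly_charpoly using p_gt_0 by (intro prod_zero) (auto intro!: bexI [of _ 0])
  have normal: "y \<in> L" if f: "Factorial_Ring.irreducible f" "ac_poly f x = 0" and x: "x \<in> L"
      and y: "ac_poly f y = 0" for f :: "'a poly" and x y
  proof -
    obtain g where g: "charpoly x = map_poly to_ac g"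
      using charpoly x by blast
    then have "f dvd g"
      using irreducible_imp_minimal_poly [OF f] root [of x] by (simp add: minimal_poly_def)
    then have "poly (charpoly x) y = 0"
      using y unfolding g by (auto simp: dvd_def map_poly_to_ac_mult)
    then obtain i where "y = conj i x"
      unfolding poly_charpoly by (auto simp: prod_zero_iff)
    then show ?thesis
      using x by simp
  qed
  have separable: "\<exists>f :: 'a poly. Factorial_Ring.irreducible f \<and> ac_poly f x = 0 \<and> rsquarefree (map_poly to_ac f)"
    if x: "x \<in> L" for x
  proof -
    obtain m where m: "minimal_poly m x"
      using ex_minimal_poly .
    obtain g where g: "ac_poly g x = 0" "ac_poly (pderiv g) x \<noteq> 0" "\<And>y. ac_poly g y = 0 \<Longrightarrow> \<exists>i<p. y = conj i x"
    \<comment> \<open>For \<open>x\<close> in the base field \<open>charpoly x\<close> is a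
      \<open>p\<close>-th power; the linear polynomial replaces it.\<close>
    proof (cases "x \<in> base")
      case True
      then obtain c where "x = to_ac c"
        by blast
      then show thesis
        using that [of "[:- c, 1:]"] p_gt_0 by (auto simp: ac_poly_pCons pderiv_pCons intro!: exI [of _ 0])
    next
      case False
      obtain g where g: "charpoly x = map_poly to_ac g"
        using charpoly x by blast
      have "x \<noteq> conj i x" if "i \<in> {1..<p}" for i
        using conj_distinct [OF x False, of 0 i] that by auto
      then have "(\<Prod>i\<in>{1..<p}. x - conj i x) \<noteq> 0"
        by (simp add: prod_zero_iff)
      then have "ac_poly (pderiv g) x \<noteq> 0"
        using poly_pderiv_charpoly [of x] by (simp add: map_poly_to_ac_pderiv g)
      moreover have "\<exists>i<p. y = conj i x" if "ac_poly g y = 0" for y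
        using that unfolding g [symmetric] poly_charpoly by (auto simp: prod_zero_iff)
      ultimately show thesis
        using that [of g] root [of x] g by simp
    qed
    obtain q where q: "g = m * q"
      using m g(1) by (auto simp: minimal_poly_def dvd_def)
    have "ac_poly (pderiv g) x = ac_poly (pderiv m) x * ac_poly q x"
      using m by (simp add: q pderiv_mult ac_poly_add ac_poly_mult minimal_poly_def)
    then have pm: "ac_poly (pderiv m) x \<noteq> 0"
      using g(2) by auto
    have "rsquarefree (map_poly to_ac m)"
      unfolding rsquarefree_iff_pderiv
    proof (intro conjI allI impI notI)
      fix a assume a: "poly (map_poly to_ac m) a = 0" "poly (pderiv (map_poly to_ac m)) a = 0"
      then have "ac_poly g a = 0"
        by (simp add: q ac_poly_mult)
      then obtain i where i: "i < p" "a = conj i x"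
        using g(3) by blast
      \<comment> \<open>\<open>conj (p - i)\<close> carries the root \<open>conj i x\<close> back to
        \<open>x\<close> and fixes the coefficients, so a multiple root anywhere would make
        \<open>x\<close> a multiple root.\<close>
      have "conj (p - i) (ac_poly (pderiv m) (conj i x)) = ac_poly (pderiv m) (conj (p - i) (conj i x))"
        using x by (intro conj_poly_base) (auto simp: coeff_map_poly)
      then have "ac_poly (pderiv m) x = 0"
        using a i x by (simp add: map_poly_to_ac_pderiv conj_conj \<sigma>_cyclic)
      then show False
        using pm by contradiction
    qed (use m in \<open>simp add: minimal_poly_def\<close>)
    then show ?thesis
      using minimal_poly_irreducible [OF m] m by (auto simp: minimal_poly_def)
  qed
  have "subfield L (ring_of_type_algebra :: 'a alg_closure ring)"
    unfolding subfield_iff_subfield_set by unfold_locales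
  then show ?thesis
    unfolding galois_extension_def intermediate_field_def normal_extension_def separable_extension_def
    using K_subset_L normal separable by blast
qed

text \<open>The conjugates of \<open>x\<close> are images of \<open>x\<close> under affine maps over the base field whose first
  \<open>p\<close> iterates move \<open>x\<close> to different places; this forces the minimal polynomial to have degree \<open>p\<close>.\<close>

theorem ex_cyclic_adjoin:
  fixes x :: "'a::field alg_closure" and f :: "'a poly"
  assumes p: "Factorial_Ring.prime p" and x: "x \<notin> base"
    and f: "degree f = p" "ac_poly f x = 0" "ac_poly (pderiv f) x \<noteq> 0"
    and affine: "\<And>r. ac_poly f r = 0 \<Longrightarrow> r \<noteq> x \<Longrightarrow>
      \<exists>a b. r = to_ac a * x + to_ac b \<and> inj_on (\<lambda>i. ((\<lambda>y. to_ac a * y + to_ac b) ^^ i) x) {..<p}"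
  obtains \<sigma> where "cyclic_extension base (adjoin x) \<sigma> p" "ext_degree (adjoin x) = p"
    "ac_poly f (\<sigma> x) = 0" "\<sigma> x \<noteq> x"
proof -
  obtain m where m: "minimal_poly m x"
    using ex_minimal_poly .
  then obtain q where q: "f = m * q"
    using f by (auto simp: minimal_poly_def dvd_def)
  have "f \<noteq> 0"
    using f by auto
  have "degree m > 1"
  proof (rule ccontr)
    assume "\<not> degree m > 1"
    then obtain a b where ab: "m = [:a, b:]"
    proof -
      have "degree m \<le> 1"
        using \<open>\<not> degree m > 1\<close> by simp
      then have "m = [:coeff m 0, coeff m 1:]"
        by (intro poly_eqI) (auto simp: coeff_pCons coeff_eq_0 split: nat.splits)
      then show thesis
        by (rule that)
    qed
    have eq: "to_ac a + x * to_ac b = 0"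
      using m by (simp add: minimal_poly_def ab ac_poly_pCons)
    have "b \<noteq> 0"
    proof
      assume "b = 0"
      then have "a = 0"
        using eq by simp
      then show False
        using m ab \<open>b = 0\<close> by (simp add: minimal_poly_def)
    qed
    then have "x = to_ac (- a / b)"
      using eq by (simp add: field_simps eq_neg_iff_add_eq_0)
    then show False
      using x by blast
  qed
  moreover have "ac_poly (pderiv f) x = ac_poly (pderiv m) x * ac_poly q x"
    using m by (simp add: q pderiv_mult ac_poly_add ac_poly_mult minimal_poly_def)
  then have "ac_poly (pderiv m) x \<noteq> 0"
    using f by auto
  ultimately obtain r where r: "ac_poly m r = 0" "r \<noteq> x"
    using ex_other_root m unfolding minimal_poly_def by blast
  then have fr: "ac_poly f r = 0"
    by (simp add: q ac_poly_mult)
  then obtain a b where ab: "r = to_ac a * x + to_ac b"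
    "inj_on (\<lambda>i. ((\<lambda>y. to_ac a * y + to_ac b) ^^ i) x) {..<p}"
    using affine r by blast
  \<comment> \<open>The composition of \<open>m\<close> with the affine map vanishes at
    \<open>x\<close>, hence is a multiple of \<open>m\<close>; so the map preserves all roots of
    \<open>m\<close>, not only \<open>x\<close>.\<close>
  have m_affine: "ac_poly m (to_ac a * y + to_ac b) = 0" if "ac_poly m y = 0" for y
  proof -
    have "ac_poly (pcompose m [:b, a:]) x = 0"
      using r ab by (simp add: ac_poly_pcompose ac_poly_pCons algebra_simps)
    then have "m dvd pcompose m [:b, a:]"
      using m by (simp add: minimal_poly_def)
    then have "ac_poly (pcompose m [:b, a:]) y = 0"
      using that by (auto simp: dvd_def ac_poly_mult)
    then show ?thesis
      by (simp add: ac_poly_pcompose ac_poly_pCons algebra_simps)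
  qed
  have "ac_poly m (((\<lambda>y. to_ac a * y + to_ac b) ^^ i) x) = 0" for i
    using m by (induction i) (auto simp: minimal_poly_def m_affine)
  then have "card ((\<lambda>i. ((\<lambda>y. to_ac a * y + to_ac b) ^^ i) x) ` {..<p}) \<le> card {y. ac_poly m y = 0}"
    using m by (intro card_mono poly_roots_finite) (auto simp: minimal_poly_def)
  also have "\<dots> \<le> degree (map_poly to_ac m)"
    using m by (intro card_poly_roots_bound) (simp add: minimal_poly_def)
  finally have "p \<le> degree m"
    using ab by (simp add: card_image)
  moreover have "degree m \<le> degree f"
    using \<open>f \<noteq> 0\<close> unfolding q by (intro dvd_imp_degree_le) auto
  ultimately have "degree m = p"
    using f by simp
  then have deg: "ext_degree (adjoin x) = p"
    using ext_degree_adjoin [OF m] by simp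
  have "r \<in> adjoin x"
    unfolding ab(1) adjoin_def by (rule range_eqI [of _ _ "[:b, a:]"]) (simp add: ac_poly_pCons algebra_simps)
  then obtain \<sigma> where "cyclic_extension base (adjoin x) \<sigma> p" "\<sigma> x = r"
    using ex_cyclic_extension [OF subfield_set_adjoin base_subset_adjoin deg p self_mem_adjoin x m r(1) _ r(2)] by blast
  then show thesis
    using that deg fr r by blast
qed

section \<open>Kaehler differentials\<close>

locale subring_set =
  fixes S :: "'b::field set"
  assumes one_mem [simp, intro]: "1 \<in> S"
    and diff_mem [simp, intro]: "x \<in> S \<Longrightarrow> y \<in> S \<Longrightarrow> x - y \<in> S"
    and mult_mem [simp, intro]: "x \<in> S \<Longrightarrow> y \<in> S \<Longrightarrow> x * y \<in> S"
begin

lemma zero_mem [simp, intro]: "0 \<in> S"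
  using diff_mem [of 1 1] by simp

lemma uminus_mem [simp, intro]: "x \<in> S \<Longrightarrow> - x \<in> S"
  using diff_mem [of 0 x] by simp

lemma add_mem [simp, intro]: "x \<in> S \<Longrightarrow> y \<in> S \<Longrightarrow> x + y \<in> S"
  using diff_mem [of x "- y"] uminus_mem by simp

abbreviation B :: "'b ring" where
  "B \<equiv> ring_of_type_algebra\<lparr>carrier := S\<rparr>"

abbreviation M :: "('b, 'b \<Rightarrow> 'b) module" where
  "M \<equiv> free_module B S"

abbreviation d :: "'b \<Rightarrow> 'b \<Rightarrow> 'b" where
  "d \<equiv> basis_elt B"

lemma B_simps [simp]:
  "carrier B = S" "x \<otimes>\<^bsub>B\<^esub> y = x * y" "x \<oplus>\<^bsub>B\<^esub> y = x + y" "\<one>\<^bsub>B\<^esub> = 1" "\<zero>\<^bsub>B\<^esub> = 0"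
  by (simp_all add: ring_of_type_algebra_def)

lemma M_simps:
  "carrier M = {f \<in> S \<rightarrow>\<^sub>E S. finite {x \<in> S. f x \<noteq> 0}}" "\<zero>\<^bsub>M\<^esub> = (\<lambda>x\<in>S. 0)"
  "f \<oplus>\<^bsub>M\<^esub> g = (\<lambda>x\<in>S. f x + g x)" "b \<odot>\<^bsub>M\<^esub> f = (\<lambda>x\<in>S. b * f x)"
  by (simp_all add: free_module_def)

lemma M_add_closed: "f \<in> carrier M \<Longrightarrow> g \<in> carrier M \<Longrightarrow> f \<oplus>\<^bsub>M\<^esub> g \<in> carrier M"
proof -
  assume *: "f \<in> carrier M" "g \<in> carrier M"
  then have "finite ({x \<in> S. f x \<noteq> 0} \<union> {x \<in> S. g x \<noteq> 0})"
    by (auto simp: M_simps)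
  then have "finite {x \<in> S. (\<lambda>x\<in>S. f x + g x) x \<noteq> 0}"
    by (rule rev_finite_subset) auto
  then show ?thesis
    using * unfolding M_simps by (auto simp: PiE_iff)
qed

lemma M_smult_closed: "b \<in> S \<Longrightarrow> f \<in> carrier M \<Longrightarrow> b \<odot>\<^bsub>M\<^esub> f \<in> carrier M"
proof -
  assume *: "b \<in> S" "f \<in> carrier M"
  then have "finite {x \<in> S. f x \<noteq> 0}"
    by (simp add: M_simps)
  then have "finite {x \<in> S. (\<lambda>x\<in>S. b * f x) x \<noteq> 0}"
    by (rule rev_finite_subset) auto
  then show ?thesis
    using * unfolding M_simps by (auto simp: PiE_iff)
qed

lemma d_closed: "d b \<in> carrier M"
proof -
  have "finite {x \<in> S. d b x \<noteq> 0}"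
    by (rule finite_subset [of _ "{b}"]) (auto simp: basis_elt_def)
  then show ?thesis
    by (auto simp: M_simps basis_elt_def)
qed

lemma abelian_group_M: "abelian_group M"
proof (rule abelian_groupI)
  fix f assume f: "f \<in> carrier M"
  then have "(- 1) \<odot>\<^bsub>M\<^esub> f \<in> carrier M"
    by (auto intro: M_smult_closed)
  moreover have "(- 1) \<odot>\<^bsub>M\<^esub> f \<oplus>\<^bsub>M\<^esub> f = \<zero>\<^bsub>M\<^esub>"
    by (auto simp: M_simps(2-))
  ultimately show "\<exists>g\<in>carrier M. g \<oplus>\<^bsub>M\<^esub> f = \<zero>\<^bsub>M\<^esub>"
    by blast
  show "\<zero>\<^bsub>M\<^esub> \<oplus>\<^bsub>M\<^esub> f = f"
    using f by (auto simp: M_simps fun_eq_iff PiE_iff extensional_def)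
qed (auto simp: M_add_closed, auto simp: M_simps algebra_simps)

interpretation M: abelian_group M
  by (rule abelian_group_M)

lemma M_uminus: "f \<in> carrier M \<Longrightarrow> \<ominus>\<^bsub>M\<^esub> f = (- 1) \<odot>\<^bsub>M\<^esub> f"
proof -
  assume f: "f \<in> carrier M"
  then have "(- 1) \<odot>\<^bsub>M\<^esub> f \<in> carrier M"
    by (auto intro: M_smult_closed)
  moreover have "(- 1) \<odot>\<^bsub>M\<^esub> f \<oplus>\<^bsub>M\<^esub> f = \<zero>\<^bsub>M\<^esub>"
    by (auto simp: M_simps(2-))
  ultimately show ?thesis
    using f by (intro M.minus_equality)
qed

lemma M_minus: "f \<in> carrier M \<Longrightarrow> g \<in> carrier M \<Longrightarrow> f \<ominus>\<^bsub>M\<^esub> g = (\<lambda>x\<in>S. f x - g x)"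
  unfolding a_minus_def by (subst M_uminus) (auto simp: M_simps(2-))

lemma submoduleI':
  assumes "N \<subseteq> carrier M" "\<zero>\<^bsub>M\<^esub> \<in> N" "\<And>f g. f \<in> N \<Longrightarrow> g \<in> N \<Longrightarrow> f \<oplus>\<^bsub>M\<^esub> g \<in> N"
    and "\<And>b f. b \<in> S \<Longrightarrow> f \<in> N \<Longrightarrow> b \<odot>\<^bsub>M\<^esub> f \<in> N"
  shows "submodule N B M"
proof (intro submodule.intro submodule_axioms.intro M.add.subgroupI)
  fix f assume f: "f \<in> N"
  then have "\<ominus>\<^bsub>M\<^esub> f = (- 1) \<odot>\<^bsub>M\<^esub> f"
    using assms(1) by (intro M_uminus) auto
  then show "\<ominus>\<^bsub>M\<^esub> f \<in> N"
    using assms(4) f by auto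
qed (use assms in auto)

lemma submoduleD:
  assumes "submodule N B M"
  shows "N \<subseteq> carrier M" "\<zero>\<^bsub>M\<^esub> \<in> N" "\<And>f g. f \<in> N \<Longrightarrow> g \<in> N \<Longrightarrow> f \<oplus>\<^bsub>M\<^esub> g \<in> N"
    "\<And>b f. b \<in> S \<Longrightarrow> f \<in> N \<Longrightarrow> b \<odot>\<^bsub>M\<^esub> f \<in> N"
proof -
  interpret submodule N B M
    by fact
  show "N \<subseteq> carrier M" "\<zero>\<^bsub>M\<^esub> \<in> N" "\<And>f g. f \<in> N \<Longrightarrow> g \<in> N \<Longrightarrow> f \<oplus>\<^bsub>M\<^esub> g \<in> N"
    "\<And>b f. b \<in> S \<Longrightarrow> f \<in> N \<Longrightarrow> b \<odot>\<^bsub>M\<^esub> f \<in> N"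
    using subset one_closed m_closed smult_closed by auto
qed

lemma submodule_carrier: "submodule (carrier M) B M"
  by (rule submoduleI') (auto intro: M_smult_closed)

lemma free_module_generated:
  assumes N: "submodule N B M" and d: "\<And>b. b \<in> S \<Longrightarrow> d b \<in> N"
  shows "carrier M \<subseteq> N"
proof
  fix f assume f: "f \<in> carrier M"
  then have fin: "finite {x \<in> S. f x \<noteq> 0}"
    by (simp add: M_simps)
  have *: "(\<lambda>x\<in>S. if x \<in> F then f x else 0) \<in> N" if "finite F" "F \<subseteq> S" for F
    using that
  proof (induction F)
    case empty
    then show ?case
      using submoduleD(2) [OF N] by (simp add: M_simps restrict_def)
  next
    case (insert y F)
    have "f y \<in> S"
      using f insert by (auto simp: M_simps)
    then have "(f y \<odot>\<^bsub>M\<^esub> d y) \<oplus>\<^bsub>M\<^esub> (\<lambda>x\<in>S. if x \<in> F then f x else 0) \<in> N"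
      using insert d submoduleD(3,4) [OF N] by blast
    also have "(f y \<odot>\<^bsub>M\<^esub> d y) \<oplus>\<^bsub>M\<^esub> (\<lambda>x\<in>S. if x \<in> F then f x else 0) = (\<lambda>x\<in>S. if x \<in> insert y F then f x else 0)"
      using insert by (auto simp: M_simps basis_elt_def fun_eq_iff)
    finally show ?case .
  qed
  have "(\<lambda>x\<in>S. if x \<in> {x \<in> S. f x \<noteq> 0} then f x else 0) = f"
    using f by (auto simp: M_simps fun_eq_iff PiE_iff extensional_def)
  then show "f \<in> N"
    using * [OF fin] by simp
qed

text \<open>The quotient vanishes if and only if the hull of the relations is the whole free module.
  Quantifying over submodules lets one direction work in an arbitrary \<open>N\<close> and the other
  test a single one.\<close>

lemma kaehler_trivial_iff_subset:
  "carrier (kaehler A B \<phi>) = {\<zero>\<^bsub>kaehler A B \<phi>\<^esub>} \<longleftrightarrow>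
    (\<forall>N. submodule N B M \<and> kaehler_relations A B \<phi> \<subseteq> N \<longrightarrow> carrier M \<subseteq> N)"
proof -
  define N where "N = (\<lambda>N. submodule N B M) hull kaehler_relations A B \<phi>"
  have car: "carrier (kaehler A B \<phi>) = {N +>\<^bsub>M\<^esub> f | f. f \<in> carrier M}" and zero: "\<zero>\<^bsub>kaehler A B \<phi>\<^esub> = N"
    by (auto simp: kaehler_def Let_def N_def quot_module_def A_RCOSETS_def')
  have N: "N = \<Inter>{N. submodule N B M \<and> kaehler_relations A B \<phi> \<subseteq> N}"
    by (simp add: N_def hull_def)
  have "carrier (kaehler A B \<phi>) = {\<zero>\<^bsub>kaehler A B \<phi>\<^esub>} \<longleftrightarrow> carrier M \<subseteq> N"
  proof
    assume *: "carrier (kaehler A B \<phi>) = {\<zero>\<^bsub>kaehler A B \<phi>\<^esub>}"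
    show "carrier M \<subseteq> N"
    proof
      fix f assume f: "f \<in> carrier M"
      have "\<zero>\<^bsub>M\<^esub> \<in> N"
        unfolding N using submoduleD(2) by blast
      then have "\<zero>\<^bsub>M\<^esub> \<oplus>\<^bsub>M\<^esub> f \<in> N +>\<^bsub>M\<^esub> f"
        unfolding a_r_coset_def' by blast
      moreover have "N +>\<^bsub>M\<^esub> f = N"
        using * f unfolding car zero by blast
      ultimately show "f \<in> N"
        using f by simp
    qed
  next
    assume *: "carrier M \<subseteq> N"
    have rel: "kaehler_relations A B \<phi> \<subseteq> carrier M"
      unfolding kaehler_relations_def Let_def using d_closed M_add_closed M_smult_closed by auto
    then have "N \<subseteq> carrier M"
      unfolding N using submodule_carrier by blast
    then have "N = carrier M"
      using * by blast
    moreover have "carrier M +>\<^bsub>M\<^esub> f = carrier M" if "f \<in> carrier M" for f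
      using M.a_coset_join2 [OF that M.add.subgroup_self that] .
    ultimately show "carrier (kaehler A B \<phi>) = {\<zero>\<^bsub>kaehler A B \<phi>\<^esub>}"
      unfolding car zero by auto
  qed
  also have "\<dots> \<longleftrightarrow> (\<forall>N. submodule N B M \<and> kaehler_relations A B \<phi> \<subseteq> N \<longrightarrow> carrier M \<subseteq> N)"
    unfolding N by auto
  finally show ?thesis .
qed

lemma kaehler_relationsE:
  assumes "kaehler_relations A B \<phi> \<subseteq> N"
  shows "\<And>b c. b \<in> S \<Longrightarrow> c \<in> S \<Longrightarrow> d (b + c) \<ominus>\<^bsub>M\<^esub> (d b \<oplus>\<^bsub>M\<^esub> d c) \<in> N"
    and "\<And>b c. b \<in> S \<Longrightarrow> c \<in> S \<Longrightarrow> d (b * c) \<ominus>\<^bsub>M\<^esub> (b \<odot>\<^bsub>M\<^esub> d c \<oplus>\<^bsub>M\<^esub> c \<odot>\<^bsub>M\<^esub> d b) \<in> N"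
    and "\<And>a. a \<in> carrier A \<Longrightarrow> d (\<phi> a) \<in> N"
  using assms unfolding kaehler_relations_def Let_def by auto

end

text \<open>Calculus of differentials modulo a submodule containing the relations:
  \<open>\<asymp>\<close> is congruence modulo \<open>N\<close>, so the rules for \<open>d\<close>
  apply to representatives and no cosets occur. \<open>T\<close> is the image of the ground
  ring.\<close>

locale kaehler_submodule = subring_set S for S :: "'b::field set" +
  fixes N and T :: "'b set"
  assumes N: "submodule N B M" and T: "T \<subseteq> S" "0 \<in> T"
    and d_add_N: "b \<in> S \<Longrightarrow> c \<in> S \<Longrightarrow> d (b + c) \<ominus>\<^bsub>M\<^esub> (d b \<oplus>\<^bsub>M\<^esub> d c) \<in> N"
    and d_mult_N: "b \<in> S \<Longrightarrow> c \<in> S \<Longrightarrow> d (b * c) \<ominus>\<^bsub>M\<^esub> (b \<odot>\<^bsub>M\<^esub> d c \<oplus>\<^bsub>M\<^esub> c \<odot>\<^bsub>M\<^esub> d b) \<in> N"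
    and d_T_N: "a \<in> T \<Longrightarrow> d a \<in> N"
begin

definition eqN :: "('b \<Rightarrow> 'b) \<Rightarrow> ('b \<Rightarrow> 'b) \<Rightarrow> bool" (infix "\<asymp>" 50) where
  "f \<asymp> g \<longleftrightarrow> f \<in> carrier M \<and> g \<in> carrier M \<and> (\<lambda>x\<in>S. f x - g x) \<in> N"

lemma eqN_minus: "f \<in> carrier M \<Longrightarrow> g \<in> carrier M \<Longrightarrow> f \<ominus>\<^bsub>M\<^esub> g \<in> N \<Longrightarrow> f \<asymp> g"
  by (simp add: eqN_def M_minus)

lemma eqN_refl [simp]: "f \<in> carrier M \<Longrightarrow> f \<asymp> f"
  using submoduleD(2) [OF N] by (simp add: eqN_def M_simps)

lemma eqN_trans [trans]: "f \<asymp> g \<Longrightarrow> g \<asymp> h \<Longrightarrow> f \<asymp> h"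
  using submoduleD(3) [OF N, of "\<lambda>x\<in>S. f x - g x" "\<lambda>x\<in>S. g x - h x"]
  by (simp add: eqN_def M_simps(3) restrict_def cong: if_cong)

lemma eqN_sym: "f \<asymp> g \<Longrightarrow> g \<asymp> f"
  using submoduleD(4) [OF N, of "- 1" "\<lambda>x\<in>S. f x - g x"]
  by (simp add: eqN_def M_simps(4) restrict_def cong: if_cong)

lemma eqN_add: "f \<asymp> g \<Longrightarrow> f' \<asymp> g' \<Longrightarrow> f \<oplus>\<^bsub>M\<^esub> f' \<asymp> g \<oplus>\<^bsub>M\<^esub> g'"
  using submoduleD(3) [OF N, of "\<lambda>x\<in>S. f x - g x" "\<lambda>x\<in>S. f' x - g' x"]
  by (simp add: eqN_def M_add_closed) (simp add: M_simps(3) restrict_def algebra_simps cong: if_cong)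

lemma eqN_smult: "b \<in> S \<Longrightarrow> f \<asymp> g \<Longrightarrow> b \<odot>\<^bsub>M\<^esub> f \<asymp> b \<odot>\<^bsub>M\<^esub> g"
  using submoduleD(4) [OF N, of b "\<lambda>x\<in>S. f x - g x"]
  by (simp add: eqN_def M_smult_closed) (simp add: M_simps(4) restrict_def right_diff_distrib cong: if_cong)

lemma eqN_zero_iff: "f \<asymp> \<zero>\<^bsub>M\<^esub> \<longleftrightarrow> f \<in> N"
proof -
  have "(\<lambda>x\<in>S. f x - (\<lambda>x\<in>S. 0) x) = f" if "f \<in> carrier M"
    using that by (auto simp: M_simps fun_eq_iff PiE_iff extensional_def)
  moreover have "\<zero>\<^bsub>M\<^esub> \<in> carrier M"
    using submoduleD(1,2) [OF N] by auto
  ultimately show ?thesis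
    using submoduleD(1) [OF N] by (auto simp: eqN_def M_simps(2))
qed

lemma M_add_zero: "f \<in> carrier M \<Longrightarrow> f \<oplus>\<^bsub>M\<^esub> \<zero>\<^bsub>M\<^esub> = f" "f \<in> carrier M \<Longrightarrow> \<zero>\<^bsub>M\<^esub> \<oplus>\<^bsub>M\<^esub> f = f"
  by (auto simp: M_simps fun_eq_iff PiE_iff extensional_def)

lemma M_smult_simps:
  "b \<odot>\<^bsub>M\<^esub> \<zero>\<^bsub>M\<^esub> = \<zero>\<^bsub>M\<^esub>" "0 \<odot>\<^bsub>M\<^esub> f = \<zero>\<^bsub>M\<^esub>" "b \<odot>\<^bsub>M\<^esub> (c \<odot>\<^bsub>M\<^esub> f) = (b * c) \<odot>\<^bsub>M\<^esub> f"
  "b \<odot>\<^bsub>M\<^esub> f \<oplus>\<^bsub>M\<^esub> c \<odot>\<^bsub>M\<^esub> f = (b + c) \<odot>\<^bsub>M\<^esub> f"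
  by (auto simp: M_simps fun_eq_iff algebra_simps)

lemma d_add: "b \<in> S \<Longrightarrow> c \<in> S \<Longrightarrow> d (b + c) \<asymp> d b \<oplus>\<^bsub>M\<^esub> d c"
  using d_add_N by (intro eqN_minus) (auto intro: d_closed M_add_closed)

lemma d_mult: "b \<in> S \<Longrightarrow> c \<in> S \<Longrightarrow> d (b * c) \<asymp> b \<odot>\<^bsub>M\<^esub> d c \<oplus>\<^bsub>M\<^esub> c \<odot>\<^bsub>M\<^esub> d b"
  using d_mult_N by (intro eqN_minus) (auto intro: d_closed M_add_closed M_smult_closed)

lemma d_base: "a \<in> T \<Longrightarrow> d a \<asymp> \<zero>\<^bsub>M\<^esub>"
  using d_T_N by (simp add: eqN_zero_iff)

lemma d_add_base:
  assumes "a \<in> T" "b \<in> S"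
  shows "d (a + b) \<asymp> d b"
proof -
  have "d (a + b) \<asymp> d a \<oplus>\<^bsub>M\<^esub> d b"
    using assms T by (intro d_add) auto
  also have "\<dots> \<asymp> \<zero>\<^bsub>M\<^esub> \<oplus>\<^bsub>M\<^esub> d b"
    using assms by (intro eqN_add d_base eqN_refl d_closed)
  finally show ?thesis
    by (simp add: M_add_zero d_closed)
qed

lemma d_mult_base:
  assumes "a \<in> T" "b \<in> S"
  shows "d (a * b) \<asymp> a \<odot>\<^bsub>M\<^esub> d b"
proof -
  have "d (a * b) \<asymp> a \<odot>\<^bsub>M\<^esub> d b \<oplus>\<^bsub>M\<^esub> b \<odot>\<^bsub>M\<^esub> d a"
    using assms T by (intro d_mult) auto
  also have "\<dots> \<asymp> a \<odot>\<^bsub>M\<^esub> d b \<oplus>\<^bsub>M\<^esub> b \<odot>\<^bsub>M\<^esub> \<zero>\<^bsub>M\<^esub>"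
    using assms T by (intro eqN_add eqN_smult d_base eqN_refl M_smult_closed d_closed) auto
  finally show ?thesis
    using assms T by (auto simp: M_smult_simps M_add_zero d_closed M_smult_closed)
qed

lemma poly_mem: "(\<And>i. coeff h i \<in> T) \<Longrightarrow> u \<in> S \<Longrightarrow> poly h u \<in> S"
proof (induction h)
  case (pCons a h)
  have "a \<in> T" "coeff h i \<in> T" for i
    using pCons.prems(1) [of 0] pCons.prems(1) [of "Suc i"] by auto
  then show ?case
    using pCons T by auto
qed simp

lemma poly_pderiv_mem: "(\<And>i. coeff h i \<in> T) \<Longrightarrow> u \<in> S \<Longrightarrow> poly (pderiv h) u \<in> S"
proof (induction h)
  case (pCons a h)
  have "coeff h i \<in> T" for i
    using pCons.prems(1) [of "Suc i"] by auto
  then show ?case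
    using pCons poly_mem by (auto simp: pderiv_pCons)
qed simp

lemma d_poly:
  assumes "\<And>i. coeff h i \<in> T" "u \<in> S"
  shows "d (poly h u) \<asymp> poly (pderiv h) u \<odot>\<^bsub>M\<^esub> d u"
  using assms(1)
proof (induction h)
  case 0
  then show ?case
    using d_base [OF T(2)] by (simp add: M_smult_simps)
next
  case (pCons a h)
  have a: "a \<in> T" and h: "coeff h i \<in> T" for i
    using pCons.prems [of 0] pCons.prems [of "Suc i"] by auto
  have hu: "poly h u \<in> S" "poly (pderiv h) u \<in> S"
    using poly_mem poly_pderiv_mem h assms(2) by auto
  have "d (poly (pCons a h) u) \<asymp> d (u * poly h u)"
    using a hu assms(2) d_add_base [of a "u * poly h u"] by simp
  also have "d (u * poly h u) \<asymp> u \<odot>\<^bsub>M\<^esub> d (poly h u) \<oplus>\<^bsub>M\<^esub> poly h u \<odot>\<^bsub>M\<^esub> d u"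
    using assms(2) hu by (intro d_mult)
  also have "\<dots> \<asymp> u \<odot>\<^bsub>M\<^esub> (poly (pderiv h) u \<odot>\<^bsub>M\<^esub> d u) \<oplus>\<^bsub>M\<^esub> poly h u \<odot>\<^bsub>M\<^esub> d u"
    using pCons.IH [OF h] hu assms(2) by (intro eqN_add eqN_smult eqN_refl M_smult_closed d_closed)
  also have "\<dots> = poly (pderiv (pCons a h)) u \<odot>\<^bsub>M\<^esub> d u"
    by (simp add: M_smult_simps pderiv_pCons add.commute)
  finally show ?case .
qed

text \<open>The differential is \<open>r * poly (pderiv h) u\<close> times \<open>d u\<close>. The
  factor \<open>poly (pderiv f) u\<close> of \<open>r\<close> turns \<open>d u\<close> into
  \<open>d (poly f u)\<close>, which is zero.\<close>

lemma d_eq_zero: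
  assumes "y \<in> T" "r \<in> T" "z \<in> S" "u \<in> S" and f: "\<And>i. coeff f i \<in> T" and h: "\<And>i. coeff h i \<in> T"
    and "poly f u = 0" "r = z * poly (pderiv f) u"
  shows "d (y + r * poly h u) \<in> N"
proof -
  have hu: "poly h u \<in> S" "poly (pderiv h) u \<in> S" "poly (pderiv f) u \<in> S" and "r \<in> S"
    using poly_mem poly_pderiv_mem h f assms T by auto
  have "d (y + r * poly h u) \<asymp> d (r * poly h u)"
    using assms hu \<open>r \<in> S\<close> by (intro d_add_base) auto
  also have "\<dots> \<asymp> r \<odot>\<^bsub>M\<^esub> d (poly h u)"
    using assms hu by (intro d_mult_base)
  also have "\<dots> \<asymp> r \<odot>\<^bsub>M\<^esub> (poly (pderiv h) u \<odot>\<^bsub>M\<^esub> d u)"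
    using \<open>r \<in> S\<close> assms by (intro eqN_smult d_poly)
  also have "\<dots> = (z * poly (pderiv h) u) \<odot>\<^bsub>M\<^esub> (poly (pderiv f) u \<odot>\<^bsub>M\<^esub> d u)"
    by (simp add: M_smult_simps assms(8) mult_ac)
  also have "\<dots> \<asymp> (z * poly (pderiv h) u) \<odot>\<^bsub>M\<^esub> \<zero>\<^bsub>M\<^esub>"
  proof (intro eqN_smult)
    have "d (poly f u) \<asymp> \<zero>\<^bsub>M\<^esub>"
      using assms(7) d_base T by simp
    then show "poly (pderiv f) u \<odot>\<^bsub>M\<^esub> d u \<asymp> \<zero>\<^bsub>M\<^esub>"
      using d_poly [OF f \<open>u \<in> S\<close>] eqN_sym eqN_trans by blast
  qed (use assms hu in auto)
  also have "\<dots> = \<zero>\<^bsub>M\<^esub>"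
    by (simp add: M_smult_simps)
  finally show ?thesis
    by (simp add: eqN_zero_iff)
qed

end

section \<open>Differentials of a cyclic extension\<close>

context cyclic_valued_extension
begin

interpretation S: subring_set "L \<inter> V"
  by unfold_locales auto

lemma D_mult: "b \<in> L \<Longrightarrow> c \<in> L \<Longrightarrow> D (b * c) = b * D c + c * D b + D b * D c"
  by (simp add: \<sigma>_mult algebra_simps)

text \<open>The square of the ideal generated by all \<open>D b\<close>: as the generators are
  comparable by divisibility, every element of it is a multiple of a single
  \<open>D c ^ 2\<close>.\<close>

definition ideal_square :: "'b set" where
  "ideal_square = {z. \<exists>c\<in>L \<inter> V - K. D c ^ 2 \<preceq> z}"

text \<open>The linear map on the free module that sends the basis element of \<open>b\<close> to
  \<open>D b\<close>.\<close>

definition Dsum :: "('b \<Rightarrow> 'b) \<Rightarrow> 'b" where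
  "Dsum f = (\<Sum>x | x \<in> L \<inter> V \<and> f x \<noteq> 0. f x * D x)"

lemma Dsum_superset: "finite F \<Longrightarrow> F \<subseteq> L \<inter> V \<Longrightarrow> {x \<in> L \<inter> V. f x \<noteq> 0} \<subseteq> F \<Longrightarrow> Dsum f = (\<Sum>x\<in>F. f x * D x)"
  unfolding Dsum_def by (intro sum.mono_neutral_left) auto

lemma Dsum_add:
  assumes "f \<in> carrier S.M" "g \<in> carrier S.M"
  shows "Dsum (f \<oplus>\<^bsub>S.M\<^esub> g) = Dsum f + Dsum g"
proof -
  define F where "F = {x \<in> L \<inter> V. f x \<noteq> 0} \<union> {x \<in> L \<inter> V. g x \<noteq> 0}"
  have F: "finite F" "F \<subseteq> L \<inter> V"
    using assms by (auto simp: F_def S.M_simps)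
  have "Dsum (f \<oplus>\<^bsub>S.M\<^esub> g) = (\<Sum>x\<in>F. (f \<oplus>\<^bsub>S.M\<^esub> g) x * D x)"
    using F by (intro Dsum_superset) (auto simp: F_def S.M_simps)
  also have "\<dots> = (\<Sum>x\<in>F. (f x + g x) * D x)"
    using F by (intro sum.cong) (auto simp: S.M_simps)
  also have "\<dots> = (\<Sum>x\<in>F. f x * D x) + (\<Sum>x\<in>F. g x * D x)"
    by (simp add: sum.distrib distrib_right)
  also have "(\<Sum>x\<in>F. f x * D x) = Dsum f"
    using F by (intro Dsum_superset [symmetric]) (auto simp: F_def)
  also have "(\<Sum>x\<in>F. g x * D x) = Dsum g"
    using F by (intro Dsum_superset [symmetric]) (auto simp: F_def)
  finally show ?thesis .
qed

lemma Dsum_smult: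
  assumes "f \<in> carrier S.M"
  shows "Dsum (b \<odot>\<^bsub>S.M\<^esub> f) = b * Dsum f"
proof -
  define F where "F = {x \<in> L \<inter> V. f x \<noteq> 0}"
  have F: "finite F" "F \<subseteq> L \<inter> V"
    using assms by (auto simp: F_def S.M_simps)
  have "Dsum (b \<odot>\<^bsub>S.M\<^esub> f) = (\<Sum>x\<in>F. (b \<odot>\<^bsub>S.M\<^esub> f) x * D x)"
    using F by (intro Dsum_superset) (auto simp: F_def S.M_simps)
  also have "\<dots> = (\<Sum>x\<in>F. b * (f x * D x))"
    using F by (intro sum.cong) (auto simp: S.M_simps)
  finally show ?thesis
    by (simp add: Dsum_def F_def sum_distrib_left)
qed

lemma Dsum_minus:
  assumes "f \<in> carrier S.M" "g \<in> carrier S.M"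
  shows "Dsum (f \<ominus>\<^bsub>S.M\<^esub> g) = Dsum f - Dsum g"
proof -
  have "f \<ominus>\<^bsub>S.M\<^esub> g = f \<oplus>\<^bsub>S.M\<^esub> (- 1) \<odot>\<^bsub>S.M\<^esub> g"
    using assms by (simp add: a_minus_def S.M_uminus)
  moreover have "(- 1) \<odot>\<^bsub>S.M\<^esub> g \<in> carrier S.M"
    using assms by (intro S.M_smult_closed S.uminus_mem S.one_mem)
  ultimately show ?thesis
    using assms by (simp add: Dsum_add Dsum_smult)
qed

lemma Dsum_d: "b \<in> L \<inter> V \<Longrightarrow> Dsum (S.d b) = D b"
proof -
  assume b: "b \<in> L \<inter> V"
  then have "{x. x \<in> L \<inter> V \<and> S.d b x \<noteq> 0} = {b}"
    by (auto simp: basis_elt_def)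
  then show ?thesis
    using b by (simp add: Dsum_def basis_elt_def)
qed

lemma ideal_square_mult:
  assumes "b \<in> L \<inter> V" "c \<in> L \<inter> V"
  shows "D b * D c \<in> ideal_square"
proof -
  obtain u where u: "u \<in> L" "u \<in> V" "u \<notin> K"
    using ex_integral_generator .
  show ?thesis
  proof (cases "b \<in> K \<or> c \<in> K")
    case True
    then have "D b * D c = 0"
      by auto
    then show ?thesis
      using u by (auto simp: ideal_square_def intro!: bexI [of _ u])
  next
    case False
    have "(D b)\<^sup>2 \<preceq> D b * D c \<or> (D c)\<^sup>2 \<preceq> D b * D c"
      unfolding power2_eq_square using vle_total [of "D b" "D c"] vle_mult by blast
    then show ?thesis
      using assms False by (auto simp: ideal_square_def)
  qed
qed

lemma zero_mem_ideal_square: "0 \<in> ideal_square"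
  using ideal_square_mult [of 0 0] by simp

lemma ideal_square_add:
  assumes "x \<in> ideal_square" "y \<in> ideal_square"
  shows "x + y \<in> ideal_square"
proof -
  obtain b c where b: "b \<in> L \<inter> V - K" "(D b)\<^sup>2 \<preceq> x" and c: "c \<in> L \<inter> V - K" "(D c)\<^sup>2 \<preceq> y"
    using assms by (auto simp: ideal_square_def)
  have "(D b)\<^sup>2 \<preceq> (D c)\<^sup>2 \<or> (D c)\<^sup>2 \<preceq> (D b)\<^sup>2"
    by (rule vle_total)
  then have "(D b)\<^sup>2 \<preceq> x + y \<or> (D c)\<^sup>2 \<preceq> x + y"
    using b c vle_add vle_trans by meson
  then show ?thesis
    using b c by (auto simp: ideal_square_def)
qed

theorem kaehler_trivial_iff_idempotent_ideal:
  fixes A :: "('c, 'm) ring_scheme"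
  assumes \<phi>: "\<phi> ` carrier A = K \<inter> V"
  shows "carrier (kaehler A S.B \<phi>) = {\<zero>\<^bsub>kaehler A S.B \<phi>\<^esub>} \<longleftrightarrow> idempotent_ideal"
proof
  assume id: idempotent_ideal
  show "carrier (kaehler A S.B \<phi>) = {\<zero>\<^bsub>kaehler A S.B \<phi>\<^esub>}"
    unfolding S.kaehler_trivial_iff_subset
  proof (intro allI impI)
    fix N assume N: "submodule N S.B S.M \<and> kaehler_relations A S.B \<phi> \<subseteq> N"
    then have rel: "kaehler_relations A S.B \<phi> \<subseteq> N"
      by blast
    have base: "S.d a \<in> N" if a: "a \<in> K \<inter> V" for a
    proof -
      have "a \<in> \<phi> ` carrier A"
        using a \<phi> by simp
      then obtain a' where "a' \<in> carrier A" "a = \<phi> a'"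
        by (rule imageE)
      then show ?thesis
        using S.kaehler_relationsE(3) [OF rel, of a'] by simp
    qed
    interpret kaehler_submodule "L \<inter> V" N "K \<inter> V"
    proof (intro kaehler_submodule.intro kaehler_submodule_axioms.intro)
      show "submodule N S.B S.M"
        using N by blast
    qed (fact S.subring_set_axioms | erule (1) S.kaehler_relationsE(1,2) [OF rel] | erule base | force)+
    show "carrier S.M \<subseteq> N"
    proof (rule S.free_module_generated)
      fix b assume "b \<in> L \<inter> V"
      then have b: "b \<in> L" "b \<in> V"
        by auto
      obtain y r b' z u f h where *: "y \<in> K" "y \<in> V" "r \<in> K" "r \<in> V" "b' \<in> L" "b' \<in> V" "z \<in> L" "z \<in> V"
        "u \<in> L" "u \<in> V" "\<And>i. coeff f i \<in> K" "\<And>i. coeff f i \<in> V" "\<And>i. coeff h i \<in> K" "\<And>i. coeff h i \<in> V"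
        "poly f u = 0" "poly h u = r * b'" "r = z * poly (pderiv f) u" "b = y + r * r * b'"
        using idempotent_ideal_decomposition [OF id b] by blast
      have "S.d (y + r * poly h u) \<in> N"
        using * by (intro d_eq_zero [of y r z u f h]) auto
      then show "S.d b \<in> N"
        using * by (simp add: mult.assoc)
    qed (use N in blast)
  qed
next
  assume "carrier (kaehler A S.B \<phi>) = {\<zero>\<^bsub>kaehler A S.B \<phi>\<^esub>}"
  then have all: "carrier S.M \<subseteq> N" if "submodule N S.B S.M" "kaehler_relations A S.B \<phi> \<subseteq> N" for N
    using that unfolding S.kaehler_trivial_iff_subset by blast
  \<comment> \<open>\<open>D\<close> violates the Leibniz rule only by \<open>D b * D c\<close>, so
    modulo \<open>ideal_square\<close> it is a derivation and this kernel contains all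
    relations.\<close>
  define N where "N = {f \<in> carrier S.M. Dsum f \<in> ideal_square}"
  have "carrier S.M \<subseteq> N"
  proof (rule all)
    have "Dsum \<zero>\<^bsub>S.M\<^esub> = 0"
      by (auto simp: Dsum_def S.M_simps intro!: sum.neutral)
    then show "submodule N S.B S.M"
      using S.submoduleD(2) [OF S.submodule_carrier] zero_mem_ideal_square
      by (intro S.submoduleI')
        (auto simp: N_def Dsum_add Dsum_smult S.M_add_closed S.M_smult_closed ideal_square_add,
         auto simp: ideal_square_def intro: vle_mult_mem')
    have 1: "S.d (b + c) \<ominus>\<^bsub>S.M\<^esub> (S.d b \<oplus>\<^bsub>S.M\<^esub> S.d c) \<in> N" if "b \<in> L \<inter> V" "c \<in> L \<inter> V" for b c
    proof -
      have "D (b + c) - (D b + D c) = 0"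
        using that by (simp add: \<sigma>_add)
      then show ?thesis
        using that zero_mem_ideal_square
        by (simp add: N_def Dsum_minus Dsum_add Dsum_d S.d_closed S.M_add_closed add_mem abelian_group.minus_closed [OF S.abelian_group_M])
    qed
    have 2: "S.d (b * c) \<ominus>\<^bsub>S.M\<^esub> (b \<odot>\<^bsub>S.M\<^esub> S.d c \<oplus>\<^bsub>S.M\<^esub> c \<odot>\<^bsub>S.M\<^esub> S.d b) \<in> N" if "b \<in> L \<inter> V" "c \<in> L \<inter> V" for b c
    proof -
      have "D (b * c) - (b * D c + c * D b) = D b * D c"
        using that D_mult [of b c] by (simp add: algebra_simps)
      then show ?thesis
        using that ideal_square_mult [OF that]
        by (simp add: N_def Dsum_minus Dsum_add Dsum_smult Dsum_d S.d_closed S.M_add_closed S.M_smult_closed mult_mem abelian_group.minus_closed [OF S.abelian_group_M])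
    qed
    have 3: "S.d (\<phi> a) \<in> N" if "a \<in> carrier A" for a
    proof -
      have "\<phi> a \<in> K \<inter> V"
        using \<phi> that by blast
      then show ?thesis
        using zero_mem_ideal_square by (simp add: N_def Dsum_d K_in_L S.d_closed)
    qed
    show "kaehler_relations A S.B \<phi> \<subseteq> N"
      unfolding kaehler_relations_def Let_def using 1 2 3 by auto
  qed
  then have "D b \<in> ideal_square" if "b \<in> L \<inter> V" for b
    using S.d_closed [of b] Dsum_d [OF that] by (auto simp: N_def)
  then show idempotent_ideal
    unfolding idempotent_ideal_def ideal_square_def by blast
qed

end

section \<open>Quotients of convex subgroups\<close>

text \<open>\<open>y\<close> represents the coset corresponding to \<open>1\<close>; the two
  conditions are injectivity and surjectivity of its powers modulo \<open>N\<close>.\<close>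

lemma (in comm_group) Mod_iso_integer_group_iff:
  assumes N: "subgroup N G"
  shows "G Mod N \<cong> integer_group \<longleftrightarrow>
    (\<exists>y\<in>carrier G. (\<forall>k::int. y [^] k \<in> N \<longrightarrow> k = 0) \<and> (\<forall>z\<in>carrier G. \<exists>k::int. z \<otimes> inv (y [^] k) \<in> N))"
proof -
  interpret normal N G
    using N by (rule subgroup_imp_normal)
  have Mod: "Group.group (G Mod N)"
    by (rule factorgroup_is_group)
  interpret q: group_hom G "G Mod N" "\<lambda>x. N #> x"
    using r_coset_hom_Mod Mod is_group by (simp add: group_hom_def group_hom_axioms_def)
  have coset_eq_iff: "N #> x = N #> y \<longleftrightarrow> x \<otimes> inv y \<in> N" if "x \<in> carrier G" "y \<in> carrier G" for x y
    using that N subset coset_mult_inv1 [of N x y] coset_mult_inv2 [of N x y]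
      coset_join1 [of N "x \<otimes> inv y"] coset_join2 [of "x \<otimes> inv y" N] by auto
  have coset_one_iff: "N #> x = N \<longleftrightarrow> x \<in> N" if "x \<in> carrier G" for x
    using that N coset_join1 coset_join2 by blast
  show ?thesis
  proof
    assume "G Mod N \<cong> integer_group"
    then obtain f where f: "f \<in> Group.iso integer_group (G Mod N)"
      using group.iso_sym [OF Mod] by (auto simp: is_iso_def)
    interpret f: group_hom integer_group "G Mod N" f
      using f Mod by (simp add: group_hom_def group_hom_axioms_def iso_def)
    have surj: "carrier (G Mod N) \<subseteq> range f" and inj: "\<And>k. f k = N \<Longrightarrow> k = 0"
      using f unfolding f.iso_iff by auto
    obtain y where y: "y \<in> carrier G" "f 1 = N #> y"
      using f.hom_closed [of 1] by (auto simp: carrier_FactGroup)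
    have fk: "f k = N #> (y [^] k)" for k
      using f.hom_int_pow [of 1 k] q.hom_int_pow [OF y(1), of k] y by simp
    have "\<exists>k::int. z \<otimes> inv (y [^] k) \<in> N" if z: "z \<in> carrier G" for z
    proof -
      obtain k where "N #> z = f k"
        using surj z by (auto simp: carrier_FactGroup)
      then have "z \<otimes> inv (y [^] k) \<in> N"
        using coset_eq_iff z y fk by simp
      then show ?thesis
        by blast
    qed
    moreover have "k = 0" if "y [^] k \<in> N" for k :: int
      using that inj fk coset_one_iff y by simp
    ultimately show "\<exists>y\<in>carrier G. (\<forall>k::int. y [^] k \<in> N \<longrightarrow> k = 0) \<and> (\<forall>z\<in>carrier G. \<exists>k::int. z \<otimes> inv (y [^] k) \<in> N)"
      using y by blast
  next
    assume "\<exists>y\<in>carrier G. (\<forall>k::int. y [^] k \<in> N \<longrightarrow> k = 0) \<and> (\<forall>z\<in>carrier G. \<exists>k::int. z \<otimes> inv (y [^] k) \<in> N)"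
    then obtain y where y: "y \<in> carrier G" "\<And>k::int. y [^] k \<in> N \<Longrightarrow> k = 0"
      "\<And>z. z \<in> carrier G \<Longrightarrow> \<exists>k::int. z \<otimes> inv (y [^] k) \<in> N"
      by blast
    define f where "f = (\<lambda>k::int. N #> (y [^] k))"
    have "f \<in> hom integer_group (G Mod N)"
      using Group.hom_compose [OF hom_integer_group_pow [OF y(1)] r_coset_hom_Mod] by (simp add: f_def comp_def)
    then interpret f: group_hom integer_group "G Mod N" f
      using Mod by (simp add: group_hom_def group_hom_axioms_def)
    have "f \<in> Group.iso integer_group (G Mod N)"
      unfolding f.iso_iff
    proof
      show "carrier (G Mod N) \<subseteq> f ` carrier integer_group"
      proof
        fix c assume "c \<in> carrier (G Mod N)"
        then obtain z where z: "z \<in> carrier G" "c = N #> z"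
          by (auto simp: carrier_FactGroup)
        then obtain k :: int where "z \<otimes> inv (y [^] k) \<in> N"
          using y(3) by blast
        then have "c = f k"
          using coset_eq_iff z y(1) by (simp add: f_def)
        then show "c \<in> f ` carrier integer_group"
          by simp
      qed
      show "\<forall>k\<in>carrier integer_group. f k = \<one>\<^bsub>G Mod N\<^esub> \<longrightarrow> k = \<one>\<^bsub>integer_group\<^esub>"
        using y(1,2) coset_one_iff by (simp add: f_def)
    qed
    then have "integer_group \<cong> G Mod N"
      by (auto simp: is_iso_def)
    then show "G Mod N \<cong> integer_group"
      using group.iso_sym [OF group_integer_group] by blast
  qed
qed

section \<open>Convex subgroups of an ordered group\<close>

lemma nsmul_mono:
  fixes x y :: "'g::linordered_ab_group_add"
  shows "x \<le> y \<Longrightarrow> nsmul n x \<le> nsmul n y"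
  by (cases "n = 0") (auto simp: nsmul_le_iff)

lemma nsmul_nonneg: "0 \<le> x \<Longrightarrow> 0 \<le> nsmul n (x::'g::linordered_ab_group_add)"
  using nsmul_mono [of 0 x n] by simp

lemma nsmul_mono_left:
  fixes x :: "'g::linordered_ab_group_add"
  assumes "0 \<le> x" "m \<le> n"
  shows "nsmul m x \<le> nsmul n x"
proof -
  obtain k where "n = m + k"
    using assms le_Suc_ex by blast
  then show ?thesis
    using nsmul_nonneg [OF assms(1), of k] by (simp add: nsmul_plus)
qed

lemma nsmul_diff: "nsmul n (x - y) = nsmul n x - nsmul n y"
  using nsmul_add [of n x "- y"] by (simp add: nsmul_uminus)

lemma nsmul_1 [simp]: "nsmul 1 x = x" "nsmul (Suc 0) x = x"
  by (simp_all add: nsmul_Suc)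

locale value_subgroup =
  fixes \<Gamma> :: "'g::linordered_ab_group_add set"
  assumes zero_mem [simp]: "0 \<in> \<Gamma>" and diff_mem: "x \<in> \<Gamma> \<Longrightarrow> y \<in> \<Gamma> \<Longrightarrow> x - y \<in> \<Gamma>"
begin

lemma uminus_mem: "x \<in> \<Gamma> \<Longrightarrow> - x \<in> \<Gamma>"
  using diff_mem [of 0 x] by simp

lemma add_mem: "x \<in> \<Gamma> \<Longrightarrow> y \<in> \<Gamma> \<Longrightarrow> x + y \<in> \<Gamma>"
  using diff_mem [of x "- y"] uminus_mem by simp

lemma nsmul_mem: "x \<in> \<Gamma> \<Longrightarrow> nsmul n x \<in> \<Gamma>"
  by (induction n) (auto simp: nsmul_Suc add_mem)

abbreviation G :: "'g monoid" where
  "G \<equiv> \<lparr>carrier = \<Gamma>, monoid.mult = (+), one = 0\<rparr>"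

lemma comm_group_G: "comm_group G"
  by (rule comm_groupI) (auto simp: add_mem add_ac intro!: bexI [of _ "- _"] uminus_mem)

lemma inv_G: "x \<in> \<Gamma> \<Longrightarrow> inv\<^bsub>G\<^esub> x = - x"
proof -
  interpret comm_group G
    by (rule comm_group_G)
  show "x \<in> \<Gamma> \<Longrightarrow> inv\<^bsub>G\<^esub> x = - x"
    by (intro inv_equality) (auto simp: uminus_mem)
qed

lemma nat_pow_G: "x [^]\<^bsub>G\<^esub> (n::nat) = nsmul n x"
  by (induction n) (auto simp: nsmul_Suc add.commute)

lemma int_pow_G: "x \<in> \<Gamma> \<Longrightarrow> x [^]\<^bsub>G\<^esub> (k::int) = (if k < 0 then - nsmul (nat (- k)) x else nsmul (nat k) x)"
  by (simp add: int_pow_def2 inv_G nat_pow_G nsmul_mem)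

lemma subgroup_iff: "subgroup C G \<longleftrightarrow> C \<subseteq> \<Gamma> \<and> value_subgroup C"
proof
  assume C: "subgroup C G"
  have sub: "C \<subseteq> \<Gamma>"
    using subgroup.subset [OF C] by simp
  have "x - y \<in> C" if "x \<in> C" "y \<in> C" for x y
  proof -
    have "x \<otimes>\<^bsub>G\<^esub> inv\<^bsub>G\<^esub> y \<in> C"
      using that by (intro subgroup.m_closed [OF C] subgroup.m_inv_closed [OF C])
    moreover have "y \<in> \<Gamma>"
      using sub that by blast
    ultimately show ?thesis
      by (simp add: inv_G)
  qed
  then show "C \<subseteq> \<Gamma> \<and> value_subgroup C"
    using sub subgroup.one_closed [OF C] by (simp add: value_subgroup_def)
next
  assume *: "C \<subseteq> \<Gamma> \<and> value_subgroup C"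
  then interpret C: value_subgroup C
    by simp
  interpret comm_group G
    by (rule comm_group_G)
  show "subgroup C G"
  proof (rule subgroupI)
    show "C \<subseteq> carrier G" "C \<noteq> {}"
      using * C.zero_mem by (simp, blast)
    fix x y assume "x \<in> C" "y \<in> C"
    moreover from this have "x \<in> \<Gamma>"
      using * by blast
    ultimately show "inv\<^bsub>G\<^esub> x \<in> C" "x \<otimes>\<^bsub>G\<^esub> y \<in> C"
      by (simp_all add: inv_G C.uminus_mem C.add_mem)
  qed
qed

lemma convex_subgroup_iff:
  "convex_subgroup C G \<longleftrightarrow> C \<subseteq> \<Gamma> \<and> value_subgroup C \<and> (\<forall>a\<in>C. \<forall>b\<in>\<Gamma>. 0 \<le> b \<and> b \<le> a \<longrightarrow> b \<in> C)"
  by (auto simp: convex_subgroup_def subgroup_iff)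

text \<open>Convexity makes injectivity automatic: the positive multiples of a positive
  \<open>y\<close> outside \<open>C\<close> are at least \<open>y\<close>, so they stay outside
  \<open>C\<close>. A generator may be taken positive by changing its sign.\<close>

lemma quotient_iso_integer_group_iff:
  assumes C: "convex_subgroup C G" "convex_subgroup E G" "C \<subseteq> E"
  shows "(G\<lparr>carrier := E\<rparr> Mod C) \<cong> integer_group \<longleftrightarrow>
    (\<exists>y\<in>E. 0 < y \<and> y \<notin> C \<and> (\<forall>z\<in>E. \<exists>n. z - nsmul n y \<in> C \<or> z + nsmul n y \<in> C))"
proof -
  note C' = C(1,2) [unfolded convex_subgroup_iff]
  interpret C: value_subgroup C
    using C' by blast
  interpret E: value_subgroup E
    using C' by blast
  interpret comm_group E.G
    by (rule E.comm_group_G)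
  have "subgroup C E.G"
    using C C' by (simp add: E.subgroup_iff)
  then have "(G\<lparr>carrier := E\<rparr> Mod C) \<cong> integer_group \<longleftrightarrow>
      (\<exists>y\<in>E. (\<forall>k::int. y [^]\<^bsub>E.G\<^esub> k \<in> C \<longrightarrow> k = 0) \<and> (\<forall>z\<in>E. \<exists>k::int. z - y [^]\<^bsub>E.G\<^esub> k \<in> C))"
    using Mod_iso_integer_group_iff [of C] by (simp add: E.inv_G int_pow_closed [simplified])
  also have "\<dots> \<longleftrightarrow> (\<exists>y\<in>E. 0 < y \<and> y \<notin> C \<and> (\<forall>z\<in>E. \<exists>n. z - nsmul n y \<in> C \<or> z + nsmul n y \<in> C))"
  proof
    assume "\<exists>y\<in>E. (\<forall>k::int. y [^]\<^bsub>E.G\<^esub> k \<in> C \<longrightarrow> k = 0) \<and> (\<forall>z\<in>E. \<exists>k::int. z - y [^]\<^bsub>E.G\<^esub> k \<in> C)"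
    then obtain y where y: "y \<in> E" "\<And>k::int. y [^]\<^bsub>E.G\<^esub> k \<in> C \<Longrightarrow> k = 0"
      "\<And>z. z \<in> E \<Longrightarrow> \<exists>k::int. z - y [^]\<^bsub>E.G\<^esub> k \<in> C"
      by blast
    have "y \<notin> C"
      using y(2) [of 1] y(1) by (auto simp: E.int_pow_G)
    then have "y \<noteq> 0"
      using C.zero_mem by auto
    have n: "\<exists>n. z - nsmul n y \<in> C \<or> z + nsmul n y \<in> C" if z: "z \<in> E" for z
    proof -
      obtain k :: int where "z - y [^]\<^bsub>E.G\<^esub> k \<in> C"
        using y(3) z by blast
      then show ?thesis
        using y(1) by (auto simp: E.int_pow_G split: if_splits)
    qed
    show "\<exists>y\<in>E. 0 < y \<and> y \<notin> C \<and> (\<forall>z\<in>E. \<exists>n. z - nsmul n y \<in> C \<or> z + nsmul n y \<in> C)"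
    proof (cases "0 < y")
      case True
      then show ?thesis
        using y \<open>y \<notin> C\<close> n by blast
    next
      case False
      then have "0 < - y" "- y \<in> E" "- y \<notin> C"
        using \<open>y \<noteq> 0\<close> y(1) \<open>y \<notin> C\<close> E.uminus_mem C.uminus_mem [of "- y"] by auto
      moreover have "\<exists>n. z - nsmul n (- y) \<in> C \<or> z + nsmul n (- y) \<in> C" if "z \<in> E" for z
        using n [OF that] by (auto simp: nsmul_uminus)
      ultimately show ?thesis
        by blast
    qed
  next
    assume "\<exists>y\<in>E. 0 < y \<and> y \<notin> C \<and> (\<forall>z\<in>E. \<exists>n. z - nsmul n y \<in> C \<or> z + nsmul n y \<in> C)"
    then obtain y where y: "y \<in> E" "0 < y" "y \<notin> C" "\<And>z. z \<in> E \<Longrightarrow> \<exists>n. z - nsmul n y \<in> C \<or> z + nsmul n y \<in> C"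
      by blast
    have pos: "nsmul n y \<notin> C" if "n > 0" for n
    proof
      assume "nsmul n y \<in> C"
      moreover have "y \<le> nsmul n y"
        using nsmul_mono_left [of y 1 n] y that by simp
      ultimately show False
        using y C' by (meson less_imp_le subsetD)
    qed
    have "k = 0" if "y [^]\<^bsub>E.G\<^esub> k \<in> C" for k :: int
    proof (rule ccontr)
      assume "k \<noteq> 0"
      then show False
        using that pos [of "nat k"] pos [of "nat (- k)"] C.uminus_mem [of "- nsmul (nat (- k)) y"] y(1)
        by (auto simp: E.int_pow_G split: if_splits)
    qed
    moreover have "\<exists>k::int. z - y [^]\<^bsub>E.G\<^esub> k \<in> C" if "z \<in> E" for z
    proof -
      obtain n where n: "z - nsmul n y \<in> C \<or> z + nsmul n y \<in> C"
        using y(4) \<open>z \<in> E\<close> by metis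
      then show ?thesis
      proof
        assume "z - nsmul n y \<in> C"
        then show ?thesis
          using y(1) by (intro exI [of _ "int n"]) (simp add: E.int_pow_G)
      next
        assume "z + nsmul n y \<in> C"
        then show ?thesis
          using y(1) by (intro exI [of _ "- int n"]) (auto simp: E.int_pow_G)
      qed
    qed
    ultimately show "\<exists>y\<in>E. (\<forall>k::int. y [^]\<^bsub>E.G\<^esub> k \<in> C \<longrightarrow> k = 0) \<and> (\<forall>z\<in>E. \<exists>k::int. z - y [^]\<^bsub>E.G\<^esub> k \<in> C)"
      using y(1) by blast
  qed
  finally show ?thesis .
qed

text \<open>If no element of \<open>\<Gamma>\<close> in the archimedean class of \<open>a\<close> is much smaller than \<open>a\<close>, then the
  class has an element that is minimal modulo infinitesimals, and the quotient is \<open>\<int>\<close>.\<close>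

lemma ex_small_element:
  assumes no_Z: "\<And>C E. convex_subgroup C G \<Longrightarrow> convex_subgroup E G \<Longrightarrow> C \<subset> E \<Longrightarrow>
      \<not> (G\<lparr>carrier := E\<rparr> Mod C) \<cong> integer_group"
    and a: "a \<in> \<Gamma>" "0 < a"
  obtains x m where "x \<in> \<Gamma>" "0 < x" "nsmul N x \<le> a" "a \<le> nsmul m x"
proof (rule ccontr)
  note small = that
  assume "\<not> thesis"
  then have *: "a < nsmul N x" if x: "x \<in> \<Gamma>" "0 < x" "a \<le> nsmul m x" for x m
    using small x by (meson not_le)
  \<comment> \<open>\<open>C\<close> consists of the elements infinitesimal with respect to
    \<open>a\<close> and \<open>E\<close> of those bounded by a multiple of \<open>a\<close>; the
    quotient of \<open>E\<close> by \<open>C\<close> is archimedean.\<close>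
  define C where "C = {x \<in> \<Gamma>. \<forall>n. nsmul n x < a \<and> nsmul n (- x) < a}"
  define E where "E = {x \<in> \<Gamma>. \<exists>n. x \<le> nsmul n a \<and> - x \<le> nsmul n a}"
  have sum_less: "nsmul n (x + y) < a" if "\<And>n. nsmul n x < a" "\<And>n. nsmul n y < a" for x y n
  proof -
    have "nsmul n (x + y) \<le> nsmul n (max x y + max x y)"
      by (intro nsmul_mono add_mono) auto
    also have "\<dots> = nsmul (n + n) (max x y)"
      by (simp add: nsmul_add nsmul_plus)
    also have "\<dots> < a"
      using that by (auto simp: max_def)
    finally show ?thesis .
  qed
  have C: "convex_subgroup C G"
    unfolding convex_subgroup_iff
  proof (intro conjI ballI impI)
    show "value_subgroup C"
    proof
      fix x y assume xy: "x \<in> C" "y \<in> C"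
      then show "x - y \<in> C"
        using sum_less [of x "- y"] sum_less [of "- x" y] diff_mem by (auto simp: C_def)
    qed (use a in \<open>simp add: C_def\<close>)
    fix x y assume xy: "x \<in> C" "y \<in> \<Gamma>" "0 \<le> y \<and> y \<le> x"
    have "nsmul n y < a \<and> nsmul n (- y) < a" for n
      using xy nsmul_mono [of y x n] nsmul_mono [of "- y" 0 n] a by (force simp: C_def intro: le_less_trans)
    then show "y \<in> C"
      using xy by (simp add: C_def)
  qed (auto simp: C_def)
  have E: "convex_subgroup E G"
    unfolding convex_subgroup_iff
  proof (intro conjI ballI impI)
    show "value_subgroup E"
    proof
      show "0 \<in> E"
        by (auto simp: E_def intro: exI [of _ 0])
      fix x y assume xy: "x \<in> E" "y \<in> E"
      then obtain n m where nm: "x \<le> nsmul n a" "- x \<le> nsmul n a" "y \<le> nsmul m a" "- y \<le> nsmul m a"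
        by (auto simp: E_def)
      then have "x - y \<le> nsmul (n + m) a" "- (x - y) \<le> nsmul (n + m) a"
        using add_mono [OF nm(1,4)] add_mono [OF nm(2,3)] by (simp_all add: nsmul_plus)
      then show "x - y \<in> E"
        using xy diff_mem unfolding E_def by blast
    qed
    fix x y assume xy: "x \<in> E" "y \<in> \<Gamma>" "0 \<le> y \<and> y \<le> x"
    then obtain n where "x \<le> nsmul n a"
      by (auto simp: E_def)
    moreover have "- y \<le> nsmul n a"
      using xy nsmul_nonneg [of a n] a by (meson less_imp_le neg_le_0_iff_le order_trans)
    ultimately show "y \<in> E"
      using xy order_trans unfolding E_def by blast
  qed (auto simp: E_def)
  interpret C: value_subgroup C
    using C by (simp add: convex_subgroup_iff)
  interpret E: value_subgroup E
    using E by (simp add: convex_subgroup_iff)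
  have pos_C: "x \<in> C \<longleftrightarrow> (\<forall>m. nsmul m x < a)" if "x \<in> \<Gamma>" "0 \<le> x" for x
    using that a nsmul_mono [of "- x" 0] by (force simp: C_def intro: le_less_trans)
  have "a \<in> E"
    using a nsmul_1 [of a] by (auto simp: E_def intro!: exI [of _ 1])
  have "a \<notin> C"
    by (auto simp: C_def intro: exI [of _ 1])
  have "C \<subseteq> E"
  proof
    fix x assume "x \<in> C"
    then have "x \<in> \<Gamma>" "nsmul 1 x < a" "nsmul 1 (- x) < a"
      unfolding C_def by blast+
    then show "x \<in> E"
      by (auto simp: E_def intro!: exI [of _ 1])
  qed
  then have "C \<subset> E"
    using \<open>a \<in> E\<close> \<open>a \<notin> C\<close> by blast
  \<comment> \<open>Minimising \<open>k\<close> replaces the choice of a least \<open>y\<close>,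
    which need exist only modulo \<open>C\<close>. If \<open>y\<close> were the sum of two positive
    elements outside \<open>C\<close>, each would have an \<open>N\<close>-fold multiple above
    \<open>a\<close>, so either of them would satisfy \<open>P\<close> with a smaller
    \<open>k\<close>.\<close>
  define P where "P k y \<longleftrightarrow> y \<in> E \<and> 0 < y \<and> y \<notin> C \<and> nsmul N y < nsmul k a" for k y
  have "P (Suc N) a"
    using \<open>a \<in> E\<close> \<open>a \<notin> C\<close> a by (simp add: P_def nsmul_Suc)
  then obtain k where k: "\<exists>y. P k y" and k_min: "\<And>k'. \<exists>y. P k' y \<Longrightarrow> k \<le> k'"
    using ex_has_least_nat [of "\<lambda>k. \<exists>y. P k y" "Suc N" id] by auto
  then obtain y where y: "y \<in> E" "0 < y" "y \<notin> C" "nsmul N y < nsmul k a"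
    by (auto simp: P_def)
  have y\<Gamma>: "y \<in> \<Gamma>"
    using y by (simp add: E_def)
  have large: "a < nsmul N x" if x: "x \<in> \<Gamma>" "0 < x" "x \<notin> C" for x
  proof -
    obtain m where "\<not> nsmul m x < a"
      using x pos_C [of x] by auto
    then show ?thesis
      using * [of x m] x by simp
  qed
  have minimal: "z \<in> C \<or> y - z \<in> C" if z: "z \<in> \<Gamma>" "0 \<le> z" "z < y" for z
  proof (rule ccontr)
    assume "\<not> ?thesis"
    then have nC: "z \<notin> C" "y - z \<notin> C"
      by auto
    then have "z \<noteq> 0"
      using C.zero_mem by auto
    have 1: "a < nsmul N z" "a < nsmul N (y - z)"
      using large z nC \<open>z \<noteq> 0\<close> y\<Gamma> diff_mem by auto
    obtain k' where k': "k = Suc k'"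
      using y nsmul_nonneg [of y N] by (cases k) (force simp: not_less [symmetric])+
    have "nsmul N z + a < nsmul N z + nsmul N (y - z)"
      using 1 by simp
    also have "\<dots> = nsmul N y"
      by (simp add: nsmul_diff)
    also have "\<dots> < nsmul k' a + a"
      using y by (simp add: k' nsmul_Suc add.commute)
    finally have "nsmul N z < nsmul k' a"
      by simp
    moreover have "z \<in> E"
      using E z y unfolding convex_subgroup_iff by (meson less_imp_le)
    ultimately have "P k' z"
      using z nC \<open>z \<noteq> 0\<close> by (simp add: P_def)
    then show False
      using k_min [of k'] k' by auto
  qed
  obtain m where m: "a \<le> nsmul m y"
    using y y\<Gamma> pos_C by (meson less_imp_le not_le)
  have cover: "\<exists>n. z - nsmul n y \<in> C" if z: "z \<in> E" "0 \<le> z" for z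
  proof -
    obtain n where "z \<le> nsmul n a"
      using z by (auto simp: E_def)
    also have "\<dots> \<le> nsmul (n * m) y"
      using m by (simp add: nsmul_mult nsmul_mono)
    also have "\<dots> < nsmul (Suc (n * m)) y"
      using y by (simp add: nsmul_Suc)
    finally have ex: "\<exists>j. z < nsmul (Suc j) y"
      by blast
    define j where "j = (LEAST j. z < nsmul (Suc j) y)"
    have j: "z < nsmul (Suc j) y"
      unfolding j_def using ex by (rule LeastI_ex)
    have "nsmul j y \<le> z"
    proof (cases j)
      case (Suc i)
      then show ?thesis
        using not_less_Least [of i "\<lambda>j. z < nsmul (Suc j) y"] by (simp add: j_def)
    qed (use z in simp)
    then have "z - nsmul j y \<in> C \<or> y - (z - nsmul j y) \<in> C"
      using j z y\<Gamma> diff_mem nsmul_mem by (intro minimal) (auto simp: E_def nsmul_Suc algebra_simps)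
    then show ?thesis
    proof
      assume "y - (z - nsmul j y) \<in> C"
      then have "z - nsmul (Suc j) y \<in> C"
        using C.uminus_mem by (force simp: nsmul_Suc algebra_simps)
      then show ?thesis
        by blast
    qed blast
  qed
  have "\<exists>n. z - nsmul n y \<in> C \<or> z + nsmul n y \<in> C" if z: "z \<in> E" for z
  proof (cases "0 \<le> z")
    case False
    then have "0 \<le> - z" "- z \<in> E"
      using E.uminus_mem z by auto
    then obtain n where "- z - nsmul n y \<in> C"
      using cover by blast
    then have "z + nsmul n y \<in> C"
      using C.uminus_mem by (force simp: algebra_simps)
    then show ?thesis
      by blast
  qed (use cover z in blast)
  then have "(G\<lparr>carrier := E\<rparr> Mod C) \<cong> integer_group"
    unfolding quotient_iso_integer_group_iff [OF C E \<open>C \<subseteq> E\<close>] using y by blast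
  then show False
    using no_Z C E \<open>C \<subset> E\<close> by blast
qed

end


section \<open>Valuations of the base field\<close>

locale field_valuation =
  fixes v :: "'a::field \<Rightarrow> 'g::linordered_ab_group_add"
  assumes v_mult: "x \<noteq> 0 \<Longrightarrow> y \<noteq> 0 \<Longrightarrow> v (x * y) = v x + v y"
    and v_add: "x \<noteq> 0 \<Longrightarrow> y \<noteq> 0 \<Longrightarrow> x + y \<noteq> 0 \<Longrightarrow> min (v x) (v y) \<le> v (x + y)"
begin

lemma v_1 [simp]: "v 1 = 0"
  using v_mult [of 1 1] by simp

lemma v_uminus [simp]: "v (- x) = v x"
proof (cases "x = 0")
  case False
  have "v (-1) + v (-1) = 0"
    using v_mult [of "-1" "-1"] by simp
  then have "v (-1) = 0"
    by simp
  then show ?thesis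
    using v_mult [of "-1" x] False by simp
qed simp

lemma v_inverse: "x \<noteq> 0 \<Longrightarrow> v (inverse x) = - v x"
  using v_mult [of x "inverse x"] by (simp add: eq_neg_iff_add_eq_0 add.commute)

lemma v_divide: "x \<noteq> 0 \<Longrightarrow> y \<noteq> 0 \<Longrightarrow> v (x / y) = v x - v y"
  by (simp add: divide_inverse v_mult v_inverse)

lemma v_power: "x \<noteq> 0 \<Longrightarrow> v (x ^ n) = nsmul n (v x)"
  by (induction n) (auto simp: v_mult nsmul_Suc)

text \<open>As \<open>v 0\<close> is unspecified, this and \<open>val_less\<close> build in the
  convention that it is infinite.\<close>

definition val_le :: "'g \<Rightarrow> 'a \<Rightarrow> bool" where
  "val_le \<gamma> x \<longleftrightarrow> x = 0 \<or> \<gamma> \<le> v x"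

definition val_less :: "'g \<Rightarrow> 'a \<Rightarrow> bool" where
  "val_less \<gamma> x \<longleftrightarrow> x = 0 \<or> \<gamma> < v x"

lemma val_le_0 [simp]: "val_le \<gamma> 0" and val_less_0 [simp]: "val_less \<gamma> 0"
  by (simp_all add: val_le_def val_less_def)

lemma val_le_uminus [simp]: "val_le \<gamma> (- x) \<longleftrightarrow> val_le \<gamma> x"
  and val_less_uminus [simp]: "val_less \<gamma> (- x) \<longleftrightarrow> val_less \<gamma> x"
  by (simp_all add: val_le_def val_less_def)

lemma val_le_add: "val_le \<gamma> x \<Longrightarrow> val_le \<gamma> y \<Longrightarrow> val_le \<gamma> (x + y)"
  using v_add [of x y] by (cases "x = 0 \<or> y = 0 \<or> x + y = 0") (auto simp: val_le_def min_def split: if_splits)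

lemma val_less_add: "val_less \<gamma> x \<Longrightarrow> val_less \<gamma> y \<Longrightarrow> val_less \<gamma> (x + y)"
  using v_add [of x y] by (cases "x = 0 \<or> y = 0 \<or> x + y = 0") (auto simp: val_less_def min_def split: if_splits)

lemma val_le_diff: "val_le \<gamma> x \<Longrightarrow> val_le \<gamma> y \<Longrightarrow> val_le \<gamma> (x - y)"
  using val_le_add [of \<gamma> x "- y"] by simp

lemma val_less_diff: "val_less \<gamma> x \<Longrightarrow> val_less \<gamma> y \<Longrightarrow> val_less \<gamma> (x - y)"
  using val_less_add [of \<gamma> x "- y"] by simp

lemma val_le_mult: "val_le \<gamma> x \<Longrightarrow> val_le \<delta> y \<Longrightarrow> val_le (\<gamma> + \<delta>) (x * y)"
  by (cases "x = 0 \<or> y = 0") (auto simp: val_le_def v_mult add_mono)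

lemma val_less_mult: "val_less \<gamma> x \<Longrightarrow> val_le \<delta> y \<Longrightarrow> val_less (\<gamma> + \<delta>) (x * y)"
  by (cases "x = 0 \<or> y = 0") (auto simp: val_le_def val_less_def v_mult add_less_le_mono)

lemma val_less_imp_le: "val_less \<gamma> x \<Longrightarrow> val_le \<gamma> x"
  by (auto simp: val_le_def val_less_def)

lemma val_le_mono: "val_le \<gamma> x \<Longrightarrow> \<delta> \<le> \<gamma> \<Longrightarrow> val_le \<delta> x"
  by (auto simp: val_le_def)

lemma val_less_mono: "val_less \<gamma> x \<Longrightarrow> \<delta> \<le> \<gamma> \<Longrightarrow> val_less \<delta> x"
  by (auto simp: val_less_def)

lemma v_add_strict:
  assumes "x \<noteq> 0" "val_less (v x) y"
  shows "x + y \<noteq> 0" "v (x + y) = v x"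
proof -
  show nz: "x + y \<noteq> 0"
  proof
    assume "x + y = 0"
    then have "y = - x"
      by (simp add: eq_neg_iff_add_eq_0 add.commute)
    then show False
      using assms by (simp add: val_less_def)
  qed
  show "v (x + y) = v x"
  proof (cases "y = 0")
    case False
    then have "v x < v y"
      using assms by (simp add: val_less_def)
    moreover have "min (v x) (v y) \<le> v (x + y)"
      using v_add assms nz False by blast
    moreover have "min (v (x + y)) (v y) \<le> v x"
      using v_add [of "x + y" "- y"] assms nz False by simp
    ultimately show ?thesis
      by (auto simp: min_def split: if_splits)
  qed simp
qed

definition value_set :: "'g set" where
  "value_set = v ` (UNIV - {0})"

lemma v_mem_value_set [simp]: "x \<noteq> 0 \<Longrightarrow> v x \<in> value_set"
  by (simp add: value_set_def)

lemma value_setE: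
  assumes "\<gamma> \<in> value_set"
  obtains x where "x \<noteq> 0" "\<gamma> = v x"
  using assms by (auto simp: value_set_def)

sublocale value_set: value_subgroup "value_set"
proof
  show "0 \<in> value_set"
    using v_mem_value_set [of 1] by simp
  fix \<gamma> \<delta> assume "\<gamma> \<in> value_set" "\<delta> \<in> value_set"
  then obtain x y where "\<gamma> = v x" "x \<noteq> 0" "\<delta> = v y" "y \<noteq> 0"
    by (elim value_setE)
  then show "\<gamma> - \<delta> \<in> value_set"
    using v_mem_value_set [of "x / y"] by (simp add: v_divide)
qed

lemma value_group_base_field: "value_group base_field v = value_set.G"
  by (simp add: value_group_def value_set_def)

abbreviation valuation_carrier :: "'a set" where
  "valuation_carrier \<equiv> {x. val_le 0 x}"

lemma valuation_ring_base_field: "valuation_ring base_field v = base_field\<lparr>carrier := valuation_carrier\<rparr>"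
  by (simp add: valuation_ring_def val_le_def)

lemma valuation_ideal_base_field: "valuation_ideal base_field v = {x. val_less 0 x}"
  by (simp add: valuation_ideal_def val_less_def)

end

lemma valuation_base_field_iff: "valuation base_field v \<longleftrightarrow> field_valuation v"
  by (auto simp: valuation_def field_valuation_def)

lemma prime_if_ord_generates:
  assumes p: "p > 0" and iff: "\<And>n. P n \<longleftrightarrow> p dvd n" and "\<not> P 1"
    and mult: "\<And>m n. P (m * n) \<Longrightarrow> P m \<or> P n"
  shows "Factorial_Ring.prime (p::nat)"
proof -
  have "Factorial_Ring.prime_elem p"
  proof (rule prime_elemI)
    show "p \<noteq> 0" "\<not> p dvd 1"
      using p \<open>\<not> P 1\<close> unfolding iff by auto
    show "p dvd m \<or> p dvd n" if "p dvd m * n" for m n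
      using that mult [of m n] unfolding iff by blast
  qed
  then show ?thesis
    by (rule Factorial_Ring.primeI) simp
qed

context field_valuation
begin

lemma val_le_1 [simp]: "val_le 0 1"
  by (simp add: val_le_def)

lemma val_le_of_nat [simp]: "val_le 0 (of_nat n)"
  by (induction n) (simp_all add: val_le_add)

lemma ring_characteristic_residue_field_dvd_iff:
  "ring_characteristic (residue_field base_field v) dvd n \<longleftrightarrow> val_less 0 (of_nat n)"
proof -
  define A where "A = (base_field :: 'a ring)\<lparr>carrier := valuation_carrier\<rparr>"
  define I where "I = {x. val_less 0 x}"
  have "subring valuation_carrier (base_field :: 'a ring)"
    by (rule R.subringI) (use val_le_mult [of 0 _ 0] in \<open>simp_all add: val_le_add\<close>)
  then interpret A: ring A
    unfolding A_def by (rule R.subring_is_ring)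
  have A_simps: "carrier A = valuation_carrier" "x \<otimes>\<^bsub>A\<^esub> y = x * y" "x \<oplus>\<^bsub>A\<^esub> y = x + y" "\<one>\<^bsub>A\<^esub> = 1" "\<zero>\<^bsub>A\<^esub> = 0" for x y
    by (simp_all add: A_def)
  have "ideal I A"
  proof (rule idealI)
    have inv_A: "\<ominus>\<^bsub>A\<^esub> x = - x" if "x \<in> carrier A" for x
      by (rule A.minus_equality) (use that in \<open>auto simp: A_simps\<close>)
    show "subgroup I (add_monoid A)"
    proof (rule group.subgroupI [OF A.add.is_group])
      show "I \<noteq> {}"
        by (auto simp: I_def intro: exI [of _ 0])
      show "inv\<^bsub>add_monoid A\<^esub> x \<in> I" if "x \<in> I" for x
        using that inv_A [of x] by (simp add: a_inv_def I_def A_simps val_less_imp_le)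
    qed (auto simp: A_simps I_def val_less_add intro: val_less_imp_le)
    show "x \<otimes>\<^bsub>A\<^esub> a \<in> I" "a \<otimes>\<^bsub>A\<^esub> x \<in> I" if "a \<in> I" "x \<in> carrier A" for a x
      using that val_less_mult [of 0 a 0 x] by (auto simp: A_simps I_def mult.commute)
  qed (rule A.ring_axioms)
  then interpret I: ideal I A .
  interpret Q: ring "A Quot I"
    by (rule I.quotient_is_ring)
  have pow: "\<one>\<^bsub>A Quot I\<^esub> [^]\<^bsub>add_monoid (A Quot I)\<^esub> n = I +>\<^bsub>A\<^esub> (of_nat n)" for n :: nat
  proof (induction n)
    case 0
    show ?case
      using A.a_rcos_zero [OF I.is_ideal, of 0] by (simp add: A_simps I_def FactRing_def)
  next
    case (Suc n)
    then show ?case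
      using I.a_rcos_sum [of "of_nat n" 1]
      by (simp add: FactRing_def A_simps add.commute)
  qed
  have mem: "I +>\<^bsub>A\<^esub> x = I \<longleftrightarrow> x \<in> I" if "x \<in> valuation_carrier" for x
    using A.a_rcos_zero [OF I.is_ideal, of x] I.rcos_const_imp_mem [of x] that by (auto simp: A_simps)
  have "ring_characteristic (residue_field base_field v) = group.ord (add_monoid (A Quot I)) \<one>\<^bsub>A Quot I\<^esub>"
    by (simp add: ring_characteristic_def residue_field_def valuation_ring_base_field
      valuation_ideal_base_field A_def I_def)
  moreover have "\<one>\<^bsub>A Quot I\<^esub> \<in> carrier (A Quot I)"
    by simp
  ultimately show ?thesis
    using Q.add.pow_eq_id [of "\<one>\<^bsub>A Quot I\<^esub>" n] group.pow_eq_id [OF Q.add.is_group, of "\<one>\<^bsub>A Quot I\<^esub>" n] pow [of n] mem [of "of_nat n"] val_le_of_nat [of n]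
    by (simp add: I_def FactRing_def)
qed

lemma prime_ring_characteristic_residue_field:
  assumes "ring_characteristic (residue_field base_field v) = p" "p > 0"
  shows "Factorial_Ring.prime p"
proof (rule prime_if_ord_generates)
  show "val_less 0 (of_nat n) \<longleftrightarrow> p dvd n" for n
    using ring_characteristic_residue_field_dvd_iff [of n] assms by simp
  show "\<not> val_less 0 (of_nat 1)"
    by (simp add: val_less_def)
  show "val_less 0 (of_nat m) \<or> val_less 0 (of_nat n)" if "val_less 0 (of_nat (m * n))" for m n
    using that val_le_of_nat [of m] val_le_of_nat [of n] by (cases "of_nat m = (0::'a) \<or> of_nat n = (0::'a)") (auto simp: val_less_def val_le_def v_mult)
qed (rule assms)

text \<open>In positive characteristic, \<open>CHAR('a)\<close> vanishes in the field and hence in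
  the residue field, so \<open>p\<close> divides this prime and equals it. The lemma links the
  distinction by \<open>CHAR\<close> in the final statement with the distinction by
  \<open>of_nat p = 0\<close> in the proofs.\<close>

lemma char_0_if_residue_char:
  assumes "ring_characteristic (residue_field base_field v) = p" "p > 0" "of_nat p \<noteq> (0::'a)"
  shows "CHAR('a) = 0"
proof (rule ccontr)
  assume "CHAR('a) \<noteq> 0"
  then have "Factorial_Ring.prime CHAR('a)"
    using prime_CHAR_semidom by auto
  moreover have "p dvd CHAR('a)"
    using ring_characteristic_residue_field_dvd_iff [of "CHAR('a)"] assms by simp
  moreover have "p \<noteq> 1"
    using prime_ring_characteristic_residue_field assms by (metis not_prime_1)
  ultimately have "p = CHAR('a)"
    by (auto simp: prime_nat_iff)
  then show False
    using assms by simp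
qed

end

context value_subgroup
begin

lemma quotient_generator_bound:
  assumes C: "convex_subgroup C G" "convex_subgroup E G"
    and y: "y \<in> E" "0 < y" "y \<notin> C" and cover: "\<And>z. z \<in> E \<Longrightarrow> \<exists>n. z - nsmul n y \<in> C \<or> z + nsmul n y \<in> C"
    and g: "g \<in> \<Gamma>" and i: "0 < i" "i < p" and nonneg: "0 \<le> nsmul p g + nsmul i y"
  shows "y \<le> nsmul 2 (nsmul p g + nsmul i y)"
proof (rule ccontr)
  define x where "x = nsmul p g + nsmul i y"
  assume "\<not> ?thesis"
  then have x: "0 \<le> x" "x + x < y"
    using nonneg by (auto simp: x_def numeral_2_eq_2 nsmul_Suc)
  note C' = C [unfolded convex_subgroup_iff]
  interpret C: value_subgroup C
    using C'(1) by simp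
  interpret E: value_subgroup E
    using C'(2) by simp
  have E_convex: "b \<in> E" if "a \<in> E" "b \<in> \<Gamma>" "0 \<le> b" "b \<le> a" for a b
    using conjunct2 [OF conjunct2 [OF C'(2)], rule_format, OF that(1,2)] that(3,4) by simp
  have "y \<in> \<Gamma>"
    using subsetD [OF conjunct1 [OF C'(2)] y(1)] .
  then have y_le: False if "a \<in> C" "y \<le> a" for a
    using conjunct2 [OF conjunct2 [OF C'(1)], rule_format, OF that(1), of y] less_imp_le [OF y(2)] that y by simp
  have "x \<le> x + x"
    using x by simp
  then have "x \<le> y"
    using x(2) by (meson le_less_trans less_imp_le)
  moreover have "x \<in> \<Gamma>"
    using g \<open>y \<in> \<Gamma>\<close> by (simp add: x_def add_mem nsmul_mem)
  ultimately have "x \<in> E"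
    using E_convex [OF y(1)] x(1) by simp
  then have pg: "nsmul p g \<in> E"
    using E.diff_mem [of x "nsmul i y"] E.nsmul_mem [OF y(1)] by (simp add: x_def)
  have "g \<in> E"
  proof (cases "0 \<le> g")
    case True
    then show ?thesis
      using E_convex [OF pg g] nsmul_mono_left [of g 1 p] i by simp
  next
    case False
    then have "- g \<in> E"
      using E_convex [OF E.uminus_mem [OF pg] uminus_mem [OF g]] nsmul_mono_left [of "- g" 1 p] i
      by (simp add: nsmul_uminus)
    then show ?thesis
      using E.uminus_mem [of "- g"] by simp
  qed
  then obtain n where n: "g - nsmul n y \<in> C \<or> g + nsmul n y \<in> C"
    using cover [of g] by metis
  \<comment> \<open>Modulo \<open>C\<close> the element \<open>x\<close> is the multiple of
    \<open>y\<close> by \<open>p * n + i\<close>, which is positive, so \<open>y \<le> x - r\<close>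
    with \<open>r\<close> in \<open>C\<close>. With \<open>x + x < y\<close> this would bound
    \<open>y\<close> by an element of \<open>C\<close>.\<close>
  have pos: False if "g - nsmul n y \<in> C" for n
  proof -
    define r where "r = nsmul p (g - nsmul n y)"
    have "r \<in> C"
      using that by (simp add: r_def C.nsmul_mem)
    have "nsmul 1 y \<le> nsmul (p * n + i) y"
      using i y by (intro nsmul_mono_left) auto
    also have "r + nsmul (p * n + i) y = x"
      by (simp add: x_def r_def nsmul_diff nsmul_plus nsmul_mult)
    then have "nsmul (p * n + i) y = x - r"
      by (simp add: algebra_simps)
    finally have 1: "y \<le> x - r"
      by simp
    have "y + y \<le> (x - r) + (x - r)"
      using 1 by (rule add_mono [OF _ 1])
    also have "\<dots> < y - (r + r)"
      using x by (simp add: algebra_simps)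
    finally have "(y + (r + r)) + y < 0 + y"
      by (simp add: algebra_simps)
    then have "y + (r + r) < 0"
      unfolding add_less_cancel_right .
    then have "y \<le> - (r + r)"
      using diff_strict_right_mono [of "y + (r + r)" 0 "r + r"] by simp
    moreover have "- (r + r) \<in> C"
      using \<open>r \<in> C\<close> C.uminus_mem C.add_mem by blast
    ultimately show False
      using y_le by blast
  qed
  show False
  proof (cases "n = 0 \<or> g - nsmul n y \<in> C")
    case True
    then show ?thesis
      using n pos [of n] by auto
  next
    case False
    \<comment> \<open>Here \<open>x\<close> would be congruent to a negative multiple of
      \<open>y\<close>: as \<open>n\<close> is positive, \<open>p * n\<close> exceeds
      \<open>i\<close>. But \<open>x\<close> is nonnegative, so \<open>r\<close> is at least
      \<open>y\<close>.\<close>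
    define r where "r = nsmul p (g + nsmul n y)"
    have r: "r \<in> C"
      unfolding r_def using False n by (auto intro: C.nsmul_mem)
    have "p * 1 \<le> p * n"
      using False by (intro mult_left_mono) auto
    then obtain k where k: "p * n = i + k" "k > 0"
      using i by (metis less_imp_add_positive less_le_trans mult.right_neutral)
    have "r = x + nsmul k y"
      by (simp add: x_def r_def nsmul_add nsmul_nsmul k nsmul_plus)
    moreover have "y \<le> nsmul k y"
      using nsmul_mono_left [of y 1 k] y k by simp
    ultimately have "y \<le> r"
      using x add_mono [of 0 x y "nsmul k y"] by simp
    then show ?thesis
      using y_le r by blast
  qed
qed

end

locale valued_closure = field_valuation v + valuation_subring V
  for v :: "'a::field \<Rightarrow> 'g::linordered_ab_group_add" and V :: "'a alg_closure set" +
  assumes to_ac_mem_iff: "to_ac x \<in> V \<longleftrightarrow> val_le 0 x"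
begin

lemma to_ac_vle_iff: "to_ac x \<preceq> to_ac y \<longleftrightarrow> y = 0 \<or> x \<noteq> 0 \<and> v x \<le> v y"
proof (cases "x = 0")
  case False
  then have "to_ac x \<preceq> to_ac y \<longleftrightarrow> to_ac (y / x) \<in> V"
    by (simp add: vle_iff_divide_mem to_ac_divide)
  then show ?thesis
    using False unfolding to_ac_mem_iff by (cases "y = 0") (auto simp: val_le_def v_divide)
qed simp

lemma to_ac_vle_1_iff: "to_ac x \<preceq> 1 \<longleftrightarrow> x \<noteq> 0 \<and> v x \<le> 0"
  using to_ac_vle_iff [of x 1] by simp

lemma base_Int_eq: "base \<inter> V = to_ac ` valuation_carrier"
  by (auto simp: to_ac_mem_iff)

lemma dense_values_if_DRvg:
  assumes "DRvg base_field v"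
  shows "dense_values base"
  unfolding dense_values_def
proof (intro ballI impI allI)
  fix a :: "'a alg_closure" and n
  assume "a \<in> base - {0}" "\<not> a \<preceq> 1"
  then obtain a' where a': "a = to_ac a'" "a' \<noteq> 0" "0 < v a'"
    by (auto simp: to_ac_vle_1_iff)
  have no_Z: "\<not> (value_set.G\<lparr>carrier := E\<rparr> Mod C) \<cong> integer_group"
    if "convex_subgroup C value_set.G" "convex_subgroup E value_set.G" "C \<subset> E" for C E
    using assms that unfolding DRvg_def value_group_base_field by blast
  have "v a' \<in> value_set"
    using a' by simp
  from value_set.ex_small_element [of "v a'" n, OF no_Z this \<open>0 < v a'\<close>]
  obtain \<xi> m where \<xi>: "\<xi> \<in> value_set" "0 < \<xi>" "nsmul n \<xi> \<le> v a'" "v a' \<le> nsmul m \<xi>"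
    by blast
  then obtain x where x: "\<xi> = v x" "x \<noteq> 0"
    by (elim value_setE)
  show "\<exists>x\<in>base. \<not> x \<preceq> 1 \<and> x ^ n \<preceq> a \<and> (\<exists>m. a \<preceq> x ^ m)"
  proof (intro bexI conjI exI)
    show "\<not> to_ac x \<preceq> 1" "to_ac x ^ n \<preceq> a" "a \<preceq> to_ac x ^ m"
      using \<xi> x a' by (simp_all add: to_ac_vle_1_iff to_ac_vle_iff v_power flip: to_ac_power)
  qed simp
qed

lemma ex_discrete_generator_if_not_DRvg:
  assumes "\<not> DRvg base_field v"
  obtains a where "a \<noteq> 0" "discrete_generator base p (to_ac a)"
proof -
  obtain C E where CE: "convex_subgroup C value_set.G" "convex_subgroup E value_set.G" "C \<subset> E"
    and iso: "(value_set.G\<lparr>carrier := E\<rparr> Mod C) \<cong> integer_group"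
    using assms unfolding DRvg_def value_group_base_field by blast
  from CE(3) have "C \<subseteq> E"
    by blast
  then obtain y where y: "y \<in> E" "0 < y" "y \<notin> C" "\<And>z. z \<in> E \<Longrightarrow> \<exists>n. z - nsmul n y \<in> C \<or> z + nsmul n y \<in> C"
    using value_set.quotient_iso_integer_group_iff [OF CE(1,2) \<open>C \<subseteq> E\<close>] iso by (elim iffD1 [elim_format] bexE conjE) metis+
  have "y \<in> value_set"
    using conjunct1 [OF CE(2) [unfolded value_set.convex_subgroup_iff]] y(1) by (rule subsetD)
  then obtain a where a: "y = v a" "a \<noteq> 0"
    by (elim value_setE)
  have "to_ac a \<preceq> (c ^ p * to_ac a ^ i)\<^sup>2"
    if c: "c \<in> base - {0}" and i: "0 < i \<and> i < p \<and> c ^ p * to_ac a ^ i \<in> V" for c i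
  proof -
    obtain c' where c': "c = to_ac c'" "c' \<noteq> 0"
      using c by auto
    have eq: "c ^ p * to_ac a ^ i = to_ac (c' ^ p * a ^ i)"
      by (simp add: c' to_ac_mult to_ac_power)
    have nz: "c' ^ p * a ^ i \<noteq> 0"
      using a c' by simp
    have v_eq: "v (c' ^ p * a ^ i) = nsmul p (v c') + nsmul i y"
      using a c' by (simp add: v_mult v_power)
    then have "0 \<le> nsmul p (v c') + nsmul i y"
      using i nz unfolding eq to_ac_mem_iff val_le_def by simp
    then have "y \<le> nsmul 2 (nsmul p (v c') + nsmul i y)"
      using i c' y by (intro value_set.quotient_generator_bound [OF CE(1,2)]) auto
    then have "v a \<le> v ((c' ^ p * a ^ i) ^ 2)"
      by (subst v_power [OF nz]) (simp add: v_eq a)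
    then show ?thesis
      using a to_ac_vle_iff [of a "(c' ^ p * a ^ i) ^ 2"] unfolding eq by simp
  qed
  moreover have "\<not> to_ac a \<preceq> 1"
    using a y by (simp add: to_ac_vle_1_iff)
  ultimately have "discrete_generator base p (to_ac a)"
    unfolding discrete_generator_def by blast
  then show thesis
    using that a by blast
qed

end

section \<open>The completion\<close>

lemma (in cring) power_surj_Quot_PIdl_iff:
  assumes a: "a \<in> carrier R"
  shows "(\<lambda>x. x [^]\<^bsub>R Quot PIdl a\<^esub> (n::nat)) ` carrier (R Quot PIdl a) = carrier (R Quot PIdl a) \<longleftrightarrow>
    (\<forall>x\<in>carrier R. \<exists>y\<in>carrier R. \<exists>z\<in>carrier R. x = y [^] n \<oplus> z \<otimes> a)"
proof -
  interpret I: ideal "PIdl a" R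
    using a by (rule cgenideal_ideal)
  interpret h: ring_hom_ring R "R Quot PIdl a" "(+>) (PIdl a)"
    by (rule I.rcos_ring_hom_ring)
  have carr: "carrier (R Quot PIdl a) = (+>) (PIdl a) ` carrier R"
    unfolding FactRing_def A_RCOSETS_def' by simp blast
  have "(\<lambda>x. x [^]\<^bsub>R Quot PIdl a\<^esub> n) ` carrier (R Quot PIdl a) = carrier (R Quot PIdl a) \<longleftrightarrow>
      carrier (R Quot PIdl a) \<subseteq> (\<lambda>x. x [^]\<^bsub>R Quot PIdl a\<^esub> n) ` carrier (R Quot PIdl a)"
    using image_subsetI [OF h.S.nat_pow_closed] by blast
  also have "\<dots> \<longleftrightarrow> (\<forall>x\<in>carrier R. \<exists>y\<in>carrier R. PIdl a +> x = PIdl a +> (y [^] n))"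
    unfolding carr image_image image_subset_iff image_iff by (intro ball_cong bex_cong refl) (simp add: h.hom_nat_pow)
  also have "\<dots> \<longleftrightarrow> (\<forall>x\<in>carrier R. \<exists>y\<in>carrier R. x \<ominus> y [^] n \<in> PIdl a)"
    using quotient_eq_iff_same_a_r_cos [OF I.is_ideal] by (intro ball_cong bex_cong) simp_all
  also have "\<dots> \<longleftrightarrow> (\<forall>x\<in>carrier R. \<exists>y\<in>carrier R. \<exists>z\<in>carrier R. x = y [^] n \<oplus> z \<otimes> a)"
  proof (intro ball_cong bex_cong refl)
    fix x y assume xy: "x \<in> carrier R" "y \<in> carrier R"
    have "x \<ominus> y [^] n = z \<otimes> a \<longleftrightarrow> x = y [^] n \<oplus> z \<otimes> a" if "z \<in> carrier R" for z
    proof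
      assume "x \<ominus> y [^] n = z \<otimes> a"
      then have "y [^] n \<oplus> z \<otimes> a = y [^] n \<oplus> (x \<ominus> y [^] n)"
        by simp
      also have "\<dots> = x"
        using xy nat_pow_closed [OF xy(2), of n] by algebra
      finally show "x = y [^] n \<oplus> z \<otimes> a" ..
    next
      assume "x = y [^] n \<oplus> z \<otimes> a"
      then show "x \<ominus> y [^] n = z \<otimes> a"
        using xy nat_pow_closed [OF xy(2), of n] that a by algebra
    qed
    then show "x \<ominus> y [^] n \<in> PIdl a \<longleftrightarrow> (\<exists>z\<in>carrier R. x = y [^] n \<oplus> z \<otimes> a)"
      unfolding cgenideal_def by blast
  qed
  finally show ?thesis .
qed

context field_valuation
begin

abbreviation value_flt :: "'g filter" where
  "value_flt \<equiv> value_filter (base_field :: 'a ring) v"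

abbreviation ev :: "('g \<Rightarrow> bool) \<Rightarrow> bool" where
  "ev P \<equiv> eventually P value_flt"

lemma carrier_value_group: "carrier (value_group base_field v) = value_set"
  by (simp add: value_group_def value_set_def)

lemma ev_iff: "ev P \<longleftrightarrow> (\<exists>\<delta>\<in>value_set. \<forall>\<alpha>\<in>value_set. \<delta> \<le> \<alpha> \<longrightarrow> P \<alpha>)"
proof -
  have "\<exists>x\<in>value_set. principal {\<alpha> \<in> value_set. x \<le> \<alpha>} \<le>
      inf (principal {\<alpha> \<in> value_set. \<gamma> \<le> \<alpha>}) (principal {\<alpha> \<in> value_set. \<delta> \<le> \<alpha>})"
    if "\<gamma> \<in> value_set" "\<delta> \<in> value_set" for \<gamma> \<delta>
    using that by (intro bexI [of _ "max \<gamma> \<delta>"]) (auto simp: max_def)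
  moreover have "value_set \<noteq> {}"
    using value_set.zero_mem by blast
  ultimately have "ev P \<longleftrightarrow> (\<exists>\<delta>\<in>value_set. eventually P (principal {\<alpha> \<in> value_set. \<delta> \<le> \<alpha>}))"
    unfolding value_filter_def carrier_value_group by (subst eventually_INF_base) auto
  then show ?thesis
    by (auto simp: eventually_principal)
qed

lemma ev_ge: "\<delta> \<in> value_set \<Longrightarrow> ev (\<lambda>\<alpha>. \<alpha> \<in> value_set \<and> \<delta> \<le> \<alpha>)"
  by (auto simp: ev_iff)

lemma value_flt_neq_bot: "value_flt \<noteq> bot"
proof
  assume "value_flt = bot"
  then have "ev (\<lambda>_. False)"
    by simp
  then show False
    unfolding ev_iff by blast
qed

lemma ev_ex: "ev P \<Longrightarrow> \<exists>\<alpha>. P \<alpha>"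
  using eventually_happens' [OF value_flt_neq_bot] by blast

lemma ev_const [simp]: "ev (\<lambda>_. P) \<longleftrightarrow> P"
  using value_flt_neq_bot by (simp add: eventually_const)

abbreviation null :: "('g \<Rightarrow> 'a) \<Rightarrow> bool" where
  "null x \<equiv> null_net base_field v x"

abbreviation cauchy :: "('g \<Rightarrow> 'a) \<Rightarrow> bool" where
  "cauchy x \<equiv> cauchy_net base_field v x"

lemma null_iff: "null x \<longleftrightarrow> (\<forall>\<gamma>\<in>value_set. ev (\<lambda>\<alpha>. val_less \<gamma> (x \<alpha>)))"
  by (simp add: null_net_def carrier_value_group val_less_def)

lemma nullD: "null x \<Longrightarrow> \<gamma> \<in> value_set \<Longrightarrow> ev (\<lambda>\<alpha>. val_less \<gamma> (x \<alpha>))"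
  by (simp add: null_iff)

text \<open>Any late entry of the net can serve as centre \<open>c\<close>, and two entries near a
  common centre are near each other. This form avoids the product filter from here on.\<close>

lemma cauchy_iff: "cauchy x \<longleftrightarrow> (\<forall>\<gamma>\<in>value_set. \<exists>c. ev (\<lambda>\<alpha>. val_less \<gamma> (x \<alpha> - c)))"
proof -
  have minus: "a \<ominus>\<^bsub>base_field\<^esub> b = a - b" for a b :: 'a
    by (simp add: a_minus_def)
  have "(\<forall>\<^sub>F (\<alpha>, \<beta>) in value_flt \<times>\<^sub>F value_flt. val_less \<gamma> (x \<alpha> - x \<beta>)) \<longleftrightarrow> (\<exists>c. ev (\<lambda>\<alpha>. val_less \<gamma> (x \<alpha> - c)))" for \<gamma>
  proof
    assume "\<forall>\<^sub>F (\<alpha>, \<beta>) in value_flt \<times>\<^sub>F value_flt. val_less \<gamma> (x \<alpha> - x \<beta>)"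
    then obtain P P' where P: "ev P" "ev P'" "\<And>\<alpha> \<beta>. P \<alpha> \<Longrightarrow> P' \<beta> \<Longrightarrow> val_less \<gamma> (x \<alpha> - x \<beta>)"
      unfolding eventually_prod_filter by auto
    obtain \<beta> where "P' \<beta>"
      using ev_ex P(2) by blast
    then have "ev (\<lambda>\<alpha>. val_less \<gamma> (x \<alpha> - x \<beta>))"
      using P by (auto elim: eventually_mono)
    then show "\<exists>c. ev (\<lambda>\<alpha>. val_less \<gamma> (x \<alpha> - c))"
      by blast
  next
    assume "\<exists>c. ev (\<lambda>\<alpha>. val_less \<gamma> (x \<alpha> - c))"
    then obtain c where c: "ev (\<lambda>\<alpha>. val_less \<gamma> (x \<alpha> - c))"
      by blast
    have "val_less \<gamma> (x \<alpha> - x \<beta>)" if "val_less \<gamma> (x \<alpha> - c)" "val_less \<gamma> (x \<beta> - c)" for \<alpha> \<beta>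
      using val_less_diff [OF that] by simp
    then show "\<forall>\<^sub>F (\<alpha>, \<beta>) in value_flt \<times>\<^sub>F value_flt. val_less \<gamma> (x \<alpha> - x \<beta>)"
      unfolding eventually_prod_filter using c by auto
  qed
  then show ?thesis
    by (simp add: cauchy_net_def carrier_value_group minus val_less_def)
qed

lemma cauchyD: "cauchy x \<Longrightarrow> \<gamma> \<in> value_set \<Longrightarrow> \<exists>c. ev (\<lambda>\<alpha>. val_less \<gamma> (x \<alpha> - c))"
  by (simp add: cauchy_iff)

lemma null_imp_cauchy: "null x \<Longrightarrow> cauchy x"
  unfolding cauchy_iff null_iff by (intro ballI exI [of _ 0]) simp

lemma cauchy_const [simp]: "cauchy (\<lambda>_. c)"
  unfolding cauchy_iff by (auto intro!: exI [of _ c])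

lemma null_0 [simp]: "null (\<lambda>_. 0)"
  unfolding null_iff by simp

lemma cauchy_bounded:
  assumes "cauchy x"
  shows "\<exists>\<gamma>\<in>value_set. ev (\<lambda>\<alpha>. val_le \<gamma> (x \<alpha>))"
proof -
  obtain c where c: "ev (\<lambda>\<alpha>. val_less 0 (x \<alpha> - c))"
    using cauchyD [OF assms value_set.zero_mem] by blast
  define \<gamma> where "\<gamma> = (if c = 0 then 0 else min 0 (v c))"
  have "val_le \<gamma> (x \<alpha>)" if "val_less 0 (x \<alpha> - c)" for \<alpha>
  proof -
    have "val_le \<gamma> (x \<alpha> - c)"
      by (rule val_le_mono [OF val_less_imp_le [OF that]]) (simp add: \<gamma>_def)
    moreover have "val_le \<gamma> c"
      by (simp add: val_le_def \<gamma>_def)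
    ultimately show ?thesis
      using val_le_add [of \<gamma> "x \<alpha> - c" c] by simp
  qed
  then have "ev (\<lambda>\<alpha>. val_le \<gamma> (x \<alpha>))"
    using c by (auto elim: eventually_mono)
  moreover have "\<gamma> \<in> value_set"
    using value_set.zero_mem by (auto simp: \<gamma>_def min_def)
  ultimately show ?thesis
    by blast
qed

lemma cauchy_add:
  assumes "cauchy x" "cauchy y"
  shows "cauchy (\<lambda>\<alpha>. x \<alpha> + y \<alpha>)"
  unfolding cauchy_iff
proof
  fix \<gamma> assume \<gamma>: "\<gamma> \<in> value_set"
  obtain c d where "ev (\<lambda>\<alpha>. val_less \<gamma> (x \<alpha> - c))" "ev (\<lambda>\<alpha>. val_less \<gamma> (y \<alpha> - d))"
    using cauchyD [OF assms(1) \<gamma>] cauchyD [OF assms(2) \<gamma>] by blast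
  then have "ev (\<lambda>\<alpha>. val_less \<gamma> (x \<alpha> + y \<alpha> - (c + d)))"
    by eventually_elim (metis val_less_add add_diff_add)
  then show "\<exists>c. ev (\<lambda>\<alpha>. val_less \<gamma> (x \<alpha> + y \<alpha> - c))"
    by blast
qed

lemma cauchy_mult:
  assumes "cauchy x" "cauchy y"
  shows "cauchy (\<lambda>\<alpha>. x \<alpha> * y \<alpha>)"
  unfolding cauchy_iff
proof
  fix \<gamma> assume \<gamma>: "\<gamma> \<in> value_set"
  obtain \<beta> where \<beta>: "\<beta> \<in> value_set" "ev (\<lambda>\<alpha>. val_le \<beta> (y \<alpha>))"
    using cauchy_bounded [OF assms(2)] by blast
  obtain c where c: "ev (\<lambda>\<alpha>. val_less (\<gamma> - \<beta>) (x \<alpha> - c))"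
    using cauchyD [OF assms(1) value_set.diff_mem [OF \<gamma> \<beta>(1)]] by blast
  define \<delta> where "\<delta> = (if c = 0 then \<gamma> else \<gamma> - v c)"
  have "\<delta> \<in> value_set"
    using \<gamma> value_set.diff_mem [OF \<gamma>, of "v c"] by (simp add: \<delta>_def)
  then obtain d where "ev (\<lambda>\<alpha>. val_less \<delta> (y \<alpha> - d))"
    using cauchyD [OF assms(2)] by blast
  with \<beta>(2) c have "ev (\<lambda>\<alpha>. val_less \<gamma> (x \<alpha> * y \<alpha> - c * d))"
  proof eventually_elim
    case (elim \<alpha>)
    have "val_less \<gamma> ((x \<alpha> - c) * y \<alpha>)"
      using val_less_mult [OF elim(2,1)] by simp
    moreover have "val_less \<gamma> (c * (y \<alpha> - d))"
      using val_less_mult [OF elim(3), of "v c" c] by (cases "c = 0") (simp_all add: \<delta>_def val_le_def mult.commute)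
    ultimately have "val_less \<gamma> ((x \<alpha> - c) * y \<alpha> + c * (y \<alpha> - d))"
      by (rule val_less_add)
    then show ?case
      by (simp add: algebra_simps)
  qed
  then show "\<exists>c. ev (\<lambda>\<alpha>. val_less \<gamma> (x \<alpha> * y \<alpha> - c))"
    by blast
qed

lemma cauchy_uminus: "cauchy x \<Longrightarrow> cauchy (\<lambda>\<alpha>. - x \<alpha>)"
  using cauchy_mult [OF cauchy_const [of "-1"], of x] by simp

lemma cauchy_power: "cauchy x \<Longrightarrow> cauchy (\<lambda>\<alpha>. x \<alpha> ^ n)"
  by (induction n) (auto intro: cauchy_mult)

lemma null_add: "null x \<Longrightarrow> null y \<Longrightarrow> null (\<lambda>\<alpha>. x \<alpha> + y \<alpha>)"
  unfolding null_iff by (auto intro: eventually_elim2 val_less_add)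

lemma null_uminus: "null x \<Longrightarrow> null (\<lambda>\<alpha>. - x \<alpha>)"
  unfolding null_iff by simp

lemma null_mult:
  assumes "null x" "cauchy y"
  shows "null (\<lambda>\<alpha>. x \<alpha> * y \<alpha>)"
  unfolding null_iff
proof
  fix \<gamma> assume \<gamma>: "\<gamma> \<in> value_set"
  obtain \<beta> where \<beta>: "\<beta> \<in> value_set" "ev (\<lambda>\<alpha>. val_le \<beta> (y \<alpha>))"
    using cauchy_bounded [OF assms(2)] by blast
  have "ev (\<lambda>\<alpha>. val_less (\<gamma> - \<beta>) (x \<alpha>))"
    by (rule nullD [OF assms(1) value_set.diff_mem [OF \<gamma> \<beta>(1)]])
  with \<beta>(2) show "ev (\<lambda>\<alpha>. val_less \<gamma> (x \<alpha> * y \<alpha>))"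
    by eventually_elim (use val_less_mult [of "\<gamma> - \<beta>" _ \<beta>] in simp)
qed

lemma cauchy_eventually_constant_value:
  assumes "cauchy x" "\<not> null x"
  obtains \<gamma> where "\<gamma> \<in> value_set" "ev (\<lambda>\<alpha>. x \<alpha> \<noteq> 0 \<and> v (x \<alpha>) = \<gamma>)"
proof -
  obtain \<gamma> where \<gamma>: "\<gamma> \<in> value_set" "\<not> ev (\<lambda>\<alpha>. val_less \<gamma> (x \<alpha>))"
    using assms(2) by (auto simp: null_iff)
  obtain c where c: "ev (\<lambda>\<alpha>. val_less \<gamma> (x \<alpha> - c))"
    using cauchyD [OF assms(1) \<gamma>(1)] by blast
  have "\<not> val_less \<gamma> c"
  proof
    assume "val_less \<gamma> c"
    then have "ev (\<lambda>\<alpha>. val_less \<gamma> (x \<alpha>))"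
      using c by (auto elim!: eventually_mono dest: val_less_add)
    then show False
      using \<gamma> by blast
  qed
  then have c': "c \<noteq> 0" "v c \<le> \<gamma>"
    by (auto simp: val_less_def)
  have "ev (\<lambda>\<alpha>. x \<alpha> \<noteq> 0 \<and> v (x \<alpha>) = v c)"
    using c
  proof eventually_elim
    case (elim \<alpha>)
    then have "val_less (v c) (x \<alpha> - c)"
      using c' val_less_mono by blast
    from v_add_strict [OF c'(1) this] show ?case
      by simp
  qed
  then show thesis
    using that [of "v c"] c'(1) by simp
qed

abbreviation nets :: "('g \<Rightarrow> 'a) ring" where
  "nets \<equiv> cauchy_net_ring base_field v"

lemma nets_simps:
  "carrier nets = {x. cauchy x}" "x \<otimes>\<^bsub>nets\<^esub> y = (\<lambda>\<alpha>. x \<alpha> * y \<alpha>)" "x \<oplus>\<^bsub>nets\<^esub> y = (\<lambda>\<alpha>. x \<alpha> + y \<alpha>)"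
  "\<one>\<^bsub>nets\<^esub> = (\<lambda>_. 1)" "\<zero>\<^bsub>nets\<^esub> = (\<lambda>_. 0)"
  by (simp_all add: cauchy_net_ring_def)

sublocale nets: cring nets
proof (rule cringI)
  show "abelian_group nets"
  proof (rule abelian_groupI)
    fix x assume "x \<in> carrier nets"
    then show "\<exists>y\<in>carrier nets. y \<oplus>\<^bsub>nets\<^esub> x = \<zero>\<^bsub>nets\<^esub>"
      by (intro bexI [of _ "\<lambda>\<alpha>. - x \<alpha>"]) (simp_all add: nets_simps cauchy_uminus)
  qed (simp_all add: nets_simps cauchy_add add_ac)
  show "comm_monoid nets"
    by (rule comm_monoidI) (simp_all add: nets_simps cauchy_mult mult_ac)
qed (simp_all add: nets_simps algebra_simps)

lemma uminus_nets: "cauchy x \<Longrightarrow> \<ominus>\<^bsub>nets\<^esub> x = (\<lambda>\<alpha>. - x \<alpha>)"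
  by (rule nets.minus_equality) (simp_all add: nets_simps cauchy_uminus)

sublocale null_ideal: ideal "{x. null x}" nets
proof (rule idealI)
  show "subgroup {x. null x} (add_monoid nets)"
  proof (rule group.subgroupI [OF nets.add.is_group])
    show "inv\<^bsub>add_monoid nets\<^esub> x \<in> {x. null x}" if "x \<in> {x. null x}" for x
      using that uminus_nets [of x] by (simp add: a_inv_def null_imp_cauchy null_uminus)
  qed (auto simp: nets_simps null_imp_cauchy null_add intro: exI [of _ "\<lambda>_. 0"])
  fix x y assume "x \<in> {x. null x}" "y \<in> carrier nets"
  then show "y \<otimes>\<^bsub>nets\<^esub> x \<in> {x. null x}" "x \<otimes>\<^bsub>nets\<^esub> y \<in> {x. null x}"
    using null_mult [of x y] by (simp_all add: nets_simps mult.commute)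
qed (rule nets.ring_axioms)

end

lemma (in ring_hom_cring) power_surj_Quot_PIdl_image_iff:
  assumes surj: "h ` carrier R = carrier S" and a: "a \<in> carrier R"
  shows "(\<lambda>x. x [^]\<^bsub>S Quot PIdl\<^bsub>S\<^esub> (h a)\<^esub> (n::nat)) ` carrier (S Quot PIdl\<^bsub>S\<^esub> (h a)) = carrier (S Quot PIdl\<^bsub>S\<^esub> (h a)) \<longleftrightarrow>
    (\<forall>x\<in>carrier R. \<exists>y\<in>carrier R. \<exists>z\<in>carrier R. h x = h (y [^]\<^bsub>R\<^esub> n \<oplus>\<^bsub>R\<^esub> z \<otimes>\<^bsub>R\<^esub> a))"
proof -
  have ha: "h a \<in> carrier S"
    using a by simp
  show ?thesis
    unfolding S.power_surj_Quot_PIdl_iff [OF ha] surj [symmetric] ball_simps bex_simps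
    using a by (intro ball_cong bex_cong refl) (simp add: hom_nat_pow)
qed

context field_valuation
begin

abbreviation coset :: "('g \<Rightarrow> 'a) \<Rightarrow> ('g \<Rightarrow> 'a) set" where
  "coset x \<equiv> {x. null x} +>\<^bsub>nets\<^esub> x"

lemma coset_eq_iff: "cauchy x \<Longrightarrow> cauchy y \<Longrightarrow> coset x = coset y \<longleftrightarrow> null (\<lambda>\<alpha>. x \<alpha> - y \<alpha>)"
  using nets.quotient_eq_iff_same_a_r_cos [OF null_ideal.is_ideal, of x y]
  by (simp add: a_minus_def uminus_nets) (simp add: nets_simps)

lemma mem_coset_iff: "cauchy x \<Longrightarrow> y \<in> coset x \<longleftrightarrow> cauchy y \<and> null (\<lambda>\<alpha>. y \<alpha> - x \<alpha>)"
proof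
  assume x: "cauchy x"
  {
    assume "y \<in> coset x"
    then obtain z where z: "null z" "y = (\<lambda>\<alpha>. z \<alpha> + x \<alpha>)"
      by (auto simp: a_r_coset_def' nets_simps)
    then show "cauchy y \<and> null (\<lambda>\<alpha>. y \<alpha> - x \<alpha>)"
      using cauchy_add [OF null_imp_cauchy x] by simp
  next
    assume y: "cauchy y \<and> null (\<lambda>\<alpha>. y \<alpha> - x \<alpha>)"
    then show "y \<in> coset x"
      unfolding a_r_coset_def' by (intro UN_I [of "\<lambda>\<alpha>. y \<alpha> - x \<alpha>"]) (auto simp: nets_simps)
  }
qed

lemma completion_valuation_coset:
  assumes x: "cauchy x" and \<gamma>: "\<gamma> \<in> value_set" "ev (\<lambda>\<alpha>. x \<alpha> \<noteq> 0 \<and> v (x \<alpha>) = \<gamma>)"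
  shows "completion_valuation base_field v (coset x) = \<gamma>"
  unfolding completion_valuation_def
proof (rule the_equality)
  have "x \<in> coset x"
    using x by (simp add: mem_coset_iff)
  then show "\<exists>x\<in>coset x. ev (\<lambda>\<alpha>. x \<alpha> \<noteq> \<zero>\<^bsub>base_field\<^esub> \<and> v (x \<alpha>) = \<gamma>)"
    using \<gamma>(2) by (intro bexI [of _ x]) simp_all
next
  fix \<gamma>' assume "\<exists>x\<in>coset x. ev (\<lambda>\<alpha>. x \<alpha> \<noteq> \<zero>\<^bsub>base_field\<^esub> \<and> v (x \<alpha>) = \<gamma>')"
  then obtain y where y: "y \<in> coset x" "ev (\<lambda>\<alpha>. y \<alpha> \<noteq> 0 \<and> v (y \<alpha>) = \<gamma>')"
    by auto
  then have "ev (\<lambda>\<alpha>. val_less \<gamma> (y \<alpha> - x \<alpha>))"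
    using mem_coset_iff [OF x] nullD [OF _ \<gamma>(1)] by simp
  with \<gamma>(2) y(2) have "ev (\<lambda>_. \<gamma>' = \<gamma>)"
  proof eventually_elim
    case (elim \<alpha>)
    then show ?case
      using v_add_strict(2) [of "x \<alpha>" "y \<alpha> - x \<alpha>"] by simp
  qed
  then show "\<gamma>' = \<gamma>"
    by simp
qed

definition integral :: "('g \<Rightarrow> 'a) \<Rightarrow> bool" where
  "integral x \<longleftrightarrow> cauchy x \<and> ev (\<lambda>\<alpha>. val_le 0 (x \<alpha>))"

lemma integral_nonneg_value_iff:
  assumes x: "cauchy x"
  shows "coset x = {x. null x} \<or> 0 \<le> completion_valuation base_field v (coset x) \<longleftrightarrow> integral x"
proof (cases "null x")
  case True
  then have "coset x = {x. null x}"
    by (intro nets.a_rcos_zero [OF null_ideal.is_ideal]) simp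
  moreover have "ev (\<lambda>\<alpha>. val_le 0 (x \<alpha>))"
    using nullD [OF True value_set.zero_mem] by (rule eventually_mono) (rule val_less_imp_le)
  ultimately show ?thesis
    using x by (simp add: integral_def)
next
  case False
  obtain \<gamma> where \<gamma>: "\<gamma> \<in> value_set" "ev (\<lambda>\<alpha>. x \<alpha> \<noteq> 0 \<and> v (x \<alpha>) = \<gamma>)"
    using cauchy_eventually_constant_value [OF x False] .
  have "coset x \<noteq> {x. null x}"
    using False null_ideal.rcos_const_imp_mem [of x] x by (auto simp: nets_simps)
  moreover have "integral x \<longleftrightarrow> 0 \<le> \<gamma>"
  proof
    assume "integral x"
    then have "ev (\<lambda>\<alpha>. val_le 0 (x \<alpha>))"
      by (simp add: integral_def)
    with \<gamma>(2) have "ev (\<lambda>_. 0 \<le> \<gamma>)"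
      by eventually_elim (auto simp: val_le_def)
    then show "0 \<le> \<gamma>"
      by simp
  next
    assume "0 \<le> \<gamma>"
    then show "integral x"
      using \<gamma>(2) x by (auto simp: integral_def val_le_def elim: eventually_mono)
  qed
  ultimately show ?thesis
    using completion_valuation_coset [OF x \<gamma>] by simp
qed

lemma integral_const: "integral (\<lambda>_. c) \<longleftrightarrow> val_le 0 c"
  by (simp add: integral_def)

lemma subring_integral: "subring {x. integral x} nets"
proof (rule nets.subringI)
  fix x y assume xy: "x \<in> {x. integral x}" "y \<in> {x. integral x}"
  then show "\<ominus>\<^bsub>nets\<^esub> x \<in> {x. integral x}"
    by (auto simp: integral_def uminus_nets cauchy_uminus)
  have "ev (\<lambda>\<alpha>. val_le 0 (x \<alpha>))" "ev (\<lambda>\<alpha>. val_le 0 (y \<alpha>))"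
    using xy by (auto simp: integral_def)
  then have "ev (\<lambda>\<alpha>. val_le 0 (x \<alpha> + y \<alpha>))" "ev (\<lambda>\<alpha>. val_le 0 (x \<alpha> * y \<alpha>))"
    by (eventually_elim, simp add: val_le_add, eventually_elim, use val_le_mult [of 0 _ 0] in simp)
  then show "x \<otimes>\<^bsub>nets\<^esub> y \<in> {x. integral x}" "x \<oplus>\<^bsub>nets\<^esub> y \<in> {x. integral x}"
    using xy by (simp_all add: nets_simps integral_def cauchy_add cauchy_mult)
qed (auto simp: nets_simps integral_const, auto simp: integral_def)

lemma valuation_ring_completion:
  "valuation_ring (completion base_field v) (completion_valuation base_field v) =
    (completion base_field v)\<lparr>carrier := coset ` {x. integral x}\<rparr>"
proof -
  have "{a \<in> carrier (completion base_field v). a = \<zero>\<^bsub>completion base_field v\<^esub> \<or> 0 \<le> completion_valuation base_field v a}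
      = coset ` {x. integral x}"
  proof -
    have "carrier (completion base_field v) = coset ` {x. cauchy x}"
      unfolding completion_def FactRing_def A_RCOSETS_def' by (simp add: nets_simps) blast
    moreover have "\<zero>\<^bsub>completion base_field v\<^esub> = {x. null x}"
      by (simp add: completion_def FactRing_def)
    moreover have "integral x \<Longrightarrow> cauchy x" for x
      by (simp add: integral_def)
    moreover have "a \<in> coset ` {x. cauchy x} \<and> (a = {x. null x} \<or> 0 \<le> completion_valuation base_field v a)
        \<longleftrightarrow> a \<in> coset ` {x. integral x}" for a
      using integral_nonneg_value_iff \<open>\<And>x. integral x \<Longrightarrow> cauchy x\<close> unfolding image_iff by (metis mem_Collect_eq)
    ultimately show ?thesis
      by simp
  qed
  then show ?thesis
    by (simp add: valuation_ring_def)
qed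

text \<open>The valuation ring of the completion is the image of the integral nets, so surjectivity
  on its quotient by \<open>p\<close> can be expressed by representatives.\<close>

lemma DRvr_iff_nets:
  assumes p: "ring_characteristic (residue_field base_field v) = p" "p > 0"
  shows "DRvr base_field v \<longleftrightarrow>
    (\<forall>x. integral x \<longrightarrow> (\<exists>y z. integral y \<and> integral z \<and> null (\<lambda>\<alpha>. x \<alpha> - (y \<alpha> ^ p + z \<alpha> * of_nat p))))"
proof -
  define R where "R = nets\<lparr>carrier := {x. integral x}\<rparr>"
  define S where "S = (completion base_field v)\<lparr>carrier := coset ` {x. integral x}\<rparr>"
  have "subcring {x. integral x} nets"
    using subring_integral by (intro nets.subcringI') auto
  then have R: "cring R"
    unfolding R_def by (rule nets.subcring_iff [THEN iffD1, rotated]) (auto simp: nets_simps integral_def)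
  interpret h0: ring_hom_cring nets "completion base_field v" coset
    unfolding completion_def by (rule null_ideal.rcos_ring_hom_cring) (rule nets.cring_axioms)
  have R_simps: "carrier R = {x. integral x}" "x \<otimes>\<^bsub>R\<^esub> y = (\<lambda>\<alpha>. x \<alpha> * y \<alpha>)" "x \<oplus>\<^bsub>R\<^esub> y = (\<lambda>\<alpha>. x \<alpha> + y \<alpha>)"
    "\<one>\<^bsub>R\<^esub> = (\<lambda>_. 1)" "\<zero>\<^bsub>R\<^esub> = (\<lambda>_. 0)" for x y
    by (simp_all add: R_def nets_simps)
  interpret R: cring R
    by (rule R)
  have int_cauchy: "x \<in> carrier nets" if "x \<in> carrier R" for x
    using that by (simp add: R_simps nets_simps integral_def)
  have h0: "ring_hom_ring R (completion base_field v) coset"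
  proof (rule ring_hom_ringI2 [OF R.ring_axioms h0.S.ring_axioms], rule ring_hom_memI)
    fix x y assume "x \<in> carrier R" "y \<in> carrier R"
    then show "coset (x \<otimes>\<^bsub>R\<^esub> y) = coset x \<otimes>\<^bsub>completion base_field v\<^esub> coset y"
      "coset (x \<oplus>\<^bsub>R\<^esub> y) = coset x \<oplus>\<^bsub>completion base_field v\<^esub> coset y"
      using h0.hom_mult [of x y] h0.hom_add [of x y] int_cauchy by (simp_all add: R_def)
  next
    show "coset \<one>\<^bsub>R\<^esub> = \<one>\<^bsub>completion base_field v\<^esub>"
      using h0.hom_one by (simp add: R_def)
  qed (use h0.hom_closed int_cauchy in blast)
  then interpret h': ring_hom_ring R "completion base_field v" coset .
  have S: "cring S"
    unfolding S_def using ring_hom_ring.img_is_cring [OF h0 h0.S.cring_axioms] by (simp add: R_def)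
  interpret h: ring_hom_cring R S coset
  proof (rule UnivPoly.ring_hom_cringI [OF R S], rule ring_hom_memI)
    fix x y assume "x \<in> carrier R" "y \<in> carrier R"
    then show "coset (x \<otimes>\<^bsub>R\<^esub> y) = coset x \<otimes>\<^bsub>S\<^esub> coset y" "coset (x \<oplus>\<^bsub>R\<^esub> y) = coset x \<oplus>\<^bsub>S\<^esub> coset y"
      using h'.hom_mult [of x y] h'.hom_add [of x y] by (simp_all add: S_def)
  next
    show "coset \<one>\<^bsub>R\<^esub> = \<one>\<^bsub>S\<^esub>"
      using h'.hom_one by (simp add: S_def)
  qed (simp add: S_def R_simps(1))
  have p1: "[n] \<cdot>\<^bsub>S\<^esub> \<one>\<^bsub>S\<^esub> = coset (\<lambda>_. of_nat n)" for n :: nat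
  proof (induction n)
    case 0
    show ?case
      using h.hom_zero by (simp add: R_simps add_pow_def)
  next
    case (Suc n)
    have "[Suc n] \<cdot>\<^bsub>S\<^esub> \<one>\<^bsub>S\<^esub> = coset (\<lambda>_. of_nat n) \<oplus>\<^bsub>S\<^esub> coset \<one>\<^bsub>R\<^esub>"
      using Suc by (simp add: add_pow_def del: h'.hom_one)
    also have "\<dots> = coset ((\<lambda>_. of_nat n) \<oplus>\<^bsub>R\<^esub> \<one>\<^bsub>R\<^esub>)"
      by (rule h.hom_add [symmetric]) (simp_all add: R_simps integral_const)
    also have "\<dots> = coset (\<lambda>_. of_nat (Suc n))"
      by (simp add: R_simps add.commute)
    finally show ?case .
  qed
  have "integral (\<lambda>_. of_nat p)"
    by (simp add: integral_const)
  have "DRvr base_field v \<longleftrightarrow> (\<lambda>x. x [^]\<^bsub>S Quot PIdl\<^bsub>S\<^esub> (coset (\<lambda>_. of_nat p))\<^esub> p) ` carrier (S Quot PIdl\<^bsub>S\<^esub> (coset (\<lambda>_. of_nat p)))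
      = carrier (S Quot PIdl\<^bsub>S\<^esub> (coset (\<lambda>_. of_nat p)))"
    using p by (simp add: DRvr_def valuation_ring_completion Let_def p1 flip: S_def)
  also have "\<dots> \<longleftrightarrow> (\<forall>x\<in>carrier R. \<exists>y\<in>carrier R. \<exists>z\<in>carrier R. coset x = coset (y [^]\<^bsub>R\<^esub> p \<oplus>\<^bsub>R\<^esub> z \<otimes>\<^bsub>R\<^esub> (\<lambda>_. of_nat p)))"
    by (rule h.power_surj_Quot_PIdl_image_iff) (simp_all add: R_def S_def integral_const)
  also have "\<dots> \<longleftrightarrow> (\<forall>x\<in>{x. integral x}. \<exists>y\<in>{x. integral x}. \<exists>z\<in>{x. integral x}.
      null (\<lambda>\<alpha>. x \<alpha> - (y \<alpha> ^ p + z \<alpha> * of_nat p)))"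
    unfolding R_simps(1)
  proof (intro ball_cong bex_cong refl)
    fix x y z assume xyz: "x \<in> {x. integral x}" "y \<in> {x. integral x}" "z \<in> {x. integral x}"
    have "y [^]\<^bsub>R\<^esub> p = (\<lambda>\<alpha>. y \<alpha> ^ p)"
      by (induction p) (simp_all add: R_simps mult.commute)
    then show "coset x = coset (y [^]\<^bsub>R\<^esub> p \<oplus>\<^bsub>R\<^esub> z \<otimes>\<^bsub>R\<^esub> (\<lambda>_. of_nat p)) \<longleftrightarrow> null (\<lambda>\<alpha>. x \<alpha> - (y \<alpha> ^ p + z \<alpha> * of_nat p))"
      using xyz by (simp add: R_simps coset_eq_iff integral_def cauchy_add cauchy_mult cauchy_power)
  qed
  also have "\<dots> \<longleftrightarrow> (\<forall>x. integral x \<longrightarrow> (\<exists>y z. integral y \<and> integral z \<and> null (\<lambda>\<alpha>. x \<alpha> - (y \<alpha> ^ p + z \<alpha> * of_nat p))))"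
    by blast
  finally show ?thesis .
qed

end

section \<open>Approximation by p-th powers\<close>

context field_valuation
begin

lemma val_less_power_cancel:
  assumes "val_less (nsmul n \<gamma>) (x ^ n)" "n > 0"
  shows "val_less \<gamma> x"
proof (cases "x = 0")
  case False
  then have "nsmul n \<gamma> < nsmul n (v x)"
    using assms by (simp add: val_less_def v_power)
  then have "\<gamma> < v x"
    using nsmul_mono [of "v x" \<gamma> n] by (meson not_less)
  then show ?thesis
    by (simp add: val_less_def)
qed simp

lemma value_set_unbounded:
  assumes "value_set \<noteq> {0}" "\<gamma> \<in> value_set"
  shows "\<exists>\<delta>\<in>value_set. \<gamma> < \<delta>"
proof -
  obtain \<delta> where \<delta>: "\<delta> \<in> value_set" "\<delta> \<noteq> 0"
    using assms(1) value_set.zero_mem by blast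
  then have "max \<delta> (- \<delta>) \<in> value_set" "0 < max \<delta> (- \<delta>)"
    using value_set.uminus_mem [OF \<delta>(1)] by (auto simp: max_def less_max_iff_disj not_le neq_iff)
  then show ?thesis
    using value_set.add_mem [OF assms(2), of "max \<delta> (- \<delta>)"] less_add_same_cancel1 [of \<gamma> "max \<delta> (- \<delta>)"] by blast
qed

text \<open>The counterpart of \<open>frobenius_dense\<close> in terms of \<open>v\<close> alone. It
  makes visible that the condition is the same for all valuation rings of the closure above
  \<open>v\<close>.\<close>

definition frobenius_approx :: "nat \<Rightarrow> bool" where
  "frobenius_approx p \<longleftrightarrow>
    (\<forall>a e. val_le 0 a \<and> e \<noteq> 0 \<and> (of_nat p = (0::'a) \<or> v e \<le> v (of_nat p)) \<longrightarrow>
      (\<exists>y. val_le 0 y \<and> val_le (v e) (a - y ^ p)))"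

lemma DRvr_imp_frobenius_approx:
  assumes p: "ring_characteristic (residue_field base_field v) = p" "p > 0" and DRvr: "DRvr base_field v"
  shows "frobenius_approx p"
  unfolding frobenius_approx_def
proof (intro allI impI)
  fix a e :: 'a
  assume e: "val_le 0 a \<and> e \<noteq> 0 \<and> (of_nat p = (0::'a) \<or> v e \<le> v (of_nat p))"
  then have "integral (\<lambda>_. a)"
    by (simp add: integral_const)
  then obtain y z where yz: "integral y" "integral z" "null (\<lambda>\<alpha>. a - (y \<alpha> ^ p + z \<alpha> * of_nat p))"
    using DRvr DRvr_iff_nets [OF p] by blast
  have "ev (\<lambda>\<alpha>. val_le 0 (y \<alpha>))" "ev (\<lambda>\<alpha>. val_le 0 (z \<alpha>))"
    using yz by (auto simp: integral_def)
  moreover have "ev (\<lambda>\<alpha>. val_less (v e) (a - (y \<alpha> ^ p + z \<alpha> * of_nat p)))"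
    using nullD [OF yz(3), of "v e"] e by simp
  ultimately have "ev (\<lambda>\<alpha>. val_le 0 (y \<alpha>) \<and> val_le (v e) (a - y \<alpha> ^ p))"
  proof eventually_elim
    case (elim \<alpha>)
    have "val_le (v e) (of_nat p)"
      using e by (auto simp: val_le_def)
    then have "val_le (v e) (z \<alpha> * of_nat p)"
      using val_le_mult [OF elim(2)] by fastforce
    then have "val_le (v e) (a - (y \<alpha> ^ p + z \<alpha> * of_nat p) + z \<alpha> * of_nat p)"
      using elim(3) val_less_imp_le val_le_add by blast
    then show ?case
      using elim(1) by (simp add: algebra_simps)
  qed
  then show "\<exists>y. val_le 0 y \<and> val_le (v e) (a - y ^ p)"
    using ev_ex by blast
qed

text \<open>If \<open>p\<close> is nonzero, a constant net \<open>y\<close> approximating modulo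
  \<open>p\<close> suffices, since \<open>z\<close> can be solved for exactly. If
  \<open>p = 0\<close>, nothing absorbs an error, so the entries of \<open>y\<close> are chosen with
  growing precision; \<open>y\<close> is Cauchy because its \<open>p\<close>-th powers are and the
  Frobenius is additive.\<close>

lemma frobenius_approx_imp_DRvr:
  assumes p: "ring_characteristic (residue_field base_field v) = p" "p > 0"
    and nontriv: "value_set \<noteq> {0}" and approx: "frobenius_approx p"
  shows "DRvr base_field v"
  unfolding DRvr_iff_nets [OF p]
proof (intro allI impI)
  fix x assume x: "integral x"
  then have x': "cauchy x" "ev (\<lambda>\<alpha>. val_le 0 (x \<alpha>))"
    by (auto simp: integral_def)
  show "\<exists>y z. integral y \<and> integral z \<and> null (\<lambda>\<alpha>. x \<alpha> - (y \<alpha> ^ p + z \<alpha> * of_nat p))"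
  proof (cases "of_nat p = (0::'a)")
    case False
    define q where "q = (of_nat p :: 'a)"
    obtain c where c: "ev (\<lambda>\<alpha>. val_less (v q) (x \<alpha> - c))"
      using cauchyD [OF x'(1), of "v q"] False by (auto simp: q_def)
    have "0 \<le> v q"
      using val_le_of_nat [of p] False by (simp add: val_le_def q_def)
    from c x'(2) have "ev (\<lambda>\<alpha>. val_le 0 c)"
    proof eventually_elim
      case (elim \<alpha>)
      have "val_le 0 (x \<alpha> - c)"
        using val_le_mono [OF val_less_imp_le [OF elim(1)] \<open>0 \<le> v q\<close>] .
      from val_le_diff [OF elim(2) this] show ?case
        by simp
    qed
    then obtain y where y: "val_le 0 y" "val_le (v q) (c - y ^ p)"
      using approx [unfolded frobenius_approx_def, rule_format, of c q] False by (auto simp: q_def)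
    define z where "z = (\<lambda>\<alpha>. (x \<alpha> + - (y ^ p)) * inverse q)"
    have "cauchy z"
      unfolding z_def by (intro cauchy_mult cauchy_add x' cauchy_const)
    moreover have "ev (\<lambda>\<alpha>. val_le 0 (z \<alpha>))"
      using c
    proof eventually_elim
      case (elim \<alpha>)
      have "val_le (v q) (x \<alpha> - c + (c - y ^ p))"
        using val_less_imp_le [OF elim] y(2) by (rule val_le_add)
      moreover have "val_le (- v q) (inverse q)"
        using False by (simp add: q_def val_le_def v_inverse)
      ultimately show ?case
        using val_le_mult [of "v q" _ "- v q" "inverse q"] by (simp add: z_def)
    qed
    moreover have "(\<lambda>\<alpha>. x \<alpha> - (y ^ p + z \<alpha> * of_nat p)) = (\<lambda>_. 0)"
      using False by (simp add: z_def q_def mult.assoc)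
    ultimately show ?thesis
      using y(1) by (intro exI [of _ "\<lambda>_. y"] exI [of _ z]) (simp add: integral_def)
  next
    case True
    have prime: "Factorial_Ring.prime p"
      using p by (rule prime_ring_characteristic_residue_field)
    have "CHAR('a) = p"
      using True prime CHAR_not_1' by (auto simp: of_nat_eq_0_iff_char_dvd prime_nat_iff)
    then have frob: "(a - b) ^ p = a ^ p - b ^ p" for a b :: 'a
    proof -
      have "(a - b + b) ^ p = (a - b) ^ p + b ^ p"
        by (rule freshmans_dream) (simp_all only: \<open>CHAR('a) = p\<close> prime)
      then show ?thesis
        by simp
    qed
    \<comment> \<open>The index \<open>\<alpha>\<close> itself is the precision demanded of the
      entry; where no approximation is available the default \<open>0\<close> keeps the net
      integral.\<close>
    have "\<exists>y. val_le 0 y \<and> (\<alpha> \<in> value_set \<and> val_le 0 (x \<alpha>) \<longrightarrow> val_le \<alpha> (x \<alpha> - y ^ p))" for \<alpha>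
    proof (cases "\<alpha> \<in> value_set \<and> val_le 0 (x \<alpha>)")
      case True
      then obtain e where "e \<noteq> 0" "\<alpha> = v e"
        by (elim conjE value_setE)
      then show ?thesis
        using True \<open>of_nat p = (0::'a)\<close> approx [unfolded frobenius_approx_def, rule_format, of "x \<alpha>" e] by auto
    next
      case False
      then show ?thesis
        by (intro exI [of _ 0]) auto
    qed
    then obtain y where y: "\<And>\<alpha>. val_le 0 (y \<alpha>)" "\<And>\<alpha>. \<alpha> \<in> value_set \<Longrightarrow> val_le 0 (x \<alpha>) \<Longrightarrow> val_le \<alpha> (x \<alpha> - y \<alpha> ^ p)"
      by metis
    have null: "ev (\<lambda>\<alpha>. val_less \<gamma> (x \<alpha> - y \<alpha> ^ p))" if \<gamma>: "\<gamma> \<in> value_set" for \<gamma>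
    proof -
      obtain \<delta> where \<delta>: "\<delta> \<in> value_set" "\<gamma> < \<delta>"
        using value_set_unbounded [OF nontriv \<gamma>] by blast
      from ev_ge [OF \<delta>(1)] x'(2) show ?thesis
      proof eventually_elim
        case (elim \<alpha>)
        then have "val_le \<alpha> (x \<alpha> - y \<alpha> ^ p)" "\<gamma> < \<alpha>"
          using y(2) \<delta> by auto
        then show ?case
          by (auto simp: val_le_def val_less_def)
      qed
    qed
    have "cauchy y"
      unfolding cauchy_iff
    proof
      fix \<gamma> assume \<gamma>: "\<gamma> \<in> value_set"
      then have p\<gamma>: "nsmul p \<gamma> \<in> value_set"
        by (rule value_set.nsmul_mem)
      obtain c where "ev (\<lambda>\<alpha>. val_less (nsmul p \<gamma>) (x \<alpha> - c))"
        using cauchyD [OF x'(1) p\<gamma>] by blast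
      with null [OF p\<gamma>] have *: "ev (\<lambda>\<alpha>. val_less (nsmul p \<gamma>) (y \<alpha> ^ p - c))"
        by eventually_elim (use val_less_diff in fastforce)
      then obtain \<beta> where \<beta>: "val_less (nsmul p \<gamma>) (y \<beta> ^ p - c)"
        using ev_ex by blast
      from * have "ev (\<lambda>\<alpha>. val_less \<gamma> (y \<alpha> - y \<beta>))"
      proof eventually_elim
        case (elim \<alpha>)
        have "val_less (nsmul p \<gamma>) ((y \<alpha> - y \<beta>) ^ p)"
          using val_less_diff [OF elim \<beta>] by (simp add: frob)
        then show ?case
          using p(2) by (rule val_less_power_cancel)
      qed
      then show "\<exists>c. ev (\<lambda>\<alpha>. val_less \<gamma> (y \<alpha> - c))"
        by blast
    qed
    then have "integral y"
      using y(1) by (simp add: integral_def)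
    moreover have "null (\<lambda>\<alpha>. x \<alpha> - (y \<alpha> ^ p + 0 * of_nat p))"
      using null by (simp add: null_iff)
    moreover have "integral (\<lambda>_. 0)"
      by (simp add: integral_const)
    ultimately show ?thesis
      by (intro exI [of _ y] exI [of _ "\<lambda>_. 0"]) simp
  qed
qed

end

context valued_closure
begin

lemma frobenius_approx_iff_frobenius_dense: "frobenius_approx p \<longleftrightarrow> frobenius_dense base p"
proof -
  have vle: "to_ac e \<preceq> to_ac x \<longleftrightarrow> val_le (v e) x" if "e \<noteq> 0" for e x
    using that by (simp add: to_ac_vle_iff val_le_def)
  have "to_ac e \<preceq> of_nat p \<longleftrightarrow> of_nat p = (0::'a) \<or> v e \<le> v (of_nat p)" if "e \<noteq> 0" for e :: 'a
    using vle [OF that, of "of_nat p"] by (simp add: val_le_def)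
  moreover have "to_ac e \<preceq> to_ac a - to_ac y ^ p \<longleftrightarrow> val_le (v e) (a - y ^ p)" if "e \<noteq> 0" for e a y :: 'a
    using vle [OF that, of "a - y ^ p"] by (simp add: to_ac_diff to_ac_power)
  moreover have "base - {0} = to_ac ` {e::'a. e \<noteq> 0}"
    by auto
  ultimately have "frobenius_dense base p \<longleftrightarrow> (\<forall>a. val_le 0 a \<longrightarrow> (\<forall>e. e \<noteq> 0 \<longrightarrow>
      of_nat p = (0::'a) \<or> v e \<le> v (of_nat p) \<longrightarrow> (\<exists>y. val_le 0 y \<and> val_le (v e) (a - y ^ p))))"
    unfolding frobenius_dense_def base_Int_eq by simp
  then show ?thesis
    unfolding frobenius_approx_def by (simp only: imp_conjL) (simp only: all_simps)
qed

theorem DRvr_iff_frobenius_dense: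
  assumes "ring_characteristic (residue_field base_field v) = p" "p > 0" "value_set \<noteq> {0}"
  shows "DRvr base_field v \<longleftrightarrow> frobenius_dense base p"
  using DRvr_imp_frobenius_approx frobenius_approx_imp_DRvr assms frobenius_approx_iff_frobenius_dense by blast

end

section \<open>Extensions of the valuation\<close>

lemma div_embed_0 [simp]: "div_embed 0 = (0 :: 'g::linordered_ab_group_add div_hull)"
  using div_embed_add [of 0 "0::'g"] by simp

lemma (in field_valuation) ex_valued_closure:
  obtains V where "valued_closure v V"
proof -
  obtain V where V: "valuation_subring V" "V \<inter> base = to_ac ` valuation_carrier"
  proof (rule subfield_set.valuation_subring_extension [OF subfield_set_base, of "to_ac ` valuation_carrier"])
    fix x y :: "'a alg_closure"
    assume "x \<in> to_ac ` valuation_carrier" "y \<in> to_ac ` valuation_carrier"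
    then obtain a b where ab: "x = to_ac a" "y = to_ac b" "val_le 0 a" "val_le 0 b"
      by auto
    then have "val_le 0 (a - b)" "val_le 0 (a * b)"
      using val_le_diff val_le_mult [of 0 a 0 b] by auto
    then show "x - y \<in> to_ac ` valuation_carrier" "x * y \<in> to_ac ` valuation_carrier"
      using ab by (auto simp flip: to_ac_diff to_ac_mult)
  next
    fix x :: "'a alg_closure"
    assume "x \<in> base"
    then obtain a where a: "x = to_ac a"
      by auto
    have "val_le 0 a \<or> val_le 0 (inverse a)"
      by (cases "a = 0") (auto simp: val_le_def v_inverse)
    then show "x \<in> to_ac ` valuation_carrier \<or> inverse x \<in> to_ac ` valuation_carrier"
      using a by (auto simp flip: to_ac_inverse)
  qed (auto intro: image_eqI [of _ _ 1])
  have "valued_closure v V"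
  proof (intro valued_closure.intro valued_closure_axioms.intro)
    show "to_ac x \<in> V \<longleftrightarrow> val_le 0 x" for x
    proof -
      have "to_ac x \<in> V \<longleftrightarrow> to_ac x \<in> V \<inter> base"
        by simp
      then show ?thesis
        unfolding V(2) by auto
    qed
  qed (use V field_valuation_axioms in auto)
  then show thesis
    by (rule that)
qed

context valued_closure
begin

text \<open>In the vanishing sum \<open>ac_poly f x\<close> two nonzero terms must have equal value,
  since otherwise the sum would have the least of the values. Their quotient relates a power of
  \<open>x\<close> to an element of the base field.\<close>

lemma algebraic_power_veq_base:
  assumes "x \<noteq> 0"
  shows "\<exists>n>0. \<exists>c\<in>base. x ^ n \<asymp> c"
proof -
  obtain f :: "'a poly" where f: "f \<noteq> 0" "ac_poly f x = 0"
    using alg_closure_algebraic .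
  define t where "t = (\<lambda>i. to_ac (coeff f i) * x ^ i)"
  have sum: "sum t {..degree f} = 0"
    using f(2) by (simp add: poly_altdef t_def coeff_map_poly)
  have t_0: "t i = 0 \<longleftrightarrow> coeff f i = 0" for i
    using assms by (simp add: t_def)
  have "\<exists>i\<in>{..degree f}. t i \<noteq> 0"
    using f(1) t_0 by (intro bexI [of _ "degree f"]) auto
  then have "\<exists>i j. i < j \<and> t i \<noteq> 0 \<and> t j \<noteq> 0 \<and> t i \<asymp> t j"
    using sum_veq_minimal [of "{..degree f}" t] sum by (metis finite_atMost linorder_neqE_nat veq_0_iff(2) veq_sym)
  then obtain i j where ij: "i < j" "t i \<noteq> 0" "t j \<noteq> 0" "t i \<asymp> t j"
    by blast
  define c where "c = to_ac (coeff f i / coeff f j)"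
  have "t i = (to_ac (coeff f j) * x ^ i) * c" "t j = (to_ac (coeff f j) * x ^ i) * x ^ (j - i)"
    using ij t_0 by (auto simp: t_def c_def to_ac_divide simp flip: power_add)
  then have "x ^ (j - i) \<asymp> c"
    using ij t_0 assms by (simp add: veq_sym)
  moreover have "c \<in> base"
    by (simp only: c_def rangeI)
  ultimately show ?thesis
    using ij(1) by (intro exI [of _ "j - i"] conjI bexI [of _ c]) simp_all
qed

end

locale extended_valuation = field_valuation v + L: subfield_set L
  for v :: "'a::field \<Rightarrow> 'g::linordered_ab_group_add" and L :: "'a alg_closure set" +
  fixes w :: "'a alg_closure \<Rightarrow> 'g div_hull"
  assumes base_subset: "base \<subseteq> L" and w: "extends_valuation v L w"
begin

lemma w_to_ac: "x \<noteq> 0 \<Longrightarrow> w (to_ac x) = div_embed (v x)"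
  using w by (simp add: extends_valuation_def)

lemma w_mult: "x \<in> L \<Longrightarrow> y \<in> L \<Longrightarrow> x \<noteq> 0 \<Longrightarrow> y \<noteq> 0 \<Longrightarrow> w (x * y) = w x + w y"
  and w_add: "x \<in> L \<Longrightarrow> y \<in> L \<Longrightarrow> x \<noteq> 0 \<Longrightarrow> y \<noteq> 0 \<Longrightarrow> x + y \<noteq> 0 \<Longrightarrow> min (w x) (w y) \<le> w (x + y)"
  using w by (auto simp: extends_valuation_def valuation_def ext_field_def)

lemma w_1: "w 1 = 0"
  using w_to_ac [of 1] by simp

lemma w_uminus: "x \<in> L \<Longrightarrow> x \<noteq> 0 \<Longrightarrow> w (- x) = w x"
  using w_to_ac [of "-1"] w_mult [of "-1" x] L.uminus_mem [of 1] by simp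

lemma w_inverse: "x \<in> L \<Longrightarrow> x \<noteq> 0 \<Longrightarrow> w (inverse x) = - w x"
  using w_mult [of x "inverse x"] w_1 by (simp add: eq_neg_iff_add_eq_0 add.commute)

lemma w_power: "x \<in> L \<Longrightarrow> x \<noteq> 0 \<Longrightarrow> w (x ^ n) = nsmul n (w x)"
  by (induction n) (auto simp: w_1 w_mult nsmul_Suc L.power_mem)

abbreviation O_L :: "'a alg_closure set" where
  "O_L \<equiv> {x \<in> L. x = 0 \<or> 0 \<le> w x}"

lemma ex_valuation_subring:
  obtains V where "valued_closure v V" "L \<inter> V = O_L"
proof -
  obtain V where V: "valuation_subring V" "V \<inter> L = O_L"
  proof (rule L.valuation_subring_extension [of O_L])
    fix x y assume xy: "x \<in> O_L" "y \<in> O_L"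
    then show "x * y \<in> O_L"
      by (cases "x = 0 \<or> y = 0") (auto simp: w_mult)
    have "0 \<le> w (x - y)" if "x - y \<noteq> 0" "x \<noteq> 0" "y \<noteq> 0"
      using w_add [of x "- y"] that xy w_uminus [of y] by (auto simp: min_def L.uminus_mem split: if_splits)
    then show "x - y \<in> O_L"
      using xy w_uminus [of y] by (cases "x = 0"; cases "y = 0") auto
  next
    show "x \<in> O_L \<or> inverse x \<in> O_L" if "x \<in> L" for x
      using w_inverse [OF that] that by (cases "x = 0") auto
  qed (auto simp: w_1)
  have "valued_closure v V"
  proof (intro valued_closure.intro valued_closure_axioms.intro)
    fix x
    have "to_ac x \<in> L"
      using base_subset by blast
    then have "to_ac x \<in> V \<longleftrightarrow> to_ac x \<in> O_L"
      using V(2) by blast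
    also have "\<dots> \<longleftrightarrow> val_le 0 x"
      using \<open>to_ac x \<in> L\<close> w_to_ac [of x] div_embed_le_iff [of 0 "v x"] by (cases "x = 0") (auto simp: val_le_def simp del: div_embed_le_iff)
    finally show "to_ac x \<in> V \<longleftrightarrow> val_le 0 x" .
  qed (use V field_valuation_axioms in auto)
  then show thesis
    using that V by blast
qed

end

section \<open>Uniqueness of the extended valuation and invariance\<close>

locale cyclic_valued_closure = valued_closure v V + cyclic_valued_extension base L \<sigma> p V
  for v :: "'a::field \<Rightarrow> 'g::linordered_ab_group_add" and V L :: "'a alg_closure set" and \<sigma> p
begin

lemma kaehler_trivial_iff:
  assumes "L \<inter> V = {x \<in> L. x = 0 \<or> 0 \<le> w x}"
  shows "(let \<Omega> = kaehler (valuation_ring base_field v) (valuation_ring (ext_field L) w) to_ac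
      in carrier \<Omega> = {\<zero>\<^bsub>\<Omega>\<^esub>}) \<longleftrightarrow> idempotent_ideal"
proof -
  have "valuation_ring (ext_field L) w = ring_of_type_algebra\<lparr>carrier := L \<inter> V\<rparr>"
    by (simp add: valuation_ring_def ext_field_def assms)
  moreover have "to_ac ` carrier (valuation_ring base_field v) = base \<inter> V"
    by (simp add: valuation_ring_base_field base_Int_eq)
  ultimately show ?thesis
    using kaehler_trivial_iff_idempotent_ideal [of to_ac "valuation_ring base_field v"] by (simp add: Let_def)
qed

text \<open>The value of the norm divided by \<open>p\<close>. By \<open>norm_veq\<close> this is
  forced, and it supplies an extension of \<open>v\<close> with valuation ring
  \<open>L \<inter> V\<close>.\<close>

definition norm_value :: "'a alg_closure \<Rightarrow> 'g div_hull" where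
  "norm_value x = (SOME \<gamma>. nsmul p \<gamma> = div_embed (v (of_ac (norm x))))"

lemma nsmul_norm_value: "nsmul p (norm_value x) = div_embed (v (of_ac (norm x)))"
  unfolding norm_value_def by (rule someI_ex) (rule div_hull_divisible [OF p_gt_0])

lemma norm_value_le_iff:
  assumes "x \<in> L" "y \<in> L" "x \<noteq> 0" "y \<noteq> 0"
  shows "norm_value x \<le> norm_value y \<longleftrightarrow> x \<preceq> y"
proof -
  obtain a b where ab: "norm x = to_ac a" "norm y = to_ac b"
    using norm_mem [OF assms(1)] norm_mem [OF assms(2)] by blast
  then have "a \<noteq> 0" "b \<noteq> 0"
    using norm_eq_0_iff assms by fastforce+
  have "norm_value x \<le> norm_value y \<longleftrightarrow> nsmul p (norm_value x) \<le> nsmul p (norm_value y)"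
    using p_gt_0 by (simp add: nsmul_le_iff)
  also have "\<dots> \<longleftrightarrow> v a \<le> v b"
    by (simp add: nsmul_norm_value ab)
  also have "\<dots> \<longleftrightarrow> norm x \<preceq> norm y"
    using \<open>a \<noteq> 0\<close> \<open>b \<noteq> 0\<close> by (simp add: ab to_ac_vle_iff)
  also have "\<dots> \<longleftrightarrow> x ^ p \<preceq> y ^ p"
    using norm_veq [OF assms(1)] norm_veq [OF assms(2)] unfolding veq_def by (metis vle_trans)
  also have "\<dots> \<longleftrightarrow> x \<preceq> y"
    using p_gt_0 by (rule vle_power_iff)
  finally show ?thesis .
qed

lemma extends_valuation_norm_value: "extends_valuation v L norm_value"
proof -
  have mult: "norm_value (x * y) = norm_value x + norm_value y"
    if xy: "x \<in> L" "y \<in> L" "x \<noteq> 0" "y \<noteq> 0" for x y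
  proof -
    obtain a b where ab: "norm x = to_ac a" "norm y = to_ac b"
      using norm_mem [OF xy(1)] norm_mem [OF xy(2)] by blast
    then have nz: "a \<noteq> 0" "b \<noteq> 0"
      using norm_eq_0_iff xy by fastforce+
    have "norm (x * y) = to_ac (a * b)"
      using norm_mult [OF xy(1,2)] by (simp add: ab to_ac_mult)
    then have "nsmul p (norm_value (x * y)) = div_embed (v (a * b))"
      unfolding nsmul_norm_value by (simp only: of_ac_to_ac)
    then have "nsmul p (norm_value (x * y)) = nsmul p (norm_value x + norm_value y)"
      using nz by (simp add: nsmul_norm_value nsmul_add ab v_mult div_embed_add)
    then show ?thesis
      using p_gt_0 by (simp add: nsmul_eq_iff)
  qed
  have add: "min (norm_value x) (norm_value y) \<le> norm_value (x + y)"
    if xy: "x \<in> L" "y \<in> L" "x \<noteq> 0" "y \<noteq> 0" "x + y \<noteq> 0" for x y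
  proof -
    have *: "x \<preceq> x + y \<or> y \<preceq> x + y"
      using vle_total [of x y] vle_add vle_refl by metis
    have "x + y \<in> L"
      using xy by blast
    with * show ?thesis
      using xy by (auto simp: min_le_iff_disj norm_value_le_iff)
  qed
  have "norm_value (to_ac x) = div_embed (v x)" if x: "x \<noteq> 0" for x
  proof -
    have norm: "norm (to_ac x) = to_ac (x ^ p)"
      by (simp add: norm_base to_ac_power)
    have embed: "div_embed (nsmul n g) = nsmul n (div_embed g)" for n and g :: 'g
      by (induction n) (simp_all add: nsmul_Suc div_embed_add)
    have "nsmul p (norm_value (to_ac x)) = div_embed (v (x ^ p))"
      unfolding nsmul_norm_value norm of_ac_to_ac ..
    also have "\<dots> = nsmul p (div_embed (v x))"
      by (simp add: v_power [OF x] embed)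
    finally show ?thesis
      using p_gt_0 by (simp add: nsmul_eq_iff)
  qed
  then show ?thesis
    using mult add by (auto simp: extends_valuation_def valuation_def ext_field_def)
qed

lemma Int_eq_norm_value: "L \<inter> V = {x \<in> L. x = 0 \<or> 0 \<le> norm_value x}"
proof -
  have "norm_value 1 = 0"
    using extends_valuation_norm_value unfolding extends_valuation_def by (metis div_embed_0 one_neq_zero to_ac_1 v_1)
  then have "x \<in> V \<longleftrightarrow> 0 \<le> norm_value x" if "x \<in> L" "x \<noteq> 0" for x
    using norm_value_le_iff [of 1 x] that by (simp add: one_vle_iff)
  then show ?thesis
    by auto
qed

end

lemma (in field_valuation) extended_valuationI:
  assumes "cyclic_extension base L \<sigma> p" "extends_valuation v L w"
  shows "extended_valuation v L w"
proof -
  interpret cyclic_extension base L \<sigma> p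
    by fact
  show ?thesis
    using assms(2) K_subset_L by unfold_locales
qed

text \<open>Composing \<open>w\<close> with \<open>\<sigma>\<close> gives another extension of
  \<open>v\<close>, which by uniqueness is \<open>w\<close>.\<close>

lemma (in field_valuation) unibranched_imp_invariant:
  assumes cyc: "cyclic_extension base L \<sigma> p" and w: "extends_valuation v L w" and "unibranched v L"
    and V: "valued_closure v V" "L \<inter> V = {x \<in> L. x = 0 \<or> 0 \<le> w x}"
  shows "cyclic_valued_closure v V L \<sigma> p"
proof -
  interpret cyclic_extension base L \<sigma> p
    by fact
  interpret w: extended_valuation v L w
    by (rule extended_valuationI) fact+
  interpret V: valued_closure v V
    by fact
  have \<sigma>_0: "\<sigma> x = 0 \<longleftrightarrow> x = 0" if "x \<in> L" for x
    using conj_eq_0_iff [OF that, of 1] by simp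
  have add: "min (w (\<sigma> x)) (w (\<sigma> y)) \<le> w (\<sigma> (x + y))" if "x \<in> L" "y \<in> L" "x \<noteq> 0" "y \<noteq> 0" "x + y \<noteq> 0" for x y
    using w.w_add [of "\<sigma> x" "\<sigma> y"] \<sigma>_0 [of "x + y"] \<sigma>_0 that L.add_mem by (simp add: \<sigma>_add)
  have "extends_valuation v L (\<lambda>x. w (\<sigma> x))"
    unfolding extends_valuation_def valuation_def
    using w.w_mult add w.w_to_ac by (auto simp: ext_field_def \<sigma>_mult \<sigma>_0)
  then have w\<sigma>: "w (\<sigma> x) = w x" if "x \<in> L" "x \<noteq> 0" for x
    using assms(3) w that unfolding unibranched_def by blast
  show ?thesis
  proof unfold_locales
    fix x assume x: "x \<in> L" "x \<in> V"
    show "\<sigma> x \<in> V"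
    proof (cases "x = 0")
      case False
      then have "0 \<le> w x"
        using V(2) x by blast
      then have "\<sigma> x \<in> L \<inter> V"
        using x w\<sigma> [OF x(1) False] unfolding V(2) by simp
      then show ?thesis
        by blast
    qed (use \<sigma>_0 L.zero_mem in auto)
  qed
qed

text \<open>Each extension \<open>w\<close> has a valuation ring coming from some \<open>V\<close>.
  Invariance makes \<open>p\<close> times \<open>w x\<close> the value of the norm of
  \<open>x\<close>, which depends on \<open>v\<close> only.\<close>

lemma (in field_valuation) unibranched_if_invariant:
  assumes cyc: "cyclic_extension base L \<sigma> p"
    and inv: "\<And>V. valued_closure v V \<Longrightarrow> cyclic_valued_closure v V L \<sigma> p"
  shows "unibranched v L"
proof -
  interpret cyclic_extension base L \<sigma> p
    by fact
  have determined: "nsmul p (w x) = div_embed (v (of_ac (norm x)))"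
    if w: "extends_valuation v L w" and x: "x \<in> L" "x \<noteq> 0" for w x
  proof -
    interpret w: extended_valuation v L w
      by (rule extended_valuationI) fact+
    obtain V where V: "valued_closure v V" "L \<inter> V = w.O_L"
      by (rule w.ex_valuation_subring)
    interpret c: cyclic_valued_closure v V L \<sigma> p
      by (rule inv) fact
    obtain a where a: "norm x = to_ac a"
      using norm_mem [OF x(1)] by blast
    then have nz: "a \<noteq> 0" "norm x \<noteq> 0"
      using norm_eq_0_iff x by fastforce+
    have le: "w y \<le> w z" if "y \<in> L" "z \<in> L" "y \<noteq> 0" "z \<noteq> 0" "c.vle y z" for y z
    proof -
      have "z / y \<in> L \<inter> V"
        using that by (simp add: c.vle_iff_divide_mem divide_inverse)
      then have "0 \<le> w (z / y)"
        using V(2) that by auto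
      moreover have "w z = w (z / y) + w y"
        using w.w_mult [of "z / y" y] that by (simp add: divide_inverse mult.assoc)
      ultimately show ?thesis
        by simp
    qed
    have "w (norm x) = w (x ^ p)"
    proof (rule order_antisym)
      have "norm x \<in> L" "x ^ p \<in> L"
        using norm_mem x K_in_L L.power_mem by blast+
      then show "w (norm x) \<le> w (x ^ p)" "w (x ^ p) \<le> w (norm x)"
        using le c.norm_veq [OF x(1)] nz x by (simp_all add: c.veq_def)
    qed
    then show ?thesis
      using w.w_power [OF x] w.w_to_ac [OF nz(1)] by (simp add: a)
  qed
  show ?thesis
    unfolding unibranched_def
  proof (intro allI impI ballI)
    fix w w' x assume "extends_valuation v L w \<and> extends_valuation v L w'" "x \<in> L - {0}"
    then have "nsmul p (w x) = nsmul p (w' x)"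
      using determined by simp
    then show "w x = w' x"
      using p_gt_0 by (simp add: nsmul_eq_iff)
  qed
qed

section \<open>Artin-Schreier and Kummer extensions\<close>

lemma CHAR_eq_if_prime:
  assumes "Factorial_Ring.prime p" "of_nat p = (0::'b::field)"
  shows "CHAR('b) = p"
  using assms CHAR_not_1' [where 'a = 'b] by (auto simp: of_nat_eq_0_iff_char_dvd prime_nat_iff)

lemma inj_on_of_nat_lessThan_CHAR: "inj_on (of_nat :: nat \<Rightarrow> 'b::field) {..<CHAR('b)}"
proof (rule linorder_inj_onI)
  fix i j assume ij: "i < j" "i \<in> {..<CHAR('b)}" "j \<in> {..<CHAR('b)}"
  show "of_nat i \<noteq> (of_nat j :: 'b)"
  proof
    assume "of_nat i = (of_nat j :: 'b)"
    then have "of_nat (j - i) = (0::'b)"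
      using ij(1) by (simp add: of_nat_diff)
    then have "CHAR('b) dvd j - i"
      by (simp only: of_nat_eq_0_iff_char_dvd)
    then show False
      using ij by (auto dest: dvd_imp_le)
  qed
qed auto

text \<open>The equation has at most \<open>p\<close> solutions in a field, and the prime field
  already provides \<open>p\<close>.\<close>

lemma frobenius_fixed_of_nat:
  fixes x :: "'b::field"
  assumes p: "Factorial_Ring.prime p" "of_nat p = (0::'b)" and x: "x ^ p = x"
  shows "\<exists>j. x = of_nat j"
proof -
  have char: "CHAR('b) = p"
    using p by (rule CHAR_eq_if_prime)
  define f where "f = monom 1 p - monom (1::'b) 1"
  have p1: "p > 1"
    using p(1) by (rule prime_gt_1_nat)
  have "coeff f p = 1"
    using p1 by (simp add: f_def)
  then have f: "f \<noteq> 0"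
    by auto
  have "degree f \<le> p"
    unfolding f_def using p1 by (intro degree_diff_le) (auto simp: degree_monom_eq)
  then have card: "card {x. poly f x = 0} \<le> p"
    using card_poly_roots_bound [OF f] by simp
  have frob: "of_nat j ^ p = (of_nat j :: 'b)" for j
  proof (induction j)
    case 0
    then show ?case
      using p1 by (simp add: power_0_left)
  next
    case (Suc j)
    have "(of_nat j + 1) ^ p = of_nat j ^ p + (1::'b) ^ p"
      by (rule freshmans_dream) (simp_all only: char p)
    then show ?case
      using Suc by (simp add: add.commute)
  qed
  have "of_nat ` {..<p} = {x. poly f x = 0}"
  proof (rule card_subset_eq)
    show "finite {x. poly f x = 0}"
      using f by (rule poly_roots_finite)
    show "of_nat ` {..<p} \<subseteq> {x. poly f x = 0}"
      using frob by (auto simp: f_def poly_monom)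
    then have "card (of_nat ` {..<p} :: 'b set) \<le> card {x. poly f x = 0}"
      using \<open>finite _\<close> by (rule card_mono [rotated])
    moreover have "inj_on (of_nat :: nat \<Rightarrow> 'b) {..<p}"
      using inj_on_of_nat_lessThan_CHAR [where 'b = 'b] unfolding char .
    then have "card (of_nat ` {..<p} :: 'b set) = p"
      by (simp add: card_image)
    ultimately show "card (of_nat ` {..<p} :: 'b set) = card {x. poly f x = 0}"
      using card by simp
  qed
  moreover have "poly f x = 0"
    using x by (simp add: f_def poly_monom)
  ultimately show ?thesis
    by blast
qed

lemma of_nat_alg_closure_eq_0_iff: "of_nat n = (0::'a::field alg_closure) \<longleftrightarrow> of_nat n = (0::'a)"
  using to_ac_eq_0_iff [of "of_nat n :: 'a"] by (simp del: to_ac_eq_0_iff to_ac_eq_0_iff')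

text \<open>The difference of two roots, divided by \<open>c\<close>, is fixed by the Frobenius and
  so lies in the prime field; the conjugates are translates of \<open>x\<close>. About
  \<open>b\<close> only the power with exponent \<open>p - 1\<close> is recorded, which determines
  its value.\<close>

lemma ex_cyclic_artin_schreier:
  fixes a c :: "'a::field" and x :: "'a alg_closure"
  assumes p: "Factorial_Ring.prime p" "of_nat p = (0::'a)" and c: "c \<noteq> 0"
    and x: "x ^ p - to_ac c ^ (p - 1) * x = to_ac a" "x \<notin> base"
  obtains \<sigma> b where "cyclic_extension base (adjoin x) \<sigma> p" "ext_degree (adjoin x) = p"
    "\<sigma> x = x + to_ac b" "b ^ (p - 1) = c ^ (p - 1)"
proof -
  define f where "f = monom 1 p + [:- a, - (c ^ (p - 1)):]"
  have p1: "p > 1"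
    using p(1) by (rule prime_gt_1_nat)
  have p_ac: "of_nat p = (0::'a alg_closure)"
    using p(2) by (simp add: of_nat_alg_closure_eq_0_iff)
  have char: "CHAR('a alg_closure) = p"
    using p(1) p_ac by (rule CHAR_eq_if_prime)
  have deg: "degree f = p"
    unfolding f_def using p1 by (subst degree_add_eq_left) (auto simp: degree_monom_eq intro: le_less_trans)
  have f_eq: "ac_poly f r = r ^ p - to_ac c ^ (p - 1) * r - to_ac a" for r
    unfolding f_def ac_poly_add by (simp add: map_poly_monom poly_monom ac_poly_pCons to_ac_power algebra_simps)
  have "pderiv f = [:- (c ^ (p - 1)):]"
    using p(2) by (simp add: f_def pderiv_add pderiv_monom pderiv_pCons)
  then have sep: "ac_poly (pderiv f) x \<noteq> 0"
    using c by (simp add: ac_poly_const)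
  have root_diff: "\<exists>b. r = x + to_ac b \<and> b \<noteq> 0 \<and> b ^ (p - 1) = c ^ (p - 1)"
    if r: "ac_poly f r = 0" "r \<noteq> x" for r
  proof -
    define d where "d = (r - x) / to_ac c"
    have "(r - x + x) ^ p = (r - x) ^ p + x ^ p"
      by (rule freshmans_dream) (simp_all only: char p)
    then have "(r - x) ^ p = r ^ p - x ^ p"
      by simp
    also have "\<dots> = to_ac c ^ (p - 1) * (r - x)"
      using r(1) x(1) by (simp add: f_eq algebra_simps)
    finally have d_p: "(r - x) ^ p = to_ac c ^ (p - 1) * (r - x)" .
    have "to_ac c ^ p = to_ac c ^ (p - 1) * to_ac c"
      using p1 by (simp flip: power_Suc2)
    then have "d ^ p = d"
      using d_p c by (simp add: d_def power_divide)
    then obtain j where j: "d = of_nat j"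
      using frobenius_fixed_of_nat p(1) p_ac by blast
    define b where "b = of_nat j * c"
    have "r - x = to_ac b"
      using j c by (simp add: d_def b_def to_ac_mult to_ac_of_nat field_simps)
    moreover from this have "b \<noteq> 0"
      using r(2) by auto
    moreover have "to_ac b ^ (p - 1) * to_ac b = to_ac c ^ (p - 1) * to_ac b"
      using d_p p1 \<open>r - x = to_ac b\<close> by (simp flip: power_Suc2)
    then have "to_ac (b ^ (p - 1)) = to_ac (c ^ (p - 1))"
      using \<open>b \<noteq> 0\<close> by simp
    then have "b ^ (p - 1) = c ^ (p - 1)"
      unfolding to_ac_eq_iff .
    moreover have "r = x + to_ac b"
      using \<open>r - x = to_ac b\<close> by (simp add: algebra_simps)
    ultimately show ?thesis
      by blast
  qed
  have affine: "\<exists>u b. r = to_ac u * x + to_ac b \<and> inj_on (\<lambda>i. ((\<lambda>y. to_ac u * y + to_ac b) ^^ i) x) {..<p}"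
    if r: "ac_poly f r = 0" "r \<noteq> x" for r
  proof -
    obtain b where b: "r = x + to_ac b" "b \<noteq> 0"
      using root_diff [OF r] by blast
    have iter: "((\<lambda>y. to_ac 1 * y + to_ac b) ^^ i) x = x + of_nat i * to_ac b" for i
      by (induction i) (simp_all add: algebra_simps)
    have "inj_on (\<lambda>i. ((\<lambda>y. to_ac 1 * y + to_ac b) ^^ i) x) {..<p}"
      unfolding iter using b(2) inj_on_of_nat_lessThan_CHAR [where 'b = "'a alg_closure", unfolded char]
      by (simp add: inj_on_def)
    then show ?thesis
      using b(1) by (intro exI [of _ 1] exI [of _ b]) simp
  qed
  have "ac_poly f x = 0"
    using x(1) by (simp add: f_eq)
  then obtain \<sigma> where \<sigma>: "cyclic_extension base (adjoin x) \<sigma> p" "ext_degree (adjoin x) = p"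
    "ac_poly f (\<sigma> x) = 0" "\<sigma> x \<noteq> x"
    using ex_cyclic_adjoin [OF p(1) x(2) deg _ sep affine] by blast
  then show thesis
    using root_diff [OF \<sigma>(3,4)] that by blast
qed

lemma ex_cyclic_kummer:
  fixes a :: "'a::field" and x :: "'a alg_closure"
  assumes p: "Factorial_Ring.prime p" "of_nat p \<noteq> (0::'a)" and roots: "{z :: 'a alg_closure. z ^ p = 1} \<subseteq> base"
    and x: "x ^ p = to_ac a" "x \<notin> base"
  obtains \<sigma> w where "cyclic_extension base (adjoin x) \<sigma> p" "ext_degree (adjoin x) = p"
    "\<sigma> x = w * x" "w ^ p = 1" "w \<noteq> 1" "w \<in> base"
proof -
  define f where "f = monom 1 p + [:- a:]"
  have p1: "p > 1"
    using p(1) by (rule prime_gt_1_nat)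
  have "x \<noteq> 0"
    using x(2) to_ac_0 rangeI by metis
  have deg: "degree f = p"
    unfolding f_def using p1 by (subst degree_add_eq_left) (auto simp: degree_monom_eq)
  have f_eq: "ac_poly f r = r ^ p - to_ac a" for r
    unfolding f_def ac_poly_add by (simp add: map_poly_monom poly_monom ac_poly_const)
  have "pderiv f = monom (of_nat p) (p - 1)"
    by (simp add: f_def pderiv_add pderiv_monom pderiv_pCons)
  then have sep: "ac_poly (pderiv f) x \<noteq> 0"
    using p(2) \<open>x \<noteq> 0\<close> by (simp add: of_nat_alg_closure_eq_0_iff map_poly_monom poly_monom)
  have root_quot: "\<exists>w\<in>base. r = w * x \<and> w ^ p = 1 \<and> w \<noteq> 1" if r: "ac_poly f r = 0" "r \<noteq> x" for r
  proof -
    have "(r / x) ^ p = 1"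
      using r(1) power_not_zero [OF \<open>x \<noteq> 0\<close>, of p] by (simp add: f_eq power_divide x(1))
    then show ?thesis
      using roots r(2) \<open>x \<noteq> 0\<close> by (intro bexI [of _ "r / x"]) auto
  qed
  have affine: "\<exists>u b. r = to_ac u * x + to_ac b \<and> inj_on (\<lambda>i. ((\<lambda>y. to_ac u * y + to_ac b) ^^ i) x) {..<p}"
    if r: "ac_poly f r = 0" "r \<noteq> x" for r
  proof -
    obtain w where w: "r = to_ac w * x" "to_ac w ^ p = 1" "to_ac w \<noteq> 1"
      using root_quot [OF r] by blast
    have iter: "((\<lambda>y. to_ac w * y + to_ac 0) ^^ i) x = to_ac w ^ i * x" for i
      by (induction i) (simp_all add: algebra_simps)
    have "False" if ij: "i < j" "j < p" "to_ac w ^ i = to_ac w ^ j" for i j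
    proof -
      have "to_ac w \<noteq> 0"
        using w(2) p1 by (auto simp: power_0_left)
      moreover have "to_ac w ^ j = to_ac w ^ i * to_ac w ^ (j - i)"
        using ij(1) by (simp flip: power_add)
      ultimately have "to_ac w ^ (j - i) = 1"
        using ij(3) by simp
      moreover have "\<not> p dvd j - i"
        using ij by (auto dest: dvd_imp_le)
      \<comment> \<open>A fact about fields is wanted that was proved next to a valuation ring; the
        trivial valuation ring gives access to it.\<close>
      moreover have "valuation_subring (UNIV :: 'a alg_closure set)"
        by unfold_locales auto
      ultimately show False
        using valuation_subring.root_of_unity_power_neq_1 [OF _ p(1) w(2,3)] by blast
    qed
    then have "inj_on (\<lambda>i. ((\<lambda>y. to_ac w * y + to_ac 0) ^^ i) x) {..<p}"
      unfolding iter using \<open>x \<noteq> 0\<close> by (intro linorder_inj_onI) auto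
    then show ?thesis
      using w(1) by (intro exI [of _ w] exI [of _ 0]) simp
  qed
  have "ac_poly f x = 0"
    using x(1) by (simp add: f_eq)
  then obtain \<sigma> where \<sigma>: "cyclic_extension base (adjoin x) \<sigma> p" "ext_degree (adjoin x) = p"
    "ac_poly f (\<sigma> x) = 0" "\<sigma> x \<noteq> x"
    using ex_cyclic_adjoin [OF p(1) x(2) deg _ sep affine] by blast
  then show thesis
    using root_quot [OF \<sigma>(3,4)] that by blast
qed

section \<open>Deeply ramified fields\<close>

locale residue_char_valuation = field_valuation v
  for v :: "'a::field \<Rightarrow> 'g::linordered_ab_group_add" +
  fixes p :: nat
  assumes residue_char: "ring_characteristic (residue_field base_field v) = p" "p > 0"
    and nontrivially_valued: "value_set \<noteq> {0}"
begin

lemma prime_p: "Factorial_Ring.prime p"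
  using residue_char by (rule prime_ring_characteristic_residue_field)

lemma val_less_p: "val_less 0 (of_nat p)"
  using ring_characteristic_residue_field_dvd_iff [of p] residue_char by simp

lemma of_nat_p_not_vle_1:
  assumes "valued_closure v V"
  shows "\<not> valuation_subring.vle V (of_nat p) 1"
proof -
  interpret valued_closure v V
    by fact
  show ?thesis
    using to_ac_vle_1_iff [of "of_nat p"] val_less_p by (auto simp: val_less_def)
qed

definition kaehler_condition :: bool where
  "kaehler_condition \<longleftrightarrow>
    (\<forall>L w. galois_extension L \<and> ext_degree L = p \<and> extends_valuation v L w \<and> unibranched v L \<longrightarrow>
       (let \<Omega> = kaehler (valuation_ring base_field v) (valuation_ring (ext_field L) w) to_ac
        in carrier \<Omega> = {\<zero>\<^bsub>\<Omega>\<^esub>}))"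

lemma kaehler_conditionD:
  assumes "kaehler_condition" "cyclic_extension base L \<sigma> p" "ext_degree L = p"
    and inv: "\<And>V. valued_closure v V \<Longrightarrow> cyclic_valued_closure v V L \<sigma> p" and V: "valued_closure v V"
  shows "cyclic_valued_extension.idempotent_ideal base L \<sigma> V"
proof -
  interpret cyclic_valued_closure v V L \<sigma> p
    by (rule inv) fact
  have "galois_extension L" "unibranched v L"
    using cyclic_extension_imp_galois unibranched_if_invariant assms by blast+
  then show ?thesis
    using assms(1,3) extends_valuation_norm_value kaehler_trivial_iff [OF Int_eq_norm_value]
    unfolding kaehler_condition_def by blast
qed

lemma cyclic_valued_closureI:
  assumes "valued_closure v V" "cyclic_extension base L \<sigma> p" "x \<in> L"
    and "\<And>i. valuation_subring.vle V d ((\<sigma> ^^ i) x - x)"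
    and "\<And>y. y \<in> base \<Longrightarrow> \<not> valuation_subring.vle V d (x - y)"
  shows "cyclic_valued_closure v V L \<sigma> p"
proof -
  interpret valued_closure v V
    by fact
  interpret cyclic_extension_valuation base L \<sigma> p V
    using assms(2) valuation_subring_axioms by (rule cyclic_extension_valuation.intro)
  have "cyclic_valued_extension base L \<sigma> p V"
    using invariant_if_no_approximation [of x d] algebraic_power_veq_base assms(3-5) by blast
  then show ?thesis
    using assms(1) by (simp add: cyclic_valued_closure_def)
qed

text \<open>The hypotheses range over all \<open>V\<close> since unibranchedness concerns every
  extension of \<open>v\<close>. If \<open>\<sigma> x - x\<close> divided \<open>x - y\<close>, then
  \<open>close\<close> would make it a unit; so \<open>x\<close> is too far from the base field for
  the valuation to be moved, and \<open>not_idempotent_ideal\<close> applies.\<close>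

lemma kaehler_condition_no_wild_generator:
  assumes cond: "kaehler_condition" and cyc: "cyclic_extension base L \<sigma> p" and deg: "ext_degree L = p"
    and x: "x \<in> L" "x \<notin> base" and k: "k > 0"
    and mem: "\<And>V. valued_closure v V \<Longrightarrow> x \<in> V"
    and nonunit: "\<And>V. valued_closure v V \<Longrightarrow> \<not> valuation_subring.vle V (\<sigma> x - x) 1"
    and close: "\<And>V y. valued_closure v V \<Longrightarrow> y \<in> base \<Longrightarrow> valuation_subring.vle V ((x - y) ^ k) ((\<sigma> x - x) ^ (k - 1))"
    and conj: "\<And>V i. valued_closure v V \<Longrightarrow> valuation_subring.vle V (\<sigma> x - x) ((\<sigma> ^^ i) x - x)"
  shows False
proof -
  have inv: "cyclic_valued_closure v V L \<sigma> p" if V: "valued_closure v V" for V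
  proof (rule cyclic_valued_closureI [OF V cyc x(1) conj [OF V]])
    interpret valued_closure v V
      by fact
    fix y :: "'a alg_closure" assume y: "y \<in> base"
    show "\<not> vle (\<sigma> x - x) (x - y)"
    proof
      assume "vle (\<sigma> x - x) (x - y)"
      then have "vle ((\<sigma> x - x) ^ k) ((x - y) ^ k)"
        by (rule vle_power)
      also have "vle \<dots> ((\<sigma> x - x) ^ (k - 1))"
        by (rule close [OF V y])
      finally have *: "vle ((\<sigma> x - x) ^ (k - 1) * (\<sigma> x - x)) ((\<sigma> x - x) ^ (k - 1) * 1)"
        using k by (simp flip: power_Suc2)
      have "\<sigma> x \<noteq> x"
        using cyclic_extension.\<sigma>_fixed [OF cyc x(1)] x(2) by blast
      then have "vle (\<sigma> x - x) 1"
        using vle_mult_cancel_left [of "(\<sigma> x - x) ^ (k - 1)" "\<sigma> x - x" 1] * by simp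
      then show False
        using nonunit [OF V] by blast
    qed
  qed
  obtain V where V: "valued_closure v V"
    by (rule ex_valued_closure)
  interpret cyclic_valued_closure v V L \<sigma> p
    by (rule inv) fact
  have "\<not> idempotent_ideal"
    using not_idempotent_ideal [OF x(1) mem [OF V] x(2) nonunit [OF V] k close [OF V]] .
  then show False
    using kaehler_conditionD [OF cond cyc deg inv V] by blast
qed

lemma not_frobenius_approxE:
  assumes "\<not> frobenius_approx p"
  obtains a e where "val_le 0 a" "e \<noteq> 0" "of_nat p = (0::'a) \<or> v e \<le> v (of_nat p)"
    "\<And>y. val_le 0 y \<Longrightarrow> \<not> val_le (v e) (a - y ^ p)"
  using assms unfolding frobenius_approx_def by blast

lemma frobenius_approx_if_kaehler_condition_char_p:
  assumes cond: "kaehler_condition" and char: "of_nat p = (0::'a)"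
  shows "frobenius_approx p"
proof (rule ccontr)
  assume "\<not> frobenius_approx p"
  then obtain a e where a: "val_le 0 a" and e: "e \<noteq> 0" "of_nat p = (0::'a) \<or> v e \<le> v (of_nat p)"
    and far: "\<And>y. val_le 0 y \<Longrightarrow> \<not> val_le (v e) (a - y ^ p)"
    using not_frobenius_approxE by blast
  have p1: "p > 1"
    using prime_p by (rule prime_gt_1_nat)
  define f where "f = monom 1 p + [:- to_ac a, - (to_ac (e * e) ^ (p - 1)):]"
  have "degree f = p"
    unfolding f_def using p1 by (subst degree_add_eq_left) (auto simp: degree_monom_eq intro: le_less_trans)
  then obtain x where "poly f x = 0"
    using alg_closed_imp_poly_has_root [of f] p1 by auto
  then have x: "x ^ p - to_ac (e * e) ^ (p - 1) * x = to_ac a"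
    by (simp add: f_def poly_monom algebra_simps)
  have bound: "x \<in> V \<and> \<not> valuation_subring.vle V (to_ac (e * e)) 1 \<and>
      (\<forall>y\<in>base. valuation_subring.vle V ((x - y) ^ 2) (to_ac (e * e)))" if V: "valued_closure v V" for V
  proof -
    interpret valued_closure v V
      by fact
    have far': "\<not> vle (to_ac e) (to_ac a - y ^ p)" if y: "y \<in> base" "y \<in> V" for y
    proof -
      obtain b where b: "y = to_ac b"
        using y by blast
      then have "\<not> val_le (v e) (a - b ^ p)"
        using far y by (simp add: to_ac_mem_iff)
      then show ?thesis
        using to_ac_vle_iff [of e "a - b ^ p"] e by (simp add: b val_le_def)
    qed
    have "to_ac a \<in> V"
      using a by (simp add: to_ac_mem_iff)
    moreover have "of_nat p = (0 :: 'a alg_closure)"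
      using char by (simp add: of_nat_alg_closure_eq_0_iff)
    moreover have "x ^ p - (to_ac e * to_ac e) ^ (p - 1) * x = to_ac a"
      using x by simp
    ultimately show ?thesis
      using artin_schreier_bound [OF subfield_set_base prime_p _ rangeI _ rangeI far'] by simp
  qed
  obtain V where V: "valued_closure v V"
    by (rule ex_valued_closure)
  \<comment> \<open>Otherwise \<open>y = x\<close> in the distance bound would make \<open>0\<close>
    a divisor of \<open>e * e\<close>.\<close>
  have "x \<notin> base"
  proof
    interpret valued_closure v V
      by fact
    assume "x \<in> base"
    then have "vle ((x - x) ^ 2) (to_ac (e * e))"
      using bound [OF V] by blast
    then show False
      using e by simp
  qed
  moreover have "e * e \<noteq> 0"
    using e by simp
  ultimately obtain \<sigma> b where \<sigma>: "cyclic_extension base (adjoin x) \<sigma> p" "ext_degree (adjoin x) = p"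
    and b: "\<sigma> x = x + to_ac b" "b ^ (p - 1) = (e * e) ^ (p - 1)"
    using ex_cyclic_artin_schreier [OF prime_p char _ x] by blast
  have veq: "valuation_subring.veq V (to_ac b) (to_ac (e * e))" if V: "valued_closure v V" for V
  proof -
    interpret valued_closure v V
      by fact
    have "to_ac b ^ (p - 1) = to_ac (e * e) ^ (p - 1)"
      using arg_cong [OF b(2), of to_ac] by (simp only: to_ac_power)
    then show ?thesis
      using veq_power_iff [of "p - 1" "to_ac b" "to_ac (e * e)"] p1 by simp
  qed
  have D: "\<sigma> x - x = to_ac b"
    using b(1) by simp
  show False
  proof (rule kaehler_condition_no_wild_generator [OF cond \<sigma> self_mem_adjoin \<open>x \<notin> base\<close>, of 2])
    fix V assume V: "valued_closure v V"
    interpret valued_closure v V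
      by fact
    interpret cyclic_extension_valuation base "adjoin x" \<sigma> p V
      using \<sigma>(1) valuation_subring_axioms by (rule cyclic_extension_valuation.intro)
    have eq: "vle (to_ac b) (to_ac (e * e))" "vle (to_ac (e * e)) (to_ac b)"
      using veq [OF V] by (simp_all only: veq_def)
    show "x \<in> V"
      using bound [OF V] by blast
    show "\<not> vle (\<sigma> x - x) 1"
      unfolding D using bound [OF V] vle_trans [OF eq(2)] by blast
    show "vle (\<sigma> x - x) ((\<sigma> ^^ i) x - x)" for i
      unfolding D using conj_translation [OF self_mem_adjoin rangeI b(1)] .
    show "vle ((x - y) ^ 2) ((\<sigma> x - x) ^ (2 - 1))" if "y \<in> base" for y
    proof -
      have "vle ((x - y) ^ 2) (to_ac (e * e))"
        using bound [OF V] that by blast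
      from vle_trans [OF this eq(2)] show ?thesis
        unfolding D by simp
    qed
  qed simp
qed

end

text \<open>Only \<open>v\<close> occurs on the right, so a discrete generator for one
  \<open>V\<close> is one for all.\<close>

lemma (in valued_closure) discrete_generator_base_iff:
  assumes "a \<noteq> 0"
  shows "discrete_generator base p (to_ac a) \<longleftrightarrow> 0 < v a \<and>
    (\<forall>c. c \<noteq> 0 \<longrightarrow> (\<forall>i. 0 < i \<and> i < p \<and> val_le 0 (c ^ p * a ^ i) \<longrightarrow> val_le (v a) ((c ^ p * a ^ i)\<^sup>2)))"
proof -
  have 1: "to_ac c ^ p * to_ac a ^ i \<in> V \<longleftrightarrow> val_le 0 (c ^ p * a ^ i)" for c i
    using to_ac_mem_iff [of "c ^ p * a ^ i"] by simp
  have 2: "to_ac a \<preceq> (to_ac c ^ p * to_ac a ^ i)\<^sup>2 \<longleftrightarrow> val_le (v a) ((c ^ p * a ^ i)\<^sup>2)" for c i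
    using to_ac_vle_iff [of a "(c ^ p * a ^ i)\<^sup>2"] assms by (simp add: val_le_def)
  have "base - {0} = to_ac ` {c::'a. c \<noteq> 0}"
    by auto
  then show ?thesis
    unfolding discrete_generator_def using assms by (simp add: 1 2 to_ac_vle_1_iff not_le)
qed

context residue_char_valuation
begin

lemma of_nat_p_not_vle_1_root:
  assumes "valued_closure v V" "w ^ p = 1" "w \<noteq> 1"
  shows "\<not> valuation_subring.vle V (w - 1) 1" "w \<in> V"
proof -
  interpret valued_closure v V
    by fact
  show "\<not> vle (w - 1) 1" "w \<in> V"
    using root_of_unity_diff_veq [OF prime_p of_nat_p_not_vle_1 [OF assms(1)] assms(2,3)] by blast+
qed

lemma ex_root_of_base: obtains x :: "'a alg_closure" where "x ^ p = to_ac a"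
proof -
  have p1: "p > 1"
    using prime_p by (rule prime_gt_1_nat)
  define f where "f = monom 1 p + [:- to_ac a:]"
  have "degree f = p"
    unfolding f_def using p1 by (subst degree_add_eq_left) (auto simp: degree_monom_eq)
  then obtain x where "poly f x = 0"
    using alg_closed_imp_poly_has_root [of f] p1 by auto
  then show thesis
    using that by (simp add: f_def poly_monom)
qed

lemma frobenius_approx_if_kaehler_condition_char_0:
  assumes cond: "kaehler_condition" and char: "of_nat p \<noteq> (0::'a)"
    and roots: "{z :: 'a alg_closure. z ^ p = 1} \<subseteq> base"
  shows "frobenius_approx p"
proof (rule ccontr)
  assume "\<not> frobenius_approx p"
  then obtain a e where a: "val_le 0 a" and e: "e \<noteq> 0" "of_nat p = (0::'a) \<or> v e \<le> v (of_nat p)"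
    and far: "\<And>y. val_le 0 y \<Longrightarrow> \<not> val_le (v e) (a - y ^ p)"
    using not_frobenius_approxE by blast
  obtain x :: "'a alg_closure" where x: "x ^ p = to_ac a"
    by (rule ex_root_of_base)
  have mem: "x \<in> V" if V: "valued_closure v V" for V
  proof -
    interpret valued_closure v V
      by fact
    show ?thesis
      using mem_power_iff [OF residue_char(2), of x] to_ac_mem_iff [of a] a x by simp
  qed
  \<comment> \<open>Since \<open>e\<close> divides \<open>p\<close>, failure of approximation modulo
    \<open>e\<close> is failure modulo \<open>p\<close>, the form that \<open>kummer_bound\<close>
    uses.\<close>
  have far': "\<not> valuation_subring.vle V (of_nat p) (x ^ p - y ^ p)"
    if V: "valued_closure v V" and y: "y \<in> base" "y \<in> V" for V y
  proof -
    interpret valued_closure v V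
      by fact
    obtain b where b: "y = to_ac b"
      using y by blast
    have "\<not> val_le (v e) (a - b ^ p)"
      using far y b by (simp add: to_ac_mem_iff)
    then have "\<not> val_le (v (of_nat p)) (a - b ^ p)"
      using e char val_le_mono by blast
    then show ?thesis
      using to_ac_vle_iff [of "of_nat p" "a - b ^ p"] char by (simp add: b x val_le_def)
  qed
  have bound: "\<not> valuation_subring.vle V ((w - 1) * x) 1 \<and>
      (\<forall>y\<in>base. valuation_subring.vle V ((x - y) ^ p) (((w - 1) * x) ^ (p - 1)))"
    if V: "valued_closure v V" and w: "w ^ p = 1" "w \<noteq> 1" for V w
  proof -
    interpret valued_closure v V
      by fact
    show ?thesis
      using kummer_bound [OF prime_p of_nat_p_not_vle_1 [OF V] far' [OF V] mem [OF V] w] by blast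
  qed
  have "x \<notin> base"
  proof
    assume x_base: "x \<in> base"
    obtain V where V: "valued_closure v V"
      by (rule ex_valued_closure)
    interpret valued_closure v V
      by fact
    show False
      using far' [OF V x_base mem [OF V]] by simp
  qed
  then obtain \<sigma> w where \<sigma>: "cyclic_extension base (adjoin x) \<sigma> p" "ext_degree (adjoin x) = p"
    and w: "\<sigma> x = w * x" "w ^ p = 1" "w \<noteq> 1" "w \<in> base"
    using ex_cyclic_kummer [OF prime_p char roots x] by blast
  have D: "\<sigma> x - x = (w - 1) * x"
    by (simp add: w(1) algebra_simps)
  show False
  proof (rule kaehler_condition_no_wild_generator [OF cond \<sigma> self_mem_adjoin \<open>x \<notin> base\<close>, of p])
    fix V assume V: "valued_closure v V"
    interpret valued_closure v V
      by fact
    interpret cyclic_extension_valuation base "adjoin x" \<sigma> p V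
      using \<sigma>(1) valuation_subring_axioms by (rule cyclic_extension_valuation.intro)
    show "x \<in> V"
      by (rule mem) fact
    show "\<not> vle (\<sigma> x - x) 1"
      unfolding D using bound [OF V w(2,3)] by blast
    show "vle (\<sigma> x - x) ((\<sigma> ^^ i) x - x)" for i
      unfolding D using conj_scaling [OF self_mem_adjoin w(4) of_nat_p_not_vle_1_root(2) [OF V w(2,3)] w(1)] .
    show "vle ((x - y) ^ p) ((\<sigma> x - x) ^ (p - 1))" if "y \<in> base" for y
      unfolding D using bound [OF V w(2,3)] that by blast
  qed (rule residue_char)
qed

text \<open>With \<open>p = 0\<close> every precision is available, in particular
  \<open>a * a\<close>, which exceeds the value of \<open>a\<close>. So \<open>a\<close> has the
  value of a \<open>p\<close>-th power, which a discrete generator never has.\<close>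

lemma no_discrete_generator_char_p:
  assumes "valued_closure v V" and char: "of_nat p = (0::'a)" and approx: "frobenius_approx p" and a: "a \<noteq> 0"
  shows "\<not> valuation_subring.discrete_generator V base p (to_ac a)"
proof
  interpret valued_closure v V
    by fact
  assume disc: "discrete_generator base p (to_ac a)"
  then have a1: "\<not> vle (to_ac a) 1"
    by (simp add: discrete_generator_def)
  have small: "\<not> vle (to_ac (a * a)) (to_ac a)"
    using a1 vle_mult_cancel_left [of "to_ac a" "to_ac a" 1] a by simp
  have mem: "to_ac a \<in> V"
    using vle_linear [OF a1] by (simp only: one_vle_iff)
  have p_0: "of_nat p = (0::'a alg_closure)"
    using char by (simp add: of_nat_alg_closure_eq_0_iff)
  have vle_p: "vle (to_ac (a * a)) (of_nat p)"
    unfolding p_0 by (rule vle_0)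
  have nz: "to_ac (a * a) \<noteq> 0"
    using a by simp
  obtain y where "y \<in> base" "veq (y ^ p) (to_ac a)"
    using frobenius_dense_root [OF approx [unfolded frobenius_approx_iff_frobenius_dense] rangeI nz vle_p rangeI mem small] .
  then show False
    using discrete_generator_not_power [OF disc _ subfield_set_base prime_gt_1_nat [OF prime_p]] a by simp
qed

text \<open>A \<open>p\<close>-th root \<open>x\<close> of \<open>a\<close> is no closer to the base
  field than to \<open>0\<close>, hence farther than \<open>(w - 1) * x\<close>, because
  \<open>w - 1\<close> is no unit. This makes its extension unibranched, and discreteness excludes
  idempotence.\<close>

lemma no_discrete_generator_char_0:
  assumes cond: "kaehler_condition" and char: "of_nat p \<noteq> (0::'a)"
    and roots: "{z :: 'a alg_closure. z ^ p = 1} \<subseteq> base" and V0: "valued_closure v V\<^sub>0" and a: "a \<noteq> 0"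
  shows "\<not> valuation_subring.discrete_generator V\<^sub>0 base p (to_ac a)"
proof
  assume disc0: "valuation_subring.discrete_generator V\<^sub>0 base p (to_ac a)"
  obtain x :: "'a alg_closure" where x: "x ^ p = to_ac a"
    by (rule ex_root_of_base)
  have disc: "valuation_subring.discrete_generator V base p (x ^ p)" if "valued_closure v V" for V
    using disc0 valued_closure.discrete_generator_base_iff [OF V0 a] valued_closure.discrete_generator_base_iff [OF that a]
    by (simp add: x)
  have p1: "p > 1"
    using prime_p by (rule prime_gt_1_nat)
  have "x \<noteq> 0"
    using x a p1 by (auto simp: power_0_left)
  have far: "\<not> valuation_subring.vle V (c * x) (x - y)"
    if V: "valued_closure v V" and y: "y \<in> base" and c: "\<not> valuation_subring.vle V c 1" for V c y
  proof -
    interpret valued_closure v V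
      by fact
    show ?thesis
      by (rule discrete_generator_bound [OF disc [OF V] \<open>x \<noteq> 0\<close> subfield_set_base p1 y c])
  qed
  have "x \<notin> base"
  proof
    assume x_base: "x \<in> base"
    interpret valued_closure v V\<^sub>0
      by fact
    show False
      using far [OF V0 x_base of_nat_p_not_vle_1 [OF V0]] by simp
  qed
  then obtain \<sigma> w where \<sigma>: "cyclic_extension base (adjoin x) \<sigma> p" "ext_degree (adjoin x) = p"
    and w: "\<sigma> x = w * x" "w ^ p = 1" "w \<noteq> 1" "w \<in> base"
    using ex_cyclic_kummer [OF prime_p char roots x] by blast
  have inv: "cyclic_valued_closure v V (adjoin x) \<sigma> p" if V: "valued_closure v V" for V
  proof (rule cyclic_valued_closureI [OF V \<sigma>(1) self_mem_adjoin, of "(w - 1) * x"])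
    interpret valued_closure v V
      by fact
    interpret cyclic_extension_valuation base "adjoin x" \<sigma> p V
      using \<sigma>(1) valuation_subring_axioms by (rule cyclic_extension_valuation.intro)
    show "vle ((w - 1) * x) ((\<sigma> ^^ i) x - x)" for i
      using conj_scaling [OF self_mem_adjoin w(4) of_nat_p_not_vle_1_root(2) [OF V w(2,3)] w(1)] .
    show "\<not> vle ((w - 1) * x) (x - y)" if "y \<in> base" for y
      using far [OF V that] of_nat_p_not_vle_1_root(1) [OF V w(2,3)] by blast
  qed
  interpret cyclic_valued_closure v V\<^sub>0 "adjoin x" \<sigma> p
    by (rule inv) fact
  interpret kummer_extension base "adjoin x" \<sigma> p V\<^sub>0 x w
    using char of_nat_p_not_vle_1 [OF V0] \<open>x \<noteq> 0\<close> w self_mem_adjoin x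
    by unfold_locales (simp_all add: of_nat_alg_closure_eq_0_iff)
  show False
    using kaehler_conditionD [OF cond \<sigma> inv V0] not_idempotent_ideal_discrete [OF disc [OF V0]] by blast
qed

lemma deeply_ramified_if_kaehler_condition:
  assumes cond: "kaehler_condition"
    and roots: "of_nat p \<noteq> (0::'a) \<Longrightarrow> {z :: 'a alg_closure. z ^ p = 1} \<subseteq> base"
  shows "DRvg base_field v \<and> DRvr base_field v"
proof
  have approx: "frobenius_approx p"
    using frobenius_approx_if_kaehler_condition_char_p frobenius_approx_if_kaehler_condition_char_0 cond roots by blast
  then show "DRvr base_field v"
    by (rule frobenius_approx_imp_DRvr [OF residue_char nontrivially_valued])
  obtain V where V: "valued_closure v V"
    by (rule ex_valued_closure)
  interpret valued_closure v V
    by fact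
  show "DRvg base_field v"
  proof (rule ccontr)
    assume "\<not> DRvg base_field v"
    then obtain a where "a \<noteq> 0" "discrete_generator base p (to_ac a)"
      by (rule ex_discrete_generator_if_not_DRvg)
    then show False
      using no_discrete_generator_char_p [OF V _ approx] no_discrete_generator_char_0 [OF cond _ roots V] by blast
  qed
qed

lemma ex_nontrivial_root_of_unity:
  assumes char: "of_nat p \<noteq> (0::'a)"
  obtains z :: "'a alg_closure" where "z ^ p = 1" "z \<noteq> 1"
proof -
  define f where "f = (\<Sum>i<p. monom (1::'a alg_closure) i)"
  have p1: "p > 1"
    using prime_p by (rule prime_gt_1_nat)
  have "coeff f (p - 1) = 1"
    using p1 by (simp add: f_def coeff_sum)
  then have "degree f \<ge> p - 1"
    by (intro le_degree) simp
  then have "degree f > 0"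
    using p1 by simp
  then obtain z where z: "poly f z = 0"
    using alg_closed_imp_poly_has_root by blast
  then have sum: "(\<Sum>i<p. z ^ i) = 0"
    by (simp add: f_def poly_sum poly_monom)
  then have "z ^ p = 1"
    using power_diff_1_eq [of z p] by simp
  moreover have "z \<noteq> 1"
    using sum char by (auto simp: of_nat_alg_closure_eq_0_iff)
  ultimately show thesis
    by (rule that)
qed

lemma kaehler_condition_if_deeply_ramified:
  assumes DRvg: "DRvg base_field v" and DRvr: "DRvr base_field v"
    and roots: "of_nat p \<noteq> (0::'a) \<Longrightarrow> {z :: 'a alg_closure. z ^ p = 1} \<subseteq> base"
  shows "kaehler_condition"
  unfolding kaehler_condition_def
proof (intro allI impI)
  fix L w
  assume *: "galois_extension L \<and> ext_degree L = p \<and> extends_valuation v L w \<and> unibranched v L"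
  then obtain \<sigma> where \<sigma>: "cyclic_extension base L \<sigma> p"
    using galois_imp_cyclic_extension [OF _ _ prime_p] by blast
  interpret w: extended_valuation v L w
    using * by (intro extended_valuationI [OF \<sigma>]) blast
  obtain V where V: "valued_closure v V" "L \<inter> V = w.O_L"
    by (rule w.ex_valuation_subring)
  interpret cyclic_valued_closure v V L \<sigma> p
    using unibranched_imp_invariant [OF \<sigma> _ _ V] * by blast
  have FD: "frobenius_dense base p"
    using DRvr DRvr_iff_frobenius_dense [OF residue_char nontrivially_valued] by blast
  have idempotent_ideal
  proof (cases "of_nat p = (0::'a)")
    case True
    obtain \<gamma> where \<gamma>: "\<gamma> \<in> value_set" "0 < \<gamma>"
      using value_set_unbounded [OF nontrivially_valued value_set.zero_mem] by blast
    then obtain m where "m \<noteq> 0" "\<gamma> = v m"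
      by (elim value_setE)
    then show ?thesis
      using FD True \<gamma>
      by (intro idempotent_idealI_char_p [of "to_ac m"]) (auto simp: of_nat_alg_closure_eq_0_iff to_ac_vle_1_iff)
  next
    case False
    then have p_0: "of_nat p \<noteq> (0::'a alg_closure)"
      by (simp add: of_nat_alg_closure_eq_0_iff)
    obtain z :: "'a alg_closure" where z: "z ^ p = 1" "z \<noteq> 1"
      using ex_nontrivial_root_of_unity False by blast
    then have "z \<in> base"
      using roots [OF False] by blast
    then obtain x u where x: "x \<in> L" "x \<noteq> 0" "x ^ p \<in> base" "u \<in> base" "u ^ p = 1" "u \<noteq> 1" "\<sigma> x = u * x"
      using ex_kummer_generator [OF _ z p_0] by blast
    interpret kummer_extension base L \<sigma> p V x u
      using p_0 of_nat_p_not_vle_1 [OF V(1)] x by unfold_locales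
    show ?thesis
      using idempotent_ideal_kummer FD dense_values_if_DRvg [OF DRvg] by blast
  qed
  then show "let \<Omega> = kaehler (valuation_ring base_field v) (valuation_ring (ext_field L) w) to_ac
      in carrier \<Omega> = {\<zero>\<^bsub>\<Omega>\<^esub>}"
    using kaehler_trivial_iff [OF V(2)] by blast
qed

end

theorem theorem1p3:
  fixes v :: "'a::field \<Rightarrow> 'g::linordered_ab_group_add" and p :: nat
  assumes "nontrivially_valued_field base_field v"
    and "ring_characteristic (residue_field base_field v) = p" and "p > 0"
    and "CHAR('a) = 0 \<Longrightarrow> {z :: 'a alg_closure. z ^ p = 1} \<subseteq> range to_ac"
  shows "deeply_ramified_field base_field v \<longleftrightarrow>
    (\<forall>L w. galois_extension L \<and> ext_degree L = p \<and> extends_valuation v L w \<and> unibranched v L \<longrightarrow>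
       (let \<Omega> = kaehler (valuation_ring base_field v) (valuation_ring (ext_field L) w) to_ac
        in carrier \<Omega> = {\<zero>\<^bsub>\<Omega>\<^esub>}))"
proof -
  interpret field_valuation v
    using assms(1) by (simp add: nontrivially_valued_field_def valuation_base_field_iff)
  interpret residue_char_valuation v p
    using assms(1-3) by unfold_locales (simp_all add: nontrivially_valued_field_def carrier_value_group)
  have roots: "{z :: 'a alg_closure. z ^ p = 1} \<subseteq> base" if "of_nat p \<noteq> (0::'a)"
    using assms(4) char_0_if_residue_char [OF residue_char that] by blast
  have "deeply_ramified_field base_field v \<longleftrightarrow> DRvg base_field v \<and> DRvr base_field v"
    using assms(1) by (simp add: deeply_ramified_field_def)
  also have "\<dots> \<longleftrightarrow> kaehler_condition"
    using deeply_ramified_if_kaehler_condition kaehler_condition_if_deeply_ramified roots by blast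
  finally show ?thesis
    by (simp only: kaehler_condition_def)
qed

end
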